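(* Let $\Omega\subset\mathbb{R}^d$ be a domain whose boundary $\Gamma$ is the union of a family $\{\Gamma_\alpha\}_{\alpha\in M}$ of non-empty closed subsets indexed by a possibly uncountable set $M$, where there is $d_0>0$ with $d(\Gamma_\alpha;\Gamma_\beta)\ge d_0$ for all $\alpha,\beta\in M$ with $\alpha\ne\beta$. Assume that each $\Gamma_\alpha$ is Ahlfors $s_\alpha$-regular with $s_\alpha\in(0,d)$. Further, whenever $s_\alpha\in[d-1,d)$, assume there are $z_\alpha\in\Gamma_\alpha$ and $R_\alpha>0$ such that $\Omega_{z_\alpha,R_\alpha}=\Omega\cap B(z_\alpha;R_\alpha)$ is $\Omega$-uniform. Finally, let $h_0(\varphi)=\sum_{k,l=1}^d\int_\Omega c_{kl}\,(\partial_k\varphi)(\partial_l\varphi)\,dx$ on $C_c^\infty(\Omega)$ and assume that, for each $\alpha\in M$, the coefficients are $\delta_\alpha$-degenerate on $\Gamma_\alpha$ for some $\delta_\alpha\ge0$. Then $h_0$ is Markov unique, i.e. $h_D=h_N$, if and only if $\delta_\alpha\ge\delta_{c,\alpha}$ for each $\alpha\in M$, where $\delta_{c,\alpha}=1+(s_\alpha-(d-1))$.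
   Context: A domain is a non-empty open connected subset of $\mathbb{R}^d$. $d(x;y)$ is Euclidean distance, $d(\Gamma_\alpha;\Gamma_\beta)$ is the Euclidean distance between the two sets, $B(x;r)$ the open Euclidean ball, $d_A(x)=\inf_{z\in A}d(x;z)$, and $A_r=\{x\in\overline\Omega: d_A(x)<r\}$ (conditions on $C(x)$ for $x\in A_r$ are read for $x\in A_r\cap\Omega$). Matrix inequalities are in the sense of order of symmetric matrices. Coefficients: $c_{kl}=c_{lk}\in L_\infty(\Omega)$ are real, $C(x)=(c_{kl}(x))>0$ for almost all $x\in\Omega$, and for each compact $K\subset\Omega$ there is $c_K>0$ with $C(x)\ge c_K I$ for almost all $x\in K$. The form $h_0$ on (real) $L_2(\Omega)$ with domain $C_c^\infty(\Omega)$ is then closable; $h_D$ denotes its closure. The form $h_N$ is $h_N(\varphi)=\int_\Omega\sum_{k,l}c_{kl}(\partial_k\varphi)(\partial_l\varphi)\,dx$ with domain $D(h_N)=\{\varphi\in W^{1,2}_{\rm loc}(\Omega):\sum_{k,l}c_{kl}(\partial_k\varphi)(\partial_l\varphi)+\varphi^2\in L_1(\Omega)\}$. Both are Dirichlet forms, the smallest and largest Dirichlet form extensions of $h_0$; $h_0$ is Markov unique if $h_D$ is its only Dirichlet form extension, equivalently $h_D=h_N$. The coefficients are $\delta_\alpha$-degenerate on $\Gamma_\alpha$ if for each bounded non-empty subset $A\subset\Gamma_\alpha$ there are $a_\alpha,b_\alpha,r_\alpha>0$ such that $a_\alpha\,d_{\Gamma_\alpha}(x)^{\delta_\alpha}I\le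 C(x)\le b_\alpha\,d_{\Gamma_\alpha}(x)^{\delta_\alpha}I$ for almost all $x\in A_{r_\alpha}$. A set $G\subset\mathbb{R}^d$ is Ahlfors $s$-regular ($s>0$) if there is a regular Borel measure $\mu$ on $G$ such that for each $A=G\cap B(x_0;R_0)$ with $x_0\in G$, $R_0>0$, there is $c>0$ with $c^{-1}r^s\le\mu(A\cap B(x;r))\le c\,r^s$ for all $x\in A$ and $r\in(0,2R_0)$. For $z\in\Gamma$, $R>0$, $\Omega_{z,R}$ is $\Omega$-uniform if there is $\sigma\ge1$ such that for all $x,y\in\Omega_{z,R}$ there is a rectifiable curve $\gamma:[0,1]\to\Omega$ with $\gamma(0)=x$, $\gamma(1)=y$, length at most $\sigma\,d(x;y)$, and $d_\Gamma(w)\ge\sigma^{-1}\min(d(x;w),d(w;y))$ for all $w\in\gamma([0,1])$. *)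

theory Defs
  imports "HOL-Analysis.Analysis"
begin

subsection \<open>Test functions\<close>

definition partial :: "'n \<Rightarrow> (real^'n \<Rightarrow> real) \<Rightarrow> real^'n \<Rightarrow> real"
  where "partial k f x = frechet_derivative f (at x) (axis k 1)"

primrec C_diff :: "nat \<Rightarrow> (real^'n \<Rightarrow> real) \<Rightarrow> bool"
  where
    "C_diff 0 f \<longleftrightarrow> continuous_on UNIV f"
  | "C_diff (Suc m) f \<longleftrightarrow> (\<forall>x. f differentiable (at x)) \<and> (\<forall>k. C_diff m (partial k f))"

text \<open>\<open>C\<^sub>c\<^sup>\<infinity>(\<Omega>)\<close>; its elements are extended by zero to the whole space.\<close>

definition Cc_infinity :: "(real^'n) set \<Rightarrow> (real^'n \<Rightarrow> real) set"
  where "Cc_infinity \<Omega> = {f. (\<forall>m. C_diff m f)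
           \<and> compact (closure {x. f x \<noteq> 0}) \<and> closure {x. f x \<noteq> 0} \<subseteq> \<Omega>}"


subsection \<open>Function spaces\<close>

text \<open>
  Elements of \<open>L\<^sub>2(\<Omega>)\<close> are handled through representatives defined on the whole space, whose
  values outside \<open>\<Omega>\<close> are irrelevant. All sets of functions below are saturated: they are closed
  under changing a representative outside \<open>\<Omega>\<close> or on a null set.
\<close>

definition L2 :: "(real^'n) set \<Rightarrow> (real^'n \<Rightarrow> real) set"
  where "L2 \<Omega> = {f \<in> borel_measurable (lebesgue_on \<Omega>). integrable (lebesgue_on \<Omega>) (\<lambda>x. (f x)\<^sup>2)}"

definition L1_loc :: "(real^'n) set \<Rightarrow> (real^'n \<Rightarrow> real) set"
  where "L1_loc \<Omega> = {f \<in> borel_measurable (lebesgue_on \<Omega>).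
           \<forall>K. compact K \<and> K \<subseteq> \<Omega> \<longrightarrow> integrable (lebesgue_on K) f}"

definition L2_loc :: "(real^'n) set \<Rightarrow> (real^'n \<Rightarrow> real) set"
  where "L2_loc \<Omega> = {f \<in> borel_measurable (lebesgue_on \<Omega>).
           \<forall>K. compact K \<and> K \<subseteq> \<Omega> \<longrightarrow> integrable (lebesgue_on K) (\<lambda>x. (f x)\<^sup>2)}"

definition weak_gradient ::
    "(real^'n) set \<Rightarrow> (real^'n \<Rightarrow> real) \<Rightarrow> (real^'n \<Rightarrow> real^'n) \<Rightarrow> bool"
  where "weak_gradient \<Omega> f g \<longleftrightarrow> f \<in> L1_loc \<Omega> \<and> (\<forall>k. (\<lambda>x. g x $ k) \<in> L1_loc \<Omega>)
           \<and> (\<forall>k. \<forall>\<eta>\<in>Cc_infinity \<Omega>.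
                 (LINT x|lebesgue_on \<Omega>. f x * partial k \<eta> x)
               = - (LINT x|lebesgue_on \<Omega>. g x $ k * \<eta> x))"

definition W12_loc :: "(real^'n) set \<Rightarrow> (real^'n \<Rightarrow> real) set"
  where "W12_loc \<Omega> = {f \<in> L2_loc \<Omega>.
           \<exists>g. weak_gradient \<Omega> f g \<and> (\<forall>k. (\<lambda>x. g x $ k) \<in> L2_loc \<Omega>)}"


subsection \<open>Coefficients\<close>

text \<open>The order of symmetric matrices; the symmetry of \<open>C x\<close> is part of \<open>coefficients\<close> below.\<close>

definition mat_le :: "real^'n^'n \<Rightarrow> real^'n^'n \<Rightarrow> bool"
  where "mat_le A B \<longleftrightarrow> (\<forall>\<xi>. \<xi> \<bullet> (A *v \<xi>) \<le> \<xi> \<bullet> (B *v \<xi>))"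

definition mat_pos :: "real^'n^'n \<Rightarrow> bool"
  where "mat_pos A \<longleftrightarrow> (\<forall>\<xi>. \<xi> \<noteq> 0 \<longrightarrow> 0 < \<xi> \<bullet> (A *v \<xi>))"

text \<open>Note that \<open>mat a\<close> is \<open>a\<close> times the identity matrix.\<close>

definition coefficients :: "(real^'n) set \<Rightarrow> (real^'n \<Rightarrow> real^'n^'n) \<Rightarrow> bool"
  where "coefficients \<Omega> C \<longleftrightarrow>
      (\<forall>k l. (\<lambda>x. C x $ k $ l) \<in> borel_measurable (lebesgue_on \<Omega>))
    \<and> (\<forall>k l. \<exists>B. AE x in lebesgue_on \<Omega>. \<bar>C x $ k $ l\<bar> \<le> B)
    \<and> (AE x in lebesgue_on \<Omega>. \<forall>k l. C x $ k $ l = C x $ l $ k)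
    \<and> (AE x in lebesgue_on \<Omega>. mat_pos (C x))
    \<and> (\<forall>K. compact K \<and> K \<subseteq> \<Omega> \<longrightarrow> (\<exists>c>0. AE x in lebesgue_on K. mat_le (mat c) (C x)))"

definition collar :: "(real^'n) set \<Rightarrow> (real^'n) set \<Rightarrow> real \<Rightarrow> (real^'n) set"
  where "collar \<Omega> A r = {x \<in> closure \<Omega>. infdist x A < r}"

definition degenerate_on ::
    "(real^'n) set \<Rightarrow> (real^'n \<Rightarrow> real^'n^'n) \<Rightarrow> (real^'n) set \<Rightarrow> real \<Rightarrow> bool"
  where "degenerate_on \<Omega> C G \<delta> \<longleftrightarrow>
    (\<forall>A. A \<subseteq> G \<and> bounded A \<and> A \<noteq> {} \<longrightarrow>
      (\<exists>a>0. \<exists>b>0. \<exists>r>0. AE x in lebesgue_on \<Omega>. x \<in> collar \<Omega> A r \<longrightarrow>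
          mat_le (mat (a * infdist x G powr \<delta>)) (C x)
        \<and> mat_le (C x) (mat (b * infdist x G powr \<delta>))))"


subsection \<open>The forms\<close>

definition h0 :: "(real^'n) set \<Rightarrow> (real^'n \<Rightarrow> real^'n^'n) \<Rightarrow> (real^'n \<Rightarrow> real) \<Rightarrow> real"
  where "h0 \<Omega> C \<phi> =
    (\<Sum>k\<in>UNIV. \<Sum>l\<in>UNIV. LINT x|lebesgue_on \<Omega>. C x $ k $ l * partial k \<phi> x * partial l \<phi> x)"

text \<open>
  A quadratic form on \<open>L\<^sub>2(\<Omega>)\<close> with its domain is represented by its graph, the set of all pairs
  \<open>(\<phi>, h(\<phi>))\<close> with \<open>\<phi>\<close> in the domain. Equality of two such graphs says that the domains coincide
  and that the forms agree there. As the form \<open>h\<^sub>0\<close> is closable, \<open>h_D\<close> is single-valued;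
  so is \<open>h_N\<close>, because the weak gradient is unique up to null sets.
\<close>

type_synonym 'n form = "((real^'n \<Rightarrow> real) \<times> real) set"

definition h_D :: "(real^'n) set \<Rightarrow> (real^'n \<Rightarrow> real^'n^'n) \<Rightarrow> 'n form"
  where "h_D \<Omega> C = {(\<phi>, v). \<phi> \<in> L2 \<Omega> \<and>
    (\<exists>u :: nat \<Rightarrow> real^'n \<Rightarrow> real.
        (\<forall>n. u n \<in> Cc_infinity \<Omega>)
      \<and> (\<lambda>n. LINT x|lebesgue_on \<Omega>. (u n x - \<phi> x)\<^sup>2) \<longlonglongrightarrow> 0
      \<and> (\<forall>\<epsilon>>0. \<exists>N. \<forall>m\<ge>N. \<forall>n\<ge>N. h0 \<Omega> C (\<lambda>x. u m x - u n x) < \<epsilon>)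
      \<and> (\<lambda>n. h0 \<Omega> C (u n)) \<longlonglongrightarrow> v)}"

definition energy_density ::
    "(real^'n \<Rightarrow> real^'n^'n) \<Rightarrow> (real^'n \<Rightarrow> real^'n) \<Rightarrow> real^'n \<Rightarrow> real"
  where "energy_density C g x = (\<Sum>k\<in>UNIV. \<Sum>l\<in>UNIV. C x $ k $ l * g x $ k * g x $ l)"

definition h_N :: "(real^'n) set \<Rightarrow> (real^'n \<Rightarrow> real^'n^'n) \<Rightarrow> 'n form"
  where "h_N \<Omega> C = {(\<phi>, v). \<phi> \<in> W12_loc \<Omega> \<and>
    (\<exists>g. weak_gradient \<Omega> \<phi> g
       \<and> integrable (lebesgue_on \<Omega>) (\<lambda>x. energy_density C g x + (\<phi> x)\<^sup>2)
       \<and> v = (LINT x|lebesgue_on \<Omega>. energy_density C g x))}"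

text \<open>
  Markov uniqueness of \<open>h\<^sub>0\<close> is taken in the form \<open>h_D = h_N\<close>: the smallest and the largest
  Dirichlet form extension coincide. The closed Markovian forms that merely restrict to \<open>h\<^sub>0\<close> on
  \<open>C\<^sub>c\<^sup>\<infinity>(\<Omega>)\<close> are not all dominated by \<open>h_N\<close>: removing a closed sphere \<open>S \<subseteq> \<Omega>\<close>, the form \<open>h_N\<close> of
  \<open>\<Omega> - S\<close> is one of them, and its domain contains functions with a jump across \<open>S\<close>.
\<close>

definition markov_unique :: "(real^'n) set \<Rightarrow> (real^'n \<Rightarrow> real^'n^'n) \<Rightarrow> bool"
  where "markov_unique \<Omega> C \<longleftrightarrow> h_D \<Omega> C = h_N \<Omega> C"


subsection \<open>Geometry of the boundary\<close>

text \<open>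
  On a closed subset of Euclidean space, inner regularity on all Borel sets is no restriction:
  it follows from finiteness on compact sets.
\<close>

definition regular_borel_measure_on :: "(real^'n) set \<Rightarrow> (real^'n) measure \<Rightarrow> bool"
  where "regular_borel_measure_on G \<mu> \<longleftrightarrow>
      sets \<mu> = sets (restrict_space borel G)
    \<and> (\<forall>K. compact K \<and> K \<subseteq> G \<longrightarrow> emeasure \<mu> K < \<infinity>)
    \<and> (\<forall>E\<in>sets \<mu>.
         emeasure \<mu> E = (INF U\<in>{U. openin (top_of_set G) U \<and> E \<subseteq> U}. emeasure \<mu> U)
       \<and> emeasure \<mu> E = (SUP K\<in>{K. compact K \<and> K \<subseteq> E}. emeasure \<mu> K))"

definition ahlfors_regular :: "real \<Rightarrow> (real^'n) set \<Rightarrow> bool"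
  where "ahlfors_regular s G \<longleftrightarrow>
    (\<exists>\<mu>. regular_borel_measure_on G \<mu> \<and>
      (\<forall>x0\<in>G. \<forall>R0>0. \<exists>c>0. \<forall>x\<in>G \<inter> ball x0 R0. \<forall>r. 0 < r \<and> r < 2 * R0 \<longrightarrow>
          ennreal (r powr s / c) \<le> emeasure \<mu> (G \<inter> ball x0 R0 \<inter> ball x r)
        \<and> emeasure \<mu> (G \<inter> ball x0 R0 \<inter> ball x r) \<le> ennreal (c * r powr s)))"

text \<open>The length of a curve on \<open>[0,1]\<close>: the supremum of the lengths of inscribed polygons.\<close>

definition curve_length :: "(real \<Rightarrow> real^'n) \<Rightarrow> ennreal"
  where "curve_length \<gamma> = (SUP ts\<in>{ts. sorted ts \<and> set ts \<subseteq> {0..1}}.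
           \<Sum>i<length ts - 1. ennreal (dist (\<gamma> (ts ! i)) (\<gamma> (ts ! Suc i))))"

definition rectifiable_curve :: "(real \<Rightarrow> real^'n) \<Rightarrow> bool"
  where "rectifiable_curve \<gamma> \<longleftrightarrow> path \<gamma> \<and> curve_length \<gamma> < \<infinity>"

text \<open>The distance in the last condition is to the whole boundary of \<open>\<Omega>\<close>, not to that of \<open>D\<close>.\<close>

definition uniform_in :: "(real^'n) set \<Rightarrow> (real^'n) set \<Rightarrow> bool"
  where "uniform_in \<Omega> D \<longleftrightarrow>
    (\<exists>\<sigma>\<ge>1. \<forall>x\<in>D. \<forall>y\<in>D. \<exists>\<gamma>. rectifiable_curve \<gamma> \<and> path_image \<gamma> \<subseteq> \<Omega>
        \<and> pathstart \<gamma> = x \<and> pathfinish \<gamma> = y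
        \<and> curve_length \<gamma> \<le> ennreal (\<sigma> * dist x y)
        \<and> (\<forall>w\<in>path_image \<gamma>. infdist w (frontier \<Omega>) \<ge> min (dist x w) (dist w y) / \<sigma>))"

end

theory Submission
  imports Defs
begin

text \<open>
  Sufficiency. A tube of radius \<open>\<rho>\<close> around \<open>\<Gamma>\<^sub>\<alpha>\<close> has volume of order \<open>\<rho>\<close> to the power \<open>d - s\<^sub>\<alpha>\<close>, so a
  cutoff at distance \<open>\<rho>\<close> has energy of order \<open>\<rho>\<close> to the power \<open>\<delta>\<^sub>\<alpha> - 2 + d - s\<^sub>\<alpha>\<close>, which is bounded if
  \<open>\<delta>\<^sub>\<alpha> \<ge> 1 + (s\<^sub>\<alpha> - (d - 1))\<close>. The average of \<open>N\<close> such cutoffs at different dyadic scales has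
  energy of order \<open>1/N\<close>. Multiplication by these functions removes the boundary from a bounded element of
  the domain of \<open>h\<^sub>N\<close>, and what is left is mollified.

  Necessity. If \<open>h\<^sub>D = h\<^sub>N\<close>, then a test function of the whole space that equals 1 near a point of \<open>\<Gamma>\<^sub>\<alpha>\<close>
  is approximated by functions \<open>u\<^sub>n\<close> in \<open>C\<^sub>c\<^sup>\<infinity>(\<Omega>)\<close>. The mean of \<open>u\<^sub>n\<close> over a fixed ball is joined to
  each boundary point, where \<open>u\<^sub>n\<close> vanishes, by a dyadic chain of balls: balls centred at the point
  itself if \<open>s\<^sub>\<alpha> < d - 1\<close>, and balls in \<open>\<Omega>\<close> along uniform curves otherwise. Telescoping along the chain,
  integrating over the boundary point with respect to the Ahlfors regular measure and applying the
  Cauchy-Schwarz inequality with the weight given by a power of the distance bounds the mean by the energy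
  of \<open>u\<^sub>n\<close> near \<open>\<Gamma>\<^sub>\<alpha>\<close>, which tends to 0. The weight is integrable exactly if
  \<open>\<delta>\<^sub>\<alpha> < 1 + (s\<^sub>\<alpha> - (d - 1))\<close>.
\<close>

subsection \<open>Smooth functions\<close>

text \<open>At the critical exponent one cutoff has merely bounded energy; averaging cutoffs with
  disjoint gradient layers turns this boundedness into convergence to 0. For the other half put
  \<sigma> = 1 - d + s. A step of a chain at scale l contributes the gradient with weight l^(1 - d),
  and the boundary points whose chain uses a given y at this scale have measure of order l^s. The
  sum of l^\<sigma> over these scales has to be of the order of the power \<sigma> of the distance
  of y from the boundary part. For \<sigma> < 0 the smallest scale, comparable to that distance,
  dominates, and the balls may cross the boundary. For \<sigma> \<ge> 0 the large scales are no
  longer negligible, and the chain has to keep a distance from the boundary comparable to its scale;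
  here uniformity enters. Cauchy-Schwarz then asks for integrability of the power 2\<sigma> -
  \<delta> of the distance, that is \<delta> - 2\<sigma> < d - s, which rearranges to \<delta> < 1 +
  (s - (d - 1)). The argument is local: one subcritical boundary part, near one of its points,
  destroys uniqueness.\<close>

lemma partial_eqI:
  assumes "(f has_derivative f') (at x)"
  shows "partial k f x = f' (axis k 1)"
  using frechet_derivative_at[OF assms] by (simp add: partial_def)

lemma frechet_derivative_eq_partials:
  fixes f :: "real^'n \<Rightarrow> real"
  assumes "f differentiable (at x)"
  shows "frechet_derivative f (at x) h = (\<Sum>k\<in>UNIV. h $ k * partial k f x)"
proof -
  interpret linear "frechet_derivative f (at x)"
    using assms by (rule linear_frechet_derivative)
  have "h = (\<Sum>k\<in>UNIV. h $ k *\<^sub>R axis k 1)"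
    by (metis (no_types, lifting) basis_expansion scalar_mult_eq_scaleR sum.cong)
  then have "frechet_derivative f (at x) h = frechet_derivative f (at x) (\<Sum>k\<in>UNIV. h $ k *\<^sub>R axis k 1)"
    by simp
  then show ?thesis
    by (simp add: sum scaleR partial_def)
qed

definition grad :: "(real^'n \<Rightarrow> real) \<Rightarrow> real^'n \<Rightarrow> real^'n"
  where "grad f x = (\<chi> k. partial k f x)"

lemma grad_nth [simp]: "grad f x $ k = partial k f x"
  by (simp add: grad_def)

lemma has_derivative_grad:
  assumes "f differentiable (at x)"
  shows "(f has_derivative (\<lambda>h. grad f x \<bullet> h)) (at x)"
proof -
  have "frechet_derivative f (at x) = (\<lambda>h. grad f x \<bullet> h)"
    by (rule ext) (simp add: frechet_derivative_eq_partials[OF assms] inner_vec_def mult.commute)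
  then show ?thesis
    using assms by (metis frechet_derivative_works)
qed

lemma partial_const [simp]: "partial k (\<lambda>x. c) = (\<lambda>x. 0)"
  by (rule ext) (rule partial_eqI[of _ "\<lambda>h. 0"], simp)

lemma
  fixes f g :: "real^'n \<Rightarrow> real"
  assumes "f differentiable (at x)" "g differentiable (at x)"
  shows partial_add: "partial k (\<lambda>x. f x + g x) x = partial k f x + partial k g x"
    and partial_diff: "partial k (\<lambda>x. f x - g x) x = partial k f x - partial k g x"
    and partial_mult: "partial k (\<lambda>x. f x * g x) x = partial k f x * g x + f x * partial k g x"
proof -
  note d = has_derivative_grad[OF assms(1)] has_derivative_grad[OF assms(2)]
  show "partial k (\<lambda>x. f x + g x) x = partial k f x + partial k g x"
    by (subst partial_eqI[OF has_derivative_add[OF d]]) (simp add: inner_axis)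
  show "partial k (\<lambda>x. f x - g x) x = partial k f x - partial k g x"
    by (subst partial_eqI[OF has_derivative_diff[OF d]]) (simp add: inner_axis)
  show "partial k (\<lambda>x. f x * g x) x = partial k f x * g x + f x * partial k g x"
    by (subst partial_eqI[OF has_derivative_mult[OF d]]) (simp add: inner_axis)
qed

lemma partial_cmult:
  fixes f :: "real^'n \<Rightarrow> real"
  assumes "f differentiable (at x)"
  shows "partial k (\<lambda>x. c * f x) x = c * partial k f x"
  by (subst partial_mult) (use assms in auto)

lemma partial_real_compose:
  fixes q :: "real^'n \<Rightarrow> real"
  assumes "(F has_real_derivative F' (q x)) (at (q x))" "q differentiable (at x)"
  shows "partial k (\<lambda>x. F (q x)) x = F' (q x) * partial k q x"
proof -
  have "((\<lambda>x. F (q x)) has_derivative (\<lambda>h. F' (q x) * (grad q x \<bullet> h))) (at x)"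
    using has_derivative_compose[OF has_derivative_grad[OF assms(2)]
        assms(1)[unfolded has_field_derivative_def]] .
  from partial_eqI[OF this] show ?thesis
    by (simp add: inner_axis)
qed

lemma partial_shift:
  fixes f :: "real^'n \<Rightarrow> real"
  assumes "\<And>x. f differentiable (at x)"
  shows "partial k (\<lambda>y. f (x - y)) y = - partial k f (x - y)"
proof -
  have d: "((\<lambda>y. x - y) has_derivative (\<lambda>h. - h)) (at y)"
    by (auto intro!: derivative_eq_intros)
  have "((\<lambda>y. f (x - y)) has_derivative (\<lambda>h. grad f (x - y) \<bullet> (- h))) (at y)"
    by (rule has_derivative_compose[OF d has_derivative_grad[OF assms]])
  from partial_eqI[OF this] show ?thesis
    by (simp add: inner_axis)
qed

lemma C_diff_continuous: "C_diff m f \<Longrightarrow> continuous_on UNIV f"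
  by (cases m) (auto simp: continuous_on_eq_continuous_at intro: differentiable_imp_continuous_within)

lemma C_diff_SucD: "C_diff (Suc m) f \<Longrightarrow> C_diff m f"
proof (induction m arbitrary: f)
  case 0
  then show ?case using C_diff_continuous[OF 0] by simp
qed auto

definition smooth :: "(real^'n \<Rightarrow> real) \<Rightarrow> bool"
  where "smooth f \<longleftrightarrow> (\<forall>m. C_diff m f)"

lemma smooth_continuous: "smooth f \<Longrightarrow> continuous_on UNIV f"
  using C_diff_continuous smooth_def by blast

lemma smooth_differentiable: "smooth f \<Longrightarrow> f differentiable (at x)"
  by (auto simp: smooth_def dest: spec[of _ "Suc 0"])

lemma smooth_partial: "smooth f \<Longrightarrow> smooth (partial k f)"
  unfolding smooth_def by (metis C_diff.simps(2))

lemma smooth_borel [measurable (raw)]: "smooth f \<Longrightarrow> f \<in> borel_measurable borel"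
  by (intro borel_measurable_continuous_onI smooth_continuous)

lemma C_diff_add: "C_diff m f \<Longrightarrow> C_diff m g \<Longrightarrow> C_diff m (\<lambda>x. f x + g x)"
proof (induction m arbitrary: f g)
  case (Suc m)
  then have "partial k (\<lambda>x. f x + g x) = (\<lambda>x. partial k f x + partial k g x)" for k
    by (intro ext partial_add) auto
  with Suc show ?case by auto
qed (auto intro: continuous_intros)

lemma C_diff_mult: "C_diff m f \<Longrightarrow> C_diff m g \<Longrightarrow> C_diff m (\<lambda>x. f x * g x)"
proof (induction m arbitrary: f g)
  case (Suc m)
  then have eq: "partial k (\<lambda>x. f x * g x) = (\<lambda>x. partial k f x * g x + f x * partial k g x)" for k
    by (intro ext partial_mult) auto
  have "C_diff m f" "C_diff m g"
    using Suc.prems C_diff_SucD by blast+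
  with Suc show ?case
    unfolding C_diff.simps eq by (auto intro!: C_diff_add)
qed (auto intro: continuous_intros)

lemma C_diff_const: "C_diff m (\<lambda>x. c)"
  by (induction m arbitrary: c) auto

lemma smooth_const [intro]: "smooth (\<lambda>x. c)"
  and smooth_add [intro]: "smooth f \<Longrightarrow> smooth g \<Longrightarrow> smooth (\<lambda>x. f x + g x)"
  and smooth_mult [intro]: "smooth f \<Longrightarrow> smooth g \<Longrightarrow> smooth (\<lambda>x. f x * g x)"
  by (simp_all add: smooth_def C_diff_const C_diff_add C_diff_mult)

lemma smooth_diff [intro]: "smooth f \<Longrightarrow> smooth g \<Longrightarrow> smooth (\<lambda>x. f x - g x)"
  using smooth_add[of f "\<lambda>x. -1 * g x"] smooth_mult[of "\<lambda>x. -1" g] by auto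

lemma smooth_sum [intro]: "(\<And>i. i \<in> I \<Longrightarrow> smooth (f i)) \<Longrightarrow> smooth (\<lambda>x. \<Sum>i\<in>I. f i x)"
  by (induction I rule: infinite_finite_induct) auto

lemma smoothI:
  assumes "\<And>x. f differentiable (at x)" "\<And>k. smooth (partial k f)"
  shows "smooth f"
  unfolding smooth_def
proof
  fix m show "C_diff m f"
    using assms C_diff_SucD[of m f] by (auto simp: smooth_def)
qed

lemma smooth_nth [intro]: "smooth (\<lambda>x. x $ i)"
proof (rule smoothI)
  fix x :: "real^'a"
  have d: "((\<lambda>x. x $ i) has_derivative (\<lambda>h. h $ i)) (at x)" for x :: "real^'a"
    by (rule bounded_linear_imp_has_derivative) (rule bounded_linear_vec_nth)
  then show "(\<lambda>x. x $ i) differentiable (at x)"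
    using differentiable_def by blast
  show "smooth (partial k (\<lambda>x::real^'a. x $ i))" for k
  proof -
    have "partial k (\<lambda>x::real^'a. x $ i) = (\<lambda>x. axis k 1 $ i)"
      by (rule ext) (rule partial_eqI[OF d])
    then show ?thesis by auto
  qed
qed

lemma smooth_inner_self [intro]: "smooth (\<lambda>x. x \<bullet> x)"
  unfolding inner_vec_def by (intro smooth_sum) (auto simp: inner_real_def)

text \<open>All derivatives of the outer function are supplied as one sequence, so that the
  induction on the order of differentiability can keep \<open>n\<close> arbitrary: by the chain rule
  a partial derivative is \<open>F (Suc n)\<close> after \<open>q\<close> times a smooth factor. It
  serves for the bump function and later for the sine truncations.\<close>

lemma smooth_real_compose:
  fixes F :: "nat \<Rightarrow> real \<Rightarrow> real"
  assumes F: "\<And>n t. (F n has_real_derivative F (Suc n) t) (at t)" and q: "smooth q"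
  shows "smooth (\<lambda>x. F n (q x))"
proof -
  have diff: "(\<lambda>x. F n (q x)) differentiable (at x)" for n x
    using has_derivative_compose[OF has_derivative_grad[OF smooth_differentiable[OF q]]
        F[unfolded has_field_derivative_def]] differentiableI by blast
  have "C_diff m (\<lambda>x. F n (q x))" for m
  proof (induction m arbitrary: n)
    case 0
    show ?case
      using diff by (auto simp: continuous_on_eq_continuous_at intro: differentiable_imp_continuous_within)
  next
    case (Suc m)
    have "partial k (\<lambda>x. F n (q x)) = (\<lambda>x. F (Suc n) (q x) * partial k q x)" for k
      using F q by (intro ext partial_real_compose) (auto intro: smooth_differentiable)
    moreover have "C_diff m (partial k q)" for k
      using q smooth_partial smooth_def by blast
    ultimately show ?case
      using Suc diff by (auto intro: C_diff_mult)
  qed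
  then show ?thesis
    by (simp add: smooth_def)
qed

text \<open>Every derivative of exp(-1/t) on the positive half-line is a polynomial in 1/t times
  exp(-1/t), and such products tend to 0 at the origin, so each one extends by 0 to a differentiable
  function.\<close>

lemma exp_inverse_derivatives:
  obtains F :: "nat \<Rightarrow> real \<Rightarrow> real"
  where "\<And>n t. (F n has_real_derivative F (Suc n) t) (at t)"
    "\<And>t. F 0 t = (if t > 0 then exp (- (1 / t)) else 0)"
proof -
  \<comment> \<open>With y = 1/t, the derivative of r(y) exp(-y) with respect to t is y^2 (r -
    r')(y) exp(-y); this is the recursion.\<close>
  define p :: "nat \<Rightarrow> real poly" where "p n = rec_nat [:1:] (\<lambda>_ r. [:0,0,1:] * (r - pderiv r)) n" for n :: nat
  have p: "p 0 = [:1:]" "p (Suc n) = [:0,0,1:] * (p n - pderiv (p n))" for n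
    by (simp_all add: p_def)
  define F where "F n t = (if t > 0 then poly (p n) (1 / t) * exp (- (1 / t)) else 0)" for n and t :: real
  have lim: "((\<lambda>t. poly q (1 / t) * exp (- (1 / t))) \<longlongrightarrow> 0) (at_right 0)" for q :: "real poly"
  proof -
    have "((\<lambda>y. poly q y * exp (- y)) \<longlongrightarrow> 0) at_top"
    proof (induction q)
      case 0
      then show ?case by simp
    next
      case (pCons a q)
      have *: "((\<lambda>y::real. y ^ i * exp (- y)) \<longlongrightarrow> 0) at_top" for i :: nat
        using tendsto_power_div_exp_0[of i] by (simp only: exp_minus divide_inverse)
      have "((\<lambda>y. \<Sum>i\<le>degree (pCons a q). coeff (pCons a q) i * (y ^ i * exp (- y))) \<longlongrightarrow> (\<Sum>i\<le>degree (pCons a q). coeff (pCons a q) i * 0)) at_top"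
        by (intro tendsto_intros *)
      then show ?case
        unfolding poly_altdef sum_distrib_right by (simp add: mult.assoc)
    qed
    moreover have "filterlim (\<lambda>t::real. 1 / t) at_top (at_right 0)"
      using filterlim_inverse_at_top_right by (simp add: inverse_eq_divide)
    ultimately show ?thesis
      by (rule filterlim_compose)
  qed
  have der: "(F n has_real_derivative F (Suc n) t) (at t)" for n t
  proof -
    consider "t > 0" | "t < 0" | "t = 0" by linarith
    then show ?thesis
    proof cases
      case 1
      have "((\<lambda>t. poly (p n) (1 / t) * exp (- (1 / t))) has_real_derivative F (Suc n) t) (at t)"
        using 1 unfolding F_def p
        by (auto intro!: derivative_eq_intros DERIV_chain'[OF _ poly_DERIV]
              simp: field_simps power2_eq_square)
      then show ?thesis
        by (rule has_field_derivative_transform_within_open[of _ _ _ "{0<..}"]) (use 1 in \<open>auto simp: F_def\<close>)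
    next
      case 2
      have "((\<lambda>t. 0) has_real_derivative F (Suc n) t) (at t)"
        using 2 by (simp add: F_def)
      then show ?thesis
        by (rule has_field_derivative_transform_within_open[of _ _ _ "{..<0}"]) (use 2 in \<open>auto simp: F_def\<close>)
    next
      case 3
      \<comment> \<open>Division by h only multiplies the polynomial by its variable, so the
        difference quotient at 0 is covered by the same limit.\<close>
      have "((\<lambda>h. F n h / h) \<longlongrightarrow> 0) (at_right 0)"
      proof -
        have "((\<lambda>t. poly ([:0,1:] * p n) (1 / t) * exp (- (1 / t))) \<longlongrightarrow> 0) (at_right 0)"
          by (rule lim)
        then show ?thesis
          by (rule Lim_transform_eventually)
            (auto simp: F_def eventually_at_right_less eventually_at_filter)
      qed
      moreover have "((\<lambda>h. F n h / h) \<longlongrightarrow> 0) (at_left 0)"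
        by (rule tendsto_eventually) (auto simp: F_def eventually_at_filter)
      ultimately have "((\<lambda>h. F n h / h) \<longlongrightarrow> 0) (at 0)"
        by (simp add: filterlim_split_at)
      with 3 show ?thesis
        by (simp add: has_field_derivative_iff F_def)
    qed
  qed
  show thesis
    by (rule that[of F, OF der]) (simp add: F_def p)
qed

lemma smooth_bump_exists:
  obtains \<beta> :: "real^'n \<Rightarrow> real" where "smooth \<beta>" "\<And>x. 0 \<le> \<beta> x" "\<And>x. norm x < 1 \<Longrightarrow> 0 < \<beta> x"
    "\<And>x. norm x \<ge> 1 \<Longrightarrow> \<beta> x = 0"
proof -
  obtain F :: "nat \<Rightarrow> real \<Rightarrow> real" where F: "\<And>n t. (F n has_real_derivative F (Suc n) t) (at t)"
    "\<And>t. F 0 t = (if t > 0 then exp (- (1 / t)) else 0)"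
    using exp_inverse_derivatives by metis
  have "smooth (\<lambda>x::real^'n. F 0 (1 - x \<bullet> x))"
    by (rule smooth_real_compose[of F, OF F(1)]) auto
  moreover have "norm x < 1 \<longleftrightarrow> 0 < 1 - x \<bullet> x" for x :: "real^'n"
    by (metis abs_norm_cancel abs_square_less_1 diff_gt_0_iff_gt dot_square_norm)
  ultimately show thesis
    by (intro that[of "\<lambda>x. F 0 (1 - x \<bullet> x)"]) (auto simp: F(2) simp flip: not_less)
qed

subsection \<open>Test functions\<close>

lemma Cc_infinity_smooth: "u \<in> Cc_infinity \<Omega> \<Longrightarrow> smooth u"
  by (simp add: Cc_infinity_def smooth_def)

lemma Cc_infinityI:
  assumes "smooth u" "compact K" "K \<subseteq> \<Omega>" "\<And>x. x \<notin> K \<Longrightarrow> u x = 0"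
  shows "u \<in> Cc_infinity \<Omega>"
proof -
  have "closure {x. u x \<noteq> 0} \<subseteq> K"
    using assms by (intro closure_minimal) (auto simp: compact_imp_closed)
  moreover have "compact (closure {x. u x \<noteq> 0})"
    using calculation assms(2) by (meson closed_closure closed_Int_compact compact_imp_bounded bounded_subset compact_eq_bounded_closed)
  ultimately show ?thesis
    using assms by (auto simp: Cc_infinity_def smooth_def)
qed

lemma Cc_infinityE:
  assumes "u \<in> Cc_infinity \<Omega>"
  obtains K where "compact K" "K \<subseteq> \<Omega>" "\<And>x. x \<notin> K \<Longrightarrow> u x = 0" "\<And>x k. x \<notin> K \<Longrightarrow> partial k u x = 0"
proof
  define K where "K = closure {x. u x \<noteq> 0}"
  show "compact K" "K \<subseteq> \<Omega>"
    using assms by (auto simp: Cc_infinity_def K_def)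
  show z: "x \<notin> K \<Longrightarrow> u x = 0" for x
    using closure_subset unfolding K_def by force
  show "partial k u x = 0" if "x \<notin> K" for x k
  proof -
    have "((\<lambda>x. 0) has_derivative (\<lambda>h. 0)) (at x)" by simp
    moreover have "open (- K)" "x \<in> - K"
      using that by (auto simp: K_def)
    ultimately have "(u has_derivative (\<lambda>h. 0)) (at x)"
      by (rule has_derivative_transform_within_open) (auto simp: z)
    from partial_eqI[OF this] show ?thesis by simp
  qed
qed

lemma Cc_infinity_partial:
  assumes "u \<in> Cc_infinity \<Omega>"
  shows "partial k u \<in> Cc_infinity \<Omega>"
proof -
  obtain K where "compact K" "K \<subseteq> \<Omega>" "\<And>x k. x \<notin> K \<Longrightarrow> partial k u x = 0"
    using assms by (metis Cc_infinityE)
  then show ?thesis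
    using assms by (intro Cc_infinityI[of _ K]) (auto intro: smooth_partial Cc_infinity_smooth)
qed

lemma Cc_infinity_mult:
  assumes "u \<in> Cc_infinity \<Omega>" "smooth v"
  shows "(\<lambda>x. v x * u x) \<in> Cc_infinity \<Omega>"
proof -
  obtain K where "compact K" "K \<subseteq> \<Omega>" "\<And>x. x \<notin> K \<Longrightarrow> u x = 0"
    using assms(1) by (metis Cc_infinityE)
  then show ?thesis
    using assms by (intro Cc_infinityI[of _ K]) (auto intro: Cc_infinity_smooth)
qed

lemma Cc_infinity_add:
  assumes "u \<in> Cc_infinity \<Omega>" "v \<in> Cc_infinity \<Omega>"
  shows "(\<lambda>x. u x + v x) \<in> Cc_infinity \<Omega>"
proof -
  obtain K L where "compact K" "K \<subseteq> \<Omega>" "\<And>x. x \<notin> K \<Longrightarrow> u x = 0"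
    "compact L" "L \<subseteq> \<Omega>" "\<And>x. x \<notin> L \<Longrightarrow> v x = 0"
    using assms by (metis Cc_infinityE)
  then show ?thesis
    using assms by (intro Cc_infinityI[where K="K \<union> L"]) (auto intro: Cc_infinity_smooth)
qed

lemma Cc_infinity_diff:
  "u \<in> Cc_infinity \<Omega> \<Longrightarrow> v \<in> Cc_infinity \<Omega> \<Longrightarrow> (\<lambda>x. u x - v x) \<in> Cc_infinity \<Omega>"
  using Cc_infinity_add[of u \<Omega> "\<lambda>x. -1 * v x"] Cc_infinity_mult[of v \<Omega> "\<lambda>x. -1"] by auto

lemma Cc_infinity_zero [intro]: "(\<lambda>x. 0) \<in> Cc_infinity \<Omega>"
  by (rule Cc_infinityI[where K="{}"]) auto

lemma Cc_infinity_sum: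
  "(\<And>i. i \<in> I \<Longrightarrow> u i \<in> Cc_infinity \<Omega>) \<Longrightarrow> (\<lambda>x. \<Sum>i\<in>I. u i x) \<in> Cc_infinity \<Omega>"
  by (induction I rule: infinite_finite_induct) (auto intro: Cc_infinity_add)

lemma Cc_infinity_bounded:
  assumes "u \<in> Cc_infinity \<Omega>"
  obtains B where "B > 0" "\<And>x. \<bar>u x\<bar> \<le> B"
proof -
  obtain K where K: "compact K" "\<And>x. x \<notin> K \<Longrightarrow> u x = 0"
    using assms by (metis Cc_infinityE)
  have "bounded (u ` K)"
    using K smooth_continuous[OF Cc_infinity_smooth[OF assms]]
    by (intro compact_imp_bounded compact_continuous_image) (auto intro: continuous_on_subset)
  then obtain B where "B > 0" "\<forall>x\<in>u ` K. norm x \<le> B"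
    using bounded_pos by blast
  then show thesis
    using K(2) by (intro that[of B]) (metis abs_zero image_eqI less_eq_real_def real_norm_def)+
qed

lemma integrable_compact_support:
  fixes f :: "'a::euclidean_space \<Rightarrow> real"
  assumes "f \<in> borel_measurable borel" "compact K" "\<And>x. x \<notin> K \<Longrightarrow> f x = 0" "\<And>x. \<bar>f x\<bar> \<le> B"
  shows "integrable lborel f"
proof (rule Bochner_Integration.integrable_bound)
  show "integrable lborel (\<lambda>x. B * indicator K x)"
    using assms(2) by (intro integrable_mult_right integrable_real_indicator)
      (auto intro!: borel_compact simp: emeasure_compact_finite[unfolded infinity_ennreal_def])
  show "f \<in> borel_measurable lborel" using assms(1) by simp
  show "AE x in lborel. norm (f x) \<le> norm (B * indicator K x)"
  proof (rule AE_I2)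
    fix x
    show "norm (f x) \<le> norm (B * indicator K x)"
      using assms(3)[of x] assms(4)[of x] by (cases "x \<in> K") auto
  qed
qed

lemma Cc_infinity_integrable:
  assumes "u \<in> Cc_infinity \<Omega>"
  shows "integrable lborel u"
proof -
  obtain B where "\<And>x. \<bar>u x\<bar> \<le> B" using Cc_infinity_bounded[OF assms] by metis
  moreover obtain K where "compact K" "\<And>x. x \<notin> K \<Longrightarrow> u x = 0"
    using assms by (metis Cc_infinityE)
  ultimately show ?thesis
    using smooth_borel[OF Cc_infinity_smooth[OF assms]] by (rule_tac integrable_compact_support) auto
qed

text \<open>The mean value inequality is applied to the difference of \<open>u\<close> and its
  linear part at \<open>x\<close>, whose gradient is small by uniform continuity. Uniformity in
  \<open>x\<close> is what permits differentiation under the integral sign in convolutions and the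
  integration of difference quotients.\<close>

lemma uniform_linear_approximation:
  assumes u: "u \<in> Cc_infinity \<Omega>" and "e > 0"
  obtains t where "t > 0" "\<And>x h. norm h < t \<Longrightarrow> \<bar>u (x + h) - u x - grad u x \<bullet> h\<bar> \<le> e * norm h"
proof -
  obtain K where K: "compact K" "\<And>x. x \<notin> K \<Longrightarrow> u x = 0" "\<And>x k. x \<notin> K \<Longrightarrow> partial k u x = 0"
    using u by (metis Cc_infinityE)
  have cont: "continuous_on UNIV (grad u)"
    unfolding grad_def
    by (intro continuous_on_vec_lambda smooth_continuous smooth_partial Cc_infinity_smooth[OF u])
  obtain R where R: "R > 0" "K \<subseteq> cball 0 R"
    using compact_imp_bounded[OF K(1)] by (metis bounded_pos mem_cball_0 subsetI)
  have "uniformly_continuous_on (cball 0 (R + 1)) (grad u)"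
    by (intro compact_uniformly_continuous continuous_on_subset[OF cont]) auto
  then obtain t0 where t0: "t0 > 0"
    "\<And>x y. x \<in> cball 0 (R+1) \<Longrightarrow> y \<in> cball 0 (R+1) \<Longrightarrow> dist y x < t0 \<Longrightarrow> dist (grad u y) (grad u x) < e"
    unfolding uniformly_continuous_on_def using \<open>e > 0\<close> by metis
  have unif: "norm (grad u y - grad u x) \<le> e" if "norm (y - x) < min t0 1" for x y
  \<comment> \<open>One point in \<open>K\<close> forces both into the ball on which uniform
    continuity is known; if neither lies in \<open>K\<close>, both gradients are 0.\<close>
  proof (cases "x \<in> K \<or> y \<in> K")
    case True
    have "norm y \<le> norm x + norm (y - x)" "norm x \<le> norm y + norm (y - x)"
      by norm+
    with True R that have "x \<in> cball 0 (R+1)" "y \<in> cball 0 (R+1)"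
      by (auto simp: subset_iff)
    then show ?thesis
      using t0(2)[of x y] that by (auto simp: dist_norm)
  next
    case False
    then have "grad u x = 0" "grad u y = 0"
      by (auto simp: vec_eq_iff K(3))
    then show ?thesis using \<open>e > 0\<close> by simp
  qed
  show thesis
  proof
    show "min t0 1 > 0" using t0 by simp
    fix x h :: "real^'a" assume h: "norm h < min t0 1"
    have "norm (u (x + h) - grad u x \<bullet> (x + h) - (u x - grad u x \<bullet> x)) \<le> e * norm (x + h - x)"
    proof (rule differentiable_bound[where S="ball x (min t0 1)" and f="\<lambda>y. u y - grad u x \<bullet> y"
          and f'="\<lambda>y v. (grad u y - grad u x) \<bullet> v"])
      fix y assume y: "y \<in> ball x (min t0 1)"
      show "((\<lambda>y. u y - grad u x \<bullet> y) has_derivative (\<lambda>v. (grad u y - grad u x) \<bullet> v)) (at y within ball x (min t0 1))"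
        by (rule has_derivative_at_withinI)
          (auto intro!: derivative_eq_intros has_derivative_grad smooth_differentiable Cc_infinity_smooth[OF u] simp: inner_diff_left)
      show "onorm (\<lambda>v. (grad u y - grad u x) \<bullet> v) \<le> e"
        using unif[of y x] y \<open>e > 0\<close>
        by (intro onorm_le) (auto intro!: order_trans[OF Cauchy_Schwarz_ineq2] mult_right_mono simp: dist_norm norm_minus_commute)
    qed (use h t0 in \<open>auto simp: dist_norm\<close>)
    then show "\<bar>u (x + h) - u x - grad u x \<bullet> h\<bar> \<le> e * norm h"
      by (simp add: inner_add_right algebra_simps)
  qed
qed

text \<open>By translation invariance the difference quotients of \<open>u\<close> have integral 0,
  and they approximate the partial derivative uniformly on a fixed ball outside which everything
  vanishes.\<close>

lemma integral_partial_eq_0: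
  assumes u: "u \<in> Cc_infinity \<Omega>"
  shows "(LINT x|lborel. partial k u x) = 0"
proof -
  obtain K where K: "compact K" "\<And>x. x \<notin> K \<Longrightarrow> u x = 0" "\<And>x k. x \<notin> K \<Longrightarrow> partial k u x = 0"
    using u by (metis Cc_infinityE)
  obtain R where R: "R > 0" "K \<subseteq> cball 0 R"
    using compact_imp_bounded[OF K(1)] by (metis bounded_pos mem_cball_0 subsetI)
  define V where "V = measure lborel (cball (0::real^'a) (R + 1))"
  have int_u: "integrable lborel u" and int_pu: "integrable lborel (partial k u)"
    using Cc_infinity_integrable u Cc_infinity_partial by blast+
  have shift: "integrable lborel (\<lambda>x. u (x + h))" "(LINT x|lborel. u (x + h)) = (LINT x|lborel. u x)" for h
  proof -
    have m: "u \<in> borel_measurable borel" using u Cc_infinity_smooth smooth_borel by blast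
    have "distr lborel borel ((+) h) = lborel" by (rule lborel_distr_plus)
    then show "integrable lborel (\<lambda>x. u (x + h))" "(LINT x|lborel. u (x + h)) = (LINT x|lborel. u x)"
      using integrable_distr_eq[of "(+) h" lborel borel u] integral_distr[of "(+) h" lborel borel u] m int_u
      by (simp_all add: add.commute)
  qed
  have *: "\<bar>LINT x|lborel. partial k u x\<bar> \<le> e * V" if "e > 0" for e
  proof -
    obtain t where t: "t > 0" "\<And>x h. norm h < t \<Longrightarrow> \<bar>u (x + h) - u x - grad u x \<bullet> h\<bar> \<le> e * norm h"
      using uniform_linear_approximation[OF u \<open>e > 0\<close>] by metis
    define s where "s = min (t/2) 1"
    define h :: "real^'a" where "h = s *\<^sub>R axis k 1"
    have s: "0 < s" "s < t" "s \<le> 1" and nh: "norm h = s"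
      using t by (auto simp: s_def h_def)
    have eq: "grad u x \<bullet> h = s * partial k u x" for x
      by (simp add: h_def inner_axis)
    have bound: "\<bar>u (x + h) - u x - s * partial k u x\<bar> \<le> e * s * indicator (cball 0 (R + 1)) x" for x
    proof (cases "x \<in> cball 0 (R+1)")
      case True
      then show ?thesis using t(2)[of h x] nh s eq by simp
    next
      case False
      have "norm x \<le> norm (x + h) + norm h"
        by norm
      with False have "x + h \<notin> K" "x \<notin> K"
        using R s nh by (auto simp: subset_iff)
      then show ?thesis using K \<open>e > 0\<close> s by simp
    qed
    have "(LINT x|lborel. u (x + h) - u x - s * partial k u x) = - s * (LINT x|lborel. partial k u x)"
      using shift int_u int_pu by simp
    moreover have "\<bar>LINT x|lborel. u (x + h) - u x - s * partial k u x\<bar> \<le> (LINT x|lborel. e * s * indicator (cball (0::real^'a) (R + 1)) x)"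
      unfolding real_norm_def[symmetric]
    proof (rule Bochner_Integration.integral_norm_bound_integral)
      show "integrable lborel (\<lambda>x. u (x + h) - u x - s * partial k u x)"
        using shift int_u int_pu by auto
      show "integrable lborel (\<lambda>x. e * s * indicator (cball (0::real^'a) (R + 1)) x)"
        by (intro integrable_mult_right integrable_real_indicator)
          (auto simp: emeasure_compact_finite[unfolded infinity_ennreal_def])
    qed (use bound in simp)
    ultimately have "s * \<bar>LINT x|lborel. partial k u x\<bar> \<le> e * s * V"
      using s by (simp add: abs_mult V_def)
    then show ?thesis using s by (simp add: mult.assoc mult.left_commute)
  qed
  have "\<bar>LINT x|lborel. partial k u x\<bar> \<le> 0 + e" if "e > 0" for e
  proof -
    have V: "V \<ge> 0" by (simp add: V_def)
    have "\<bar>LINT x|lborel. partial k u x\<bar> \<le> e / (V + 1) * V"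
      using that V *[of "e / (V + 1)"] by simp
    also have "\<dots> \<le> e"
      using that V by (simp add: field_simps)
    finally show ?thesis by simp
  qed
  then show ?thesis
    by (meson abs_le_zero_iff field_le_epsilon)
qed

lemma integral_by_parts:
  assumes "smooth f" "u \<in> Cc_infinity \<Omega>"
  shows "(LINT x|lborel. f x * partial k u x) = - (LINT x|lborel. partial k f x * u x)"
proof -
  have "(\<lambda>x. f x * u x) \<in> Cc_infinity \<Omega>"
    using assms by (simp add: Cc_infinity_mult)
  then have "(LINT x|lborel. partial k (\<lambda>x. f x * u x) x) = 0"
    by (rule integral_partial_eq_0)
  moreover have "partial k (\<lambda>x. f x * u x) x = partial k f x * u x + f x * partial k u x" for x
    using assms by (intro partial_mult smooth_differentiable) (auto intro: Cc_infinity_smooth)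
  moreover have "integrable lborel (\<lambda>x. partial k f x * u x)" "integrable lborel (\<lambda>x. f x * partial k u x)"
    using assms by (metis Cc_infinity_integrable Cc_infinity_mult Cc_infinity_partial smooth_partial)+
  ultimately show ?thesis
    by simp
qed

subsection \<open>Mollification\<close>

lemma lborel_affine_nn_integral:
  fixes f :: "'a::euclidean_space \<Rightarrow> ennreal"
  assumes "f \<in> borel_measurable borel" "c \<noteq> 0"
  shows "(\<integral>\<^sup>+x. f x \<partial>lborel) = ennreal (\<bar>c\<bar> ^ DIM('a)) * (\<integral>\<^sup>+v. f (t + c *\<^sub>R v) \<partial>lborel)"
  by (subst lborel_affine[OF assms(2), of t])
    (use assms in \<open>simp add: nn_integral_density nn_integral_distr nn_integral_cmult\<close>)

lemma
  fixes f :: "'a::euclidean_space \<Rightarrow> real"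
  assumes "f \<in> borel_measurable borel" "c \<noteq> 0"
  shows lborel_affine_integral: "(LINT x|lborel. f x) = \<bar>c\<bar> ^ DIM('a) * (LINT v|lborel. f (t + c *\<^sub>R v))"
    and lborel_affine_integrable: "integrable lborel f \<Longrightarrow> integrable lborel (\<lambda>v. f (t + c *\<^sub>R v))"
proof -
  show "(LINT x|lborel. f x) = \<bar>c\<bar> ^ DIM('a) * (LINT v|lborel. f (t + c *\<^sub>R v))"
    by (subst lborel_affine[OF assms(2), of t])
      (use assms in \<open>simp add: integral_density integral_distr\<close>)
  assume "integrable lborel f"
  then have "integrable (density (distr lborel borel (\<lambda>x. t + c *\<^sub>R x)) (\<lambda>_. ennreal (\<bar>c\<bar> ^ DIM('a)))) f"
    by (subst (asm) lborel_affine[OF assms(2), of t])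
  then show "integrable lborel (\<lambda>v. f (t + c *\<^sub>R v))"
    using assms by (simp add: integrable_density integrable_distr_eq)
qed

lemma
  fixes f :: "'a::euclidean_space \<Rightarrow> real"
  assumes "f \<in> borel_measurable borel"
  shows lborel_integral_reflect: "(LINT y|lborel. f (x - y)) = (LINT y|lborel. f y)"
    and lborel_integrable_reflect: "integrable lborel f \<Longrightarrow> integrable lborel (\<lambda>y. f (x - y))"
  using lborel_affine_integral[OF assms, of "-1" x] lborel_affine_integrable[OF assms, of "-1" x] by simp_all

text \<open>The integral is taken over the completed measure, since \<open>f\<close> will be a
  representative that is only Lebesgue measurable; in practice \<open>K\<close> is a smooth kernel
  or one of its partial derivatives.\<close>

definition conv :: "(real^'n \<Rightarrow> real) \<Rightarrow> (real^'n \<Rightarrow> real) \<Rightarrow> real^'n \<Rightarrow> real"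
  where "conv K f x = (LINT y|lebesgue. K (x - y) * f y)"

lemma borel_imp_lebesgue: "f \<in> borel_measurable borel \<Longrightarrow> f \<in> borel_measurable lebesgue"
  by (rule measurable_completion) simp

lemma borel_shift_lebesgue:
  fixes K :: "real^'n \<Rightarrow> real"
  assumes "K \<in> borel_measurable borel"
  shows "(\<lambda>y. K (x - y)) \<in> borel_measurable lebesgue"
  by (rule borel_imp_lebesgue) (use assms in measurable)

lemma conv_integrable:
  fixes K f :: "real^'n \<Rightarrow> real"
  assumes "K \<in> borel_measurable borel" "\<And>x. \<bar>K x\<bar> \<le> B" "integrable lebesgue f"
  shows "integrable lebesgue (\<lambda>y. K (x - y) * f y)"
proof (rule Bochner_Integration.integrable_bound)
  show "integrable lebesgue (\<lambda>y. B * f y)" using assms(3) by simp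
  show "(\<lambda>y. K (x - y) * f y) \<in> borel_measurable lebesgue"
    using borel_shift_lebesgue[OF assms(1)] assms(3) by (intro borel_measurable_times) auto
  have "\<bar>K z\<bar> \<le> \<bar>B\<bar>" for z
    using assms(2)[of z] by linarith
  then show "AE y in lebesgue. norm (K (x - y) * f y) \<le> norm (B * f y)"
    by (auto simp: abs_mult intro!: mult_right_mono)
qed

lemma conv_integrable_Cc:
  assumes "K \<in> Cc_infinity A" "integrable lebesgue f"
  shows "integrable lebesgue (\<lambda>y. K (x - y) * f y)"
  by (rule Cc_infinity_bounded[OF assms(1)])
    (rule conv_integrable[OF smooth_borel[OF Cc_infinity_smooth[OF assms(1)]] _ assms(2)])

text \<open>Differentiation under the integral sign: the Taylor remainder of the kernel is at most a
  small multiple of \<open>norm h\<close>, uniformly in \<open>y\<close>, so that integrability of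
  \<open>f\<close> is all that enters.\<close>

lemma conv_has_derivative:
  fixes K f :: "real^'n \<Rightarrow> real"
  assumes K: "K \<in> Cc_infinity A" and f: "integrable lebesgue f"
  shows "(conv K f has_derivative (\<lambda>h. (\<chi> k. conv (partial k K) f x) \<bullet> h)) (at x)"
  unfolding has_derivative_at_alt
proof (intro conjI allI impI)
  show "bounded_linear ((\<bullet>) (\<chi> k. conv (partial k K) f x))"
    by (rule bounded_linear_inner_right)
  fix e :: real assume "e > 0"
  \<comment> \<open>The tolerance for the kernel is e / (I + 1), which keeps the quotient meaningful
    when \<open>f\<close> is a null function.\<close>
  define I where "I = (LINT y|lebesgue. \<bar>f y\<bar>)"
  have I: "I \<ge> 0" by (simp add: I_def)
  then obtain t where t: "t > 0"
    "\<And>x h. norm h < t \<Longrightarrow> \<bar>K (x + h) - K x - grad K x \<bullet> h\<bar> \<le> (e / (I + 1)) * norm h"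
    using \<open>e > 0\<close> by (auto intro: uniform_linear_approximation[OF K, of "e / (I + 1)"])
  have int: "integrable lebesgue (\<lambda>y. K (x - y) * f y)" "integrable lebesgue (\<lambda>y. partial k K (x - y) * f y)" for x k
    using K f by (auto intro: conv_integrable_Cc Cc_infinity_partial)
  show "\<exists>d>0. \<forall>y. norm (y - x) < d \<longrightarrow>
      norm (conv K f y - conv K f x - (\<chi> k. conv (partial k K) f x) \<bullet> (y - x)) \<le> e * norm (y - x)"
  proof (intro exI[of _ t] conjI allI impI)
    fix x' assume x': "norm (x' - x) < t"
    define h where "h = x' - x"
    have "conv K f x' - conv K f x - (\<chi> k. conv (partial k K) f x) \<bullet> h
        = (LINT y|lebesgue. K (x' - y) * f y - K (x - y) * f y - (\<Sum>k\<in>UNIV. h $ k * (partial k K (x - y) * f y)))"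
      using int by (simp add: conv_def inner_vec_def mult.commute)
    also have "\<dots> = (LINT y|lebesgue. (K ((x - y) + h) - K (x - y) - grad K (x - y) \<bullet> h) * f y)"
      by (intro Bochner_Integration.integral_cong) (auto simp: inner_vec_def sum_distrib_left algebra_simps h_def)
    also have "\<bar>\<dots>\<bar> \<le> (LINT y|lebesgue. (e / (I + 1)) * norm h * \<bar>f y\<bar>)"
    proof (rule integral_abs_bound_integral)
      have "integrable lebesgue (\<lambda>y. K (x' - y) * f y - K (x - y) * f y - (\<Sum>k\<in>UNIV. h $ k * (partial k K (x - y) * f y)))"
        using int by auto
      then show "integrable lebesgue (\<lambda>y. (K ((x - y) + h) - K (x - y) - grad K (x - y) \<bullet> h) * f y)"
        by (rule Bochner_Integration.integrable_cong[THEN iffD1, rotated 2])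
         (auto simp: inner_vec_def sum_distrib_left algebra_simps h_def)
      show "integrable lebesgue (\<lambda>y. (e / (I + 1)) * norm h * \<bar>f y\<bar>)"
        using f by auto
      show "\<bar>(K ((x - y) + h) - K (x - y) - grad K (x - y) \<bullet> h) * f y\<bar> \<le> (e / (I + 1)) * norm h * \<bar>f y\<bar>" for y
        using mult_right_mono[OF t(2)[of h "x - y"], of "\<bar>f y\<bar>"] x' by (simp add: abs_mult h_def)
    qed
    also have "\<dots> = (e / (I + 1)) * norm h * I"
      by (simp add: I_def)
    also have "\<dots> \<le> e * norm h"
      using I \<open>e > 0\<close> by (simp add: field_simps mult_left_mono)
    finally show "norm (conv K f x' - conv K f x - (\<chi> k. conv (partial k K) f x) \<bullet> (x' - x)) \<le> e * norm (x' - x)"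
      by (simp add: h_def)
  qed (rule t)
qed

lemma partial_conv:
  assumes "K \<in> Cc_infinity A" "integrable lebesgue f"
  shows "partial k (conv K f) = conv (partial k K) f"
  by (rule ext) (simp add: partial_eqI[OF conv_has_derivative[OF assms]] inner_axis)

lemma smooth_conv:
  assumes K: "K \<in> Cc_infinity A" and f: "integrable lebesgue f"
  shows "smooth (conv K f)"
proof -
  have "C_diff m (conv K f)" for m
    using K
  proof (induction m arbitrary: K)
    case 0
    then show ?case
      using conv_has_derivative[OF 0 f]
      by (auto simp: continuous_on_eq_continuous_at dest: has_derivative_continuous)
  next
    case (Suc m)
    then show ?case
      using conv_has_derivative[OF Suc.prems f] Cc_infinity_partial[OF Suc.prems]
      by (auto simp: partial_conv[OF Suc.prems f] intro: differentiableI)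
  qed
  then show ?thesis by (simp add: smooth_def)
qed

lemma conv_eq_0:
  assumes "\<And>y. f y \<noteq> 0 \<Longrightarrow> K (x - y) = 0"
  shows "conv K f x = 0"
proof -
  have *: "(\<lambda>y. K (x - y) * f y) = (\<lambda>y. 0)"
    using assms by (intro ext) auto
  show ?thesis unfolding conv_def * by simp
qed

section \<open>Mollifiers and their norm inequalities\<close>

lemma lebesgue_lborel_integral: "f \<in> borel_measurable borel \<Longrightarrow> (LINT x|lebesgue. f x) = (LINT x|lborel. f (x::'a::euclidean_space) :: real)"
  by (simp add: integral_completion)

lemma lebesgue_lborel_integrable: "f \<in> borel_measurable borel \<Longrightarrow> integrable lebesgue f \<longleftrightarrow> integrable lborel (f::'a::euclidean_space \<Rightarrow> real)"
  by (simp add: integrable_completion)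

text \<open>A property of a kernel rather than a fixed family, since the convergence statements
  below are to hold for every kernel of small support: one kernel then serves a function and all its
  partial derivatives at once.\<close>

definition mollifier :: "real \<Rightarrow> (real^'n \<Rightarrow> real) \<Rightarrow> bool"
  where "mollifier e \<rho> \<longleftrightarrow> \<rho> \<in> Cc_infinity UNIV \<and> (\<forall>x. 0 \<le> \<rho> x) \<and> (\<forall>x. e \<le> norm x \<longrightarrow> \<rho> x = 0)
     \<and> (LINT x|lborel. \<rho> x) = 1"

lemma mollifierD:
  assumes "mollifier e \<rho>"
  shows "\<rho> \<in> Cc_infinity UNIV" "smooth \<rho>" "\<rho> \<in> borel_measurable borel" "0 \<le> \<rho> x" "e \<le> norm x \<Longrightarrow> \<rho> x = 0"
    "integrable lborel \<rho>" "(LINT x|lborel. \<rho> x) = 1"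
    "integrable lebesgue (\<lambda>y. \<rho> (x - y))" "(LINT y|lebesgue. \<rho> (x - y)) = 1"
proof -
  show *: "\<rho> \<in> Cc_infinity UNIV" "smooth \<rho>" "\<rho> \<in> borel_measurable borel" "0 \<le> \<rho> x" "e \<le> norm x \<Longrightarrow> \<rho> x = 0"
    "integrable lborel \<rho>" "(LINT x|lborel. \<rho> x) = 1"
    using assms by (auto simp: mollifier_def intro: Cc_infinity_smooth smooth_borel Cc_infinity_integrable)
  have "(\<lambda>y. \<rho> (x - y)) \<in> borel_measurable borel" using *(3) by measurable
  then show "integrable lebesgue (\<lambda>y. \<rho> (x - y))" "(LINT y|lebesgue. \<rho> (x - y)) = 1"
    using * by (simp_all add: lebesgue_lborel_integrable lebesgue_lborel_integral lborel_integral_reflect lborel_integrable_reflect)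
qed

lemma partial_scale:
  fixes f :: "real^'n \<Rightarrow> real"
  assumes "\<And>x. f differentiable (at x)"
  shows "partial k (\<lambda>x. f (c *\<^sub>R x)) = (\<lambda>x. c * partial k f (c *\<^sub>R x))"
    and "(\<lambda>x. f (c *\<^sub>R x)) differentiable (at x)"
proof -
  have d: "((\<lambda>x. f (c *\<^sub>R x)) has_derivative (\<lambda>h. grad f (c *\<^sub>R x) \<bullet> (c *\<^sub>R h))) (at x)" for x
    by (rule has_derivative_compose[OF _ has_derivative_grad[OF assms]])
      (auto intro!: derivative_eq_intros)
  show "partial k (\<lambda>x. f (c *\<^sub>R x)) = (\<lambda>x. c * partial k f (c *\<^sub>R x))"
    by (rule ext, subst partial_eqI[OF d]) (simp add: inner_axis)
  show "(\<lambda>x. f (c *\<^sub>R x)) differentiable (at x)"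
    using d differentiableI by blast
qed

lemma smooth_scale: "smooth f \<Longrightarrow> smooth (\<lambda>x. f (c *\<^sub>R x))"
proof -
  have "C_diff m (\<lambda>x. f (c *\<^sub>R x))" if "smooth f" for m
    using that
  proof (induction m arbitrary: f)
    case 0
    then show ?case
      using smooth_continuous[OF 0] by (auto intro!: continuous_on_compose2[of UNIV f] continuous_intros)
  next
    case (Suc m)
    have "f differentiable (at x)" for x using Suc.prems smooth_differentiable by blast
    note * = partial_scale[OF this]
    show ?case
      using *(2) Suc.IH[OF smooth_partial[OF Suc.prems]] by (auto simp: *(1) intro!: C_diff_mult C_diff_const)
  qed
  then show "smooth f \<Longrightarrow> smooth (\<lambda>x. f (c *\<^sub>R x))"
    by (simp add: smooth_def)
qed

text \<open>Scaling of one normalised bump, e^(-d) \<beta>(x/e). The bound of order 1/e on the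
  \<open>L1\<close> norm of the gradient is what later gives a characteristic function smoothed at
  scale e a gradient of order 1/e.\<close>

lemma mollifier_exists:
  obtains \<rho> :: "real \<Rightarrow> real^'n \<Rightarrow> real" and A :: real
  where "\<And>e. e > 0 \<Longrightarrow> mollifier e (\<rho> e)" "A > 0"
    "\<And>e k. e > 0 \<Longrightarrow> (LINT x|lborel. \<bar>partial k (\<rho> e) x\<bar>) \<le> A / e"
proof -
  obtain \<beta> :: "real^'n \<Rightarrow> real" where \<beta>: "smooth \<beta>" "\<And>x. 0 \<le> \<beta> x" "\<And>x. norm x < 1 \<Longrightarrow> 0 < \<beta> x"
    "\<And>x. norm x \<ge> 1 \<Longrightarrow> \<beta> x = 0"
    using smooth_bump_exists by metis
  have \<beta>C: "\<beta> \<in> Cc_infinity UNIV"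
    by (rule Cc_infinityI[OF \<beta>(1), of "cball 0 1"]) (auto simp: \<beta>(4))
  define I where "I = (LINT x|lborel. \<beta> x)"
  have "I \<noteq> 0"
  proof
    assume "I = 0"
    then have "AE x in lborel. \<beta> x = 0"
      unfolding I_def using \<beta>(2) Cc_infinity_integrable[OF \<beta>C] by (subst (asm) integral_nonneg_eq_0_iff_AE) auto
    then have "AE x in lborel. x \<notin> ball (0::real^'n) 1"
      by eventually_elim (use \<beta>(3) in force)
    then have "emeasure lborel (ball (0::real^'n) 1) = 0"
      by (subst (asm) AE_iff_measurable[of "ball 0 1"]) auto
    then show False
      using emeasure_ball[of 1 "0::real^'n"] by (simp add: unit_ball_vol_pos less_imp_neq[THEN not_sym])
  qed
  moreover have "I \<ge> 0" unfolding I_def using \<beta>(2) by simp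
  ultimately have I: "I > 0" by simp
  define \<rho> where "\<rho> e x = (inverse e ^ CARD('n) / I) * \<beta> (inverse e *\<^sub>R x)" for e and x :: "real^'n"
  define A where "A = (\<Sum>k\<in>UNIV. (LINT x|lborel. \<bar>partial k \<beta> x\<bar>)) / I + 1"
  have moll: "mollifier e (\<rho> e)" if "e > 0" for e
    unfolding mollifier_def
  proof (intro conjI allI impI)
    have sm: "smooth (\<rho> e)"
      unfolding \<rho>_def using \<beta>(1) by (intro smooth_mult smooth_const smooth_scale)
    have z: "\<rho> e x = 0" if "e \<le> norm x" for x
      using that \<open>e > 0\<close> by (simp add: \<rho>_def \<beta>(4) field_simps)
    then show "e \<le> norm x \<Longrightarrow> \<rho> e x = 0" for x .
    show "\<rho> e \<in> Cc_infinity UNIV"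
      by (rule Cc_infinityI[OF sm, of "cball 0 e"]) (auto simp: z)
    show "0 \<le> \<rho> e x" for x using \<beta>(2) I \<open>e > 0\<close> by (simp add: \<rho>_def)
    have eq: "I = inverse e ^ CARD('n) * (LINT v|lborel. \<beta> (inverse e *\<^sub>R v))"
      unfolding I_def using lborel_affine_integral[OF smooth_borel[OF \<beta>(1)], of "inverse e" 0] \<open>e > 0\<close> by simp
    have "(LINT x|lborel. \<rho> e x) = inverse e ^ CARD('n) * (LINT v|lborel. \<beta> (inverse e *\<^sub>R v)) / I"
      unfolding \<rho>_def by simp
    then show "(LINT x|lborel. \<rho> e x) = 1"
      unfolding eq[symmetric] using I by simp
  qed
  have grad: "(LINT x|lborel. \<bar>partial k (\<rho> e) x\<bar>) \<le> A / e" if "e > 0" for e k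
  proof -
    have p: "partial k (\<rho> e) x = (inverse e ^ CARD('n) / I) * (inverse e * partial k \<beta> (inverse e *\<^sub>R x))" for x
      unfolding \<rho>_def using partial_scale[OF smooth_differentiable[OF \<beta>(1)], where c="inverse e"]
      by (subst partial_cmult) auto
    have m: "(\<lambda>x. \<bar>partial k \<beta> x\<bar>) \<in> borel_measurable borel"
      using smooth_borel[OF smooth_partial[OF \<beta>(1)]] by measurable
    have "(LINT x|lborel. \<bar>partial k (\<rho> e) x\<bar>)
       = (inverse e / I) * (inverse e ^ CARD('n) * (LINT x|lborel. \<bar>partial k \<beta> (inverse e *\<^sub>R x)\<bar>))"
      unfolding p using \<open>e > 0\<close> I by (simp add: abs_mult field_simps)
    also have "inverse e ^ CARD('n) * (LINT x|lborel. \<bar>partial k \<beta> (inverse e *\<^sub>R x)\<bar>) = (LINT x|lborel. \<bar>partial k \<beta> x\<bar>)"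
      using lborel_affine_integral[OF m, of "inverse e" 0] \<open>e > 0\<close> by simp
    also have "inverse e / I * \<dots> \<le> inverse e / I * (\<Sum>k\<in>UNIV. (LINT x|lborel. \<bar>partial k \<beta> x\<bar>))"
      using \<open>e > 0\<close> I by (intro mult_left_mono member_le_sum) auto
    also have "\<dots> \<le> A / e"
      using \<open>e > 0\<close> I by (simp add: A_def field_simps)
    finally show ?thesis .
  qed
  have "A > 0"
    unfolding A_def using I by (intro add_nonneg_pos divide_nonneg_pos sum_nonneg) auto
  then show thesis
    using that moll grad by blast
qed

text \<open>Jensen's inequality for the probability density \<open>\<rho> (x - y)\<close> in
  \<open>y\<close>: expand the nonnegative variance of \<open>f\<close> about its mean
  \<open>a\<close>.\<close>

lemma conv_square_le:
  assumes \<rho>: "mollifier e \<rho>" and f: "integrable lebesgue f" "integrable lebesgue (\<lambda>x. (f x)\<^sup>2)"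
  shows "(conv \<rho> f x)\<^sup>2 \<le> (LINT y|lebesgue. \<rho> (x - y) * (f y)\<^sup>2)"
proof -
  define a where "a = conv \<rho> f x"
  note [simp] = conv_integrable_Cc[OF mollifierD(1)[OF \<rho>] f(1)] conv_integrable_Cc[OF mollifierD(1)[OF \<rho>] f(2)]
    mollifierD(8)[OF \<rho>]
  have "0 \<le> (LINT y|lebesgue. \<rho> (x - y) * (f y - a)\<^sup>2)"
    using mollifierD(4)[OF \<rho>] by simp
  also have "\<dots> = (LINT y|lebesgue. \<rho> (x - y) * (f y)\<^sup>2 - 2 * a * (\<rho> (x - y) * f y) + a\<^sup>2 * \<rho> (x - y))"
    by (intro Bochner_Integration.integral_cong) (auto simp: power2_eq_square algebra_simps)
  also have "\<dots> = (LINT y|lebesgue. \<rho> (x - y) * (f y)\<^sup>2) - 2 * a * a + a\<^sup>2"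
    by (simp add: mollifierD(9)[OF \<rho>] conv_def a_def)
  finally show ?thesis
    by (simp add: a_def power2_eq_square)
qed

lemma Young_L2:
  assumes \<rho>: "mollifier e \<rho>" and f: "integrable lebesgue f" "integrable lebesgue (\<lambda>x. (f x)\<^sup>2)"
  shows "integrable lebesgue (\<lambda>x. (conv \<rho> f x)\<^sup>2)"
    and "(LINT x|lebesgue. (conv \<rho> f x)\<^sup>2) \<le> (LINT x|lebesgue. (f x)\<^sup>2)"
proof -
  \<comment> \<open>Tonelli's theorem is applied on a product of Borel spaces, so the square of
    \<open>f\<close> is replaced by a Borel function that agrees with it almost everywhere.\<close>
  obtain F where F: "F \<in> borel_measurable lborel" "AE x in lborel. (f x)\<^sup>2 = F x"
    using completion_ex_borel_measurable_real[OF borel_measurable_integrable[OF f(2)]] by auto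
  have [measurable]: "F \<in> borel_measurable borel" "\<rho> \<in> borel_measurable borel"
    using F mollifierD[OF \<rho>] by auto
  have [measurable]: "conv \<rho> f \<in> borel_measurable borel"
    using smooth_conv[OF mollifierD(1)[OF \<rho>] f(1)] smooth_borel by blast
  have "(\<integral>\<^sup>+x. ennreal ((conv \<rho> f x)\<^sup>2) \<partial>lborel) \<le> (\<integral>\<^sup>+x. \<integral>\<^sup>+y. ennreal (\<rho> (x - y)) * ennreal (F y) \<partial>lborel \<partial>lborel)"
  proof (rule nn_integral_mono)
    fix x :: "real^'a"
    have "ennreal ((conv \<rho> f x)\<^sup>2) \<le> ennreal (LINT y|lebesgue. \<rho> (x - y) * (f y)\<^sup>2)"
      using conv_square_le[OF assms] by (simp add: ennreal_leI)
    also have "\<dots> = (\<integral>\<^sup>+y. ennreal (\<rho> (x - y) * (f y)\<^sup>2) \<partial>lebesgue)"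
      using conv_integrable_Cc[OF mollifierD(1)[OF \<rho>] f(2)] mollifierD(4)[OF \<rho>]
      by (intro nn_integral_eq_integral[symmetric]) auto
    also have "\<dots> = (\<integral>\<^sup>+y. ennreal (\<rho> (x - y) * (f y)\<^sup>2) \<partial>lborel)"
      by (rule nn_integral_completion)
    also have "\<dots> = (\<integral>\<^sup>+y. ennreal (\<rho> (x - y)) * ennreal (F y) \<partial>lborel)"
      using F(2) mollifierD(4)[OF \<rho>]
      by (intro nn_integral_cong_AE, elim AE_mp) (auto simp: ennreal_mult' intro!: AE_I2 simp flip: ennreal_mult)
    finally show "ennreal ((conv \<rho> f x)\<^sup>2) \<le> (\<integral>\<^sup>+y. ennreal (\<rho> (x - y)) * ennreal (F y) \<partial>lborel)" .
  qed
  also have "\<dots> = (\<integral>\<^sup>+y. \<integral>\<^sup>+x. ennreal (\<rho> (x - y)) * ennreal (F y) \<partial>lborel \<partial>lborel)"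
    by (rule lborel_pair.Fubini') measurable
  also have "\<dots> = (\<integral>\<^sup>+y. ennreal (F y) \<partial>lborel)"
  proof (rule nn_integral_cong)
    fix y :: "real^'a"
    have "(\<integral>\<^sup>+x. ennreal (\<rho> (x - y)) \<partial>lborel) = (\<integral>\<^sup>+x. ennreal (\<rho> x) \<partial>lborel)"
      using lborel_affine_nn_integral[of "\<lambda>x. ennreal (\<rho> x)" 1 "- y"] by simp
    also have "\<dots> = 1"
      using mollifierD[OF \<rho>] by (subst nn_integral_eq_integral) auto
    finally show "(\<integral>\<^sup>+x. ennreal (\<rho> (x - y)) * ennreal (F y) \<partial>lborel) = ennreal (F y)"
      by (subst nn_integral_multc) auto
  qed
  also have "\<dots> = (\<integral>\<^sup>+y. ennreal ((f y)\<^sup>2) \<partial>lborel)"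
    using F(2) by (intro nn_integral_cong_AE) auto
  also have "\<dots> = (\<integral>\<^sup>+y. ennreal ((f y)\<^sup>2) \<partial>lebesgue)"
    by (rule nn_integral_completion[symmetric])
  also have "\<dots> = ennreal (LINT x|lebesgue. (f x)\<^sup>2)"
    using f by (intro nn_integral_eq_integral) auto
  finally have le: "(\<integral>\<^sup>+x. ennreal ((conv \<rho> f x)\<^sup>2) \<partial>lebesgue) \<le> ennreal (LINT x|lebesgue. (f x)\<^sup>2)"
    by (simp add: nn_integral_completion)
  show int: "integrable lebesgue (\<lambda>x. (conv \<rho> f x)\<^sup>2)"
  proof (rule integrableI_bounded)
    show "(\<lambda>x. (conv \<rho> f x)\<^sup>2) \<in> borel_measurable lebesgue"
      by (rule borel_imp_lebesgue) measurable
    show "(\<integral>\<^sup>+x. ennreal (norm ((conv \<rho> f x)\<^sup>2)) \<partial>lebesgue) < \<infinity>"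
      using le by (auto simp: order_le_less_trans)
  qed
  show "(LINT x|lebesgue. (conv \<rho> f x)\<^sup>2) \<le> (LINT x|lebesgue. (f x)\<^sup>2)"
    using le int by (subst (asm) nn_integral_eq_integral) (auto simp: ennreal_le_iff)
qed

section \<open>Convergence of mollifications in \<open>L2\<close>\<close>

lemma square_integrable_imp_integrable:
  assumes "f \<in> borel_measurable M" "integrable M (\<lambda>x. (f x)\<^sup>2)" "K \<in> sets M" "emeasure M K < \<infinity>"
    "\<And>x. x \<in> space M \<Longrightarrow> x \<notin> K \<Longrightarrow> f x = (0::real)"
  shows "integrable M f"
proof (rule Bochner_Integration.integrable_bound)
  show "integrable M (\<lambda>x. indicator K x + (f x)\<^sup>2)"
    using assms by (intro Bochner_Integration.integrable_add integrable_real_indicator) auto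
  show "AE x in M. norm (f x) \<le> norm (indicator K x + (f x)\<^sup>2)"
  proof (rule AE_I2)
    fix x assume "x \<in> space M"
    have "2 * \<bar>f x\<bar> \<le> 1 + (f x)\<^sup>2"
      using sum_squares_bound[of 1 "\<bar>f x\<bar>"] by simp
    then show "norm (f x) \<le> norm (indicator K x + (f x)\<^sup>2)"
      using assms(5)[of x] \<open>x \<in> space M\<close> by (cases "x \<in> K") auto
  qed
qed (use assms in auto)

lemma finite_measure_cball [simp]:
  "emeasure lborel (cball (a::'a::euclidean_space) r) < \<infinity>" "emeasure lborel (cball a r) < top"
  using emeasure_compact_finite[of "cball a r"] by simp_all

lemma power2_sum_le: "(a + b)\<^sup>2 \<le> 2 * a\<^sup>2 + 2 * (b::real)\<^sup>2"
  using sum_squares_bound[of a b] by (simp add: power2_sum)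

lemma
  assumes "f \<in> borel_measurable M" "g \<in> borel_measurable M"
    "integrable M (\<lambda>x. (f x)\<^sup>2)" "integrable M (\<lambda>x. (g x :: real)\<^sup>2)"
  shows integrable_add_square: "integrable M (\<lambda>x. (f x + g x)\<^sup>2)"
    and integral_add_square_le:
      "(LINT x|M. (f x + g x)\<^sup>2) \<le> 2 * (LINT x|M. (f x)\<^sup>2) + 2 * (LINT x|M. (g x)\<^sup>2)"
proof -
  show *: "integrable M (\<lambda>x. (f x + g x)\<^sup>2)"
    by (rule Bochner_Integration.integrable_bound[of _ "\<lambda>x. 2 * (f x)\<^sup>2 + 2 * (g x)\<^sup>2"])
      (use assms in \<open>auto intro: order_trans[OF power2_sum_le]\<close>)
  have "(LINT x|M. (f x + g x)\<^sup>2) \<le> (LINT x|M. 2 * (f x)\<^sup>2 + 2 * (g x)\<^sup>2)"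
    using * assms by (intro integral_mono power2_sum_le) auto
  then show "(LINT x|M. (f x + g x)\<^sup>2) \<le> 2 * (LINT x|M. (f x)\<^sup>2) + 2 * (LINT x|M. (g x)\<^sup>2)"
    using assms by simp
qed

lemma
  assumes "f \<in> borel_measurable M" "g \<in> borel_measurable M"
    "integrable M (\<lambda>x. (f x)\<^sup>2)" "integrable M (\<lambda>x. (g x :: real)\<^sup>2)"
  shows integrable_diff_square: "integrable M (\<lambda>x. (f x - g x)\<^sup>2)"
    and integral_diff_square_le:
      "(LINT x|M. (f x - g x)\<^sup>2) \<le> 2 * (LINT x|M. (f x)\<^sup>2) + 2 * (LINT x|M. (g x)\<^sup>2)"
  using integrable_add_square[of f M "\<lambda>x. - g x"] integral_add_square_le[of f M "\<lambda>x. - g x"] assms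
  by simp_all

text \<open>The function is truncated to bounded values, and the truncation is written as an almost
  everywhere limit of continuous functions. Truncating these in turn and multiplying by a radial
  cutoff provides a dominating function, so both errors are handled by dominated
  convergence.\<close>

lemma L2_continuous_approximation:
  fixes f :: "real^'n \<Rightarrow> real"
  assumes f: "f \<in> borel_measurable lebesgue" "integrable lebesgue (\<lambda>x. (f x)\<^sup>2)"
    and supp: "\<And>x. x \<notin> cball 0 R \<Longrightarrow> f x = 0" and "\<epsilon> > 0"
  obtains g B where "continuous_on UNIV g" "\<And>x. x \<notin> cball 0 (R + 1) \<Longrightarrow> g x = 0" "\<And>x. \<bar>g x\<bar> \<le> B"
    "integrable lebesgue (\<lambda>x. (f x - g x)\<^sup>2)" "(LINT x|lebesgue. (f x - g x)\<^sup>2) < \<epsilon>"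
proof -
  define T where "T n t = max (- real n) (min t (real n))" for n t
  have T: "\<bar>T n t\<bar> \<le> real n" "\<bar>t - T n t\<bar> \<le> \<bar>t\<bar>" "T n 0 = 0" for n t
    by (auto simp: T_def)
  have T_cont: "continuous_on UNIV (T n)" for n
    unfolding T_def by (intro continuous_intros)
  have T_meas [measurable]: "(\<lambda>x. T n (f x)) \<in> borel_measurable lebesgue" for n
    unfolding T_def using f(1) by measurable
  have "(\<lambda>n. LINT x|lebesgue. (f x - T n (f x))\<^sup>2) \<longlonglongrightarrow> (LINT x|(lebesgue :: (real^'n) measure). (0::real))"
  proof (rule integral_dominated_convergence[where w="\<lambda>x. (f x)\<^sup>2"])
    show "AE x in lebesgue. (\<lambda>n. (f x - T n (f x))\<^sup>2) \<longlonglongrightarrow> 0"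
    proof (rule AE_I2)
      fix x :: "real^'n"
      obtain N where N: "\<bar>f x\<bar> \<le> real N" using real_arch_simple by blast
      show "(\<lambda>n. (f x - T n (f x))\<^sup>2) \<longlonglongrightarrow> 0"
        by (rule tendsto_eventually, rule eventually_sequentiallyI[of N]) (use N in \<open>auto simp: T_def\<close>)
    qed
    show "AE x in lebesgue. norm ((f x - T n (f x))\<^sup>2) \<le> (f x)\<^sup>2" for n
      using T(2) by (auto simp flip: abs_le_square_iff)
  qed (use f in \<open>auto intro!: borel_measurable_power borel_measurable_diff\<close>)
  then have "eventually (\<lambda>n. (LINT x|lebesgue. (f x - T n (f x))\<^sup>2) < \<epsilon> / 4) sequentially"
    using \<open>\<epsilon> > 0\<close> by (intro order_tendstoD(2)[where y=0]) auto
  then obtain M where M: "(LINT x|lebesgue. (f x - T M (f x))\<^sup>2) < \<epsilon> / 4"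
    by (auto simp: eventually_sequentially)
  have M_int: "integrable lebesgue (\<lambda>x. (f x - T M (f x))\<^sup>2)"
    by (rule Bochner_Integration.integrable_bound[OF f(2)])
      (use f(1) T(2) in \<open>auto intro!: borel_measurable_power borel_measurable_diff AE_I2 simp flip: abs_le_square_iff\<close>)
  \<comment> \<open>This notion of measurability is by definition a pointwise limit of continuous
    functions off a negligible set.\<close>
  have "(\<lambda>x. T M (f x)) measurable_on UNIV"
    by (rule lebesgue_measurable_imp_measurable_on) auto
  then obtain N h where N: "negligible N" and h: "\<And>n. continuous_on UNIV (h n)"
    "\<And>x. x \<notin> N \<Longrightarrow> (\<lambda>n. h n x) \<longlonglongrightarrow> T M (f x)"
    unfolding measurable_on_def by auto
  define \<kappa> :: "real^'n \<Rightarrow> real" where "\<kappa> x = max 0 (min 1 (R + 1 - norm x))" for x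
  have \<kappa>: "0 \<le> \<kappa> x" "\<kappa> x \<le> 1" "x \<in> cball 0 R \<Longrightarrow> \<kappa> x = 1" "x \<notin> cball 0 (R+1) \<Longrightarrow> \<kappa> x = 0" for x
    by (auto simp: \<kappa>_def)
  define g where "g n x = \<kappa> x * T M (h n x)" for n x
  have g_cont: "continuous_on UNIV (g n)" for n
    unfolding g_def \<kappa>_def
    by (intro continuous_intros continuous_on_compose2[OF T_cont h(1)]) auto
  have g_meas: "g n \<in> borel_measurable lebesgue" for n
    by (intro borel_imp_lebesgue borel_measurable_continuous_onI g_cont)
  have g_bd: "\<bar>g n x\<bar> \<le> real M" for n x
    using mult_mono[OF \<kappa>(2)[of x] T(1)[of M "h n x"]] \<kappa>(1)[of x] by (simp add: g_def abs_mult)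
  have g_supp: "x \<notin> cball 0 (R + 1) \<Longrightarrow> g n x = 0" for n x
    using \<kappa>(4) by (simp add: g_def)
  have diff_bd: "(T M (f x) - g n x)\<^sup>2 \<le> 4 * (real M)\<^sup>2 * indicator (cball 0 (R+1)) x" for n x
  proof (cases "x \<in> cball 0 (R+1)")
    case True
    have "\<bar>T M (f x) - g n x\<bar> \<le> \<bar>2 * real M\<bar>"
      using T(1)[of M "f x"] g_bd[of n x] by linarith
    then have "(T M (f x) - g n x)\<^sup>2 \<le> (2 * real M)\<^sup>2"
      by (simp only: abs_le_square_iff)
    then show ?thesis using True by (simp add: power_mult_distrib)
  next
    case False
    then have "x \<notin> cball 0 R" by simp
    with False supp[of x] g_supp[of x n] T(3) show ?thesis by simp
  qed
  have ind_int: "integrable lebesgue (\<lambda>x. 4 * (real M)\<^sup>2 * indicator (cball (0::real^'n) (R+1)) x)"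
    by (intro integrable_mult_right integrable_real_indicator) auto
  have "(\<lambda>n. LINT x|lebesgue. (T M (f x) - g n x)\<^sup>2) \<longlonglongrightarrow> (LINT x|(lebesgue :: (real^'n) measure). (0::real))"
  proof (rule integral_dominated_convergence[OF _ _ ind_int])
    have "N \<in> null_sets lebesgue" using N by (simp add: negligible_iff_null_sets)
    then have "AE x in lebesgue. x \<notin> N" by (rule AE_not_in)
    then show "AE x in lebesgue. (\<lambda>n. (T M (f x) - g n x)\<^sup>2) \<longlonglongrightarrow> 0"
    proof eventually_elim
      case (elim x)
      have "isCont (T M) (T M (f x))" using T_cont by (simp add: continuous_on_eq_continuous_at)
      then have "(\<lambda>n. T M (h n x)) \<longlonglongrightarrow> T M (T M (f x))"
        using h(2)[OF elim] by (rule isCont_tendsto_compose)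
      then have "(\<lambda>n. (T M (f x) - g n x)\<^sup>2) \<longlonglongrightarrow> (T M (f x) - \<kappa> x * T M (T M (f x)))\<^sup>2"
        unfolding g_def by (intro tendsto_intros)
      moreover have "\<kappa> x * T M (T M (f x)) = T M (f x)"
        using \<kappa>(3)[of x] supp[of x] T(3) by (cases "x \<in> cball 0 R") (auto simp: T_def)
      ultimately show ?case by simp
    qed
    show "AE x in lebesgue. norm ((T M (f x) - g n x)\<^sup>2) \<le> 4 * (real M)\<^sup>2 * indicator (cball 0 (R + 1)) x" for n
      using diff_bd by simp
  qed (use g_meas in \<open>auto intro!: borel_measurable_power borel_measurable_diff\<close>)
  then have "eventually (\<lambda>n. (LINT x|lebesgue. (T M (f x) - g n x)\<^sup>2) < \<epsilon> / 4) sequentially"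
    using \<open>\<epsilon> > 0\<close> by (intro order_tendstoD(2)[where y=0]) auto
  then obtain n where n: "(LINT x|lebesgue. (T M (f x) - g n x)\<^sup>2) < \<epsilon> / 4"
    by (auto simp: eventually_sequentially)
  have n_int: "integrable lebesgue (\<lambda>x. (T M (f x) - g n x)\<^sup>2)"
    by (rule Bochner_Integration.integrable_bound[OF ind_int])
      (use g_meas diff_bd in \<open>auto intro!: borel_measurable_power borel_measurable_diff AE_I2\<close>)
  have meas: "(\<lambda>x. f x - T M (f x)) \<in> borel_measurable lebesgue" "(\<lambda>x. T M (f x) - g n x) \<in> borel_measurable lebesgue"
    using f(1) g_meas by (auto intro!: borel_measurable_diff)
  show thesis
  proof (rule that[OF g_cont g_supp g_bd])
    show "integrable lebesgue (\<lambda>x. (f x - g n x)\<^sup>2)"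
      using integrable_add_square[OF meas M_int n_int] by simp
    show "(LINT x|lebesgue. (f x - g n x)\<^sup>2) < \<epsilon>"
      using integral_add_square_le[OF meas M_int n_int] M n by simp
  qed auto
qed

lemma compact_support_uniformly_continuous:
  fixes g :: "'a::euclidean_space \<Rightarrow> real"
  assumes "continuous_on UNIV g" "\<And>x. x \<notin> cball 0 R \<Longrightarrow> g x = 0" "\<epsilon> > 0"
  obtains t where "t > 0" "\<And>x y. norm (x - y) < t \<Longrightarrow> \<bar>g x - g y\<bar> \<le> \<epsilon>"
proof -
  have "uniformly_continuous_on (cball 0 (R + 1)) g"
    by (intro compact_uniformly_continuous continuous_on_subset[OF assms(1)]) auto
  then obtain t0 where t0: "t0 > 0"
    "\<And>x y. x \<in> cball 0 (R+1) \<Longrightarrow> y \<in> cball 0 (R+1) \<Longrightarrow> dist x y < t0 \<Longrightarrow> dist (g x) (g y) < \<epsilon>"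
    unfolding uniformly_continuous_on_def using \<open>\<epsilon> > 0\<close> by (metis dist_commute)
  show thesis
  proof
    show "min t0 1 > 0" using t0 by simp
    fix x y :: 'a assume xy: "norm (x - y) < min t0 1"
    show "\<bar>g x - g y\<bar> \<le> \<epsilon>"
    proof (cases "x \<in> cball 0 R \<or> y \<in> cball 0 R")
      case True
      have "norm y \<le> norm x + norm (x - y)" "norm x \<le> norm y + norm (x - y)"
        by norm+
      with True xy have "x \<in> cball 0 (R+1)" "y \<in> cball 0 (R+1)"
        by auto
      then show ?thesis
        using t0(2)[of x y] xy by (auto simp: dist_norm)
    qed (use assms in auto)
  qed
qed

lemma mollifier_uniform_convergence:
  fixes g :: "real^'n \<Rightarrow> real"
  assumes g: "continuous_on UNIV g" "\<And>x. x \<notin> cball 0 R \<Longrightarrow> g x = 0" "\<And>x. \<bar>g x\<bar> \<le> B" and "\<epsilon> > 0"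
  obtains t where "t > 0" "\<And>e \<rho> x. e < t \<Longrightarrow> mollifier e \<rho> \<Longrightarrow> \<bar>conv \<rho> g x - g x\<bar> \<le> \<epsilon>"
proof -
  obtain t where t: "t > 0" "\<And>x y. norm (x - y) < t \<Longrightarrow> \<bar>g x - g y\<bar> \<le> \<epsilon>"
    using compact_support_uniformly_continuous[OF g(1,2) \<open>\<epsilon> > 0\<close>] by metis
  have "g \<in> borel_measurable borel" using g(1) by (rule borel_measurable_continuous_onI)
  moreover from this have "integrable lborel g"
    using g by (rule_tac integrable_compact_support[of _ "cball 0 R"]) auto
  ultimately have gint: "integrable lebesgue g"
    by (simp add: lebesgue_lborel_integrable)
  show thesis
  proof (rule that[OF t(1)])
    fix e x and \<rho> :: "real^'n \<Rightarrow> real" assume e: "e < t" "mollifier e \<rho>"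
    note \<rho> = mollifierD[OF e(2)]
    have int: "integrable lebesgue (\<lambda>y. \<rho> (x - y) * g y)"
      by (rule conv_integrable_Cc[OF \<rho>(1) gint])
    have "conv \<rho> g x - g x = (LINT y|lebesgue. \<rho> (x - y) * g y - g x * \<rho> (x - y))"
      using int \<rho>(8,9) by (simp add: conv_def)
    also have "\<bar>\<dots>\<bar> \<le> (LINT y|lebesgue. \<epsilon> * \<rho> (x - y))"
    proof (rule integral_abs_bound_integral)
      fix y
      have "\<bar>\<rho> (x - y) * g y - g x * \<rho> (x - y)\<bar> = \<bar>g x - g y\<bar> * \<rho> (x - y)"
        using \<rho>(4)[of "x - y"] by (simp add: abs_mult abs_minus_commute mult.commute flip: left_diff_distrib)
      also have "\<dots> \<le> \<epsilon> * \<rho> (x - y)"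
        using t(2)[of x y] \<rho>(5)[of "x - y"] \<rho>(4)[of "x - y"] e(1) by (cases "norm (x - y) < e") (auto intro: mult_right_mono)
      finally show "\<bar>\<rho> (x - y) * g y - g x * \<rho> (x - y)\<bar> \<le> \<epsilon> * \<rho> (x - y)" .
    qed (use int \<rho>(8) in auto)
    also have "\<dots> = \<epsilon>" using \<rho>(9) by simp
    finally show "\<bar>conv \<rho> g x - g x\<bar> \<le> \<epsilon>" .
  qed
qed

text \<open>The three-term estimate: \<open>f\<close> is close to a continuous \<open>g\<close> in
  \<open>L2\<close>, mollification of \<open>f - g\<close> does not increase the norm by
  \<open>Young_L2\<close>, and mollification of \<open>g\<close> converges uniformly with support in
  a fixed ball.\<close>

lemma mollifier_L2_convergence:
  fixes f :: "real^'n \<Rightarrow> real"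
  assumes f: "f \<in> borel_measurable lebesgue" "integrable lebesgue (\<lambda>x. (f x)\<^sup>2)"
    and supp: "\<And>x. x \<notin> cball 0 R \<Longrightarrow> f x = 0" and "\<epsilon> > 0"
  obtains t where "t > 0" "\<And>e \<rho>. e < t \<Longrightarrow> mollifier e \<rho> \<Longrightarrow>
     integrable lebesgue (\<lambda>x. (conv \<rho> f x - f x)\<^sup>2) \<and> (LINT x|lebesgue. (conv \<rho> f x - f x)\<^sup>2) < \<epsilon>"
proof -
  \<comment> \<open>Each splitting of a square costs a factor 2: the part from \<open>f - g\<close>
    and its mollification is at most 4 times \<epsilon>/16, and two parts of size \<epsilon>/4 then
    add up to \<epsilon>.\<close>
  have "\<epsilon> / 16 > 0" using \<open>\<epsilon> > 0\<close> by simp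
  then obtain g B where g: "continuous_on UNIV g" "\<And>x. x \<notin> cball 0 (R + 1) \<Longrightarrow> g x = 0" "\<And>x. \<bar>g x\<bar> \<le> B"
    and gf: "integrable lebesgue (\<lambda>x. (f x - g x)\<^sup>2)" "(LINT x|lebesgue. (f x - g x)\<^sup>2) < \<epsilon> / 16"
    using L2_continuous_approximation[OF f supp, where \<epsilon>="\<epsilon> / 16"] by blast
  define V where "V = measure lebesgue (cball (0::real^'n) (R + 2))"
  \<comment> \<open>A uniform error \<open>\<tau>\<close> on a ball of volume \<open>V\<close> costs
    \<open>\<tau>\<^sup>2 * V\<close>, which has to stay below \<epsilon>/4.\<close>
  define \<tau> where "\<tau> = sqrt (\<epsilon> / (12 * (V + 1)))"
  have V: "V \<ge> 0" by (simp add: V_def)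
  then have \<tau>: "\<tau> > 0" "\<tau>\<^sup>2 * V < \<epsilon> / 4"
    using \<open>\<epsilon> > 0\<close> by (auto simp: \<tau>_def field_simps intro!: add_pos_nonneg)
  obtain t where t: "t > 0" "\<And>e \<rho> x. e < t \<Longrightarrow> mollifier e \<rho> \<Longrightarrow> \<bar>conv \<rho> g x - g x\<bar> \<le> \<tau>"
    using mollifier_uniform_convergence[OF g \<tau>(1)] by metis
  have gm: "g \<in> borel_measurable lebesgue"
    by (intro borel_imp_lebesgue borel_measurable_continuous_onI g)
  have fi: "integrable lebesgue f"
    by (rule square_integrable_imp_integrable[OF f, of "cball 0 R"]) (use supp in auto)
  have dm: "(\<lambda>x. f x - g x) \<in> borel_measurable lebesgue"
    using f gm by (intro borel_measurable_diff)
  have di: "integrable lebesgue (\<lambda>x. f x - g x)"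
    by (rule square_integrable_imp_integrable[OF dm gf(1), of "cball 0 (R+1)"]) (use supp g in auto)
  have gi: "integrable lebesgue g"
    using Bochner_Integration.integrable_diff[OF fi di] by simp
  show thesis
  proof (rule that[of "min t 1"], use t in simp)
    fix e and \<rho> :: "real^'n \<Rightarrow> real" assume e: "e < min t 1" and \<rho>: "mollifier e \<rho>"
    note Y = Young_L2[OF \<rho> di gf(1)]
    have cm: "conv \<rho> h \<in> borel_measurable lebesgue" if "integrable lebesgue h" for h
      using borel_imp_lebesgue[OF smooth_borel[OF smooth_conv[OF mollifierD(1)[OF \<rho>] that]]] .
    have lin: "conv \<rho> (\<lambda>x. f x - g x) x = conv \<rho> f x - conv \<rho> g x" for x
      using conv_integrable_Cc[OF mollifierD(1)[OF \<rho>] fi, of x] conv_integrable_Cc[OF mollifierD(1)[OF \<rho>] gi, of x]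
      by (simp add: conv_def right_diff_distrib)
    have bd: "(conv \<rho> g x - g x)\<^sup>2 \<le> \<tau>\<^sup>2 * indicator (cball 0 (R + 2)) x" for x
    proof (cases "x \<in> cball 0 (R + 2)")
      case True
      have "\<bar>conv \<rho> g x - g x\<bar> \<le> \<bar>\<tau>\<bar>" using t(2)[of e \<rho> x] e \<rho> \<tau> by auto
      then show ?thesis using True by (simp add: abs_le_square_iff)
    next
      case False
      have "conv \<rho> g x = 0"
      proof (rule conv_eq_0)
        fix y assume "g y \<noteq> 0"
        then have "norm y \<le> R + 1" using g(2)[of y] by fastforce
        moreover have "norm x \<le> norm y + norm (x - y)" by norm
        ultimately show "\<rho> (x - y) = 0"
          using False e by (intro mollifierD(5)[OF \<rho>]) auto
      qed
      moreover have "g x = 0" using False g(2)[of x] by auto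
      ultimately show ?thesis using False by simp
    qed
    have ii: "integrable lebesgue (\<lambda>x. \<tau>\<^sup>2 * indicator (cball (0::real^'n) (R + 2)) x)"
      by (intro integrable_mult_right integrable_real_indicator) auto
    have gc_m: "(\<lambda>x. conv \<rho> g x - g x) \<in> borel_measurable lebesgue"
      using cm[OF gi] gm by (intro borel_measurable_diff)
    have gc_i: "integrable lebesgue (\<lambda>x. (conv \<rho> g x - g x)\<^sup>2)"
      by (rule Bochner_Integration.integrable_bound[OF ii]) (use gc_m bd in \<open>auto intro!: AE_I2\<close>)
    have "(LINT x|lebesgue. (conv \<rho> g x - g x)\<^sup>2) \<le> (LINT x|lebesgue. \<tau>\<^sup>2 * indicator (cball (0::real^'n) (R + 2)) x)"
      by (rule integral_mono[OF gc_i ii bd])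
    also have "\<dots> = \<tau>\<^sup>2 * V" by (simp add: V_def)
    finally have gc: "(LINT x|lebesgue. (conv \<rho> g x - g x)\<^sup>2) < \<epsilon> / 4" using \<tau> by simp
    define D where "D x = conv \<rho> (\<lambda>x. f x - g x) x - (f x - g x)" for x
    have D: "D \<in> borel_measurable lebesgue" "integrable lebesgue (\<lambda>x. (D x)\<^sup>2)" "(LINT x|lebesgue. (D x)\<^sup>2) < \<epsilon> / 4"
      using cm[OF di] dm integrable_diff_square[OF cm[OF di] dm Y(1) gf(1)]
        integral_diff_square_le[OF cm[OF di] dm Y(1) gf(1)] Y(2) gf(2) \<open>\<epsilon> > 0\<close>
      by (auto simp: D_def[abs_def] intro!: borel_measurable_diff)
    have eq: "conv \<rho> f x - f x = D x + (conv \<rho> g x - g x)" for x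
      by (simp add: D_def lin)
    show "integrable lebesgue (\<lambda>x. (conv \<rho> f x - f x)\<^sup>2) \<and> (LINT x|lebesgue. (conv \<rho> f x - f x)\<^sup>2) < \<epsilon>"
      unfolding eq using integrable_add_square[OF D(1) gc_m D(2) gc_i] integral_add_square_le[OF D(1) gc_m D(2) gc_i] D(3) gc
      by simp
  qed
qed

subsection \<open>Weak gradients\<close>

lemma compact_lebesgue:
  assumes "compact (K::'a::euclidean_space set)"
  shows "K \<in> sets lebesgue" "emeasure lebesgue K < \<infinity>" "emeasure (lebesgue_on K) K < \<infinity>"
  using lmeasurable_compact[OF assms]
  by (auto simp: fmeasurable_def emeasure_restrict_space)

lemma smooth_reflect: "smooth f \<Longrightarrow> smooth (\<lambda>y. f (x - y))"
proof -
  have "C_diff m (\<lambda>y. f (x - y))" if "smooth f" for m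
    using that
  proof (induction m arbitrary: f)
    case 0
    then show ?case
      using smooth_continuous[OF 0] by (auto intro!: continuous_on_compose2[of UNIV f] continuous_intros)
  next
    case (Suc m)
    have d: "f differentiable (at x)" for x using Suc.prems smooth_differentiable by blast
    have "(\<lambda>y. f (x - y)) differentiable (at y)" for y
      by (rule differentiable_compose[of f]) (auto intro: differentiable_at_imp_differentiable_on d)
    moreover have "partial k (\<lambda>y. f (x - y)) = (\<lambda>y. -1 * partial k f (x - y))" for k
      using partial_shift[OF d] by (intro ext) simp
    ultimately show ?case
      using Suc.IH[OF smooth_partial[OF Suc.prems]] by (auto intro!: C_diff_mult[of _ "\<lambda>x. -1", simplified] C_diff_const)
  qed
  then show "smooth f \<Longrightarrow> smooth (\<lambda>y. f (x - y))"
    by (simp add: smooth_def)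
qed

text \<open>A smoothed characteristic function and its gradient. Where the ball of radius
  \<open>e\<close> lies in \<open>U\<close> the convolution sees a constant, and the gradient
  vanishes because a partial derivative of \<open>\<rho>\<close> has integral 0. The gradient bound
  is the \<open>L1\<close> norm of the derivative of the kernel, whatever the shape of
  \<open>U\<close>.\<close>

lemma
  fixes \<rho> :: "real^'n \<Rightarrow> real"
  assumes \<rho>: "mollifier e \<rho>" and U: "U \<in> sets lebesgue" "emeasure lebesgue U < \<infinity>"
  shows conv_indicator_smooth: "smooth (conv \<rho> (indicator U))"
    and conv_indicator_nonneg: "0 \<le> conv \<rho> (indicator U) x"
    and conv_indicator_le_1: "conv \<rho> (indicator U) x \<le> 1"
    and conv_indicator_eq_1: "ball x e \<subseteq> U \<Longrightarrow> conv \<rho> (indicator U) x = 1"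
    and conv_indicator_eq_0: "ball x e \<inter> U = {} \<Longrightarrow> conv \<rho> (indicator U) x = 0"
    and partial_conv_indicator_le: "\<bar>partial k (conv \<rho> (indicator U)) x\<bar> \<le> (LINT x|lborel. \<bar>partial k \<rho> x\<bar>)"
    and partial_conv_indicator_inside: "ball x e \<subseteq> U \<Longrightarrow> partial k (conv \<rho> (indicator U)) x = 0"
    and partial_conv_indicator_outside: "ball x e \<inter> U = {} \<Longrightarrow> partial k (conv \<rho> (indicator U)) x = 0"
proof -
  note m = mollifierD[OF \<rho>]
  have I: "integrable lebesgue (indicator U :: _ \<Rightarrow> real)"
    using U by (rule integrable_real_indicator)
  have pz: "partial k \<rho> z = 0" if "e \<le> norm z" for z
  proof (cases "e \<le> 0")
    case True
    then have "\<rho> = (\<lambda>x. 0)"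
      by (intro ext m(5)) (auto intro: order_trans)
    then show ?thesis by simp
  next
    case False
    \<comment> \<open>The kernel vanishes on the open exterior of the ball, hence so does its
      derivative there; continuity extends this to the sphere \<open>norm z = e\<close>.\<close>
    have "closure (- cball (0::real^'n) e) = - ball 0 e"
      using False by (simp add: closure_complement)
    then have "z \<in> closure (- cball 0 e)" using that by simp
    then show ?thesis
    proof (rule continuous_constant_on_closure[rotated 2])
      show "continuous_on (closure (- cball 0 e)) (partial k \<rho>)"
        using smooth_continuous[OF smooth_partial[OF m(2)]] continuous_on_subset by blast
      show "\<And>x. x \<in> - cball 0 e \<Longrightarrow> partial k \<rho> x = 0"
      proof -
        fix x :: "real^'n" assume x: "x \<in> - cball 0 e"
        have "((\<lambda>x. 0) has_derivative (\<lambda>h. 0)) (at x)" by simp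
        moreover have "open (- cball (0::real^'n) e)" by auto
        ultimately have "(\<rho> has_derivative (\<lambda>h. 0)) (at x)"
          by (rule has_derivative_transform_within_open) (use x in \<open>auto simp: m(5)\<close>)
        from partial_eqI[OF this] show "partial k \<rho> x = 0" by simp
      qed
    qed
  qed
  have pc: "partial k (conv \<rho> (indicator U)) x = conv (partial k \<rho>) (indicator U) x"
    by (simp add: partial_conv[OF m(1) I])
  show "smooth (conv \<rho> (indicator U))" by (rule smooth_conv[OF m(1) I])
  show "0 \<le> conv \<rho> (indicator U) x"
    unfolding conv_def using m(4) by simp
  show "conv \<rho> (indicator U) x \<le> 1"
  proof -
    have "conv \<rho> (indicator U) x \<le> (LINT y|lebesgue. \<rho> (x - y))"
      unfolding conv_def using conv_integrable_Cc[OF m(1) I] m(4,8)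
      by (intro integral_mono) (auto simp: indicator_def)
    then show ?thesis using m(9) by simp
  qed
  have pm: "partial k \<rho> \<in> borel_measurable borel" using m(2) smooth_partial smooth_borel by blast
  have in_eq: "K (x - y) * indicator U y = K (x - y)"
    if "ball x e \<subseteq> U" "\<And>z. e \<le> norm z \<Longrightarrow> K z = (0::real)" for K y
    using that(1) that(2)[of "x - y"] by (cases "dist x y < e") (auto simp: dist_norm)
  show "conv \<rho> (indicator U) x = 1" if "ball x e \<subseteq> U"
  proof -
    have eq: "(\<lambda>y. \<rho> (x - y) * indicator U y) = (\<lambda>y. \<rho> (x - y))"
      by (rule ext, rule in_eq[OF that]) (rule m(5))
    show ?thesis unfolding conv_def eq by (rule m(9))
  qed
  have "conv (partial k \<rho>) (indicator U) x = 0" if "ball x e \<subseteq> U"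
  proof -
    have eq: "(\<lambda>y. partial k \<rho> (x - y) * indicator U y) = (\<lambda>y. partial k \<rho> (x - y))"
      by (rule ext, rule in_eq[OF that]) (rule pz)
    have "(\<lambda>y. partial k \<rho> (x - y)) \<in> borel_measurable borel" using pm by measurable
    then show ?thesis
      unfolding conv_def eq using integral_partial_eq_0[OF m(1)] lborel_integral_reflect[OF pm, of x]
      by (simp add: lebesgue_lborel_integral)
  qed
  then show "ball x e \<subseteq> U \<Longrightarrow> partial k (conv \<rho> (indicator U)) x = 0" by (simp add: pc)
  have out: "e \<le> norm (x - y)" if "ball x e \<inter> U = {}" "indicator U y \<noteq> (0::real)" for y
    using that by (force simp: indicator_def dist_norm not_less split: if_splits)
  show "ball x e \<inter> U = {} \<Longrightarrow> conv \<rho> (indicator U) x = 0"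
    by (rule conv_eq_0) (use out m(5) in blast)
  have "ball x e \<inter> U = {} \<Longrightarrow> conv (partial k \<rho>) (indicator U) x = 0"
    by (rule conv_eq_0) (use out pz in blast)
  then show "ball x e \<inter> U = {} \<Longrightarrow> partial k (conv \<rho> (indicator U)) x = 0" by (simp add: pc)
  have pint: "integrable lborel (\<lambda>x. \<bar>partial k \<rho> x\<bar>)"
    using Cc_infinity_integrable[OF Cc_infinity_partial[OF m(1)]] by auto
  have pam: "(\<lambda>x. \<bar>partial k \<rho> x\<bar>) \<in> borel_measurable borel" using pm by measurable
  then have pam': "(\<lambda>y. \<bar>partial k \<rho> (x - y)\<bar>) \<in> borel_measurable borel" by measurable
  have "\<bar>conv (partial k \<rho>) (indicator U) x\<bar> \<le> (LINT y|lebesgue. \<bar>partial k \<rho> (x - y)\<bar>)"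
    unfolding conv_def
  proof (rule integral_abs_bound_integral)
    show "integrable lebesgue (\<lambda>y. \<bar>partial k \<rho> (x - y)\<bar>)"
      using lborel_integrable_reflect[OF pam pint] lebesgue_lborel_integrable[OF pam'] by simp
    show "integrable lebesgue (\<lambda>y. partial k \<rho> (x - y) * indicator U y)"
      by (rule conv_integrable_Cc[OF Cc_infinity_partial[OF m(1)] I])
  qed (simp add: indicator_def)
  also have "\<dots> = (LINT x|lborel. \<bar>partial k \<rho> x\<bar>)"
    using lborel_integral_reflect[OF pam] lebesgue_lborel_integral[OF pam'] by simp
  finally show "\<bar>partial k (conv \<rho> (indicator U)) x\<bar> \<le> (LINT x|lborel. \<bar>partial k \<rho> x\<bar>)"
    by (simp add: pc)
qed

lemma compact_neighbourhood:
  fixes K :: "'a::euclidean_space set"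
  assumes "compact K" "open \<Omega>" "K \<subseteq> \<Omega>"
  obtains d where "d > 0" "compact {x + y | x y. x \<in> K \<and> y \<in> cball 0 d}"
    "{x + y | x y. x \<in> K \<and> y \<in> cball 0 d} \<subseteq> \<Omega>"
proof -
  obtain d where "d > 0" "(\<Union>x\<in>K. cball x d) \<subseteq> \<Omega>"
    using compact_subset_open_imp_cball_epsilon_subset[OF assms] by metis
  moreover have "x + y \<in> cball x d" if "y \<in> cball 0 d" for x y :: 'a
    using that by (simp add: dist_norm)
  ultimately have "{x + y | x y. x \<in> K \<and> y \<in> cball 0 d} \<subseteq> \<Omega>"
    by blast
  with \<open>d > 0\<close> show thesis
    using assms(1) by (intro that[of d] compact_sums) auto
qed

text \<open>Mollify the characteristic function of a neighbourhood of \<open>K\<close> of half the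
  available width, with a kernel of the same radius: around a point of \<open>K\<close> the kernel
  sees only this neighbourhood, so value and gradient are those of a constant.\<close>

lemma smooth_cutoff:
  fixes K :: "(real^'n) set"
  assumes K: "compact K" "open \<Omega>" "K \<subseteq> \<Omega>"
  obtains \<zeta> where "\<zeta> \<in> Cc_infinity \<Omega>" "\<And>x. 0 \<le> \<zeta> x" "\<And>x. \<zeta> x \<le> 1" "\<And>x. x \<in> K \<Longrightarrow> \<zeta> x = 1"
    "\<And>x k. x \<in> K \<Longrightarrow> partial k \<zeta> x = 0"
proof -
  obtain d where d: "d > 0" "compact {x + y | x y. x \<in> K \<and> y \<in> cball 0 d}"
    "{x + y | x y. x \<in> K \<and> y \<in> cball 0 d} \<subseteq> \<Omega>"
    using compact_neighbourhood[OF K] by blast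
  define U where "U = {x + y | x y. x \<in> K \<and> y \<in> cball 0 (d/2)}"
  have cU: "compact U"
    unfolding U_def using K(1) by (rule compact_sums) auto
  have U: "U \<in> sets lebesgue" "emeasure lebesgue U < \<infinity>"
    using compact_lebesgue[OF cU] by auto
  obtain \<rho> :: "real \<Rightarrow> real^'n \<Rightarrow> real" where \<rho>: "\<And>e. e > 0 \<Longrightarrow> mollifier e (\<rho> e)"
    using mollifier_exists by metis
  note c = \<rho>[of "d/2"] U
  have m: "mollifier (d/2) (\<rho> (d/2))" using \<rho> d by simp
  note c = conv_indicator_smooth[OF m U] conv_indicator_nonneg[OF m U] conv_indicator_le_1[OF m U]
    conv_indicator_eq_1[OF m U] conv_indicator_eq_0[OF m U] partial_conv_indicator_inside[OF m U]
  have inside: "ball x (d/2) \<subseteq> U" if "x \<in> K" for x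
  proof
    fix z assume "z \<in> ball x (d/2)"
    then have "z = x + (z - x)" "z - x \<in> cball 0 (d/2)" by (auto simp: dist_norm norm_minus_commute)
    then show "z \<in> U" unfolding U_def using that by blast
  qed
  show thesis
  proof (rule that[OF _ c(2,3) c(4)[OF inside] c(6)[OF inside]])
    show "conv (\<rho> (d/2)) (indicator U) \<in> Cc_infinity \<Omega>"
    proof (rule Cc_infinityI[OF c(1) d(2,3)])
      fix x assume x: "x \<notin> {x + y | x y. x \<in> K \<and> y \<in> cball 0 d}"
      show "conv (\<rho> (d/2)) (indicator U) x = 0"
      proof (rule c(5), rule ccontr)
        assume "ball x (d/2) \<inter> U \<noteq> {}"
        then obtain a b where ab: "a \<in> K" "norm b \<le> d/2" "dist x (a + b) < d/2"
          unfolding U_def by auto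
        have "norm (x - a) \<le> norm (x - (a + b)) + norm b" by norm
        then have "x - a \<in> cball 0 d" using ab by (simp add: dist_norm norm_minus_commute)
        moreover have "x = a + (x - a)" by simp
        ultimately show False using x ab(1) by blast
      qed
    qed
  qed
qed

lemma L1_loc_test_integrable:
  assumes f: "f \<in> L1_loc \<Omega>" and \<eta>: "\<eta> \<in> Cc_infinity \<Omega>" and \<Omega>: "\<Omega> \<in> sets lebesgue"
  shows "integrable (lebesgue_on \<Omega>) (\<lambda>x. f x * \<eta> x)"
proof -
  obtain K where K: "compact K" "K \<subseteq> \<Omega>" "\<And>x. x \<notin> K \<Longrightarrow> \<eta> x = 0"
    using \<eta> by (metis Cc_infinityE)
  obtain B where B: "\<And>x. \<bar>\<eta> x\<bar> \<le> B" using Cc_infinity_bounded[OF \<eta>] by metis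
  have Km: "K \<in> sets lebesgue" using K compact_lebesgue by blast
  have "integrable (lebesgue_on K) f" using f K by (auto simp: L1_loc_def)
  then have "integrable lebesgue (\<lambda>x. if x \<in> K then f x else 0)"
    by (simp add: Lebesgue_Measure.integrable_restrict_UNIV[OF Km])
  then have "integrable lebesgue (\<lambda>x. (if x \<in> K then f x else 0) * \<eta> x)"
  proof (rule Bochner_Integration.integrable_bound[OF integrable_mult_right[of B]])
    show "(\<lambda>x. (if x \<in> K then f x else 0) * \<eta> x) \<in> borel_measurable lebesgue"
      using \<open>integrable lebesgue (\<lambda>x. if x \<in> K then f x else 0)\<close>
        borel_imp_lebesgue[OF smooth_borel[OF Cc_infinity_smooth[OF \<eta>]]]
      by (intro borel_measurable_times) auto
    show "AE x in lebesgue. norm ((if x \<in> K then f x else 0) * \<eta> x) \<le> norm (B * (if x \<in> K then f x else 0))"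
    proof (rule AE_I2)
      fix x
      show "norm ((if x \<in> K then f x else 0) * \<eta> x) \<le> norm (B * (if x \<in> K then f x else 0))"
        using mult_right_mono[OF B[of x], of "\<bar>f x\<bar>"] B[of x] by (auto simp: abs_mult mult.commute)
    qed
  qed
  also have "(\<lambda>x. (if x \<in> K then f x else 0) * \<eta> x) = (\<lambda>x. if x \<in> \<Omega> then f x * \<eta> x else 0)"
    by (rule ext) (use K in auto)
  finally show ?thesis
    by (simp add: Lebesgue_Measure.integrable_restrict_UNIV[OF \<Omega>])
qed

lemma L2_loc_L1_loc: "f \<in> L2_loc \<Omega> \<Longrightarrow> f \<in> L1_loc \<Omega>"
proof -
  assume f: "f \<in> L2_loc \<Omega>"
  then have fm: "f \<in> borel_measurable (lebesgue_on \<Omega>)" by (simp add: L2_loc_def)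
  have "integrable (lebesgue_on K) f" if "compact K" "K \<subseteq> \<Omega>" for K
  proof (rule square_integrable_imp_integrable[of _ _ K])
    show "f \<in> borel_measurable (lebesgue_on K)"
      by (rule measurable_restrict_mono[OF fm that(2)])
    show "integrable (lebesgue_on K) (\<lambda>x. (f x)\<^sup>2)"
      using f that by (simp add: L2_loc_def)
    show "K \<in> sets (lebesgue_on K)" by simp
    show "emeasure (lebesgue_on K) K < \<infinity>" using compact_lebesgue[OF that(1)] by simp
  qed simp
  then show ?thesis using f by (auto simp: L1_loc_def L2_loc_def)
qed

lemma L2_loc_mult_test:
  fixes f :: "real^'n \<Rightarrow> real"
  assumes f: "f \<in> L2_loc \<Omega>" and \<eta>: "\<eta> \<in> Cc_infinity \<Omega>" and \<Omega>: "\<Omega> \<in> sets lebesgue"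
  defines "F \<equiv> (\<lambda>x. if x \<in> \<Omega> then f x * \<eta> x else 0)"
  shows "F \<in> borel_measurable lebesgue" "integrable lebesgue (\<lambda>x. (F x)\<^sup>2)" "integrable lebesgue F"
proof -
  show "F \<in> borel_measurable lebesgue"
    unfolding F_def
  proof (intro borel_measurable_if_I borel_measurable_times)
    show "f \<in> borel_measurable (lebesgue_on \<Omega>)" using f by (simp add: L2_loc_def)
    show "\<eta> \<in> borel_measurable (lebesgue_on \<Omega>)"
      by (intro measurable_restrict_space1 borel_imp_lebesgue smooth_borel Cc_infinity_smooth[OF \<eta>])
  qed (rule \<Omega>)
  have "(\<lambda>x. (f x)\<^sup>2) \<in> L1_loc \<Omega>"
    using f by (auto simp: L1_loc_def L2_loc_def intro: borel_measurable_power)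
  then have "integrable (lebesgue_on \<Omega>) (\<lambda>x. (f x)\<^sup>2 * (\<eta> x * \<eta> x))"
    using \<eta> \<Omega> by (intro L1_loc_test_integrable Cc_infinity_mult Cc_infinity_smooth)
  then have "integrable lebesgue (\<lambda>x. if x \<in> \<Omega> then (f x)\<^sup>2 * (\<eta> x * \<eta> x) else 0)"
    by (simp add: Lebesgue_Measure.integrable_restrict_UNIV[OF \<Omega>])
  also have "(\<lambda>x. if x \<in> \<Omega> then (f x)\<^sup>2 * (\<eta> x * \<eta> x) else 0) = (\<lambda>x. (F x)\<^sup>2)"
    by (auto simp: F_def power2_eq_square)
  finally show "integrable lebesgue (\<lambda>x. (F x)\<^sup>2)" .
  show "integrable lebesgue F"
    unfolding F_def Lebesgue_Measure.integrable_restrict_UNIV[OF \<Omega>]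
    by (intro L1_loc_test_integrable L2_loc_L1_loc f \<eta> \<Omega>)
qed

lemma conv_restrict:
  assumes "\<Omega> \<in> sets lebesgue"
  shows "conv K (\<lambda>x. if x \<in> \<Omega> then f x else 0) x = (LINT y|lebesgue_on \<Omega>. K (x - y) * f y)"
proof -
  have "(\<lambda>y. K (x - y) * (if y \<in> \<Omega> then f y else 0)) = (\<lambda>y. if y \<in> \<Omega> then K (x - y) * f y else 0)"
    by auto
  then show ?thesis
    by (simp add: conv_def Lebesgue_Measure.integral_restrict_UNIV[OF assms])
qed

text \<open>The product of the reflected kernel with \<open>\<zeta>\<close> is itself an admissible
  test function, so the definition of the weak gradient can be applied at each fixed
  \<open>x\<close>. The product rule is thereby applied to smooth functions only.\<close>

lemma partial_conv_weak_gradient: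
  fixes f :: "real^'n \<Rightarrow> real"
  assumes wg: "weak_gradient \<Omega> f g" and f: "f \<in> L2_loc \<Omega>" and \<zeta>: "\<zeta> \<in> Cc_infinity \<Omega>"
    and \<rho>: "\<rho> \<in> Cc_infinity UNIV" and \<Omega>: "\<Omega> \<in> sets lebesgue"
  shows "partial k (conv \<rho> (\<lambda>x. if x \<in> \<Omega> then f x * \<zeta> x else 0)) x
    = conv \<rho> (\<lambda>x. if x \<in> \<Omega> then g x $ k * \<zeta> x + f x * partial k \<zeta> x else 0) x"
proof -
  define \<eta> where "\<eta> y = \<rho> (x - y) * \<zeta> y" for y
  have s\<rho>: "smooth (\<lambda>y. \<rho> (x - y))" "smooth (\<lambda>y. partial k \<rho> (x - y))"
    by (intro smooth_reflect smooth_partial Cc_infinity_smooth[OF \<rho>])+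
  have \<eta>: "\<eta> \<in> Cc_infinity \<Omega>"
    unfolding \<eta>_def by (rule Cc_infinity_mult[OF \<zeta> s\<rho>(1)])
  have p\<eta>: "partial k \<eta> y = - (partial k \<rho> (x - y) * \<zeta> y) + \<rho> (x - y) * partial k \<zeta> y" for y
  proof -
    have "partial k \<eta> y = partial k (\<lambda>y. \<rho> (x - y)) y * \<zeta> y + \<rho> (x - y) * partial k \<zeta> y"
      unfolding \<eta>_def by (rule partial_mult[OF smooth_differentiable[OF s\<rho>(1)] smooth_differentiable[OF Cc_infinity_smooth[OF \<zeta>]]])
    then show ?thesis
      by (simp add: partial_shift[OF smooth_differentiable[OF Cc_infinity_smooth[OF \<rho>]]])
  qed
  have t1: "(\<lambda>y. partial k \<rho> (x - y) * \<zeta> y) \<in> Cc_infinity \<Omega>"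
    by (rule Cc_infinity_mult[OF \<zeta> s\<rho>(2)])
  have t2: "(\<lambda>y. \<rho> (x - y) * partial k \<zeta> y) \<in> Cc_infinity \<Omega>"
    by (rule Cc_infinity_mult[OF Cc_infinity_partial[OF \<zeta>] s\<rho>(1)])
  have f1: "f \<in> L1_loc \<Omega>" and g1: "(\<lambda>x. g x $ k) \<in> L1_loc \<Omega>"
    using wg by (auto simp: weak_gradient_def)
  note i = L1_loc_test_integrable[OF f1 t1 \<Omega>] L1_loc_test_integrable[OF f1 t2 \<Omega>] L1_loc_test_integrable[OF g1 \<eta> \<Omega>]
  have "(LINT y|lebesgue_on \<Omega>. f y * partial k \<eta> y) = - (LINT y|lebesgue_on \<Omega>. g y $ k * \<eta> y)"
    using wg \<eta> by (auto simp: weak_gradient_def)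
  moreover have "(LINT y|lebesgue_on \<Omega>. f y * partial k \<eta> y)
     = (LINT y|lebesgue_on \<Omega>. f y * (\<rho> (x - y) * partial k \<zeta> y) - f y * (partial k \<rho> (x - y) * \<zeta> y))"
    unfolding p\<eta> by (intro Bochner_Integration.integral_cong) (auto simp: algebra_simps)
  ultimately have eq: "(LINT y|lebesgue_on \<Omega>. f y * (partial k \<rho> (x - y) * \<zeta> y))
     = (LINT y|lebesgue_on \<Omega>. g y $ k * \<eta> y) + (LINT y|lebesgue_on \<Omega>. f y * (\<rho> (x - y) * partial k \<zeta> y))"
    using i by simp
  have "partial k (conv \<rho> (\<lambda>x. if x \<in> \<Omega> then f x * \<zeta> x else 0)) x
     = conv (partial k \<rho>) (\<lambda>x. if x \<in> \<Omega> then f x * \<zeta> x else 0) x"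
    by (simp add: partial_conv[OF \<rho> L2_loc_mult_test(3)[OF f \<zeta> \<Omega>]])
  also have "\<dots> = (LINT y|lebesgue_on \<Omega>. f y * (partial k \<rho> (x - y) * \<zeta> y))"
    unfolding conv_restrict[OF \<Omega>] by (intro Bochner_Integration.integral_cong) auto
  also have "\<dots> = (LINT y|lebesgue_on \<Omega>. g y $ k * \<eta> y + f y * (\<rho> (x - y) * partial k \<zeta> y))"
    unfolding eq using i by simp
  also have "\<dots> = conv \<rho> (\<lambda>x. if x \<in> \<Omega> then g x $ k * \<zeta> x + f x * partial k \<zeta> x else 0) x"
    unfolding conv_restrict[OF \<Omega>] \<eta>_def by (intro Bochner_Integration.integral_cong) (auto simp: algebra_simps)
  finally show ?thesis .
qed

text \<open>A single kernel mollifies the compactly supported product. Its radius is below a width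
  by which the support can be enlarged inside \<Omega>, and below the finitely many thresholds for
  the product and its partial derivatives.\<close>

lemma mollified_product:
  fixes f :: "real^'n \<Rightarrow> real"
  assumes wg: "weak_gradient \<Omega> f g" and f: "f \<in> L2_loc \<Omega>" and g: "\<And>k. (\<lambda>x. g x $ k) \<in> L2_loc \<Omega>"
    and \<zeta>: "\<zeta> \<in> Cc_infinity \<Omega>" and \<Omega>: "open \<Omega>" and "\<epsilon> > 0"
  obtains u where "u \<in> Cc_infinity \<Omega>"
    "integrable (lebesgue_on \<Omega>) (\<lambda>x. (u x - f x * \<zeta> x)\<^sup>2)"
    "(LINT x|lebesgue_on \<Omega>. (u x - f x * \<zeta> x)\<^sup>2) < \<epsilon>"
    "\<And>k. integrable (lebesgue_on \<Omega>) (\<lambda>x. (partial k u x - (g x $ k * \<zeta> x + f x * partial k \<zeta> x))\<^sup>2)"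
    "\<And>k. (LINT x|lebesgue_on \<Omega>. (partial k u x - (g x $ k * \<zeta> x + f x * partial k \<zeta> x))\<^sup>2) < \<epsilon>"
proof -
  have \<Omega>m: "\<Omega> \<in> sets lebesgue" using \<Omega> by auto
  define F where "F x = (if x \<in> \<Omega> then f x * \<zeta> x else 0)" for x
  define G where "G k x = (if x \<in> \<Omega> then g x $ k * \<zeta> x + f x * partial k \<zeta> x else 0)" for k x
  obtain K where K: "compact K" "K \<subseteq> \<Omega>" "\<And>x. x \<notin> K \<Longrightarrow> \<zeta> x = 0" "\<And>x k. x \<notin> K \<Longrightarrow> partial k \<zeta> x = 0"
    using \<zeta> by (metis Cc_infinityE)
  obtain R where R: "K \<subseteq> cball 0 R"
    using compact_imp_bounded[OF K(1)] by (metis bounded_pos mem_cball_0 subsetI)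
  obtain d where d: "d > 0" "compact {x + y | x y. x \<in> K \<and> y \<in> cball 0 d}"
    "{x + y | x y. x \<in> K \<and> y \<in> cball 0 d} \<subseteq> \<Omega>"
    using compact_neighbourhood[OF K(1) \<Omega> K(2)] by blast
  have F: "F \<in> borel_measurable lebesgue" "integrable lebesgue (\<lambda>x. (F x)\<^sup>2)" "integrable lebesgue F"
    unfolding F_def by (rule L2_loc_mult_test[OF f \<zeta> \<Omega>m])+
  have G: "G k \<in> borel_measurable lebesgue" "integrable lebesgue (\<lambda>x. (G k x)\<^sup>2)" for k
  proof -
    define G1 where "G1 x = (if x \<in> \<Omega> then g x $ k * \<zeta> x else 0)" for x
    define G2 where "G2 x = (if x \<in> \<Omega> then f x * partial k \<zeta> x else 0)" for x
    have "G1 \<in> borel_measurable lebesgue" "integrable lebesgue (\<lambda>x. (G1 x)\<^sup>2)"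
      "G2 \<in> borel_measurable lebesgue" "integrable lebesgue (\<lambda>x. (G2 x)\<^sup>2)"
      unfolding G1_def G2_def
      using L2_loc_mult_test[OF g \<zeta> \<Omega>m] L2_loc_mult_test[OF f Cc_infinity_partial[OF \<zeta>] \<Omega>m] by auto
    moreover have "G k = (\<lambda>x. G1 x + G2 x)"
      by (auto simp: G_def G1_def G2_def)
    ultimately show "G k \<in> borel_measurable lebesgue" "integrable lebesgue (\<lambda>x. (G k x)\<^sup>2)"
      by (auto intro: integrable_add_square)
  qed
  have Fz: "x \<notin> K \<Longrightarrow> F x = 0" and Gz: "x \<notin> K \<Longrightarrow> G k x = 0" for x k
    using K by (auto simp: F_def G_def)
  have FR: "x \<notin> cball 0 R \<Longrightarrow> F x = 0" and GR: "x \<notin> cball 0 R \<Longrightarrow> G k x = 0" for x k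
    using Fz Gz R by blast+
  define Q where "Q H t \<longleftrightarrow> (\<forall>e \<rho>. e < t \<longrightarrow> mollifier e \<rho> \<longrightarrow> integrable lebesgue (\<lambda>x. (conv \<rho> H x - H x)\<^sup>2)
      \<and> (LINT x|lebesgue. (conv \<rho> H x - H x)\<^sup>2) < \<epsilon>)" for H :: "real^'n \<Rightarrow> real" and t
  have Q: "\<exists>t>0. Q H t" if "H \<in> borel_measurable lebesgue" "integrable lebesgue (\<lambda>x. (H x)\<^sup>2)"
    "\<And>x. x \<notin> cball 0 R \<Longrightarrow> H x = 0" for H
  proof (rule mollifier_L2_convergence[OF that \<open>\<epsilon> > 0\<close>])
    fix t assume "t > 0" and t: "\<And>e \<rho>. e < t \<Longrightarrow> mollifier e \<rho> \<Longrightarrow>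
      integrable lebesgue (\<lambda>x. (conv \<rho> H x - H x)\<^sup>2) \<and> (LINT x|lebesgue. (conv \<rho> H x - H x)\<^sup>2) < \<epsilon>"
    then have "Q H t" unfolding Q_def by blast
    then show ?thesis using \<open>t > 0\<close> by blast
  qed
  obtain t where t: "t > 0" "Q F t"
    using Q[OF F(1,2) FR] by blast
  have "\<exists>t>0. Q (G k) t" for k
    by (rule Q[OF G GR])
  then obtain s where s: "\<And>k. s k > 0" "\<And>k. Q (G k) (s k)"
    by metis
  define s0 where "s0 = Min (range s)"
  define e where "e = min d (min t s0) / 2"
  have "s0 > 0" unfolding s0_def using s(1) by (subst Min_gr_iff) auto
  then have e: "e > 0" "e < d" "e < t" "e < s0"
    using d(1) t(1) by (auto simp: e_def min_def)
  have es: "e < s k" for k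
    using e(4) Min_le[of "range s" "s k"] by (auto simp: s0_def)
  obtain \<rho> :: "real \<Rightarrow> real^'n \<Rightarrow> real" where "\<And>e. e > 0 \<Longrightarrow> mollifier e (\<rho> e)"
    using mollifier_exists by metis
  then have \<rho>: "mollifier e (\<rho> e)" using e by simp
  note m = mollifierD[OF \<rho>]
  define u where "u = conv (\<rho> e) F"
  have pu: "partial k u x = conv (\<rho> e) (G k) x" for k x
    unfolding u_def F_def[abs_def] G_def[abs_def]
    by (rule partial_conv_weak_gradient[OF wg f \<zeta> m(1) \<Omega>m])
  have eqF: "(\<lambda>x. if x \<in> \<Omega> then (u x - f x * \<zeta> x)\<^sup>2 else 0) = (\<lambda>x. if x \<in> \<Omega> then (u x - F x)\<^sup>2 else 0)"
    by (auto simp: F_def)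
  have eqG: "(\<lambda>x. if x \<in> \<Omega> then (partial k u x - (g x $ k * \<zeta> x + f x * partial k \<zeta> x))\<^sup>2 else 0)
     = (\<lambda>x. if x \<in> \<Omega> then (conv (\<rho> e) (G k) x - G k x)\<^sup>2 else 0)" for k
    by (auto simp: G_def pu)
  have restr: "integrable lebesgue (\<lambda>x. if x \<in> \<Omega> then (h x)\<^sup>2 else 0)"
    "(LINT x|lebesgue. (if x \<in> \<Omega> then (h x)\<^sup>2 else 0)) \<le> (LINT x|lebesgue. (h x)\<^sup>2)"
    if "integrable lebesgue (\<lambda>x. (h x)\<^sup>2)" for h :: "real^'n \<Rightarrow> real"
  proof -
    show *: "integrable lebesgue (\<lambda>x. if x \<in> \<Omega> then (h x)\<^sup>2 else 0)"
      by (rule Bochner_Integration.integrable_bound[OF that])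
        (use that \<Omega>m in \<open>auto intro!: borel_measurable_if_I measurable_restrict_space1\<close>)
    show "(LINT x|lebesgue. (if x \<in> \<Omega> then (h x)\<^sup>2 else 0)) \<le> (LINT x|lebesgue. (h x)\<^sup>2)"
      by (rule integral_mono[OF * that]) auto
  qed
  note tF = t(2)[unfolded Q_def, rule_format, OF e(3) \<rho>, folded u_def]
  note tG = s(2)[unfolded Q_def, rule_format, OF es \<rho>]
  show thesis
  proof (rule that[of u])
    show "u \<in> Cc_infinity \<Omega>"
    proof (rule Cc_infinityI[OF _ d(2,3)])
      show "smooth u" unfolding u_def by (rule smooth_conv[OF m(1) F(3)])
      fix x assume x: "x \<notin> {x + y | x y. x \<in> K \<and> y \<in> cball 0 d}"
      show "u x = 0" unfolding u_def
      proof (rule conv_eq_0)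
        fix y assume "F y \<noteq> 0"
        then have "y \<in> K" using Fz by blast
        have "x - y \<notin> cball 0 d"
        proof
          assume "x - y \<in> cball 0 d"
          moreover have "x = y + (x - y)" by simp
          ultimately show False using x \<open>y \<in> K\<close> by blast
        qed
        then show "\<rho> e (x - y) = 0"
          using e by (intro m(5)) (auto simp: dist_norm norm_minus_commute)
      qed
    qed
    show "integrable (lebesgue_on \<Omega>) (\<lambda>x. (u x - f x * \<zeta> x)\<^sup>2)"
      using restr(1)[of "\<lambda>x. u x - F x"] tF unfolding Lebesgue_Measure.integrable_restrict_UNIV[OF \<Omega>m, symmetric] eqF by simp
    show "(LINT x|lebesgue_on \<Omega>. (u x - f x * \<zeta> x)\<^sup>2) < \<epsilon>"
      using restr(2)[of "\<lambda>x. u x - F x"] tF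
      unfolding Lebesgue_Measure.integral_restrict_UNIV[OF \<Omega>m, symmetric] eqF by simp
    show "integrable (lebesgue_on \<Omega>) (\<lambda>x. (partial k u x - (g x $ k * \<zeta> x + f x * partial k \<zeta> x))\<^sup>2)" for k
      using restr(1)[of "\<lambda>x. conv (\<rho> e) (G k) x - G k x"] tG[of k]
      unfolding Lebesgue_Measure.integrable_restrict_UNIV[OF \<Omega>m, symmetric] eqG by simp
    show "(LINT x|lebesgue_on \<Omega>. (partial k u x - (g x $ k * \<zeta> x + f x * partial k \<zeta> x))\<^sup>2) < \<epsilon>" for k
      using restr(2)[of "\<lambda>x. conv (\<rho> e) (G k) x - G k x"] tG[of k]
      unfolding Lebesgue_Measure.integral_restrict_UNIV[OF \<Omega>m, symmetric] eqG by simp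
  qed
qed

section \<open>Integrals over subsets and the Cauchy-Schwarz inequality\<close>

lemma integrable_lebesgue_on_subset:
  fixes f :: "'a::euclidean_space \<Rightarrow> real"
  assumes "integrable (lebesgue_on T) f" "S \<subseteq> T" "S \<in> sets lebesgue" "T \<in> sets lebesgue"
  shows "integrable (lebesgue_on S) f"
proof -
  have "integrable lebesgue (\<lambda>x. indicator S x *\<^sub>R (if x \<in> T then f x else 0))"
    using assms by (intro integrable_mult_indicator) (auto simp: Lebesgue_Measure.integrable_restrict_UNIV)
  also have "(\<lambda>x. indicator S x *\<^sub>R (if x \<in> T then f x else 0)) = (\<lambda>x. if x \<in> S then f x else 0)"
    by (rule ext) (use assms(2) in \<open>auto simp: indicator_def\<close>)
  finally show ?thesis
    using assms by (simp add: Lebesgue_Measure.integrable_restrict_UNIV)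
qed

lemma integral_lebesgue_on_subset_le:
  fixes f :: "'a::euclidean_space \<Rightarrow> real"
  assumes "integrable (lebesgue_on T) f" "\<And>x. 0 \<le> f x" "S \<subseteq> T" "S \<in> sets lebesgue" "T \<in> sets lebesgue"
  shows "(LINT x|lebesgue_on S. f x) \<le> (LINT x|lebesgue_on T. f x)"
  using assms by (intro integral_mono_lebesgue_on_AE) auto

lemma integral_lebesgue_on_support:
  fixes f :: "'a::euclidean_space \<Rightarrow> real"
  assumes "S \<subseteq> T" "S \<in> sets lebesgue" "T \<in> sets lebesgue" "\<And>x. x \<in> T - S \<Longrightarrow> f x = 0"
  shows "(LINT x|lebesgue_on T. f x) = (LINT x|lebesgue_on S. f x)"
proof -
  have "(LINT x|lebesgue_on T. f x) = (LINT x|lebesgue_on T. (if x \<in> S then f x else 0))"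
    using assms(4) by (intro Bochner_Integration.integral_cong) auto
  then show ?thesis using Lebesgue_Measure.integral_restrict[OF assms(1-3)] by simp
qed

lemma
  fixes f g :: "'a \<Rightarrow> real"
  assumes f: "f \<in> borel_measurable M" "integrable M (\<lambda>x. (f x)\<^sup>2)"
    and g: "g \<in> borel_measurable M" "integrable M (\<lambda>x. (g x)\<^sup>2)"
  shows integrable_mult_L2: "integrable M (\<lambda>x. f x * g x)"
    and Cauchy_Schwarz_L2: "(LINT x|M. \<bar>f x * g x\<bar>) \<le> sqrt (LINT x|M. (f x)\<^sup>2) * sqrt (LINT x|M. (g x)\<^sup>2)"
proof -
  show i: "integrable M (\<lambda>x. f x * g x)"
  proof (rule Bochner_Integration.integrable_bound)
    show "integrable M (\<lambda>x. (f x)\<^sup>2 + (g x)\<^sup>2)" using f g by simp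
    show "AE x in M. norm (f x * g x) \<le> norm ((f x)\<^sup>2 + (g x)\<^sup>2)"
    proof (rule AE_I2)
      fix x
      have "2 * \<bar>f x\<bar> * \<bar>g x\<bar> \<le> (f x)\<^sup>2 + (g x)\<^sup>2"
        using sum_squares_bound[of "\<bar>f x\<bar>" "\<bar>g x\<bar>"] by simp
      moreover have "\<bar>f x\<bar> * \<bar>g x\<bar> \<le> 2 * (\<bar>f x\<bar> * \<bar>g x\<bar>)"
        using mult_nonneg_nonneg[of "\<bar>f x\<bar>" "\<bar>g x\<bar>"] by linarith
      ultimately have "\<bar>f x\<bar> * \<bar>g x\<bar> \<le> (f x)\<^sup>2 + (g x)\<^sup>2"
        by linarith
      then show "norm (f x * g x) \<le> norm ((f x)\<^sup>2 + (g x)\<^sup>2)"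
        by (simp add: abs_mult)
    qed
  qed (use f g in auto)
  have "(\<integral>\<^sup>+x. ennreal \<bar>f x\<bar> * ennreal \<bar>g x\<bar> \<partial>M)\<^sup>2 \<le> (\<integral>\<^sup>+x. (ennreal \<bar>f x\<bar>)\<^sup>2 \<partial>M) * (\<integral>\<^sup>+x. (ennreal \<bar>g x\<bar>)\<^sup>2 \<partial>M)"
    using f g by (intro Cauchy_Schwarz_nn_integral) auto
  moreover have "(\<integral>\<^sup>+x. ennreal \<bar>f x\<bar> * ennreal \<bar>g x\<bar> \<partial>M) = ennreal (LINT x|M. \<bar>f x * g x\<bar>)"
    using integrable_abs[OF i] by (subst nn_integral_eq_integral[symmetric]) (auto simp: abs_mult ennreal_mult)
  moreover have "(\<integral>\<^sup>+x. (ennreal \<bar>h x\<bar>)\<^sup>2 \<partial>M) = ennreal (LINT x|M. (h x)\<^sup>2)" if "integrable M (\<lambda>x. (h x)\<^sup>2)" for h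
    using that by (subst nn_integral_eq_integral[symmetric]) (auto simp: ennreal_power)
  ultimately have "ennreal ((LINT x|M. \<bar>f x * g x\<bar>)\<^sup>2) \<le> ennreal ((LINT x|M. (f x)\<^sup>2) * (LINT x|M. (g x)\<^sup>2))"
    using f(2) g(2) by (simp add: ennreal_power ennreal_mult)
  then have "(LINT x|M. \<bar>f x * g x\<bar>)\<^sup>2 \<le> (LINT x|M. (f x)\<^sup>2) * (LINT x|M. (g x)\<^sup>2)"
    by (subst (asm) ennreal_le_iff) auto
  then show "(LINT x|M. \<bar>f x * g x\<bar>) \<le> sqrt (LINT x|M. (f x)\<^sup>2) * sqrt (LINT x|M. (g x)\<^sup>2)"
    by (simp add: real_le_rsqrt flip: real_sqrt_mult)
qed

lemma tendsto_integral_mult_L2: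
  fixes a :: "nat \<Rightarrow> 'a \<Rightarrow> real"
  assumes a: "\<And>n. a n \<in> borel_measurable M" "\<And>n. integrable M (\<lambda>x. (a n x)\<^sup>2)"
    "(\<lambda>n. LINT x|M. (a n x)\<^sup>2) \<longlonglongrightarrow> 0"
    and b: "b \<in> borel_measurable M" "integrable M (\<lambda>x. (b x)\<^sup>2)"
  shows "(\<lambda>n. LINT x|M. \<bar>a n x * b x\<bar>) \<longlonglongrightarrow> 0"
proof (rule tendsto_sandwich[of "\<lambda>_. 0"])
  show "(\<lambda>n. sqrt (LINT x|M. (a n x)\<^sup>2) * sqrt (LINT x|M. (b x)\<^sup>2)) \<longlonglongrightarrow> 0"
    using tendsto_mult[OF tendsto_real_sqrt[OF a(3)] tendsto_const] by simp
  show "eventually (\<lambda>n. (LINT x|M. \<bar>a n x * b x\<bar>) \<le> sqrt (LINT x|M. (a n x)\<^sup>2) * sqrt (LINT x|M. (b x)\<^sup>2)) sequentially"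
    using Cauchy_Schwarz_L2[OF a(1,2) b] by simp
qed auto

lemma tendsto_integral_abs_diff:
  fixes f :: "nat \<Rightarrow> 'a \<Rightarrow> real"
  assumes "\<And>n. integrable M (f n)" "integrable M g" "\<And>n. integrable M (d n)"
    and "\<And>n x. x \<in> space M \<Longrightarrow> \<bar>f n x - g x\<bar> \<le> d n x" "(\<lambda>n. LINT x|M. d n x) \<longlonglongrightarrow> 0"
  shows "(\<lambda>n. LINT x|M. f n x) \<longlonglongrightarrow> (LINT x|M. g x)"
proof -
  have "(\<lambda>n. (LINT x|M. f n x) - (LINT x|M. g x)) \<longlonglongrightarrow> 0"
  proof (rule Lim_null_comparison[OF _ assms(5)], rule always_eventually, rule allI)
    fix n
    have "norm ((LINT x|M. f n x) - (LINT x|M. g x)) = \<bar>LINT x|M. f n x - g x\<bar>"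
      using assms by simp
    also have "\<dots> \<le> (LINT x|M. \<bar>f n x - g x\<bar>)" by simp
    also have "\<dots> \<le> (LINT x|M. d n x)"
      using assms by (intro integral_mono) auto
    finally show "norm ((LINT x|M. f n x) - (LINT x|M. g x)) \<le> (LINT x|M. d n x)" .
  qed
  then show ?thesis by (simp add: LIM_zero_iff)
qed

lemma square_integrable_mult_bounded:
  fixes f w :: "'a \<Rightarrow> real"
  assumes "f \<in> borel_measurable M" "integrable M (\<lambda>x. (f x)\<^sup>2)" "w \<in> borel_measurable M" "\<And>x. \<bar>w x\<bar> \<le> B"
  shows "integrable M (\<lambda>x. (w x * f x)\<^sup>2)"
proof (rule Bochner_Integration.integrable_bound[OF integrable_mult_right[OF assms(2), of "B\<^sup>2"]])
  have "\<bar>w x\<bar> \<le> \<bar>B\<bar>" for x using assms(4)[of x] by linarith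
  then have "(w x)\<^sup>2 \<le> B\<^sup>2" for x by (simp add: abs_le_square_iff)
  then show "AE x in M. norm ((w x * f x)\<^sup>2) \<le> norm (B\<^sup>2 * (f x)\<^sup>2)"
    by (auto simp: power_mult_distrib intro!: mult_right_mono)
qed (use assms in auto)

lemma L2_locD:
  assumes "f \<in> L2_loc \<Omega>" "compact K" "K \<subseteq> \<Omega>"
  shows "f \<in> borel_measurable (lebesgue_on K)" "integrable (lebesgue_on K) (\<lambda>x. (f x)\<^sup>2)"
proof -
  have "f \<in> borel_measurable (lebesgue_on \<Omega>)" using assms(1) by (simp add: L2_loc_def)
  then show "f \<in> borel_measurable (lebesgue_on K)"
    by (rule measurable_restrict_mono[OF _ assms(3)])
qed (use assms in \<open>simp add: L2_loc_def\<close>)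

lemma borel_lebesgue_on: "f \<in> borel_measurable borel \<Longrightarrow> f \<in> borel_measurable (lebesgue_on S)"
  by (intro measurable_restrict_space1 borel_imp_lebesgue)

lemma smooth_lebesgue_on: "smooth f \<Longrightarrow> f \<in> borel_measurable (lebesgue_on S)"
  by (intro borel_lebesgue_on smooth_borel)

lemma Cc_infinity_integrable_lebesgue_on:
  assumes "u \<in> Cc_infinity A" "S \<in> sets lebesgue"
  shows "integrable (lebesgue_on S) u"
proof (rule integrable_lebesgue_on_subset[of UNIV])
  show "integrable (lebesgue_on UNIV) u"
    using Cc_infinity_integrable[OF assms(1)] smooth_borel[OF Cc_infinity_smooth[OF assms(1)]]
    by (simp add: lebesgue_on_UNIV_eq lebesgue_lborel_integrable)
qed (use assms in auto)

lemma Cc_infinity_square: "u \<in> Cc_infinity A \<Longrightarrow> (\<lambda>x. (u x)\<^sup>2) \<in> Cc_infinity A"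
  unfolding power2_eq_square by (intro Cc_infinity_mult Cc_infinity_smooth)

lemma integral_by_parts_on:
  assumes f: "smooth f" and u: "u \<in> Cc_infinity \<Omega>" and \<Omega>: "\<Omega> \<in> sets lebesgue"
  shows "(LINT x|lebesgue_on \<Omega>. f x * partial k u x) = - (LINT x|lebesgue_on \<Omega>. partial k f x * u x)"
proof -
  obtain K where K: "K \<subseteq> \<Omega>" "\<And>x. x \<notin> K \<Longrightarrow> u x = 0" "\<And>x k. x \<notin> K \<Longrightarrow> partial k u x = 0"
    using u by (metis Cc_infinityE)
  have m: "(\<lambda>x. f x * partial k u x) \<in> borel_measurable borel" "(\<lambda>x. partial k f x * u x) \<in> borel_measurable borel"
    by (intro borel_measurable_times smooth_borel smooth_partial f Cc_infinity_smooth[OF u])+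
  have "(LINT x|lebesgue_on \<Omega>. f x * partial k u x) = (LINT x|lebesgue. f x * partial k u x)"
    "(LINT x|lebesgue_on \<Omega>. partial k f x * u x) = (LINT x|lebesgue. partial k f x * u x)"
  proof -
    have "(LINT x|lebesgue_on UNIV. f x * partial k u x) = (LINT x|lebesgue_on \<Omega>. f x * partial k u x)"
      by (rule integral_lebesgue_on_support) (use K \<Omega> in auto)
    moreover have "(LINT x|lebesgue_on UNIV. partial k f x * u x) = (LINT x|lebesgue_on \<Omega>. partial k f x * u x)"
      by (rule integral_lebesgue_on_support) (use K \<Omega> in auto)
    ultimately show "(LINT x|lebesgue_on \<Omega>. f x * partial k u x) = (LINT x|lebesgue. f x * partial k u x)"
      "(LINT x|lebesgue_on \<Omega>. partial k f x * u x) = (LINT x|lebesgue. partial k f x * u x)"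
      by (simp_all add: lebesgue_on_UNIV_eq)
  qed
  then show ?thesis
    using m integral_by_parts[OF f u] by (simp add: lebesgue_lborel_integral)
qed

section \<open>Calculus of weak gradients\<close>

lemma local_approximation:
  fixes f :: "real^'n \<Rightarrow> real"
  assumes wg: "weak_gradient \<Omega> f g" and f: "f \<in> L2_loc \<Omega>" and g: "\<And>k. (\<lambda>x. g x $ k) \<in> L2_loc \<Omega>"
    and \<Omega>: "open \<Omega>" and K: "compact K" "K \<subseteq> \<Omega>"
  obtains u where "\<And>n::nat. u n \<in> Cc_infinity \<Omega>"
    "(\<lambda>n. LINT x|lebesgue_on K. (u n x - f x)\<^sup>2) \<longlonglongrightarrow> 0"
    "\<And>k. (\<lambda>n. LINT x|lebesgue_on K. (partial k (u n) x - g x $ k)\<^sup>2) \<longlonglongrightarrow> 0"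
proof -
  have \<Omega>m: "\<Omega> \<in> sets lebesgue" and Km: "K \<in> sets lebesgue" using \<Omega> K compact_lebesgue by auto
  obtain \<zeta> where \<zeta>: "\<zeta> \<in> Cc_infinity \<Omega>" "\<And>x. x \<in> K \<Longrightarrow> \<zeta> x = 1" "\<And>x k. x \<in> K \<Longrightarrow> partial k \<zeta> x = 0"
    using smooth_cutoff[OF K(1) \<Omega> K(2)] by metis
  define P where "P n u \<longleftrightarrow> u \<in> Cc_infinity \<Omega> \<and> (LINT x|lebesgue_on K. (u x - f x)\<^sup>2) \<le> inverse (real (Suc n))
     \<and> (\<forall>k. (LINT x|lebesgue_on K. (partial k u x - g x $ k)\<^sup>2) \<le> inverse (real (Suc n)))" for n and u :: "real^'n \<Rightarrow> real"
  have "\<exists>u. P n u" for n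
  proof -
    have "inverse (real (Suc n)) > 0" by simp
    then obtain u where u: "u \<in> Cc_infinity \<Omega>"
      "integrable (lebesgue_on \<Omega>) (\<lambda>x. (u x - f x * \<zeta> x)\<^sup>2)"
      "(LINT x|lebesgue_on \<Omega>. (u x - f x * \<zeta> x)\<^sup>2) < inverse (real (Suc n))"
      "\<And>k. integrable (lebesgue_on \<Omega>) (\<lambda>x. (partial k u x - (g x $ k * \<zeta> x + f x * partial k \<zeta> x))\<^sup>2)"
      "\<And>k. (LINT x|lebesgue_on \<Omega>. (partial k u x - (g x $ k * \<zeta> x + f x * partial k \<zeta> x))\<^sup>2) < inverse (real (Suc n))"
      by (rule mollified_product[OF wg f g \<zeta>(1) \<Omega>]) blast
    have "(LINT x|lebesgue_on K. (u x - f x)\<^sup>2) = (LINT x|lebesgue_on K. (u x - f x * \<zeta> x)\<^sup>2)"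
      using \<zeta> by (intro Bochner_Integration.integral_cong) auto
    also have "\<dots> \<le> (LINT x|lebesgue_on \<Omega>. (u x - f x * \<zeta> x)\<^sup>2)"
      by (intro integral_lebesgue_on_subset_le u K Km \<Omega>m) auto
    finally have 1: "(LINT x|lebesgue_on K. (u x - f x)\<^sup>2) \<le> inverse (real (Suc n))" using u(3) by simp
    have 2: "(LINT x|lebesgue_on K. (partial k u x - g x $ k)\<^sup>2) \<le> inverse (real (Suc n))" for k
    proof -
      have "(LINT x|lebesgue_on K. (partial k u x - g x $ k)\<^sup>2)
         = (LINT x|lebesgue_on K. (partial k u x - (g x $ k * \<zeta> x + f x * partial k \<zeta> x))\<^sup>2)"
        using \<zeta> by (intro Bochner_Integration.integral_cong) auto
      also have "\<dots> \<le> (LINT x|lebesgue_on \<Omega>. (partial k u x - (g x $ k * \<zeta> x + f x * partial k \<zeta> x))\<^sup>2)"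
        by (intro integral_lebesgue_on_subset_le u K Km \<Omega>m) auto
      finally show ?thesis using u(5)[of k] by simp
    qed
    show ?thesis using u(1) 1 2 unfolding P_def by blast
  qed
  then obtain u where u: "\<And>n. P n (u n)" by metis
  show thesis
  proof (rule that[of u])
    show "u n \<in> Cc_infinity \<Omega>" for n using u P_def by blast
    show "(\<lambda>n. LINT x|lebesgue_on K. (u n x - f x)\<^sup>2) \<longlonglongrightarrow> 0"
      by (rule tendsto_sandwich[OF _ _ tendsto_const LIMSEQ_inverse_real_of_nat])
       (use u in \<open>auto simp: P_def\<close>)
    show "(\<lambda>n. LINT x|lebesgue_on K. (partial k (u n) x - g x $ k)\<^sup>2) \<longlonglongrightarrow> 0" for k
      by (rule tendsto_sandwich[OF _ _ tendsto_const LIMSEQ_inverse_real_of_nat])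
       (use u in \<open>auto simp: P_def\<close>)
  qed
qed

text \<open>Both sides of the defining identity pass to the limit along smooth functions that
  approximate \<open>f\<close> and its gradient in \<open>L2\<close> on the support of the test
  function. The Lipschitz bound on \<open>D 1\<close> makes the convergence of
  \<open>D 1 (u n x)\<close> quantitative, so that convergence in norm is enough and no almost
  everywhere convergent subsequence has to be extracted.\<close>

lemma weak_chain_rule:
  fixes f :: "real^'n \<Rightarrow> real" and D :: "nat \<Rightarrow> real \<Rightarrow> real"
  assumes wg: "weak_gradient \<Omega> f g" and f: "f \<in> L2_loc \<Omega>" and g: "\<And>k. (\<lambda>x. g x $ k) \<in> L2_loc \<Omega>"
    and \<Omega>: "open \<Omega>"
    and D: "\<And>n t. (D n has_real_derivative D (Suc n) t) (at t)"
    and D0: "D 0 0 = 0" "\<And>s t. \<bar>D 0 s - D 0 t\<bar> \<le> \<bar>s - t\<bar>"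
    and D1: "\<And>t. \<bar>D 1 t\<bar> \<le> 1" "\<And>s t. \<bar>D 1 s - D 1 t\<bar> \<le> L * \<bar>s - t\<bar>"
  shows "weak_gradient \<Omega> (\<lambda>x. D 0 (f x)) (\<lambda>x. D 1 (f x) *\<^sub>R g x)"
    and "(\<lambda>x. D 0 (f x)) \<in> L2_loc \<Omega>" and "(\<lambda>x. (D 1 (f x) *\<^sub>R g x) $ k) \<in> L2_loc \<Omega>"
proof -
  have \<Omega>m: "\<Omega> \<in> sets lebesgue" using \<Omega> by auto
  have Dm: "D n \<in> borel_measurable borel" for n
    using D by (intro borel_measurable_continuous_onI) (auto intro!: continuous_at_imp_continuous_on DERIV_isCont)
  have L: "L \<ge> 0" using D1(2)[of 0 1] by (simp add: order_trans[OF abs_ge_zero])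
  have fm: "f \<in> borel_measurable (lebesgue_on \<Omega>)" and gm: "(\<lambda>x. g x $ k) \<in> borel_measurable (lebesgue_on \<Omega>)" for k
    using f g by (auto simp: L2_loc_def)
  note fK = L2_locD[OF f] and gK = L2_locD[OF g]
  show L20: "(\<lambda>x. D 0 (f x)) \<in> L2_loc \<Omega>"
    unfolding L2_loc_def
  proof (intro CollectI conjI allI impI)
    show "(\<lambda>x. D 0 (f x)) \<in> borel_measurable (lebesgue_on \<Omega>)"
      by (rule measurable_compose[OF fm Dm])
    fix K assume K: "compact K \<and> K \<subseteq> \<Omega>"
    show "integrable (lebesgue_on K) (\<lambda>x. (D 0 (f x))\<^sup>2)"
    proof (rule Bochner_Integration.integrable_bound[OF fK(2)[of K]])
      have "\<bar>D 0 t\<bar> \<le> \<bar>t\<bar>" for t using D0(2)[of t 0] D0(1) by simp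
      then show "AE x in lebesgue_on K. norm ((D 0 (f x))\<^sup>2) \<le> norm ((f x)\<^sup>2)"
        by (simp add: abs_le_square_iff)
    qed (use K in \<open>auto intro!: borel_measurable_power measurable_compose[OF fK(1) Dm]\<close>)
  qed
  have L21: "(\<lambda>x. D 1 (f x) * g x $ k) \<in> L2_loc \<Omega>" for k
    unfolding L2_loc_def
  proof (intro CollectI conjI allI impI)
    show "(\<lambda>x. D 1 (f x) * g x $ k) \<in> borel_measurable (lebesgue_on \<Omega>)"
      by (intro borel_measurable_times gm measurable_compose[OF fm Dm])
    fix K assume K: "compact K \<and> K \<subseteq> \<Omega>"
    show "integrable (lebesgue_on K) (\<lambda>x. (D 1 (f x) * g x $ k)\<^sup>2)"
      by (rule square_integrable_mult_bounded[OF gK(1,2) measurable_compose[OF fK(1) Dm] D1(1)]) (use K in auto)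
  qed
  then show "(\<lambda>x. (D 1 (f x) *\<^sub>R g x) $ k) \<in> L2_loc \<Omega>"
    by simp
  show "weak_gradient \<Omega> (\<lambda>x. D 0 (f x)) (\<lambda>x. D 1 (f x) *\<^sub>R g x)"
    unfolding weak_gradient_def
  proof (intro conjI allI ballI)
    show "(\<lambda>x. D 0 (f x)) \<in> L1_loc \<Omega>" using L20 by (rule L2_loc_L1_loc)
    show "(\<lambda>x. (D 1 (f x) *\<^sub>R g x) $ k) \<in> L1_loc \<Omega>" for k using L2_loc_L1_loc[OF L21] by simp
    fix k \<eta> assume \<eta>: "\<eta> \<in> Cc_infinity \<Omega>"
    obtain K where K: "compact K" "K \<subseteq> \<Omega>" "\<And>x. x \<notin> K \<Longrightarrow> \<eta> x = 0" "\<And>x k. x \<notin> K \<Longrightarrow> partial k \<eta> x = 0"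
      using \<eta> by (metis Cc_infinityE)
    have Km: "K \<in> sets lebesgue" using K compact_lebesgue by auto
    obtain u where u: "\<And>n::nat. u n \<in> Cc_infinity \<Omega>"
      "(\<lambda>n. LINT x|lebesgue_on K. (u n x - f x)\<^sup>2) \<longlonglongrightarrow> 0"
      "\<And>k. (\<lambda>n. LINT x|lebesgue_on K. (partial k (u n) x - g x $ k)\<^sup>2) \<longlonglongrightarrow> 0"
      by (rule local_approximation[OF wg f g \<Omega> K(1,2)]) blast
    define w where "w = partial k \<eta>"
    have w: "w \<in> Cc_infinity \<Omega>" unfolding w_def by (rule Cc_infinity_partial[OF \<eta>])
    obtain B where B: "\<And>x. \<bar>\<eta> x\<bar> \<le> B" using Cc_infinity_bounded[OF \<eta>] by metis
    let ?M = "lebesgue_on K"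
    have test_m: "v \<in> borel_measurable ?M" and test_i: "integrable ?M (\<lambda>x. (v x)\<^sup>2)" if "v \<in> Cc_infinity \<Omega>" for v
      using that Km Cc_infinity_integrable_lebesgue_on[OF Cc_infinity_square[OF that] Km]
      by (auto intro: smooth_lebesgue_on Cc_infinity_smooth)
    note fK = fK[OF K(1,2)] and gK = gK[OF K(1,2)]
    have comp_m: "(\<lambda>x. D i (f x)) \<in> borel_measurable ?M" "(\<lambda>x. D i (u n x)) \<in> borel_measurable ?M" for i n
      using fK test_m[OF u(1)] by (auto intro: measurable_compose[OF _ Dm])
    have uf: "(\<lambda>x. u n x - f x) \<in> borel_measurable ?M" "integrable ?M (\<lambda>x. (u n x - f x)\<^sup>2)" for n
      using test_m[OF u(1)] test_i[OF u(1)] fK by (auto intro!: integrable_diff_square)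
    have ug: "(\<lambda>x. partial k (u n) x - g x $ k) \<in> borel_measurable ?M" "integrable ?M (\<lambda>x. (partial k (u n) x - g x $ k)\<^sup>2)" for n
      using test_m[OF Cc_infinity_partial[OF u(1)]] test_i[OF Cc_infinity_partial[OF u(1)]] gK
      by (auto intro!: integrable_diff_square)
    have smu: "smooth (\<lambda>x. D i (u n x))" for i n
      by (rule smooth_real_compose[of D, OF D Cc_infinity_smooth[OF u(1)]])
    have fw: "integrable ?M (\<lambda>x. D 0 (f x) * w x)"
      using L2_locD[OF L20 K(1,2)] test_m[OF w] test_i[OF w] by (intro integrable_mult_L2)
    have uw: "integrable ?M (\<lambda>x. D 0 (u n x) * w x)" for n
      by (rule Cc_infinity_integrable_lebesgue_on[OF Cc_infinity_mult[OF w smu] Km])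
    have lim1: "(\<lambda>n. LINT x|?M. D 0 (u n x) * w x) \<longlonglongrightarrow> (LINT x|?M. D 0 (f x) * w x)"
    proof (rule tendsto_integral_abs_diff[OF uw fw])
      show "(\<lambda>n. LINT x|?M. \<bar>(u n x - f x) * w x\<bar>) \<longlonglongrightarrow> 0"
        by (rule tendsto_integral_mult_L2[OF uf u(2) test_m[OF w] test_i[OF w]])
      show "integrable ?M (\<lambda>x. \<bar>(u n x - f x) * w x\<bar>)" for n
        using integrable_mult_L2[OF uf test_m[OF w] test_i[OF w]] by simp
      show "\<bar>D 0 (u n x) * w x - D 0 (f x) * w x\<bar> \<le> \<bar>(u n x - f x) * w x\<bar>" for n x
        using D0(2)[of "u n x" "f x"] by (simp add: abs_mult mult_right_mono flip: left_diff_distrib)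
    qed
    \<comment> \<open>In the difference of the two integrands the factor
      \<open>D 1 (u n x) - D 1 (f x)\<close> meets \<open>g\<close>, which is only square integrable
      on \<open>K\<close>. Absorbing the bounded test function into \<open>b\<close> lets the
      Lipschitz bound pair two \<open>L2\<close> functions.\<close>
    define b where "b x = \<eta> x * g x $ k" for x
    have b: "b \<in> borel_measurable ?M" "integrable ?M (\<lambda>x. (b x)\<^sup>2)"
      unfolding b_def[abs_def] using gK test_m[OF \<eta>] B
      by (auto intro!: square_integrable_mult_bounded)
    have fg: "integrable ?M (\<lambda>x. D 1 (f x) * g x $ k * \<eta> x)"
      using L2_locD[OF L21[of k] K(1,2)] test_m[OF \<eta>] test_i[OF \<eta>] by (intro integrable_mult_L2)
    have ugi: "integrable ?M (\<lambda>x. D 1 (u n x) * partial k (u n) x * \<eta> x)" for n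
      using Cc_infinity_integrable_lebesgue_on[OF Cc_infinity_mult[OF \<eta> smooth_mult[OF smu smooth_partial[OF Cc_infinity_smooth[OF u(1)]]]] Km] .
    have lim2: "(\<lambda>n. LINT x|?M. D 1 (u n x) * partial k (u n) x * \<eta> x) \<longlonglongrightarrow> (LINT x|?M. D 1 (f x) * g x $ k * \<eta> x)"
    proof (rule tendsto_integral_abs_diff[OF ugi fg])
      let ?d = "\<lambda>n x. \<bar>(partial k (u n) x - g x $ k) * \<eta> x\<bar> + L * \<bar>(u n x - f x) * b x\<bar>"
      have i1: "integrable ?M (\<lambda>x. \<bar>(partial k (u n) x - g x $ k) * \<eta> x\<bar>)" for n
        using integrable_mult_L2[OF ug test_m[OF \<eta>] test_i[OF \<eta>]] by simp
      have i2: "integrable ?M (\<lambda>x. \<bar>(u n x - f x) * b x\<bar>)" for n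
        using integrable_mult_L2[OF uf b] by simp
      show "integrable ?M (?d n)" for n using i1 i2 by auto
      have "(\<lambda>n. (LINT x|?M. \<bar>(partial k (u n) x - g x $ k) * \<eta> x\<bar>) + L * (LINT x|?M. \<bar>(u n x - f x) * b x\<bar>)) \<longlonglongrightarrow> 0 + L * 0"
        by (intro tendsto_intros tendsto_integral_mult_L2[OF ug u(3) test_m[OF \<eta>] test_i[OF \<eta>]]
            tendsto_integral_mult_L2[OF uf u(2) b])
      then show "(\<lambda>n. LINT x|?M. ?d n x) \<longlonglongrightarrow> 0"
        using i1 i2 by simp
      fix n x
      have "D 1 (u n x) * partial k (u n) x * \<eta> x - D 1 (f x) * g x $ k * \<eta> x
         = D 1 (u n x) * ((partial k (u n) x - g x $ k) * \<eta> x) + (D 1 (u n x) - D 1 (f x)) * b x"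
        by (simp add: b_def algebra_simps)
      also have "\<bar>\<dots>\<bar> \<le> \<bar>D 1 (u n x)\<bar> * \<bar>(partial k (u n) x - g x $ k) * \<eta> x\<bar> + \<bar>D 1 (u n x) - D 1 (f x)\<bar> * \<bar>b x\<bar>"
        by (metis abs_mult abs_triangle_ineq)
      also have "\<dots> \<le> 1 * \<bar>(partial k (u n) x - g x $ k) * \<eta> x\<bar> + (L * \<bar>u n x - f x\<bar>) * \<bar>b x\<bar>"
        by (intro add_mono mult_right_mono D1) auto
      finally show "\<bar>D 1 (u n x) * partial k (u n) x * \<eta> x - D 1 (f x) * g x $ k * \<eta> x\<bar> \<le> ?d n x"
        by (simp add: abs_mult)
    qed
    have "(LINT x|?M. D 0 (u n x) * w x) = - (LINT x|?M. D 1 (u n x) * partial k (u n) x * \<eta> x)" for n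
    proof -
      have "(LINT x|lebesgue_on \<Omega>. D 0 (u n x) * w x) = - (LINT x|lebesgue_on \<Omega>. partial k (\<lambda>x. D 0 (u n x)) x * \<eta> x)"
        unfolding w_def by (rule integral_by_parts_on[OF smu \<eta> \<Omega>m])
      moreover have "partial k (\<lambda>x. D 0 (u n x)) x = D 1 (u n x) * partial k (u n) x" for x
        using partial_real_compose[of "D 0" "D 1", OF _ smooth_differentiable[OF Cc_infinity_smooth[OF u(1)]]] D[of 0]
        by simp
      ultimately show ?thesis
        using integral_lebesgue_on_support[OF K(2) Km \<Omega>m, of "\<lambda>x. D 0 (u n x) * w x"]
          integral_lebesgue_on_support[OF K(2) Km \<Omega>m, of "\<lambda>x. D 1 (u n x) * partial k (u n) x * \<eta> x"] K(3,4)
        by (simp add: w_def)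
    qed
    then have "(\<lambda>n. LINT x|?M. D 0 (u n x) * w x) \<longlonglongrightarrow> - (LINT x|?M. D 1 (f x) * g x $ k * \<eta> x)"
      using tendsto_minus[OF lim2] by simp
    from LIMSEQ_unique[OF lim1 this]
    show "(LINT x|lebesgue_on \<Omega>. D 0 (f x) * partial k \<eta> x) = - (LINT x|lebesgue_on \<Omega>. (D 1 (f x) *\<^sub>R g x) $ k * \<eta> x)"
      using integral_lebesgue_on_support[OF K(2) Km \<Omega>m, of "\<lambda>x. D 0 (f x) * w x"]
          integral_lebesgue_on_support[OF K(2) Km \<Omega>m, of "\<lambda>x. D 1 (f x) * g x $ k * \<eta> x"] K(3,4)
      by (simp add: w_def)
  qed
qed

text \<open>The difference of two weak gradients, multiplied by a cutoff, is orthogonal to every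
  shifted kernel, since kernel times cutoff is a test function. Hence all its mollifications vanish,
  while they converge to it in \<open>L2\<close>. A countable exhaustion by compact sets
  finishes.\<close>

lemma weak_gradient_unique:
  fixes f :: "real^'n \<Rightarrow> real"
  assumes "weak_gradient \<Omega> f g" "weak_gradient \<Omega> f g'" and \<Omega>: "open \<Omega>"
    and g: "\<And>k. (\<lambda>x. g x $ k) \<in> L2_loc \<Omega>" "\<And>k. (\<lambda>x. g' x $ k) \<in> L2_loc \<Omega>"
  shows "AE x in lebesgue_on \<Omega>. g x = g' x"
proof -
  have \<Omega>m: "\<Omega> \<in> sets lebesgue" using \<Omega> by auto
  have local: "AE x in lebesgue. x \<in> K \<longrightarrow> g x $ k = g' x $ k" if K: "compact K" "K \<subseteq> \<Omega>" for K k
  proof -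
    define h where "h x = g x $ k - g' x $ k" for x
    have h: "h \<in> L2_loc \<Omega>"
      unfolding L2_loc_def
    proof (intro CollectI conjI allI impI)
      show "h \<in> borel_measurable (lebesgue_on \<Omega>)"
        unfolding h_def[abs_def] using g by (intro borel_measurable_diff) (auto simp: L2_loc_def)
      fix K assume "compact K \<and> K \<subseteq> \<Omega>"
      then show "integrable (lebesgue_on K) (\<lambda>x. (h x)\<^sup>2)"
        unfolding h_def using L2_locD[OF g(1)] L2_locD[OF g(2)] by (intro integrable_diff_square) auto
    qed
    obtain \<zeta> where \<zeta>: "\<zeta> \<in> Cc_infinity \<Omega>" "\<And>x. x \<in> K \<Longrightarrow> \<zeta> x = 1"
      using smooth_cutoff[OF K(1) \<Omega> K(2)] by metis
    define F where "F x = (if x \<in> \<Omega> then h x * \<zeta> x else 0)" for x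
    have F: "F \<in> borel_measurable lebesgue" "integrable lebesgue (\<lambda>x. (F x)\<^sup>2)"
      unfolding F_def by (rule L2_loc_mult_test[OF h \<zeta>(1) \<Omega>m])+
    obtain K' where K': "compact K'" "\<And>x. x \<notin> K' \<Longrightarrow> \<zeta> x = 0"
      using \<zeta>(1) by (metis Cc_infinityE)
    obtain R where "K' \<subseteq> cball 0 R"
      using compact_imp_bounded[OF K'(1)] by (metis bounded_pos mem_cball_0 subsetI)
    then have FR: "F x = 0" if "x \<notin> cball 0 R" for x
    proof -
      have "x \<notin> K'" using that \<open>K' \<subseteq> cball 0 R\<close> by blast
      then show ?thesis using K'(2)[of x] by (simp add: F_def)
    qed
    obtain \<rho> :: "real \<Rightarrow> real^'n \<Rightarrow> real" where \<rho>: "\<And>e. e > 0 \<Longrightarrow> mollifier e (\<rho> e)"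
      using mollifier_exists by metis
    have zero: "conv r F x = 0" if r: "r \<in> Cc_infinity UNIV" for r x
    proof -
      define \<eta> where "\<eta> y = r (x - y) * \<zeta> y" for y
      have \<eta>: "\<eta> \<in> Cc_infinity \<Omega>"
        unfolding \<eta>_def by (rule Cc_infinity_mult[OF \<zeta>(1) smooth_reflect[OF Cc_infinity_smooth[OF r]]])
      have "conv r F x = (LINT y|lebesgue_on \<Omega>. g y $ k * \<eta> y - g' y $ k * \<eta> y)"
        unfolding F_def[abs_def] conv_restrict[OF \<Omega>m] by (intro Bochner_Integration.integral_cong) (auto simp: h_def \<eta>_def algebra_simps)
      also have "\<dots> = (LINT y|lebesgue_on \<Omega>. g y $ k * \<eta> y) - (LINT y|lebesgue_on \<Omega>. g' y $ k * \<eta> y)"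
        using L1_loc_test_integrable[OF L2_loc_L1_loc \<eta> \<Omega>m] g by (intro Bochner_Integration.integral_diff) auto
      also have "\<dots> = 0"
      proof -
        have "(LINT y|lebesgue_on \<Omega>. f y * partial k \<eta> y) = - (LINT y|lebesgue_on \<Omega>. g y $ k * \<eta> y)"
          "(LINT y|lebesgue_on \<Omega>. f y * partial k \<eta> y) = - (LINT y|lebesgue_on \<Omega>. g' y $ k * \<eta> y)"
          using assms(1,2) \<eta> unfolding weak_gradient_def by blast+
        then show ?thesis by simp
      qed
      finally show ?thesis .
    qed
    have small: "(LINT x|lebesgue. (F x)\<^sup>2) \<le> 0 + \<epsilon>" if "\<epsilon> > 0" for \<epsilon>
    proof (rule mollifier_L2_convergence[OF F FR that])
      fix t assume t: "t > 0" "\<And>e \<rho>. e < t \<Longrightarrow> mollifier e \<rho> \<Longrightarrow>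
        integrable lebesgue (\<lambda>x. (conv \<rho> F x - F x)\<^sup>2) \<and> (LINT x|lebesgue. (conv \<rho> F x - F x)\<^sup>2) < \<epsilon>"
      show ?thesis
        using t(2)[of "t/2" "\<rho> (t/2)"] t(1) \<rho>[of "t/2"] zero[OF mollifierD(1)[OF \<rho>[of "t/2"]]] by simp
    qed
    have "(LINT x|lebesgue. (F x)\<^sup>2) \<le> 0"
      by (rule field_le_epsilon) (rule small)
    then have "(LINT x|lebesgue. (F x)\<^sup>2) = 0"
      by (intro antisym) auto
    then have "AE x in lebesgue. (F x)\<^sup>2 = 0"
      using F(2) by (subst (asm) integral_nonneg_eq_0_iff_AE) auto
    then show ?thesis
    proof eventually_elim
      case (elim x)
      then show ?case using \<zeta>(2)[of x] K by (auto simp: F_def h_def)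
    qed
  qed
  obtain A :: "nat \<Rightarrow> (real^'n) set" where A: "\<And>n. compact (A n)" "\<And>n. A n \<subseteq> \<Omega>" "\<Union> (range A) = \<Omega>"
    using open_Union_compact_subsets[OF \<Omega>] by metis
  have "AE x in lebesgue. \<forall>n k. x \<in> A n \<longrightarrow> g x $ k = g' x $ k"
    unfolding AE_all_countable using local A by auto
  then have "AE x in lebesgue. x \<in> \<Omega> \<longrightarrow> g x = g' x"
  proof eventually_elim
    case (elim x)
    then show ?case using A(3) by (auto simp: vec_eq_iff)
  qed
  then show ?thesis
    using \<Omega>m by (simp add: AE_restrict_space_iff)
qed

subsection \<open>The energy\<close>

lemma energy_density_eq: "energy_density C g x = g x \<bullet> (C x *v g x)"
  by (simp add: energy_density_def inner_vec_def matrix_vector_mult_def sum_distrib_left algebra_simps)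

text \<open>What \<open>coefficients\<close> yields at almost every single point. The upper bound
  \<open>B\<close> is common to all points, whereas positivity carries no common lower bound, so
  that degeneracy at the boundary remains allowed.\<close>

definition good_matrix :: "real \<Rightarrow> real^'n^'n \<Rightarrow> bool"
  where "good_matrix B A \<longleftrightarrow> mat_pos A \<and> (\<forall>\<xi>. \<xi> \<bullet> (A *v \<xi>) \<le> B * (norm \<xi>)\<^sup>2) \<and> (\<forall>\<xi> \<eta>. \<xi> \<bullet> (A *v \<eta>) = \<eta> \<bullet> (A *v \<xi>))"

lemma quadratic_nonneg: "good_matrix B A \<Longrightarrow> 0 \<le> \<xi> \<bullet> (A *v \<xi>)"
  unfolding good_matrix_def mat_pos_def by (cases "\<xi> = 0") (auto simp: less_imp_le)

lemma quadratic_add: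
  assumes "good_matrix B A"
  shows "(\<xi> + \<eta>) \<bullet> (A *v (\<xi> + \<eta>)) = \<xi> \<bullet> (A *v \<xi>) + 2 * (\<xi> \<bullet> (A *v \<eta>)) + \<eta> \<bullet> (A *v \<eta>)"
  using assms by (simp add: good_matrix_def matrix_vector_right_distrib inner_add_left inner_add_right)

text \<open>Nonnegativity of the form at \<open>sqrt t *\<^sub>R \<xi>\<close> plus or minus
  \<open>(1 / sqrt t) *\<^sub>R \<eta>\<close>. The weight \<open>t\<close> is chosen small when
  energies of nearby fields are compared.\<close>

lemma quadratic_mixed_le:
  assumes A: "good_matrix B A" and "t > 0"
  shows "\<bar>2 * (\<xi> \<bullet> (A *v \<eta>))\<bar> \<le> t * (\<xi> \<bullet> (A *v \<xi>)) + (\<eta> \<bullet> (A *v \<eta>)) / t"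
proof -
  have "0 \<le> t * (\<xi> \<bullet> (A *v \<xi>)) + 2 * r * (\<xi> \<bullet> (A *v \<eta>)) + (\<eta> \<bullet> (A *v \<eta>)) / t" if "r = 1 \<or> r = -1" for r
  proof -
    have "0 \<le> (sqrt t *\<^sub>R \<xi> + (r / sqrt t) *\<^sub>R \<eta>) \<bullet> (A *v (sqrt t *\<^sub>R \<xi> + (r / sqrt t) *\<^sub>R \<eta>))"
      by (rule quadratic_nonneg[OF A])
    also have "\<dots> = t * (\<xi> \<bullet> (A *v \<xi>)) + 2 * r * (\<xi> \<bullet> (A *v \<eta>)) + (\<eta> \<bullet> (A *v \<eta>)) / t"
      using that \<open>t > 0\<close>
      by (subst quadratic_add[OF A]) (auto simp: matrix_vector_mult_scaleR field_simps simp flip: power2_eq_square)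
    finally show ?thesis .
  qed
  from this[of 1] this[of "-1"] show ?thesis by (simp add: abs_le_iff)
qed

lemma quadratic_add_le:
  assumes "good_matrix B A"
  shows "(\<xi> + \<eta>) \<bullet> (A *v (\<xi> + \<eta>)) \<le> 2 * (\<xi> \<bullet> (A *v \<xi>)) + 2 * (\<eta> \<bullet> (A *v \<eta>))"
  using quadratic_mixed_le[OF assms, of 1 \<xi> \<eta>] by (simp add: quadratic_add[OF assms])

lemma quadratic_diff_le:
  assumes A: "good_matrix B A" and "t > 0"
  shows "\<bar>\<xi> \<bullet> (A *v \<xi>) - \<eta> \<bullet> (A *v \<eta>)\<bar> \<le> t * (\<eta> \<bullet> (A *v \<eta>)) + (1 + 1 / t) * ((\<xi> - \<eta>) \<bullet> (A *v (\<xi> - \<eta>)))"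
proof -
  have "\<xi> \<bullet> (A *v \<xi>) = \<eta> \<bullet> (A *v \<eta>) + 2 * (\<eta> \<bullet> (A *v (\<xi> - \<eta>))) + (\<xi> - \<eta>) \<bullet> (A *v (\<xi> - \<eta>))"
    using quadratic_add[OF A, of \<eta> "\<xi> - \<eta>"] by simp
  moreover have "(1 + 1 / t) * ((\<xi> - \<eta>) \<bullet> (A *v (\<xi> - \<eta>))) = (\<xi> - \<eta>) \<bullet> (A *v (\<xi> - \<eta>)) + ((\<xi> - \<eta>) \<bullet> (A *v (\<xi> - \<eta>))) / t"
    by (simp only: distrib_right) simp
  ultimately show ?thesis
    using quadratic_mixed_le[OF assms, of \<eta> "\<xi> - \<eta>"] quadratic_nonneg[OF A, of "\<xi> - \<eta>"]
    by linarith
qed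

lemma inner_mat: "\<xi> \<bullet> (mat c *v \<xi>) = c * (norm \<xi>)\<^sup>2" for \<xi> :: "real^'n"
proof -
  have "mat c *v \<xi> = c *\<^sub>R \<xi>"
    by (simp add: vec_eq_iff matrix_vector_mult_def mat_def if_distrib[of "\<lambda>z. z * _"] cong: if_cong)
  then show ?thesis by (simp add: power2_norm_eq_inner)
qed

text \<open>Compactness of the unit sphere. The constant depends on the matrix and is used at one
  point \<open>x\<close> at a time, to turn smallness of the quadratic form into smallness of the
  vector.\<close>

lemma mat_pos_lower_bound:
  assumes "mat_pos A"
  obtains c where "c > 0" "\<And>\<xi>. c * (norm \<xi>)\<^sup>2 \<le> \<xi> \<bullet> (A *v \<xi>)"
proof -
  have "continuous_on (sphere 0 1) ((*v) A)"
    by (rule linear_continuous_on[OF matrix_vector_mul_bounded_linear])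
  then have "continuous_on (sphere 0 1) (\<lambda>\<xi>. \<xi> \<bullet> (A *v \<xi>))"
    by (rule continuous_on_inner[OF continuous_on_id])
  then have "\<exists>z\<in>sphere 0 1. \<forall>\<xi>\<in>sphere 0 1. z \<bullet> (A *v z) \<le> \<xi> \<bullet> (A *v \<xi>)"
    by (rule continuous_attains_inf[OF compact_sphere, rotated]) simp
  then obtain z where z: "z \<in> sphere 0 1" "\<And>\<xi>. \<xi> \<in> sphere 0 1 \<Longrightarrow> z \<bullet> (A *v z) \<le> \<xi> \<bullet> (A *v \<xi>)"
    by blast
  show thesis
  proof
    have "z \<noteq> 0" using z(1) by auto
    then show "z \<bullet> (A *v z) > 0" using assms by (simp add: mat_pos_def)
    fix \<xi>
    show "z \<bullet> (A *v z) * (norm \<xi>)\<^sup>2 \<le> \<xi> \<bullet> (A *v \<xi>)"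
    proof (cases "\<xi> = 0")
      case False
      have "z \<bullet> (A *v z) \<le> (inverse (norm \<xi>) *\<^sub>R \<xi>) \<bullet> (A *v (inverse (norm \<xi>) *\<^sub>R \<xi>))"
        using False by (intro z(2)) simp
      also have "\<dots> = (\<xi> \<bullet> (A *v \<xi>)) / (norm \<xi>)\<^sup>2"
        by (simp add: matrix_vector_mult_scaleR power2_eq_square field_simps)
      finally show ?thesis using False by (simp add: field_simps)
    qed simp
  qed
qed

lemma coefficients_good:
  fixes C :: "real^'n \<Rightarrow> real^'n^'n"
  assumes "coefficients \<Omega> C"
  obtains B where "B > 0" "AE x in lebesgue_on \<Omega>. good_matrix B (C x)"
proof -
  have "\<forall>k l. \<exists>B. AE x in lebesgue_on \<Omega>. \<bar>C x $ k $ l\<bar> \<le> B"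
    using assms by (simp add: coefficients_def)
  then obtain b where b: "\<And>k l. AE x in lebesgue_on \<Omega>. \<bar>C x $ k $ l\<bar> \<le> b k l"
    by metis
  define B where "B = (\<Sum>k\<in>UNIV. \<Sum>l\<in>UNIV. \<bar>b k l\<bar>) + 1"
  have "B > 0" unfolding B_def by (intro add_nonneg_pos sum_nonneg) auto
  have "AE x in lebesgue_on \<Omega>. \<forall>k\<in>UNIV. \<forall>l\<in>UNIV. \<bar>C x $ k $ l\<bar> \<le> b k l"
    by (intro AE_finite_allI b) auto
  moreover have "AE x in lebesgue_on \<Omega>. \<forall>k l. C x $ k $ l = C x $ l $ k" "AE x in lebesgue_on \<Omega>. mat_pos (C x)"
    using assms by (auto simp: coefficients_def)
  ultimately have "AE x in lebesgue_on \<Omega>. good_matrix B (C x)"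
  proof eventually_elim
    case (elim x)
    have "\<xi> \<bullet> (C x *v \<xi>) \<le> B * (norm \<xi>)\<^sup>2" for \<xi>
    proof -
      have "\<xi> \<bullet> (C x *v \<xi>) = (\<Sum>k\<in>UNIV. \<Sum>l\<in>UNIV. C x $ k $ l * \<xi> $ k * \<xi> $ l)"
        by (simp add: inner_vec_def matrix_vector_mult_def sum_distrib_left algebra_simps)
      also have "\<dots> \<le> (\<Sum>k\<in>UNIV. \<Sum>l\<in>UNIV. \<bar>b k l\<bar> * (norm \<xi>)\<^sup>2)"
      proof (intro sum_mono)
        fix k l
        have "C x $ k $ l * \<xi> $ k * \<xi> $ l \<le> \<bar>C x $ k $ l\<bar> * (\<bar>\<xi> $ k\<bar> * \<bar>\<xi> $ l\<bar>)"
          by (metis abs_ge_self abs_mult mult.assoc)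
        also have "\<dots> \<le> \<bar>b k l\<bar> * (norm \<xi> * norm \<xi>)"
        proof (intro mult_mono component_le_norm_cart)
          show "\<bar>C x $ k $ l\<bar> \<le> \<bar>b k l\<bar>"
            using elim(1) abs_ge_self[of "b k l"] by (meson UNIV_I order_trans)
        qed auto
        finally show "C x $ k $ l * \<xi> $ k * \<xi> $ l \<le> \<bar>b k l\<bar> * (norm \<xi>)\<^sup>2"
          by (simp add: power2_eq_square)
      qed
      also have "\<dots> \<le> B * (norm \<xi>)\<^sup>2"
        by (simp add: B_def distrib_right sum_distrib_right)
      finally show ?thesis .
    qed
    moreover have "\<xi> \<bullet> (C x *v \<eta>) = \<eta> \<bullet> (C x *v \<xi>)" for \<xi> \<eta>
    proof -
      have "transpose (C x) = C x" using elim(2) by (simp add: transpose_def vec_eq_iff)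
      then show ?thesis by (metis dot_lmul_matrix inner_commute transpose_matrix_vector)
    qed
    ultimately show ?case using elim by (simp add: good_matrix_def)
  qed
  with \<open>B > 0\<close> show thesis using that by blast
qed

section \<open>Energies of vector fields\<close>

definition energy :: "(real^'n) set \<Rightarrow> (real^'n \<Rightarrow> real^'n^'n) \<Rightarrow> (real^'n \<Rightarrow> real^'n) \<Rightarrow> real"
  where "energy \<Omega> C g = (LINT x|lebesgue_on \<Omega>. energy_density C g x)"

definition finite_energy :: "(real^'n) set \<Rightarrow> (real^'n \<Rightarrow> real^'n^'n) \<Rightarrow> (real^'n \<Rightarrow> real^'n) \<Rightarrow> bool"
  where "finite_energy \<Omega> C g \<longleftrightarrow> (\<forall>k. (\<lambda>x. g x $ k) \<in> borel_measurable (lebesgue_on \<Omega>))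
     \<and> integrable (lebesgue_on \<Omega>) (energy_density C g)"

locale elliptic =
  fixes \<Omega> :: "(real^'n) set" and C :: "real^'n \<Rightarrow> real^'n^'n" and B :: real
  assumes open_\<Omega>: "open \<Omega>" and C: "coefficients \<Omega> C" and B_pos: "B > 0"
    and good: "AE x in lebesgue_on \<Omega>. good_matrix B (C x)"
begin

lemma \<Omega>_sets: "\<Omega> \<in> sets lebesgue" using open_\<Omega> by auto

lemma energy_density_measurable:
  assumes "\<And>k. (\<lambda>x. g x $ k) \<in> borel_measurable (lebesgue_on \<Omega>)"
  shows "energy_density C g \<in> borel_measurable (lebesgue_on \<Omega>)"
  unfolding energy_density_def[abs_def] using C assms
  by (intro borel_measurable_sum borel_measurable_times) (auto simp: coefficients_def)

lemma energy_density_nonneg: "AE x in lebesgue_on \<Omega>. 0 \<le> energy_density C g x"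
  using good by eventually_elim (simp add: energy_density_eq quadratic_nonneg)

lemma energy_nonneg: "0 \<le> energy \<Omega> C g"
  unfolding energy_def by (rule integral_nonneg_AE[OF energy_density_nonneg])

lemma finite_energyI:
  assumes "\<And>k. (\<lambda>x. g x $ k) \<in> borel_measurable (lebesgue_on \<Omega>)" "integrable (lebesgue_on \<Omega>) h"
    "AE x in lebesgue_on \<Omega>. energy_density C g x \<le> h x"
  shows "finite_energy \<Omega> C g" "energy \<Omega> C g \<le> (LINT x|lebesgue_on \<Omega>. h x)"
proof -
  have i: "integrable (lebesgue_on \<Omega>) (energy_density C g)"
  proof (rule Bochner_Integration.integrable_bound[OF assms(2)])
    show "AE x in lebesgue_on \<Omega>. norm (energy_density C g x) \<le> norm (h x)"
      using assms(3) energy_density_nonneg[of g] by eventually_elim simp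
  qed (rule energy_density_measurable[OF assms(1)])
  then show "finite_energy \<Omega> C g" using assms(1) by (simp add: finite_energy_def)
  show "energy \<Omega> C g \<le> (LINT x|lebesgue_on \<Omega>. h x)"
    unfolding energy_def using i assms(2,3) by (rule integral_mono_AE)
qed

lemma
  assumes "finite_energy \<Omega> C f" "finite_energy \<Omega> C g"
  shows finite_energy_add: "finite_energy \<Omega> C (\<lambda>x. f x + g x)"
    and energy_add_le: "energy \<Omega> C (\<lambda>x. f x + g x) \<le> 2 * energy \<Omega> C f + 2 * energy \<Omega> C g"
proof -
  have 1: "(\<lambda>x. (f x + g x) $ k) \<in> borel_measurable (lebesgue_on \<Omega>)" for k
    unfolding vector_add_component using assms
    by (intro borel_measurable_add) (simp_all add: finite_energy_def)
  have 2: "integrable (lebesgue_on \<Omega>) (\<lambda>x. 2 * energy_density C f x + 2 * energy_density C g x)"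
    using assms by (auto simp: finite_energy_def)
  have 3: "AE x in lebesgue_on \<Omega>. energy_density C (\<lambda>x. f x + g x) x \<le> 2 * energy_density C f x + 2 * energy_density C g x"
    using good by eventually_elim (simp add: energy_density_eq quadratic_add_le)
  from finite_energyI[OF 1 2 3]
  show "finite_energy \<Omega> C (\<lambda>x. f x + g x)" "energy \<Omega> C (\<lambda>x. f x + g x) \<le> 2 * energy \<Omega> C f + 2 * energy \<Omega> C g"
    using assms by (auto simp: energy_def finite_energy_def)
qed

lemma energy_density_uminus: "energy_density C (\<lambda>x. - g x) x = energy_density C g x"
  by (simp add: energy_density_def)

lemma finite_energy_uminus: "finite_energy \<Omega> C g \<Longrightarrow> finite_energy \<Omega> C (\<lambda>x. - g x)"
  by (auto simp: finite_energy_def energy_density_uminus[abs_def] cong: Bochner_Integration.integrable_cong)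

lemma
  assumes "finite_energy \<Omega> C f" "finite_energy \<Omega> C g"
  shows finite_energy_diff: "finite_energy \<Omega> C (\<lambda>x. f x - g x)"
    and energy_diff_le: "energy \<Omega> C (\<lambda>x. f x - g x) \<le> 2 * energy \<Omega> C f + 2 * energy \<Omega> C g"
  using finite_energy_add[OF assms(1) finite_energy_uminus[OF assms(2)]]
    energy_add_le[OF assms(1) finite_energy_uminus[OF assms(2)]]
  by (simp_all add: energy_def energy_density_uminus)

text \<open>A substitute for the triangle inequality of the seminorm that avoids square roots: for
  small \<open>t\<close> it trades a small multiple of the energy of \<open>g\<close> for a large
  multiple of the energy of the difference.\<close>

lemma energy_diff_abs_le:
  assumes "finite_energy \<Omega> C f" "finite_energy \<Omega> C g" "t > 0"
  shows "\<bar>energy \<Omega> C f - energy \<Omega> C g\<bar> \<le> t * energy \<Omega> C g + (1 + 1 / t) * energy \<Omega> C (\<lambda>x. f x - g x)"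
proof -
  have i: "integrable (lebesgue_on \<Omega>) (energy_density C f)" "integrable (lebesgue_on \<Omega>) (energy_density C g)"
    "integrable (lebesgue_on \<Omega>) (energy_density C (\<lambda>x. f x - g x))"
    using assms finite_energy_diff[OF assms(1,2)] by (auto simp: finite_energy_def)
  have "\<bar>energy \<Omega> C f - energy \<Omega> C g\<bar> = \<bar>LINT x|lebesgue_on \<Omega>. energy_density C f x - energy_density C g x\<bar>"
    using i by (simp add: energy_def)
  also have "\<dots> \<le> (LINT x|lebesgue_on \<Omega>. \<bar>energy_density C f x - energy_density C g x\<bar>)"
    by simp
  also have "\<dots> \<le> (LINT x|lebesgue_on \<Omega>. t * energy_density C g x + (1 + 1 / t) * energy_density C (\<lambda>x. f x - g x) x)"
  proof (rule integral_mono_AE)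
    show "AE x in lebesgue_on \<Omega>. \<bar>energy_density C f x - energy_density C g x\<bar>
        \<le> t * energy_density C g x + (1 + 1 / t) * energy_density C (\<lambda>x. f x - g x) x"
      using good by eventually_elim (use quadratic_diff_le[OF _ \<open>t > 0\<close>] in \<open>simp add: energy_density_eq\<close>)
  qed (use i in auto)
  also have "\<dots> = t * energy \<Omega> C g + (1 + 1 / t) * energy \<Omega> C (\<lambda>x. f x - g x)"
    using i by (simp add: energy_def)
  finally show ?thesis .
qed

lemma energy_tendsto:
  assumes "\<And>n. finite_energy \<Omega> C (f n)" "finite_energy \<Omega> C g"
    and lim: "(\<lambda>n. energy \<Omega> C (\<lambda>x. f n x - g x)) \<longlonglongrightarrow> 0"
  shows "(\<lambda>n. energy \<Omega> C (f n)) \<longlonglongrightarrow> energy \<Omega> C g"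
proof (rule LIMSEQ_I)
  fix r :: real assume "r > 0"
  define t where "t = r / (2 * (energy \<Omega> C g + 1))"
  have e: "energy \<Omega> C g \<ge> 0" by (rule energy_nonneg)
  have t: "t > 0" "t * energy \<Omega> C g < r / 2 + r / 4"
  proof -
    show "t > 0" using e \<open>r > 0\<close> by (simp add: t_def)
    have "t * energy \<Omega> C g \<le> r / 2" using e \<open>r > 0\<close> by (simp add: t_def field_simps)
    then show "t * energy \<Omega> C g < r / 2 + r / 4" using \<open>r > 0\<close> by simp
  qed
  have "(\<lambda>n. (1 + 1 / t) * energy \<Omega> C (\<lambda>x. f n x - g x)) \<longlonglongrightarrow> (1 + 1 / t) * 0"
    by (intro tendsto_intros lim)
  then have "eventually (\<lambda>n. (1 + 1 / t) * energy \<Omega> C (\<lambda>x. f n x - g x) < r / 4) sequentially"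
    using \<open>r > 0\<close> by (intro order_tendstoD(2)) auto
  then obtain N where N: "\<And>n. n \<ge> N \<Longrightarrow> (1 + 1 / t) * energy \<Omega> C (\<lambda>x. f n x - g x) < r / 4"
    by (auto simp: eventually_sequentially)
  show "\<exists>N. \<forall>n\<ge>N. norm (energy \<Omega> C (f n) - energy \<Omega> C g) < r"
  proof (intro exI[of _ N] allI impI)
    fix n assume "N \<le> n"
    then show "norm (energy \<Omega> C (f n) - energy \<Omega> C g) < r"
      using energy_diff_abs_le[OF assms(1,2) t(1), of n] N[of n] t(2) unfolding real_norm_def by linarith
  qed
qed

lemma finite_energy_L2:
  assumes m: "\<And>k. (\<lambda>x. g x $ k) \<in> borel_measurable (lebesgue_on \<Omega>)"
    and i: "\<And>k. integrable (lebesgue_on \<Omega>) (\<lambda>x. (g x $ k)\<^sup>2)"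
  shows "finite_energy \<Omega> C g"
    and "energy \<Omega> C g \<le> B * (\<Sum>k\<in>UNIV. LINT x|lebesgue_on \<Omega>. (g x $ k)\<^sup>2)"
proof -
  have n: "(norm (g x))\<^sup>2 = (\<Sum>k\<in>UNIV. (g x $ k)\<^sup>2)" for x
    by (simp add: norm_vec_def L2_set_def sum_nonneg)
  have *: "AE x in lebesgue_on \<Omega>. energy_density C g x \<le> B * (\<Sum>k\<in>UNIV. (g x $ k)\<^sup>2)"
    using good by eventually_elim (simp add: energy_density_eq good_matrix_def flip: n)
  have int: "integrable (lebesgue_on \<Omega>) (\<lambda>x. B * (\<Sum>k\<in>UNIV. (g x $ k)\<^sup>2))"
    using i by auto
  show "finite_energy \<Omega> C g" by (rule finite_energyI(1)[OF m int *])
  show "energy \<Omega> C g \<le> B * (\<Sum>k\<in>UNIV. LINT x|lebesgue_on \<Omega>. (g x $ k)\<^sup>2)"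
    using finite_energyI(2)[OF m int *] i by simp
qed

lemma finite_energy_grad:
  assumes "u \<in> Cc_infinity A"
  shows "finite_energy \<Omega> C (grad u)"
proof (rule finite_energy_L2(1))
  show "(\<lambda>x. grad u x $ k) \<in> borel_measurable (lebesgue_on \<Omega>)" for k
    using smooth_lebesgue_on[OF smooth_partial[OF Cc_infinity_smooth[OF assms]]] by simp
  show "integrable (lebesgue_on \<Omega>) (\<lambda>x. (grad u x $ k)\<^sup>2)" for k
    using Cc_infinity_integrable_lebesgue_on[OF Cc_infinity_square[OF Cc_infinity_partial[OF assms]] \<Omega>_sets] by simp
qed

lemma h0_eq_energy:
  assumes u: "u \<in> Cc_infinity A"
  shows "h0 \<Omega> C u = energy \<Omega> C (grad u)"
proof -
  have i: "integrable (lebesgue_on \<Omega>) (\<lambda>x. C x $ k $ l * partial k u x * partial l u x)" for k l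
  proof -
    obtain b where b: "AE x in lebesgue_on \<Omega>. \<bar>C x $ k $ l\<bar> \<le> b"
      using C unfolding coefficients_def by blast
    have m: "(\<lambda>x. C x $ k $ l) \<in> borel_measurable (lebesgue_on \<Omega>)"
      using C by (simp add: coefficients_def)
    have p: "integrable (lebesgue_on \<Omega>) (\<lambda>x. partial k u x * partial l u x)"
      by (intro Cc_infinity_integrable_lebesgue_on[OF _ \<Omega>_sets, of _ A] Cc_infinity_mult Cc_infinity_partial u
          smooth_partial Cc_infinity_smooth[OF u])
    show ?thesis
    proof (rule Bochner_Integration.integrable_bound[OF integrable_mult_right[OF p, of b]])
      show "(\<lambda>x. C x $ k $ l * partial k u x * partial l u x) \<in> borel_measurable (lebesgue_on \<Omega>)"
        by (intro borel_measurable_times m smooth_lebesgue_on smooth_partial Cc_infinity_smooth[OF u])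
      show "AE x in lebesgue_on \<Omega>. norm (C x $ k $ l * partial k u x * partial l u x) \<le> norm (b * (partial k u x * partial l u x))"
        using b by eventually_elim (auto simp: abs_mult mult.assoc intro!: mult_right_mono)
    qed
  qed
  show ?thesis
    unfolding h0_def energy_def energy_density_def grad_nth
    using i by (simp add: Bochner_Integration.integral_sum)
qed

lemma grad_diff:
  assumes "u \<in> Cc_infinity A" "v \<in> Cc_infinity A"
  shows "grad (\<lambda>x. u x - v x) = (\<lambda>x. grad u x - grad v x)"
  using assms by (auto simp: vec_eq_iff fun_eq_iff partial_diff smooth_differentiable Cc_infinity_smooth)

text \<open>On a compact subset of \<Omega> the coefficients have a positive lower bound, which
  divides the energy density. The constant is obtained before the fields, so that it can be used
  along a sequence.\<close>

lemma local_ellipticity: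
  assumes K: "compact K" "K \<subseteq> \<Omega>" and g: "finite_energy \<Omega> C g"
  obtains c where "c > 0"
    "\<And>g. finite_energy \<Omega> C g \<Longrightarrow> integrable (lebesgue_on K) (\<lambda>x. (g x $ k)\<^sup>2)"
    "\<And>g. finite_energy \<Omega> C g \<Longrightarrow> (LINT x|lebesgue_on K. (g x $ k)\<^sup>2) \<le> c * energy \<Omega> C g"
proof -
  obtain c where c: "c > 0" "AE x in lebesgue_on K. mat_le (mat c) (C x)"
    using C K by (auto simp: coefficients_def)
  have Km: "K \<in> sets lebesgue" using compact_lebesgue K by blast
  have e: "AE x in lebesgue_on K. (g x $ k)\<^sup>2 \<le> inverse c * energy_density C g x" for g
    using c(2)
  proof eventually_elim
    case (elim x)
    have "c * (norm (g x))\<^sup>2 \<le> energy_density C g x"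
      using elim by (auto simp: mat_le_def energy_density_eq inner_mat)
    moreover have "(g x $ k)\<^sup>2 \<le> (norm (g x))\<^sup>2"
      using component_le_norm_cart[of "g x" k] by (simp add: abs_le_square_iff[of _ "norm (g x)", simplified])
    ultimately have "c * (g x $ k)\<^sup>2 \<le> energy_density C g x"
      using c(1) by (meson less_imp_le mult_left_mono order_trans)
    then show ?case using c(1) by (simp add: field_simps)
  qed
  have i: "integrable (lebesgue_on K) (energy_density C g)" if "finite_energy \<Omega> C g" for g
    using that K Km \<Omega>_sets by (auto simp: finite_energy_def intro: integrable_lebesgue_on_subset)
  show thesis
  proof (rule that[of "inverse c"])
    show "inverse c > 0" using c by simp
    fix g assume g: "finite_energy \<Omega> C g"
    have m: "(\<lambda>x. g x $ k) \<in> borel_measurable (lebesgue_on K)"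
      using g K(2) measurable_restrict_mono unfolding finite_energy_def by blast
    show int: "integrable (lebesgue_on K) (\<lambda>x. (g x $ k)\<^sup>2)"
    proof (rule Bochner_Integration.integrable_bound[OF integrable_mult_right[OF i[OF g], of "inverse c"]])
      show "AE x in lebesgue_on K. norm ((g x $ k)\<^sup>2) \<le> norm (inverse c * energy_density C g x)"
        using e[of g] by eventually_elim (auto intro: order_trans[OF _ abs_ge_self])
    qed (use m in simp)
    have "(LINT x|lebesgue_on K. (g x $ k)\<^sup>2) \<le> (LINT x|lebesgue_on K. inverse c * energy_density C g x)"
      using int i[OF g] e by (intro integral_mono_AE) auto
    also have "\<dots> = inverse c * (LINT x|lebesgue_on K. energy_density C g x)" by simp
    also have "\<dots> \<le> inverse c * energy \<Omega> C g"
      unfolding energy_def using c(1) g energy_density_nonneg K Km \<Omega>_sets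
      by (intro mult_left_mono integral_mono_lebesgue_on_AE) (auto simp: finite_energy_def)
    finally show "(LINT x|lebesgue_on K. (g x $ k)\<^sup>2) \<le> inverse c * energy \<Omega> C g" .
  qed
qed

lemma finite_energy_L2_loc:
  assumes "finite_energy \<Omega> C g"
  shows "(\<lambda>x. g x $ k) \<in> L2_loc \<Omega>"
  unfolding L2_loc_def
proof (intro CollectI conjI allI impI)
  show "(\<lambda>x. g x $ k) \<in> borel_measurable (lebesgue_on \<Omega>)"
    using assms by (simp add: finite_energy_def)
  fix K assume "compact K \<and> K \<subseteq> \<Omega>"
  then show "integrable (lebesgue_on K) (\<lambda>x. (g x $ k)\<^sup>2)"
    using local_ellipticity[OF _ _ assms, of K k] assms by blast
qed

end

section \<open>Completeness, closability and the two forms\<close>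

lemma summable_diff_convergent:
  fixes a :: "nat \<Rightarrow> real"
  assumes "summable (\<lambda>n. a (Suc n) - a n)"
  shows "convergent a"
proof -
  have "(\<lambda>n. \<Sum>i<n. a (Suc i) - a i) \<longlonglongrightarrow> suminf (\<lambda>n. a (Suc n) - a n)"
    using assms by (rule summable_LIMSEQ)
  then have "(\<lambda>n. a n - a 0) \<longlonglongrightarrow> suminf (\<lambda>n. a (Suc n) - a n)"
    by (simp add: sum_lessThan_telescope)
  then have "convergent (\<lambda>n. a n - a 0)"
    by (auto simp: convergent_def)
  then show ?thesis by (simp add: convergent_diff_const_right_iff)
qed

context elliptic
begin

text \<open>The proof of the Riesz-Fischer theorem for a norm whose weight \<open>C x\<close> varies
  and may degenerate: a rapidly convergent subsequence converges at almost every point, by the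
  ellipticity constant of that point alone, and Fatou's lemma gives convergence in energy. Applied
  to gradients of test functions it produces the candidate gradient for an element of the domain of
  \<open>h_D\<close>.\<close>

lemma energy_limit_exists:
  fixes v :: "nat \<Rightarrow> real^'n \<Rightarrow> real^'n"
  assumes v: "\<And>n. finite_energy \<Omega> C (v n)"
    and cauchy: "\<And>\<epsilon>. \<epsilon> > 0 \<Longrightarrow> \<exists>N. \<forall>m\<ge>N. \<forall>n\<ge>N. energy \<Omega> C (\<lambda>x. v m x - v n x) < \<epsilon>"
  obtains g where "finite_energy \<Omega> C g" "(\<lambda>n. energy \<Omega> C (\<lambda>x. v n x - g x)) \<longlonglongrightarrow> 0"
proof -
  let ?M = "lebesgue_on \<Omega>"
  \<comment> \<open>With increments of energy below 4^(-k), the weights 2^k still leave a summable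
    series. So at almost every point \<open>D k x\<close> is at most S 2^(-k), and the increments of
    the subsequence are dominated by a geometric series of ratio \<open>sqrt (1/2)\<close>.\<close>
  have "\<exists>N. \<forall>m\<ge>N. \<forall>n\<ge>N. energy \<Omega> C (\<lambda>x. v m x - v n x) < (1/4)^k" for k :: nat
    by (rule cauchy) simp
  then obtain N where N: "\<And>k m n. m \<ge> N k \<Longrightarrow> n \<ge> N k \<Longrightarrow> energy \<Omega> C (\<lambda>x. v m x - v n x) < (1/4)^k"
    by metis
  \<comment> \<open>The maximum makes the index of stage k admissible for all earlier tolerances as
    well: the increments need it for two consecutive stages, the Fatou step for all later
    ones.\<close>
  define r where "r k = Max (N ` {..k})" for k
  have r: "N i \<le> r k" if "i \<le> k" for i k
    unfolding r_def using that by (intro Max_ge) auto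
  have fd: "finite_energy \<Omega> C (\<lambda>x. v m x - v n x)" for m n
    by (intro finite_energy_diff v)
  define D where "D k = energy_density C (\<lambda>x. v (r (Suc k)) x - v (r k) x)" for k
  have D_int: "integrable ?M (D k)" for k
    using fd by (simp add: D_def finite_energy_def)
  have D_m [measurable]: "D k \<in> borel_measurable ?M" for k using D_int by auto
  have D_nonneg: "AE x in ?M. \<forall>k. 0 \<le> D k x"
    unfolding AE_all_countable D_def using energy_density_nonneg by blast
  have "(\<integral>\<^sup>+x. (\<Sum>k. ennreal (2^k * D k x)) \<partial>?M) = (\<Sum>k. \<integral>\<^sup>+x. ennreal (2^k * D k x) \<partial>?M)"
    by (rule nn_integral_suminf) measurable
  also have "\<dots> \<le> (\<Sum>k. ennreal ((1/2)^k))"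
  proof (intro suminf_le allI summableI)
    fix k
    have "(\<integral>\<^sup>+x. ennreal (2^k * D k x) \<partial>?M) = ennreal (LINT x|?M. 2^k * D k x)"
    proof (rule nn_integral_eq_integral)
      show "AE x in ?M. 0 \<le> 2 ^ k * D k x"
        using D_nonneg by eventually_elim simp
    qed (use D_int in simp)
    also have "(LINT x|?M. 2^k * D k x) \<le> 2^k * (1/4)^k"
      using N[of k "r (Suc k)" "r k"] r[of k k] r[of k "Suc k"]
      by (simp add: D_def energy_def)
    also have "2^k * (1/4)^k = (1/2::real)^k"
      by (simp flip: power_mult_distrib)
    finally show "(\<integral>\<^sup>+x. ennreal (2^k * D k x) \<partial>?M) \<le> ennreal ((1/2)^k)"
      by (simp add: ennreal_leI)
  qed
  also have "\<dots> = ennreal (\<Sum>k. (1/2)^k)"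
    by (intro suminf_ennreal2) auto
  also have "\<dots> < \<infinity>" by simp
  finally have "(\<integral>\<^sup>+x. (\<Sum>k. ennreal (2^k * D k x)) \<partial>?M) \<noteq> \<infinity>" by simp
  then have fin: "AE x in ?M. (\<Sum>k. ennreal (2^k * D k x)) \<noteq> \<infinity>"
    by (intro nn_integral_noteq_infinite) auto
  define g where "g x = (\<chi> k. lim (\<lambda>j. v (r j) x $ k))" for x
  have vm: "(\<lambda>x. v n x $ k) \<in> borel_measurable ?M" for n k
    using v by (auto simp: finite_energy_def)
  have gm: "(\<lambda>x. g x $ k) \<in> borel_measurable ?M" for k
    unfolding g_def by (simp add: borel_measurable_lim_metric vm)
  have conv: "AE x in ?M. (\<lambda>j. v (r j) x) \<longlonglongrightarrow> g x"
    using fin good D_nonneg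
  proof eventually_elim
    case (elim x)
    obtain S where S: "(\<Sum>k. ennreal (2^k * D k x)) = ennreal S" "S \<ge> 0"
      using elim(1) by (cases "\<Sum>k. ennreal (2^k * D k x)") auto
    have DS: "2^k * D k x \<le> S" for k
    proof -
      have "sum (\<lambda>k. ennreal (2^k * D k x)) {k} \<le> (\<Sum>k. ennreal (2^k * D k x))"
        by (rule sum_le_suminf) auto
      then show ?thesis using S by (simp add: ennreal_le_iff)
    qed
    have "mat_pos (C x)" using elim(2) by (simp add: good_matrix_def)
    then obtain c where c: "c > 0" "\<And>\<xi>. c * (norm \<xi>)\<^sup>2 \<le> \<xi> \<bullet> (C x *v \<xi>)"
      by (rule mat_pos_lower_bound) blast
    define q where "q = sqrt (1/2::real)"
    have q: "0 \<le> q" "q < 1" "q\<^sup>2 = 1/2" by (auto simp: q_def)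
    have bound: "norm (v (r (Suc k)) x - v (r k) x) \<le> sqrt (S / c) * q ^ k" for k
    proof -
      have "(norm (v (r (Suc k)) x - v (r k) x))\<^sup>2 \<le> D k x / c"
        using c(2)[of "v (r (Suc k)) x - v (r k) x"] c(1) by (simp add: D_def energy_density_eq field_simps)
      also have "\<dots> \<le> S / c * (1/2)^k"
        using DS[of k] c(1) by (simp add: field_simps)
      also have "\<dots> = (sqrt (S / c) * q ^ k)\<^sup>2"
      proof -
        have "(q ^ k)\<^sup>2 = (q\<^sup>2) ^ k" by (simp add: mult.commute flip: power_mult)
        then show ?thesis using S(2) c(1) q(3) by (simp add: power_mult_distrib)
      qed
      finally show ?thesis
        using S(2) c(1) q by (simp add: power2_le_iff_abs_le)
    qed
    have "convergent (\<lambda>j. v (r j) x $ k)" for k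
    proof (rule summable_diff_convergent, rule summable_comparison_test)
      show "summable (\<lambda>n. sqrt (S / c) * q ^ n)"
        using q by (intro summable_mult summable_geometric) auto
      have "norm (v (r (Suc n)) x $ k - v (r n) x $ k) \<le> sqrt (S / c) * q ^ n" for n
        using order_trans[OF component_le_norm_cart[of "v (r (Suc n)) x - v (r n) x" k] bound[of n]] by simp
      then show "\<exists>N. \<forall>n\<ge>N. norm (v (r (Suc n)) x $ k - v (r n) x $ k) \<le> sqrt (S / c) * q ^ n"
        by blast
    qed
    then show ?case
      by (intro vec_tendstoI) (simp add: g_def convergent_LIMSEQ_iff)
  qed
  have fatou: "(\<integral>\<^sup>+x. ennreal (energy_density C (\<lambda>x. v n x - g x) x) \<partial>?M) \<le> ennreal ((1/4)^k)" if "n \<ge> N k" for n k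
  proof -
    have "(\<integral>\<^sup>+x. ennreal (energy_density C (\<lambda>x. v n x - g x) x) \<partial>?M)
       = (\<integral>\<^sup>+x. liminf (\<lambda>j. ennreal (energy_density C (\<lambda>x. v n x - v (r j) x) x)) \<partial>?M)"
    proof (rule nn_integral_cong_AE, use conv in eventually_elim)
      case (elim x)
      have "(\<lambda>j. energy_density C (\<lambda>x. v n x - v (r j) x) x) \<longlonglongrightarrow> energy_density C (\<lambda>x. v n x - g x) x"
        unfolding energy_density_def using elim by (intro tendsto_intros tendsto_vec_nth)
      then have "(\<lambda>j. ennreal (energy_density C (\<lambda>x. v n x - v (r j) x) x)) \<longlonglongrightarrow> ennreal (energy_density C (\<lambda>x. v n x - g x) x)"
        by (rule tendsto_ennrealI)
      from lim_imp_Liminf[OF _ this] show ?case by simp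
    qed
    also have "\<dots> \<le> liminf (\<lambda>j. \<integral>\<^sup>+x. ennreal (energy_density C (\<lambda>x. v n x - v (r j) x) x) \<partial>?M)"
    proof (rule nn_integral_liminf)
      fix j
      have "energy_density C (\<lambda>x. v n x - v (r j) x) \<in> borel_measurable ?M"
        using fd[of n "r j"] unfolding finite_energy_def by (blast intro: borel_measurable_integrable)
      then show "(\<lambda>x. ennreal (energy_density C (\<lambda>x. v n x - v (r j) x) x)) \<in> borel_measurable ?M"
        by measurable
    qed
    also have "\<dots> \<le> ennreal ((1/4)^k)"
    proof (rule Liminf_le)
      show "\<forall>\<^sub>F j in sequentially. (\<integral>\<^sup>+x. ennreal (energy_density C (\<lambda>x. v n x - v (r j) x) x) \<partial>?M) \<le> ennreal ((1/4)^k)"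
      proof (rule eventually_sequentiallyI[of k])
        fix j assume "j \<ge> k"
        have "(\<integral>\<^sup>+x. ennreal (energy_density C (\<lambda>x. v n x - v (r j) x) x) \<partial>?M) = ennreal (energy \<Omega> C (\<lambda>x. v n x - v (r j) x))"
          unfolding energy_def using fd energy_density_nonneg by (intro nn_integral_eq_integral) (auto simp: finite_energy_def)
        also have "\<dots> \<le> ennreal ((1/4)^k)"
          using N[OF that r[OF \<open>j \<ge> k\<close>]] by (intro ennreal_leI) simp
        finally show "(\<integral>\<^sup>+x. ennreal (energy_density C (\<lambda>x. v n x - v (r j) x) x) \<partial>?M) \<le> ennreal ((1/4)^k)" .
      qed
    qed simp
    finally show ?thesis .
  qed
  have dm: "(\<lambda>x. (v n x - g x) $ k) \<in> borel_measurable ?M" for n k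
    using vm gm by (simp add: borel_measurable_diff)
  have fvg: "finite_energy \<Omega> C (\<lambda>x. v n x - g x)" and small: "energy \<Omega> C (\<lambda>x. v n x - g x) \<le> (1/4)^k" if "n \<ge> N k" for n k
  proof -
    have int: "integrable ?M (energy_density C (\<lambda>x. v n x - g x))"
    proof (rule integrableI_nonneg[OF energy_density_measurable[OF dm] energy_density_nonneg])
      show "(\<integral>\<^sup>+x. ennreal (energy_density C (\<lambda>x. v n x - g x) x) \<partial>?M) < \<infinity>"
        using fatou[OF that] by (auto simp: order_le_less_trans)
    qed
    then show "finite_energy \<Omega> C (\<lambda>x. v n x - g x)" using dm by (auto simp: finite_energy_def)
    show "energy \<Omega> C (\<lambda>x. v n x - g x) \<le> (1/4)^k"
      using fatou[OF that] nn_integral_eq_integral[OF int energy_density_nonneg]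
      by (simp add: energy_def ennreal_le_iff)
  qed
  show thesis
  proof (rule that[of g])
    have "finite_energy \<Omega> C (\<lambda>x. v (N 0) x - (v (N 0) x - g x))"
      by (intro finite_energy_diff v fvg[of 0]) simp
    then show "finite_energy \<Omega> C g" by simp
    show "(\<lambda>n. energy \<Omega> C (\<lambda>x. v n x - g x)) \<longlonglongrightarrow> 0"
    proof (rule LIMSEQ_I)
      fix e :: real assume "e > 0"
      then obtain k where k: "(1/4::real)^k < e" using real_arch_pow_inv[of e "1/4"] by auto
      show "\<exists>no. \<forall>n\<ge>no. norm (energy \<Omega> C (\<lambda>x. v n x - g x) - 0) < e"
      proof (intro exI[of _ "N k"] allI impI)
        fix n assume "N k \<le> n"
        then show "norm (energy \<Omega> C (\<lambda>x. v n x - g x) - 0) < e"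
          using small[of k n] energy_nonneg[of "\<lambda>x. v n x - g x"] k by simp
      qed
    qed
  qed
qed

lemma L2_restrict:
  assumes "f \<in> L2 \<Omega>" "compact K" "K \<subseteq> \<Omega>"
  shows "f \<in> borel_measurable (lebesgue_on K)" "integrable (lebesgue_on K) (\<lambda>x. (f x)\<^sup>2)"
proof -
  show "f \<in> borel_measurable (lebesgue_on K)"
    by (rule measurable_restrict_mono[OF _ assms(3)]) (use assms in \<open>simp add: L2_def\<close>)
  show "integrable (lebesgue_on K) (\<lambda>x. (f x)\<^sup>2)"
    by (rule integrable_lebesgue_on_subset[of \<Omega>]) (use assms compact_lebesgue \<Omega>_sets in \<open>auto simp: L2_def\<close>)
qed

lemma L2_imp_L2_loc: "f \<in> L2 \<Omega> \<Longrightarrow> f \<in> L2_loc \<Omega>"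
  unfolding L2_loc_def
proof (intro CollectI conjI allI impI)
  assume f: "f \<in> L2 \<Omega>"
  then show "f \<in> borel_measurable (lebesgue_on \<Omega>)" by (simp add: L2_def)
  fix K assume "compact K \<and> K \<subseteq> \<Omega>"
  then show "integrable (lebesgue_on K) (\<lambda>x. (f x)\<^sup>2)"
    by (intro L2_restrict(2)[OF f]) auto
qed

lemma test_L2: "u \<in> Cc_infinity A \<Longrightarrow> u \<in> L2 \<Omega>"
  using Cc_infinity_integrable_lebesgue_on[OF Cc_infinity_square \<Omega>_sets]
  by (auto simp: L2_def intro: smooth_lebesgue_on Cc_infinity_smooth)

text \<open>The reason why \<open>h0\<close> is closable: on the support of a test function local
  ellipticity turns convergence in energy into \<open>L2\<close> convergence of the gradients, so
  the integration by parts identity of the \<open>u n\<close> survives in the limit.\<close>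

lemma weak_gradient_limit:
  assumes \<phi>: "\<phi> \<in> L2 \<Omega>" and u: "\<And>n. u n \<in> Cc_infinity \<Omega>"
    and L2: "(\<lambda>n. LINT x|lebesgue_on \<Omega>. (u n x - \<phi> x)\<^sup>2) \<longlonglongrightarrow> 0"
    and g: "finite_energy \<Omega> C g" "(\<lambda>n. energy \<Omega> C (\<lambda>x. grad (u n) x - g x)) \<longlonglongrightarrow> 0"
  shows "weak_gradient \<Omega> \<phi> g"
  unfolding weak_gradient_def
proof (intro conjI allI ballI)
  show "\<phi> \<in> L1_loc \<Omega>" using \<phi> by (intro L2_loc_L1_loc L2_imp_L2_loc)
  show gL: "(\<lambda>x. g x $ k) \<in> L1_loc \<Omega>" for k
    by (intro L2_loc_L1_loc finite_energy_L2_loc g)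
  fix k \<eta> assume \<eta>: "\<eta> \<in> Cc_infinity \<Omega>"
  obtain K where K: "compact K" "K \<subseteq> \<Omega>" "\<And>x. x \<notin> K \<Longrightarrow> \<eta> x = 0" "\<And>x k. x \<notin> K \<Longrightarrow> partial k \<eta> x = 0"
    using \<eta> by (metis Cc_infinityE)
  have Km: "K \<in> sets lebesgue" using K compact_lebesgue by auto
  let ?M = "lebesgue_on K"
  define w where "w = partial k \<eta>"
  have w: "w \<in> Cc_infinity \<Omega>" unfolding w_def by (rule Cc_infinity_partial[OF \<eta>])
  have t: "v \<in> borel_measurable ?M" "integrable ?M (\<lambda>x. (v x)\<^sup>2)" if "v \<in> Cc_infinity \<Omega>" for v
    using that Km Cc_infinity_integrable_lebesgue_on[OF Cc_infinity_square[OF that] Km]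
    by (auto intro: smooth_lebesgue_on Cc_infinity_smooth)
  note \<phi>K = L2_restrict[OF \<phi> K(1,2)]
  note gK = L2_locD[OF finite_energy_L2_loc[OF g(1)] K(1,2)]
  have d1: "(\<lambda>x. u n x - \<phi> x) \<in> borel_measurable ?M" "integrable ?M (\<lambda>x. (u n x - \<phi> x)\<^sup>2)" for n
    using t[OF u] \<phi>K by (auto intro!: integrable_diff_square)
  have d2: "(\<lambda>x. partial k (u n) x - g x $ k) \<in> borel_measurable ?M" "integrable ?M (\<lambda>x. (partial k (u n) x - g x $ k)\<^sup>2)" for n
    using t[OF Cc_infinity_partial[OF u]] gK by (auto intro!: integrable_diff_square)
  have l1: "(\<lambda>n. LINT x|?M. (u n x - \<phi> x)\<^sup>2) \<longlonglongrightarrow> 0"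
  proof (rule tendsto_sandwich[OF _ _ tendsto_const L2])
    have "integrable (lebesgue_on \<Omega>) (\<lambda>x. (u n x - \<phi> x)\<^sup>2)" for n
      using test_L2[OF u, of n] \<phi> by (intro integrable_diff_square) (auto simp: L2_def)
    then show "\<forall>\<^sub>F n in sequentially. (LINT x|?M. (u n x - \<phi> x)\<^sup>2) \<le> (LINT x|lebesgue_on \<Omega>. (u n x - \<phi> x)\<^sup>2)"
      using K Km \<Omega>_sets by (intro always_eventually allI integral_lebesgue_on_subset_le) auto
  qed auto
  obtain c where c: "c > 0"
    "\<And>g. finite_energy \<Omega> C g \<Longrightarrow> (LINT x|?M. (g x $ k)\<^sup>2) \<le> c * energy \<Omega> C g"
  proof (rule local_ellipticity[OF K(1,2) g(1), of k])
    fix c assume c: "c > 0" "\<And>g. finite_energy \<Omega> C g \<Longrightarrow> integrable ?M (\<lambda>x. (g x $ k)\<^sup>2)"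
      "\<And>g. finite_energy \<Omega> C g \<Longrightarrow> (LINT x|?M. (g x $ k)\<^sup>2) \<le> c * energy \<Omega> C g"
    show thesis by (rule that[OF c(1,3)])
  qed
  have l2: "(\<lambda>n. LINT x|?M. (partial k (u n) x - g x $ k)\<^sup>2) \<longlonglongrightarrow> 0"
  proof (rule tendsto_sandwich[OF _ _ tendsto_const])
    show "(\<lambda>n. c * energy \<Omega> C (\<lambda>x. grad (u n) x - g x)) \<longlonglongrightarrow> 0"
      using tendsto_mult[OF tendsto_const g(2), of c] by simp
    show "\<forall>\<^sub>F n in sequentially. (LINT x|?M. (partial k (u n) x - g x $ k)\<^sup>2) \<le> c * energy \<Omega> C (\<lambda>x. grad (u n) x - g x)"
      using c(2)[OF finite_energy_diff[OF finite_energy_grad[OF u] g(1)]]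
      by (intro always_eventually allI) simp
  qed auto
  have lim1: "(\<lambda>n. LINT x|?M. u n x * w x) \<longlonglongrightarrow> (LINT x|?M. \<phi> x * w x)"
  proof (rule tendsto_integral_abs_diff)
    show "integrable ?M (\<lambda>x. u n x * w x)" "integrable ?M (\<lambda>x. \<phi> x * w x)" "integrable ?M (\<lambda>x. \<bar>(u n x - \<phi> x) * w x\<bar>)" for n
      using integrable_mult_L2[OF t[OF u] t[OF w]] integrable_mult_L2[OF \<phi>K t[OF w]] integrable_mult_L2[OF d1 t[OF w]] by auto
    show "(\<lambda>n. LINT x|?M. \<bar>(u n x - \<phi> x) * w x\<bar>) \<longlonglongrightarrow> 0"
      by (rule tendsto_integral_mult_L2[OF d1 l1 t[OF w]])
  qed (simp add: left_diff_distrib)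
  have lim2: "(\<lambda>n. LINT x|?M. partial k (u n) x * \<eta> x) \<longlonglongrightarrow> (LINT x|?M. g x $ k * \<eta> x)"
  proof (rule tendsto_integral_abs_diff)
    show "integrable ?M (\<lambda>x. partial k (u n) x * \<eta> x)" "integrable ?M (\<lambda>x. g x $ k * \<eta> x)"
      "integrable ?M (\<lambda>x. \<bar>(partial k (u n) x - g x $ k) * \<eta> x\<bar>)" for n
      using integrable_mult_L2[OF t[OF Cc_infinity_partial[OF u]] t[OF \<eta>]] integrable_mult_L2[OF gK t[OF \<eta>]]
        integrable_mult_L2[OF d2 t[OF \<eta>]] by auto
    show "(\<lambda>n. LINT x|?M. \<bar>(partial k (u n) x - g x $ k) * \<eta> x\<bar>) \<longlonglongrightarrow> 0"
      by (rule tendsto_integral_mult_L2[OF d2 l2 t[OF \<eta>]])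
  qed (simp add: left_diff_distrib)
  have to_K: "(LINT x|lebesgue_on \<Omega>. f x * v x) = (LINT x|?M. f x * v x)" if "\<And>x. x \<notin> K \<Longrightarrow> v x = 0" for f v :: "real^'n \<Rightarrow> real"
    by (rule integral_lebesgue_on_support[OF K(2) Km \<Omega>_sets]) (use that in auto)
  have "(LINT x|?M. u n x * w x) = - (LINT x|?M. partial k (u n) x * \<eta> x)" for n
    using integral_by_parts_on[OF Cc_infinity_smooth[OF u] \<eta> \<Omega>_sets, of n k] to_K[of w "u n"] to_K[of \<eta> "partial k (u n)"] K(3,4)
    by (simp add: w_def)
  then have "(\<lambda>n. LINT x|?M. u n x * w x) \<longlonglongrightarrow> - (LINT x|?M. g x $ k * \<eta> x)"
    using tendsto_minus[OF lim2] by simp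
  from LIMSEQ_unique[OF lim1 this]
  show "(LINT x|lebesgue_on \<Omega>. \<phi> x * partial k \<eta> x) = - (LINT x|lebesgue_on \<Omega>. g x $ k * \<eta> x)"
    using to_K[of w \<phi>] to_K[of \<eta> "\<lambda>x. g x $ k"] K(3,4) by (simp add: w_def)
qed

lemma h_D_limit:
  assumes "(\<phi>, v) \<in> h_D \<Omega> C"
  obtains u g where "\<And>n::nat. u n \<in> Cc_infinity \<Omega>" "\<phi> \<in> L2 \<Omega>"
    "(\<lambda>n. LINT x|lebesgue_on \<Omega>. (u n x - \<phi> x)\<^sup>2) \<longlonglongrightarrow> 0"
    "finite_energy \<Omega> C g" "(\<lambda>n. energy \<Omega> C (\<lambda>x. grad (u n) x - g x)) \<longlonglongrightarrow> 0"
    "weak_gradient \<Omega> \<phi> g" "v = energy \<Omega> C g"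
proof -
  obtain u where \<phi>: "\<phi> \<in> L2 \<Omega>" and u: "\<And>n. u n \<in> Cc_infinity \<Omega>"
    "(\<lambda>n. LINT x|lebesgue_on \<Omega>. (u n x - \<phi> x)\<^sup>2) \<longlonglongrightarrow> 0"
    "\<And>\<epsilon>. \<epsilon> > 0 \<Longrightarrow> \<exists>N. \<forall>m\<ge>N. \<forall>n\<ge>N. h0 \<Omega> C (\<lambda>x. u m x - u n x) < \<epsilon>"
    "(\<lambda>n. h0 \<Omega> C (u n)) \<longlonglongrightarrow> v"
    using assms unfolding h_D_def by blast
  have e: "h0 \<Omega> C (\<lambda>x. u m x - u n x) = energy \<Omega> C (\<lambda>x. grad (u m) x - grad (u n) x)" for m n
    by (simp add: h0_eq_energy[OF Cc_infinity_diff[OF u(1) u(1)]] grad_diff[OF u(1) u(1)])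
  obtain g where g: "finite_energy \<Omega> C g" "(\<lambda>n. energy \<Omega> C (\<lambda>x. grad (u n) x - g x)) \<longlonglongrightarrow> 0"
    using energy_limit_exists[OF finite_energy_grad[OF u(1)] u(3)[unfolded e]] by blast
  have "(\<lambda>n. energy \<Omega> C (grad (u n))) \<longlonglongrightarrow> energy \<Omega> C g"
    by (rule energy_tendsto[OF finite_energy_grad[OF u(1)] g])
  then have "v = energy \<Omega> C g"
    using u(4) LIMSEQ_unique by (simp add: h0_eq_energy[OF u(1)])
  moreover have "weak_gradient \<Omega> \<phi> g"
    by (rule weak_gradient_limit[OF \<phi> u(1,2) g])
  ultimately show thesis using that \<phi> u(1,2) g by blast
qed

lemma h_ND:
  assumes "(\<phi>, v) \<in> h_N \<Omega> C"
  obtains g where "weak_gradient \<Omega> \<phi> g" "\<phi> \<in> L2 \<Omega>" "finite_energy \<Omega> C g" "v = energy \<Omega> C g"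
proof -
  obtain g where \<phi>: "\<phi> \<in> W12_loc \<Omega>" and g: "weak_gradient \<Omega> \<phi> g" 
    "integrable (lebesgue_on \<Omega>) (\<lambda>x. energy_density C g x + (\<phi> x)\<^sup>2)" "v = energy \<Omega> C g"
    using assms by (auto simp: h_N_def energy_def)
  have gm: "(\<lambda>x. g x $ k) \<in> borel_measurable (lebesgue_on \<Omega>)" for k
    using g(1) by (simp add: weak_gradient_def L1_loc_def)
  have \<phi>m: "\<phi> \<in> borel_measurable (lebesgue_on \<Omega>)"
    using \<phi> by (simp add: W12_loc_def L2_loc_def)
  have "AE x in lebesgue_on \<Omega>. energy_density C g x \<le> energy_density C g x + (\<phi> x)\<^sup>2" by simp
  from finite_energyI(1)[OF gm g(2) this] have fg: "finite_energy \<Omega> C g" .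
  have "integrable (lebesgue_on \<Omega>) (\<lambda>x. (\<phi> x)\<^sup>2)"
    using Bochner_Integration.integrable_diff[OF g(2), of "energy_density C g"] fg by (simp add: finite_energy_def)
  then have "\<phi> \<in> L2 \<Omega>" using \<phi>m by (simp add: L2_def)
  then show thesis using that g fg by blast
qed

lemma h_NI:
  assumes "weak_gradient \<Omega> \<phi> g" "\<phi> \<in> L2 \<Omega>" "finite_energy \<Omega> C g"
  shows "(\<phi>, energy \<Omega> C g) \<in> h_N \<Omega> C"
  unfolding h_N_def W12_loc_def using assms finite_energy_L2_loc[OF assms(3)] L2_imp_L2_loc[OF assms(2)]
  by (auto simp: energy_def finite_energy_def L2_def)

lemma h_D_subset_h_N: "h_D \<Omega> C \<subseteq> h_N \<Omega> C"
proof
  fix z assume z: "z \<in> h_D \<Omega> C"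
  obtain \<phi> v where zz: "z = (\<phi>, v)" by (cases z)
  show "z \<in> h_N \<Omega> C"
    using z h_NI unfolding zz by (elim h_D_limit) auto
qed

lemma h_DI:
  assumes \<phi>: "\<phi> \<in> L2 \<Omega>" and g: "finite_energy \<Omega> C g"
    and approx: "\<And>\<epsilon>. \<epsilon> > 0 \<Longrightarrow> \<exists>u\<in>Cc_infinity \<Omega>. (LINT x|lebesgue_on \<Omega>. (u x - \<phi> x)\<^sup>2) < \<epsilon>
        \<and> energy \<Omega> C (\<lambda>x. grad u x - g x) < \<epsilon>"
  shows "(\<phi>, energy \<Omega> C g) \<in> h_D \<Omega> C"
proof -
  define P where "P n u \<longleftrightarrow> u \<in> Cc_infinity \<Omega> \<and> (LINT x|lebesgue_on \<Omega>. (u x - \<phi> x)\<^sup>2) < inverse (real (Suc n))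
        \<and> energy \<Omega> C (\<lambda>x. grad u x - g x) < inverse (real (Suc n))" for n u
  have "\<exists>u. P n u" for n
    using approx[of "inverse (real (Suc n))"] by (auto simp: P_def)
  then obtain u where "\<And>n. P n (u n)"
    by metis
  then have u: "\<And>n. u n \<in> Cc_infinity \<Omega>"
    "\<And>n. (LINT x|lebesgue_on \<Omega>. (u n x - \<phi> x)\<^sup>2) < inverse (real (Suc n))"
    "\<And>n. energy \<Omega> C (\<lambda>x. grad (u n) x - g x) < inverse (real (Suc n))"
    by (simp_all add: P_def)
  have l1: "(\<lambda>n. LINT x|lebesgue_on \<Omega>. (u n x - \<phi> x)\<^sup>2) \<longlonglongrightarrow> 0"
    by (rule tendsto_sandwich[OF _ _ tendsto_const LIMSEQ_inverse_real_of_nat])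
      (use u(2) in \<open>auto intro!: always_eventually less_imp_le\<close>)
  have l2: "(\<lambda>n. energy \<Omega> C (\<lambda>x. grad (u n) x - g x)) \<longlonglongrightarrow> 0"
    by (rule tendsto_sandwich[OF _ _ tendsto_const LIMSEQ_inverse_real_of_nat])
      (use u(3) energy_nonneg in \<open>auto intro!: always_eventually less_imp_le\<close>)
  have l3: "(\<lambda>n. h0 \<Omega> C (u n)) \<longlonglongrightarrow> energy \<Omega> C g"
    using energy_tendsto[OF finite_energy_grad[OF u(1)] g l2] by (simp add: h0_eq_energy[OF u(1)])
  have cauchy: "\<exists>N. \<forall>m\<ge>N. \<forall>n\<ge>N. h0 \<Omega> C (\<lambda>x. u m x - u n x) < \<epsilon>" if "\<epsilon> > 0" for \<epsilon>
  proof -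
    have "\<exists>N. \<forall>n\<ge>N. norm (energy \<Omega> C (\<lambda>x. grad (u n) x - g x) - 0) < \<epsilon> / 4"
      using LIMSEQ_D[OF l2, of "\<epsilon> / 4"] that by simp
    then obtain N where N: "\<And>n. n \<ge> N \<Longrightarrow> energy \<Omega> C (\<lambda>x. grad (u n) x - g x) < \<epsilon> / 4"
      by (auto simp: energy_nonneg)
    have f: "finite_energy \<Omega> C (\<lambda>x. grad (u n) x - g x)" for n
      by (intro finite_energy_diff finite_energy_grad[OF u(1)] g)
    show ?thesis
    proof (intro exI[of _ N] allI impI)
      fix m n assume "N \<le> m" "N \<le> n"
      have "h0 \<Omega> C (\<lambda>x. u m x - u n x) = energy \<Omega> C (\<lambda>x. (grad (u m) x - g x) - (grad (u n) x - g x))"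
        by (simp add: h0_eq_energy[OF Cc_infinity_diff[OF u(1) u(1)]] grad_diff[OF u(1) u(1)])
      also have "\<dots> \<le> 2 * energy \<Omega> C (\<lambda>x. grad (u m) x - g x) + 2 * energy \<Omega> C (\<lambda>x. grad (u n) x - g x)"
        by (rule energy_diff_le[OF f f])
      finally show "h0 \<Omega> C (\<lambda>x. u m x - u n x) < \<epsilon>"
        using N[OF \<open>N \<le> m\<close>] N[OF \<open>N \<le> n\<close>] by simp
    qed
  qed
  show ?thesis
    unfolding h_D_def
  proof (intro CollectI case_prodI conjI exI[of _ u])
    show "\<forall>\<epsilon>>0. \<exists>N. \<forall>m\<ge>N. \<forall>n\<ge>N. h0 \<Omega> C (\<lambda>x. u m x - u n x) < \<epsilon>"
    proof (intro allI impI)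
      fix \<epsilon> :: real assume "\<epsilon> > 0"
      then show "\<exists>N. \<forall>m\<ge>N. \<forall>n\<ge>N. h0 \<Omega> C (\<lambda>x. u m x - u n x) < \<epsilon>" by (rule cauchy)
    qed
  qed (rule \<phi> l1 l3 allI[OF u(1)])+
qed

end

subsection \<open>Approximation by test functions\<close>

context elliptic
begin

text \<open>The approximation that \<open>h_DI\<close> asks for, with the gradient kept as explicit
  data. In this form it is stable under limits, so truncation, cutoff and mollification can be
  carried out one after the other.\<close>

definition approximable :: "(real^'n \<Rightarrow> real) \<Rightarrow> (real^'n \<Rightarrow> real^'n) \<Rightarrow> bool"
  where "approximable \<phi> g \<longleftrightarrow> \<phi> \<in> L2 \<Omega> \<and> finite_energy \<Omega> C g \<and>
    (\<forall>\<epsilon>>0. \<exists>u\<in>Cc_infinity \<Omega>. (LINT x|lebesgue_on \<Omega>. (u x - \<phi> x)\<^sup>2) < \<epsilon> \<and> energy \<Omega> C (\<lambda>x. grad u x - g x) < \<epsilon>)"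

lemma L2D: "f \<in> L2 \<Omega> \<Longrightarrow> f \<in> borel_measurable (lebesgue_on \<Omega>)" "f \<in> L2 \<Omega> \<Longrightarrow> integrable (lebesgue_on \<Omega>) (\<lambda>x. (f x)\<^sup>2)"
  by (auto simp: L2_def)

lemma L2_diff: "f \<in> L2 \<Omega> \<Longrightarrow> g \<in> L2 \<Omega> \<Longrightarrow> (\<lambda>x. f x - g x) \<in> L2 \<Omega>"
  by (auto simp: L2_def intro!: integrable_diff_square)

lemma approximable_limit:
  assumes \<phi>: "\<phi> \<in> L2 \<Omega>" "finite_energy \<Omega> C g"
    and lim: "\<And>\<epsilon>. \<epsilon> > 0 \<Longrightarrow> \<exists>\<psi> h. approximable \<psi> h \<and> (LINT x|lebesgue_on \<Omega>. (\<psi> x - \<phi> x)\<^sup>2) < \<epsilon> \<and> energy \<Omega> C (\<lambda>x. h x - g x) < \<epsilon>"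
  shows "approximable \<phi> g"
  unfolding approximable_def
proof (intro conjI \<phi> allI impI)
  fix \<epsilon> :: real assume "\<epsilon> > 0"
  then have e4: "\<epsilon> / 4 > 0" by simp
  then obtain \<psi> h where a: "approximable \<psi> h" and l: "(LINT x|lebesgue_on \<Omega>. (\<psi> x - \<phi> x)\<^sup>2) < \<epsilon> / 4" "energy \<Omega> C (\<lambda>x. h x - g x) < \<epsilon> / 4"
    using lim by blast
  have \<psi>: "\<psi> \<in> L2 \<Omega>" "finite_energy \<Omega> C h" using a by (auto simp: approximable_def)
  obtain u where u: "u \<in> Cc_infinity \<Omega>" "(LINT x|lebesgue_on \<Omega>. (u x - \<psi> x)\<^sup>2) < \<epsilon> / 4" "energy \<Omega> C (\<lambda>x. grad u x - h x) < \<epsilon> / 4"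
    using a e4 unfolding approximable_def by blast
  have uL: "u \<in> L2 \<Omega>" "finite_energy \<Omega> C (grad u)" using test_L2 u(1) finite_energy_grad by auto
  have "(LINT x|lebesgue_on \<Omega>. (u x - \<phi> x)\<^sup>2) = (LINT x|lebesgue_on \<Omega>. ((u x - \<psi> x) + (\<psi> x - \<phi> x))\<^sup>2)" by simp
  also have "\<dots> \<le> 2 * (LINT x|lebesgue_on \<Omega>. (u x - \<psi> x)\<^sup>2) + 2 * (LINT x|lebesgue_on \<Omega>. (\<psi> x - \<phi> x)\<^sup>2)"
    using L2D[OF L2_diff[OF uL(1) \<psi>(1)]] L2D[OF L2_diff[OF \<psi>(1) \<phi>(1)]] by (intro integral_add_square_le)
  also have "\<dots> < \<epsilon>" using u(2) l(1) by simp
  finally have 1: "(LINT x|lebesgue_on \<Omega>. (u x - \<phi> x)\<^sup>2) < \<epsilon>" .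
  have "energy \<Omega> C (\<lambda>x. grad u x - g x) = energy \<Omega> C (\<lambda>x. (grad u x - h x) + (h x - g x))" by simp
  also have "\<dots> \<le> 2 * energy \<Omega> C (\<lambda>x. grad u x - h x) + 2 * energy \<Omega> C (\<lambda>x. h x - g x)"
    by (intro energy_add_le finite_energy_diff uL \<psi> \<phi>)
  also have "\<dots> < \<epsilon>" using u(3) l(2) by simp
  finally show "\<exists>u\<in>Cc_infinity \<Omega>. (LINT x|lebesgue_on \<Omega>. (u x - \<phi> x)\<^sup>2) < \<epsilon> \<and> energy \<Omega> C (\<lambda>x. grad u x - g x) < \<epsilon>"
    using u(1) 1 by blast
qed

text \<open>A product with a test function has compact support in \<Omega>, where mollification
  works, and the upper bound \<open>B\<close> converts \<open>L2\<close> errors of the gradient into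
  energy errors. The second field is the gradient of the product according to the product
  rule.\<close>

lemma approximable_test_mult:
  assumes wg: "weak_gradient \<Omega> \<psi> G" and \<psi>: "\<psi> \<in> L2 \<Omega>" and G: "finite_energy \<Omega> C G" and \<zeta>: "\<zeta> \<in> Cc_infinity \<Omega>"
  shows "approximable (\<lambda>x. \<psi> x * \<zeta> x) (\<lambda>x. \<zeta> x *\<^sub>R G x + \<psi> x *\<^sub>R grad \<zeta> x)"
proof -
  let ?M = "lebesgue_on \<Omega>"
  let ?H = "\<lambda>x. \<zeta> x *\<^sub>R G x + \<psi> x *\<^sub>R grad \<zeta> x"
  note loc = L2_imp_L2_loc[OF \<psi>] finite_energy_L2_loc[OF G]
  have zm: "\<zeta> \<in> borel_measurable ?M" "partial k \<zeta> \<in> borel_measurable ?M" for k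
    by (intro smooth_lebesgue_on smooth_partial Cc_infinity_smooth[OF \<zeta>])+
  have Hk: "?H x $ k = G x $ k * \<zeta> x + \<psi> x * partial k \<zeta> x" for x k
    by (simp add: mult.commute)
  have Hm: "(\<lambda>x. ?H x $ k) \<in> borel_measurable ?M" for k
    unfolding Hk using G L2D(1)[OF \<psi>] zm
    by (intro borel_measurable_add borel_measurable_times) (auto simp: finite_energy_def)
  have pm: "(\<lambda>x. \<psi> x * \<zeta> x) \<in> borel_measurable ?M" using L2D(1)[OF \<psi>] zm by (intro borel_measurable_times)
  have ex: "\<exists>u\<in>Cc_infinity \<Omega>. integrable ?M (\<lambda>x. (u x - \<psi> x * \<zeta> x)\<^sup>2) \<and> (LINT x|?M. (u x - \<psi> x * \<zeta> x)\<^sup>2) < \<epsilon>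
     \<and> (\<forall>k. integrable ?M (\<lambda>x. (partial k u x - ?H x $ k)\<^sup>2)) \<and> (\<forall>k. (LINT x|?M. (partial k u x - ?H x $ k)\<^sup>2) < \<epsilon>)" if "\<epsilon> > 0" for \<epsilon>
    unfolding Hk by (rule mollified_product[OF wg loc \<zeta> open_\<Omega> that]) blast
  have um: "u \<in> borel_measurable ?M" "integrable ?M (\<lambda>x. (u x)\<^sup>2)" "partial k u \<in> borel_measurable ?M"
    "integrable ?M (\<lambda>x. (partial k u x)\<^sup>2)" if "u \<in> Cc_infinity \<Omega>" for u k
    using L2D test_L2[OF that] test_L2[OF Cc_infinity_partial[OF that]] by auto
  obtain u where u: "u \<in> Cc_infinity \<Omega>" "integrable ?M (\<lambda>x. (u x - \<psi> x * \<zeta> x)\<^sup>2)"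
     "\<And>k. integrable ?M (\<lambda>x. (partial k u x - ?H x $ k)\<^sup>2)"
    using ex[of 1] by auto
  have "(\<lambda>x. u x - \<psi> x * \<zeta> x) \<in> borel_measurable ?M"
    using um[OF u(1)] pm by (intro borel_measurable_diff)
  from integrable_diff_square[OF um(1)[OF u(1)] this um(2)[OF u(1)] u(2)]
  have "(\<lambda>x. \<psi> x * \<zeta> x) \<in> L2 \<Omega>" using pm by (simp add: L2_def)
  moreover have Hi: "integrable ?M (\<lambda>x. (?H x $ k)\<^sup>2)" for k
  proof -
    have "(\<lambda>x. partial k u x - ?H x $ k) \<in> borel_measurable ?M"
      using um[OF u(1)] Hm by (intro borel_measurable_diff)
    from integrable_diff_square[OF um(3)[OF u(1), of k] this um(4)[OF u(1), of k] u(3)]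
    show ?thesis by simp
  qed
  then have fe: "finite_energy \<Omega> C ?H" by (intro finite_energy_L2(1) Hm)
  moreover have "\<exists>u\<in>Cc_infinity \<Omega>. (LINT x|?M. (u x - \<psi> x * \<zeta> x)\<^sup>2) < \<epsilon> \<and> energy \<Omega> C (\<lambda>x. grad u x - ?H x) < \<epsilon>"
    if "\<epsilon> > 0" for \<epsilon>
  proof -
    \<comment> \<open>The energy is at most \<open>B\<close> times a sum of \<open>CARD('n)\<close>
      component errors, each below \<open>e\<close>; the additional 1 makes the inequality
      strict.\<close>
    define e where "e = min \<epsilon> (\<epsilon> / (B * (real CARD('n) + 1)))"
    have e: "e > 0" "e \<le> \<epsilon>" "B * (real CARD('n) * e) < \<epsilon>"
    proof -
      show "e > 0" "e \<le> \<epsilon>" using that B_pos by (auto simp: e_def)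
      have "B * (real CARD('n) * e) < B * ((real CARD('n) + 1) * e)" using \<open>e > 0\<close> B_pos by simp
      also have "\<dots> \<le> B * ((real CARD('n) + 1) * (\<epsilon> / (B * (real CARD('n) + 1))))"
        using B_pos by (intro mult_left_mono) (auto simp: e_def)
      also have "\<dots> = \<epsilon>"
        using B_pos by (simp add: add_nonneg_eq_0_iff)
      finally show "B * (real CARD('n) * e) < \<epsilon>" .
    qed
    obtain u where u: "u \<in> Cc_infinity \<Omega>" "(LINT x|?M. (u x - \<psi> x * \<zeta> x)\<^sup>2) < e"
     "\<And>k. integrable ?M (\<lambda>x. (partial k u x - ?H x $ k)\<^sup>2)" "\<And>k. (LINT x|?M. (partial k u x - ?H x $ k)\<^sup>2) < e"
      using ex[OF e(1)] by auto
    have "energy \<Omega> C (\<lambda>x. grad u x - ?H x) \<le> B * (\<Sum>k\<in>UNIV. LINT x|?M. ((grad u x - ?H x) $ k)\<^sup>2)"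
    proof (rule finite_energy_L2(2))
      show "(\<lambda>x. (grad u x - ?H x) $ k) \<in> borel_measurable ?M" for k
        unfolding vector_minus_component grad_nth using um[OF u(1)] Hm by (intro borel_measurable_diff)
      show "integrable ?M (\<lambda>x. ((grad u x - ?H x) $ k)\<^sup>2)" for k
        unfolding vector_minus_component[of "grad u _"] grad_nth by (rule u(3))
    qed
    also have "\<dots> \<le> B * (\<Sum>k::'n\<in>UNIV. e)"
      using u(4) B_pos unfolding vector_minus_component[of "grad u _"] grad_nth
      by (intro mult_left_mono sum_mono) (auto intro: less_imp_le)
    also have "\<dots> < \<epsilon>" using e(3) by simp
    finally show ?thesis using u(1,2) e(2) by (intro bexI[of _ u]) auto
  qed
  ultimately show ?thesis unfolding approximable_def by blast
qed

text \<open>The interface between the geometry of the boundary and the form. The sequence may depend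
  on the radius \<open>R\<close>, because the construction treats finitely many boundary parts at a
  time, and the energy density is bounded only inside the ball, because a further cutoff at infinity
  will remove the rest.\<close>

definition has_boundary_cutoffs :: bool
  where "has_boundary_cutoffs \<longleftrightarrow> (\<forall>R>0. \<exists>\<eta> K. \<forall>N::nat. \<eta> N \<in> Cc_infinity \<Omega> \<and> (\<forall>x. 0 \<le> \<eta> N x \<and> \<eta> N x \<le> 1)
     \<and> (\<forall>x\<in>\<Omega> \<inter> ball 0 R. (\<lambda>N. \<eta> N x) \<longlonglongrightarrow> 1)
     \<and> (\<exists>H. integrable (lebesgue_on \<Omega>) H \<and> (\<forall>x. 0 \<le> H x) \<and> (LINT x|lebesgue_on \<Omega>. H x) \<le> K / real (Suc N)
          \<and> (AE x in lebesgue_on \<Omega>. x \<in> ball 0 R \<longrightarrow> energy_density C (grad (\<eta> N)) x \<le> H x)))"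

lemma energy_density_scale: "energy_density C (\<lambda>x. w x *\<^sub>R g x) x = (w x)\<^sup>2 * energy_density C g x"
  by (simp add: energy_density_eq matrix_vector_mult_scaleR power2_eq_square)

text \<open>The error in the gradient has three parts: \<open>(\<zeta> x - 1) *\<^sub>R G x\<close>,
  a term with the gradient of the cutoff at infinity, and a term with the gradient of the boundary
  cutoff. Dominated convergence handles the first and square integrability of \<psi> the second. In
  the third, \<psi> multiplies a gradient that is large near the boundary, and here the bound
  \<open>M\<close> enters.\<close>

lemma approximable_bounded:
  assumes wg: "weak_gradient \<Omega> \<psi> G" and \<psi>: "\<psi> \<in> L2 \<Omega>" and G: "finite_energy \<Omega> C G"
    and bound: "\<And>x. \<bar>\<psi> x\<bar> \<le> M" and cut: has_boundary_cutoffs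
  shows "approximable \<psi> G"
proof (rule approximable_limit[OF \<psi> G])
  fix \<epsilon> :: real assume \<epsilon>: "\<epsilon> > 0"
  let ?M = "lebesgue_on \<Omega>"
  obtain \<rho> :: "real \<Rightarrow> real^'n \<Rightarrow> real" and A where \<rho>: "\<And>e. e > 0 \<Longrightarrow> mollifier e (\<rho> e)" "A > 0"
    "\<And>e k. e > 0 \<Longrightarrow> (LINT x|lborel. \<bar>partial k (\<rho> e) x\<bar>) \<le> A / e"
    using mollifier_exists by metis
  \<comment> \<open>A cutoff at infinity: 1 for \<open>norm x < real (Suc m)\<close>, 0 for
    \<open>norm x \<ge> 3 * real (Suc m)\<close>, with gradient of order 1/(m + 1).\<close>
  define \<kappa> where "\<kappa> m = conv (\<rho> (real (Suc m))) (indicator (ball 0 (2 * real (Suc m))))" for m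
  have U: "ball (0::real^'n) r \<in> sets lebesgue" "emeasure lebesgue (ball (0::real^'n) r) < \<infinity>" for r
    using fmeasurableD2[OF lmeasurable_ball[of 0 r]] by (auto simp: less_top)
  have mo: "mollifier (real (Suc m)) (\<rho> (real (Suc m)))" for m by (rule \<rho>(1)) simp
  note c = conv_indicator_smooth[OF mo U] conv_indicator_nonneg[OF mo U] conv_indicator_le_1[OF mo U]
    conv_indicator_eq_1[OF mo U] conv_indicator_eq_0[OF mo U] partial_conv_indicator_le[OF mo U]
  have \<kappa>_smooth: "smooth (\<kappa> m)" and \<kappa>0: "0 \<le> \<kappa> m x" and \<kappa>1: "\<kappa> m x \<le> 1" for m x
    unfolding \<kappa>_def using c by auto
  have \<kappa>_one: "\<kappa> m x = 1" if "norm x < real (Suc m)" for m x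
    unfolding \<kappa>_def
  proof (rule c(4), rule subsetI)
    fix y assume "y \<in> ball x (real (Suc m))"
    then have "norm (y - x) < real (Suc m)" by (simp add: dist_norm norm_minus_commute)
    moreover have "norm y \<le> norm (y - x) + norm x" by norm
    ultimately show "y \<in> ball 0 (2 * real (Suc m))" using that by simp
  qed
  have \<kappa>_zero: "\<kappa> m x = 0" if "norm x \<ge> 3 * real (Suc m)" for m x
    unfolding \<kappa>_def
  proof (rule c(5), rule ccontr)
    assume "ball x (real (Suc m)) \<inter> ball 0 (2 * real (Suc m)) \<noteq> {}"
    then obtain y where "norm (x - y) < real (Suc m)" "norm y < 2 * real (Suc m)"
      by (auto simp: dist_norm)
    moreover have "norm x \<le> norm (x - y) + norm y" by norm
    ultimately show False using that by simp
  qed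
  have \<kappa>_grad: "(norm (grad (\<kappa> m) x))\<^sup>2 \<le> real CARD('n) * (A / real (Suc m))\<^sup>2" for m x
  proof -
    have "\<bar>partial k (\<kappa> m) x\<bar> \<le> A / real (Suc m)" for k
      unfolding \<kappa>_def using c(6) \<rho>(3)[of "real (Suc m)"] by (meson of_nat_0_less_iff order_trans zero_less_Suc)
    then have "(partial k (\<kappa> m) x)\<^sup>2 \<le> (A / real (Suc m))\<^sup>2" for k
      by (metis abs_ge_zero power2_abs power_mono)
    then have "(\<Sum>k\<in>UNIV. (partial k (\<kappa> m) x)\<^sup>2) \<le> (\<Sum>k::'n\<in>UNIV. (A / real (Suc m))\<^sup>2)"
      by (intro sum_mono) auto
    then show ?thesis by (simp add: norm_vec_def L2_set_def sum_nonneg)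
  qed
  \<comment> \<open>One integrable weight that dominates both the \<open>L2\<close> error and the
    energy of the first error term; the factor 2 is the one of
    \<open>quadratic_add_le\<close>.\<close>
  define w where "w x = 2 * energy_density C G x + (\<psi> x)\<^sup>2" for x
  have w_int: "integrable ?M w"
    unfolding w_def[abs_def] using G L2D(2)[OF \<psi>] by (auto simp: finite_energy_def)
  have w_nonneg: "AE x in ?M. 0 \<le> w x"
    using energy_density_nonneg[of G] by eventually_elim (simp add: w_def)
  have \<kappa>m: "\<kappa> m \<in> borel_measurable ?M" for m by (rule smooth_lebesgue_on[OF \<kappa>_smooth])
  have sq_le: "(1 - t)\<^sup>2 * r \<le> r" "0 \<le> (1 - t)\<^sup>2 * r" if "0 \<le> t" "t \<le> 1" "0 \<le> r" for t r :: real
  proof -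
    have "(1 - t)\<^sup>2 \<le> 1" using that by (simp add: power_le_one)
    then show "(1 - t)\<^sup>2 * r \<le> r" using that(3) mult_right_mono by fastforce
  qed (use that in simp)
  have lim_m: "(\<lambda>m. LINT x|?M. (1 - \<kappa> m x)\<^sup>2 * w x) \<longlonglongrightarrow> (LINT x|?M. 0)"
  proof (rule integral_dominated_convergence[OF _ _ w_int])
    show "AE x in ?M. (\<lambda>m. (1 - \<kappa> m x)\<^sup>2 * w x) \<longlonglongrightarrow> 0"
    proof (rule AE_I2)
      fix x :: "real^'n"
      obtain m0 where "norm x < real m0" using reals_Archimedean2 by blast
      then show "(\<lambda>m. (1 - \<kappa> m x)\<^sup>2 * w x) \<longlonglongrightarrow> 0"
        by (intro tendsto_eventually eventually_sequentiallyI[of m0]) (simp add: \<kappa>_one)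
    qed
    show "AE x in ?M. norm ((1 - \<kappa> m x)\<^sup>2 * w x) \<le> w x" for m
      using w_nonneg by eventually_elim (use sq_le \<kappa>0 \<kappa>1 in auto)
  qed (use \<kappa>m w_int in auto)
  define S where "S = (LINT x|?M. (\<psi> x)\<^sup>2)"
  have S: "S \<ge> 0" by (simp add: S_def)
  define D where "D = 4 * B * (real CARD('n) * A\<^sup>2) * S"
  have lim_D: "(\<lambda>m. D * inverse (real (Suc m))) \<longlonglongrightarrow> D * 0"
    by (intro tendsto_intros LIMSEQ_inverse_real_of_nat)
  have "eventually (\<lambda>m. (LINT x|?M. (1 - \<kappa> m x)\<^sup>2 * w x) < \<epsilon> / 4) sequentially"
    using \<epsilon> lim_m by (intro order_tendstoD(2)) auto
  moreover have "eventually (\<lambda>m. D * inverse (real (Suc m)) < \<epsilon> / 4) sequentially"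
    using \<epsilon> lim_D by (intro order_tendstoD(2)) auto
  ultimately have "eventually (\<lambda>m. (LINT x|?M. (1 - \<kappa> m x)\<^sup>2 * w x) < \<epsilon> / 4 \<and> D * inverse (real (Suc m)) < \<epsilon> / 4) sequentially"
    by (rule eventually_conj)
  then obtain m where m: "(LINT x|?M. (1 - \<kappa> m x)\<^sup>2 * w x) < \<epsilon> / 4" "D * inverse (real (Suc m)) < \<epsilon> / 4"
    by (auto simp: eventually_sequentially)
  \<comment> \<open>Outside this ball \<open>\<kappa> m\<close> vanishes. The index \<open>m\<close>
    has to be fixed before the boundary cutoffs are chosen, since these depend on the
    radius.\<close>
  define R where "R = 3 * real (Suc m)"
  have "R > 0" by (simp add: R_def)
  then obtain \<eta> K where \<eta>: "\<And>N::nat. \<eta> N \<in> Cc_infinity \<Omega>" "\<And>N x. 0 \<le> \<eta> N x" "\<And>N x. \<eta> N x \<le> 1"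
     "\<And>x. x \<in> \<Omega> \<inter> ball 0 R \<Longrightarrow> (\<lambda>N. \<eta> N x) \<longlonglongrightarrow> 1"
     and H_ex: "\<And>N. \<exists>H. integrable ?M H \<and> (\<forall>x. 0 \<le> H x) \<and> (LINT x|?M. H x) \<le> K / real (Suc N)
          \<and> (AE x in ?M. x \<in> ball 0 R \<longrightarrow> energy_density C (grad (\<eta> N)) x \<le> H x)"
    using cut unfolding has_boundary_cutoffs_def by meson
  have \<eta>m: "\<eta> N \<in> borel_measurable ?M" for N by (rule smooth_lebesgue_on[OF Cc_infinity_smooth[OF \<eta>(1)]])
  have \<zeta>01: "0 \<le> \<kappa> m x * \<eta> N x" "\<kappa> m x * \<eta> N x \<le> 1" for N x
    using \<kappa>0 \<kappa>1 \<eta>(2,3) by (auto intro: mult_le_one)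
  have "(\<lambda>N. LINT x|?M. (1 - \<kappa> m x * \<eta> N x)\<^sup>2 * w x) \<longlonglongrightarrow> (LINT x|?M. (1 - \<kappa> m x)\<^sup>2 * w x)"
  proof (rule integral_dominated_convergence[OF _ _ w_int])
    show "AE x in ?M. (\<lambda>N. (1 - \<kappa> m x * \<eta> N x)\<^sup>2 * w x) \<longlonglongrightarrow> (1 - \<kappa> m x)\<^sup>2 * w x"
    proof (rule AE_I2)
      fix x assume "x \<in> space ?M"
      then have "x \<in> \<Omega>" by simp
      show "(\<lambda>N. (1 - \<kappa> m x * \<eta> N x)\<^sup>2 * w x) \<longlonglongrightarrow> (1 - \<kappa> m x)\<^sup>2 * w x"
      proof (cases "norm x < R")
        case True
        then have "(\<lambda>N. (1 - \<kappa> m x * \<eta> N x)\<^sup>2 * w x) \<longlonglongrightarrow> (1 - \<kappa> m x * 1)\<^sup>2 * w x"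
          using \<open>x \<in> \<Omega>\<close> by (intro tendsto_intros \<eta>(4)) auto
        then show ?thesis by simp
      next
        case False
        then show ?thesis using \<kappa>_zero[of m x] by (simp add: R_def)
      qed
    qed
    show "AE x in ?M. norm ((1 - \<kappa> m x * \<eta> N x)\<^sup>2 * w x) \<le> w x" for N
      using w_nonneg by eventually_elim (use sq_le \<zeta>01 in auto)
  qed (use \<kappa>m \<eta>m w_int in auto)
  from order_tendstoD(2)[OF this m(1)]
  have ev1: "eventually (\<lambda>N. (LINT x|?M. (1 - \<kappa> m x * \<eta> N x)\<^sup>2 * w x) < \<epsilon> / 4) sequentially" .
  have "(\<lambda>N. 4 * M\<^sup>2 * K * inverse (real (Suc N))) \<longlonglongrightarrow> 4 * M\<^sup>2 * K * 0"
    by (intro tendsto_intros LIMSEQ_inverse_real_of_nat)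
  then have "eventually (\<lambda>N. 4 * M\<^sup>2 * K * inverse (real (Suc N)) < \<epsilon> / 4) sequentially"
    using \<epsilon> by (intro order_tendstoD(2)) auto
  from eventually_conj[OF ev1 this] obtain N where N: "(LINT x|?M. (1 - \<kappa> m x * \<eta> N x)\<^sup>2 * w x) < \<epsilon> / 4"
    "4 * M\<^sup>2 * K * inverse (real (Suc N)) < \<epsilon> / 4"
    by (auto simp: eventually_sequentially)
  obtain H where H: "integrable ?M H" "\<And>x. 0 \<le> H x" "(LINT x|?M. H x) \<le> K / real (Suc N)"
    "AE x in ?M. x \<in> ball 0 R \<longrightarrow> energy_density C (grad (\<eta> N)) x \<le> H x"
    using H_ex[of N] by blast
  define \<zeta> where "\<zeta> x = \<kappa> m x * \<eta> N x" for x
  have \<zeta>: "\<zeta> \<in> Cc_infinity \<Omega>" unfolding \<zeta>_def by (rule Cc_infinity_mult[OF \<eta>(1) \<kappa>_smooth])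
  have \<zeta>b: "0 \<le> \<zeta> x" "\<zeta> x \<le> 1" for x unfolding \<zeta>_def by (rule \<zeta>01)+
  have \<zeta>m: "\<zeta> \<in> borel_measurable ?M" by (rule smooth_lebesgue_on[OF Cc_infinity_smooth[OF \<zeta>]])
  have grad_\<zeta>: "grad \<zeta> x = \<eta> N x *\<^sub>R grad (\<kappa> m) x + \<kappa> m x *\<^sub>R grad (\<eta> N) x" for x
    unfolding \<zeta>_def
    by (simp add: vec_eq_iff partial_mult smooth_differentiable \<kappa>_smooth Cc_infinity_smooth[OF \<eta>(1)] mult.commute)
  let ?h = "\<lambda>x. \<zeta> x *\<^sub>R G x + \<psi> x *\<^sub>R grad \<zeta> x"
  have app: "approximable (\<lambda>x. \<psi> x * \<zeta> x) ?h"
    by (rule approximable_test_mult[OF wg \<psi> G \<zeta>])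
  have i1: "integrable ?M (\<lambda>x. (1 - \<zeta> x)\<^sup>2 * w x)"
  proof (rule Bochner_Integration.integrable_bound[OF w_int])
    show "AE x in ?M. norm ((1 - \<zeta> x)\<^sup>2 * w x) \<le> norm (w x)"
      using w_nonneg by eventually_elim (use sq_le \<zeta>b in auto)
  qed (use \<zeta>m w_int in auto)
  have l1: "(LINT x|?M. (\<psi> x * \<zeta> x - \<psi> x)\<^sup>2) < \<epsilon>"
  proof -
    have "(LINT x|?M. (\<psi> x * \<zeta> x - \<psi> x)\<^sup>2) \<le> (LINT x|?M. (1 - \<zeta> x)\<^sup>2 * w x)"
    proof (rule integral_mono_AE[OF _ i1])
      show "integrable ?M (\<lambda>x. (\<psi> x * \<zeta> x - \<psi> x)\<^sup>2)"
        using app \<psi> L2D(2)[OF L2_diff] by (auto simp: approximable_def)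
      show "AE x in ?M. (\<psi> x * \<zeta> x - \<psi> x)\<^sup>2 \<le> (1 - \<zeta> x)\<^sup>2 * w x"
        using energy_density_nonneg[of G]
      proof eventually_elim
        case (elim x)
        have "(\<psi> x * \<zeta> x - \<psi> x)\<^sup>2 = (1 - \<zeta> x)\<^sup>2 * (\<psi> x)\<^sup>2"
          by (simp add: power2_eq_square algebra_simps)
        also have "\<dots> \<le> (1 - \<zeta> x)\<^sup>2 * w x"
          using elim by (intro mult_left_mono) (auto simp: w_def)
        finally show ?case .
      qed
    qed
    then show ?thesis using N(1) \<epsilon> unfolding \<zeta>_def by simp
  qed
  have l2: "energy \<Omega> C (\<lambda>x. ?h x - G x) < \<epsilon>"
  proof -
    define P where "P = 4 * B * (real CARD('n) * (A / real (Suc m))\<^sup>2)"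
    have P: "P \<ge> 0" using B_pos by (simp add: P_def)
    let ?Q = "\<lambda>x. (1 - \<zeta> x)\<^sup>2 * w x + P * (\<psi> x)\<^sup>2 + 4 * M\<^sup>2 * H x"
    have Qi: "integrable ?M ?Q" using i1 L2D(2)[OF \<psi>] H(1) by auto
    have "energy \<Omega> C (\<lambda>x. ?h x - G x) \<le> (LINT x|?M. ?Q x)"
    proof (rule finite_energyI(2)[OF _ Qi])
      show "(\<lambda>x. (?h x - G x) $ k) \<in> borel_measurable ?M" for k
        using app finite_energy_diff[OF _ G, of ?h] unfolding approximable_def finite_energy_def by blast
      show "AE x in ?M. energy_density C (\<lambda>x. ?h x - G x) x \<le> ?Q x"
        using good H(4)
      proof eventually_elim
        case (elim x)
        let ?q = "\<lambda>\<xi>. \<xi> \<bullet> (C x *v \<xi>)"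
        have q0: "0 \<le> ?q \<xi>" for \<xi> by (rule quadratic_nonneg[OF elim(1)])
        have qs: "?q (t *\<^sub>R \<xi>) = t\<^sup>2 * ?q \<xi>" for t \<xi>
          by (simp add: matrix_vector_mult_scaleR power2_eq_square)
        have "?h x - G x = (\<zeta> x - 1) *\<^sub>R G x + ((\<psi> x * \<eta> N x) *\<^sub>R grad (\<kappa> m) x + (\<psi> x * \<kappa> m x) *\<^sub>R grad (\<eta> N) x)"
          by (simp add: grad_\<zeta> algebra_simps)
        then have "energy_density C (\<lambda>x. ?h x - G x) x
           \<le> 2 * ?q ((\<zeta> x - 1) *\<^sub>R G x) + 2 * (2 * ?q ((\<psi> x * \<eta> N x) *\<^sub>R grad (\<kappa> m) x) + 2 * ?q ((\<psi> x * \<kappa> m x) *\<^sub>R grad (\<eta> N) x))"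
          unfolding energy_density_eq
          using quadratic_add_le[OF elim(1), of "(\<zeta> x - 1) *\<^sub>R G x" "(\<psi> x * \<eta> N x) *\<^sub>R grad (\<kappa> m) x + (\<psi> x * \<kappa> m x) *\<^sub>R grad (\<eta> N) x"]
            quadratic_add_le[OF elim(1), of "(\<psi> x * \<eta> N x) *\<^sub>R grad (\<kappa> m) x" "(\<psi> x * \<kappa> m x) *\<^sub>R grad (\<eta> N) x"]
          by simp
        also have "\<dots> = 2 * ((\<zeta> x - 1)\<^sup>2 * ?q (G x)) + 4 * ((\<psi> x * \<eta> N x)\<^sup>2 * ?q (grad (\<kappa> m) x)) + 4 * ((\<psi> x * \<kappa> m x)\<^sup>2 * ?q (grad (\<eta> N) x))"
          unfolding qs by simp
        also have "\<dots> \<le> (1 - \<zeta> x)\<^sup>2 * w x + P * (\<psi> x)\<^sup>2 + 4 * M\<^sup>2 * H x"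
        proof (intro add_mono)
          have "(\<zeta> x - 1)\<^sup>2 * (2 * ?q (G x)) \<le> (\<zeta> x - 1)\<^sup>2 * w x"
            by (intro mult_left_mono) (simp_all add: w_def energy_density_eq)
          then show "2 * ((\<zeta> x - 1)\<^sup>2 * ?q (G x)) \<le> (1 - \<zeta> x)\<^sup>2 * w x"
            by (simp add: power2_commute[of _ 1] mult.left_commute)
          have e1: "(\<eta> N x)\<^sup>2 \<le> 1" using \<eta>(2,3) by (simp add: power_le_one)
          have "?q (grad (\<kappa> m) x) \<le> B * (norm (grad (\<kappa> m) x))\<^sup>2" using elim(1) by (simp add: good_matrix_def)
          also have "\<dots> \<le> B * (real CARD('n) * (A / real (Suc m))\<^sup>2)"
            using B_pos \<kappa>_grad by (intro mult_left_mono) auto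
          finally have "(\<psi> x * \<eta> N x)\<^sup>2 * ?q (grad (\<kappa> m) x) \<le> (\<psi> x)\<^sup>2 * (B * (real CARD('n) * (A / real (Suc m))\<^sup>2))"
            using e1 q0 mult_left_mono[OF e1, of "(\<psi> x)\<^sup>2"] by (intro mult_mono) (auto simp: power_mult_distrib)
          then show "4 * ((\<psi> x * \<eta> N x)\<^sup>2 * ?q (grad (\<kappa> m) x)) \<le> P * (\<psi> x)\<^sup>2"
            by (simp add: P_def mult_ac)
          show "4 * ((\<psi> x * \<kappa> m x)\<^sup>2 * ?q (grad (\<eta> N) x)) \<le> 4 * M\<^sup>2 * H x"
          proof (cases "x \<in> ball 0 R")
            case True
            then have qH: "?q (grad (\<eta> N) x) \<le> H x" using elim(2) by (simp add: energy_density_eq)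
            have "\<bar>\<psi> x * \<kappa> m x\<bar> \<le> \<bar>M\<bar> * 1"
              unfolding abs_mult using bound[of x] \<kappa>0[of m x] \<kappa>1[of m x] by (intro mult_mono) auto
            then have "(\<psi> x * \<kappa> m x)\<^sup>2 \<le> M\<^sup>2" by (simp add: abs_le_square_iff)
            then have "(\<psi> x * \<kappa> m x)\<^sup>2 * ?q (grad (\<eta> N) x) \<le> M\<^sup>2 * H x"
              using qH q0 by (intro mult_mono) auto
            then show ?thesis by simp
          next
            case False
            then show ?thesis using \<kappa>_zero[of m x] H(2)[of x] by (simp add: R_def)
          qed
        qed
        finally show ?case .
      qed
    qed
    also have "\<dots> = (LINT x|?M. (1 - \<zeta> x)\<^sup>2 * w x) + P * S + 4 * M\<^sup>2 * (LINT x|?M. H x)"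
      using i1 L2D(2)[OF \<psi>] H(1) by (simp add: S_def)
    also have "P * S \<le> D * inverse (real (Suc m))"
    proof -
      have "inverse (real (Suc m)) * inverse (real (Suc m)) \<le> inverse (real (Suc m)) * 1"
        by (intro mult_left_mono) (auto simp: field_simps)
      then have i2: "(inverse (real (Suc m)))\<^sup>2 \<le> inverse (real (Suc m))"
        by (simp add: power2_eq_square)
      have "P * S = D * (inverse (real (Suc m)))\<^sup>2"
        by (simp add: P_def D_def power_mult_distrib power_inverse divide_inverse)
      also have "\<dots> \<le> D * inverse (real (Suc m))"
        using i2 S B_pos by (intro mult_left_mono) (auto simp: D_def)
      finally show ?thesis .
    qed
    also have "4 * M\<^sup>2 * (LINT x|?M. H x) \<le> 4 * M\<^sup>2 * K * inverse (real (Suc N))"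
      using mult_left_mono[OF H(3), of "4 * M\<^sup>2"] by (simp add: divide_inverse mult.assoc)
    finally show ?thesis
      using N m(2) \<epsilon> unfolding \<zeta>_def by linarith
  qed
  show "\<exists>\<psi>' h. approximable \<psi>' h \<and> (LINT x|?M. (\<psi>' x - \<psi> x)\<^sup>2) < \<epsilon> \<and> energy \<Omega> C (\<lambda>x. h x - G x) < \<epsilon>"
    using app l1 l2 by blast
qed

text \<open>Differentiation is a shift of phase by a quarter period, so the derivatives of a
  sin(t/a) of all orders have one closed form, as the hypothesis of \<open>weak_chain_rule\<close>
  demands.\<close>

lemma sine_derivatives:
  fixes a :: real
  assumes "a \<noteq> 0"
  shows "((\<lambda>t. a * (1 / a) ^ n * sin (t / a + real n * (pi / 2))) has_real_derivative
     a * (1 / a) ^ Suc n * sin (t / a + real (Suc n) * (pi / 2))) (at t)"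
proof -
  have "t / a + real (Suc n) * (pi / 2) = (t / a + real n * (pi / 2)) + pi / 2"
    by (simp add: algebra_simps)
  then have "sin (t / a + real (Suc n) * (pi / 2)) = cos (t / a + real n * (pi / 2))"
    by (simp only: sin_add) simp
  then show ?thesis
    using assms by (auto intro!: derivative_eq_intros simp: field_simps)
qed

text \<open>Reduction to bounded functions by the truncations a sin(t/a) with a = n + 1. They are
  smooth, bounded by a, 1-Lipschitz with Lipschitz derivative, and they tend to t with derivative
  tending to 1. Unlike a clamp they fall under the smooth chain rule, and dominated convergence
  gives convergence in \<open>L2\<close> and in energy.\<close>

lemma approximable_if_cutoffs:
  assumes wg: "weak_gradient \<Omega> \<phi> g" and \<phi>: "\<phi> \<in> L2 \<Omega>" and g: "finite_energy \<Omega> C g"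
    and cut: has_boundary_cutoffs
  shows "approximable \<phi> g"
proof (rule approximable_limit[OF \<phi> g])
  fix \<epsilon> :: real assume \<epsilon>: "\<epsilon> > 0"
  let ?M = "lebesgue_on \<Omega>"
  define a where "a n = real (Suc n)" for n
  have a: "a n \<noteq> 0" "a n > 0" "a n \<ge> 1" for n by (auto simp: a_def)
  define F where "F n t = a n * sin (t / a n)" for n t
  define F' where "F' n t = cos (t / a n)" for n t
  have sin_lip: "\<bar>sin s - sin t\<bar> \<le> \<bar>s - t\<bar>" for s t :: real
  proof -
    have "norm (sin s - sin t) \<le> 1 * norm (s - t)"
      by (rule field_differentiable_bound[of UNIV sin cos]) (auto intro: DERIV_subset[OF DERIV_sin])
    then show ?thesis by simp
  qed
  have cos_lip: "\<bar>cos s - cos t\<bar> \<le> \<bar>s - t\<bar>" for s t :: real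
    using sin_lip[of "pi / 2 - s" "pi / 2 - t"] by (simp add: sin_cos_eq[symmetric] cos_sin_eq abs_minus_commute)
  have F_lip: "\<bar>F n s - F n t\<bar> \<le> \<bar>s - t\<bar>" for n s t
  proof -
    have "\<bar>F n s - F n t\<bar> = a n * \<bar>sin (s / a n) - sin (t / a n)\<bar>"
      using a(2)[of n] by (simp add: F_def abs_mult flip: right_diff_distrib)
    also have "\<dots> \<le> a n * \<bar>s / a n - t / a n\<bar>"
      using a(2)[of n] by (intro mult_left_mono sin_lip) simp
    also have "\<dots> = \<bar>s - t\<bar>" using a(2)[of n] by (simp add: abs_divide flip: diff_divide_distrib)
    finally show ?thesis .
  qed
  have F'_lip: "\<bar>F' n s - F' n t\<bar> \<le> (1 / a n) * \<bar>s - t\<bar>" for n s t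
    using cos_lip[of "s / a n" "t / a n"] a(2)[of n] by (simp add: F'_def abs_divide flip: diff_divide_distrib)
  define D where "D n i t = a n * (1 / a n) ^ i * sin (t / a n + real i * (pi / 2))" for n i t
  have D: "(D n i has_real_derivative D n (Suc i) t) (at t)" for n i t
    unfolding D_def[abs_def] by (rule sine_derivatives[OF a(1)])
  have D0: "D n 0 = F n" for n by (rule ext) (simp add: D_def F_def)
  have D1: "D n 1 = F' n" for n
    using a(1)[of n] by (intro ext) (simp add: D_def F'_def cos_sin_eq add.commute sin_add)
  note chain = weak_chain_rule[OF wg L2_imp_L2_loc[OF \<phi>] finite_energy_L2_loc[OF g] open_\<Omega>, of "D _", OF D, unfolded D0 D1]
  have F0: "F n 0 = 0" for n by (simp add: F_def)
  have F'b: "\<bar>F' n t\<bar> \<le> 1" for n t by (simp add: F'_def)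
  note wgF = chain(1)[OF F0 F_lip F'b F'_lip]
  have Fm: "F n \<in> borel_measurable borel" "F' n \<in> borel_measurable borel" for n
    unfolding F_def[abs_def] F'_def[abs_def] by (intro borel_measurable_continuous_onI continuous_intros; simp add: a)+
  have \<phi>m: "\<phi> \<in> borel_measurable ?M" and gm: "(\<lambda>x. g x $ k) \<in> borel_measurable ?M" for k
    using \<phi> g by (auto simp: L2_def finite_energy_def)
  have m: "(\<lambda>x. F n (\<phi> x)) \<in> borel_measurable ?M" "(\<lambda>x. F' n (\<phi> x)) \<in> borel_measurable ?M" for n
    by (rule measurable_compose[OF \<phi>m Fm(1)], rule measurable_compose[OF \<phi>m Fm(2)])
  have F_abs: "\<bar>F n t\<bar> \<le> \<bar>t\<bar>" for n t using F_lip[of n t 0] F0 by simp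
  have FL2: "(\<lambda>x. F n (\<phi> x)) \<in> L2 \<Omega>" for n
    unfolding L2_def
  proof (intro CollectI conjI m)
    show "integrable ?M (\<lambda>x. (F n (\<phi> x))\<^sup>2)"
      by (rule Bochner_Integration.integrable_bound[OF L2D(2)[OF \<phi>]])
        (use m F_abs in \<open>auto simp: abs_le_square_iff[symmetric]\<close>)
  qed
  have sm: "(\<lambda>x. (w x *\<^sub>R g x) $ k) \<in> borel_measurable ?M" if "w \<in> borel_measurable ?M" for w k
    using that gm by (auto intro!: borel_measurable_times)
  have gi: "integrable ?M (energy_density C g)" using g by (simp add: finite_energy_def)
  have Fe: "finite_energy \<Omega> C (\<lambda>x. F' n (\<phi> x) *\<^sub>R g x)" for n
  proof (rule finite_energyI(1)[OF sm[OF m(2)] gi])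
    show "AE x in ?M. energy_density C (\<lambda>x. F' n (\<phi> x) *\<^sub>R g x) x \<le> energy_density C g x"
      using energy_density_nonneg[of g]
    proof eventually_elim
      case (elim x)
      have "(F' n (\<phi> x))\<^sup>2 \<le> 1" using F'b by (simp add: abs_square_le_1)
      then show ?case unfolding energy_density_scale using elim by (rule mult_left_le_one_le[rotated 2]) simp
    qed
  qed
  have F_bd: "\<bar>F n t\<bar> \<le> a n" for n t
    using a(2)[of n] by (simp add: F_def abs_mult mult_left_le)
  have app: "approximable (\<lambda>x. F n (\<phi> x)) (\<lambda>x. F' n (\<phi> x) *\<^sub>R g x)" for n
    by (rule approximable_bounded[OF wgF FL2 Fe F_bd cut])
  have lim0: "(\<lambda>n. t / a n) \<longlonglongrightarrow> 0" for t
    using tendsto_mult[OF tendsto_const LIMSEQ_inverse_real_of_nat, of t] by (simp add: a_def divide_inverse)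
  have F'_lim: "(\<lambda>n. F' n t) \<longlonglongrightarrow> 1" for t
    unfolding F'_def using tendsto_cos[OF lim0[of t]] by simp
  have F_lim: "(\<lambda>n. F n t) \<longlonglongrightarrow> t" for t
  proof -
    have "\<bar>F n t - t\<bar> \<le> \<bar>t\<bar> * \<bar>t / a n\<bar>" for n
    proof -
      \<comment> \<open>The derivative of sin x - x is cos x - 1, of absolute value at most |x|. The
        difference is therefore quadratic in t/a, and after multiplication by a it is still of order
        1/a.\<close>
      have "norm ((sin (t / a n) - t / a n) - (sin 0 - 0)) \<le> \<bar>t / a n\<bar> * norm (t / a n - 0)"
      proof (rule field_differentiable_bound[of "cball 0 \<bar>t / a n\<bar>" "\<lambda>x. sin x - x" "\<lambda>x. cos x - 1"])
        show "((\<lambda>x. sin x - x) has_field_derivative cos z - 1) (at z within cball 0 \<bar>t / a n\<bar>)" for z :: real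
          by (auto intro!: derivative_eq_intros)
        show "norm (cos z - 1) \<le> \<bar>t / a n\<bar>" if "z \<in> cball 0 \<bar>t / a n\<bar>" for z :: real
          using cos_lip[of z 0] that by simp
      qed auto
      then have "a n * \<bar>sin (t / a n) - t / a n\<bar> \<le> a n * (\<bar>t / a n\<bar> * \<bar>t / a n\<bar>)"
        using a(2)[of n] by (intro mult_left_mono) auto
      moreover have "a n * \<bar>sin (t / a n) - t / a n\<bar> = \<bar>F n t - t\<bar>"
        using a(2)[of n] by (simp add: F_def abs_mult[symmetric, of "a n", simplified] right_diff_distrib abs_mult_pos' )
      moreover have "a n * (\<bar>t / a n\<bar> * \<bar>t / a n\<bar>) = \<bar>t\<bar> * \<bar>t / a n\<bar>"
        using a(2)[of n] by (simp add: abs_divide)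
      ultimately show ?thesis by simp
    qed
    moreover have "(\<lambda>n. \<bar>t\<bar> * \<bar>t / a n\<bar>) \<longlonglongrightarrow> \<bar>t\<bar> * \<bar>0\<bar>"
      by (intro tendsto_intros lim0)
    ultimately have "(\<lambda>n. F n t - t) \<longlonglongrightarrow> 0"
      by (intro Lim_null_comparison[of "\<lambda>n. F n t - t" "\<lambda>n. \<bar>t\<bar> * \<bar>t / a n\<bar>"]) (auto intro!: always_eventually)
    then show ?thesis by (simp add: LIM_zero_iff)
  qed
  have "(\<lambda>n. LINT x|?M. (F n (\<phi> x) - \<phi> x)\<^sup>2) \<longlonglongrightarrow> (LINT x|?M. 0)"
  proof (rule integral_dominated_convergence[where w="\<lambda>x. 4 * (\<phi> x)\<^sup>2"])
    show "AE x in ?M. (\<lambda>n. (F n (\<phi> x) - \<phi> x)\<^sup>2) \<longlonglongrightarrow> 0"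
    proof (rule AE_I2)
      fix x
      have "(\<lambda>n. (F n (\<phi> x) - \<phi> x)\<^sup>2) \<longlonglongrightarrow> (\<phi> x - \<phi> x)\<^sup>2"
        by (intro tendsto_intros F_lim)
      then show "(\<lambda>n. (F n (\<phi> x) - \<phi> x)\<^sup>2) \<longlonglongrightarrow> 0" by simp
    qed
    show "AE x in ?M. norm ((F n (\<phi> x) - \<phi> x)\<^sup>2) \<le> 4 * (\<phi> x)\<^sup>2" for n
    proof (rule AE_I2)
      fix x
      have "\<bar>F n (\<phi> x) - \<phi> x\<bar> \<le> \<bar>2 * \<phi> x\<bar>" using F_abs[of n "\<phi> x"] by linarith
      then have "(F n (\<phi> x) - \<phi> x)\<^sup>2 \<le> (2 * \<phi> x)\<^sup>2" by (simp only: abs_le_square_iff)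
      then show "norm ((F n (\<phi> x) - \<phi> x)\<^sup>2) \<le> 4 * (\<phi> x)\<^sup>2" by (simp add: power_mult_distrib)
    qed
  qed (use m \<phi>m L2D(2)[OF \<phi>] in auto)
  then have ev1: "eventually (\<lambda>n. (LINT x|?M. (F n (\<phi> x) - \<phi> x)\<^sup>2) < \<epsilon>) sequentially"
    using \<epsilon> by (intro order_tendstoD(2)) auto
  have eq: "energy_density C (\<lambda>x. F' n (\<phi> x) *\<^sub>R g x - g x) x = (F' n (\<phi> x) - 1)\<^sup>2 * energy_density C g x" for n x
    using energy_density_scale[of "\<lambda>x. F' n (\<phi> x) - 1" g x] by (simp add: scaleR_left_diff_distrib)
  have "(\<lambda>n. energy \<Omega> C (\<lambda>x. F' n (\<phi> x) *\<^sub>R g x - g x)) \<longlonglongrightarrow> (LINT x|?M. 0)"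
    unfolding energy_def eq
  proof (rule integral_dominated_convergence[where w="\<lambda>x. 4 * energy_density C g x"])
    show "AE x in ?M. (\<lambda>n. (F' n (\<phi> x) - 1)\<^sup>2 * energy_density C g x) \<longlonglongrightarrow> 0"
    proof (rule AE_I2)
      fix x
      have "(\<lambda>n. (F' n (\<phi> x) - 1)\<^sup>2 * energy_density C g x) \<longlonglongrightarrow> (1 - 1)\<^sup>2 * energy_density C g x"
        by (intro tendsto_intros F'_lim)
      then show "(\<lambda>n. (F' n (\<phi> x) - 1)\<^sup>2 * energy_density C g x) \<longlonglongrightarrow> 0" by simp
    qed
    show "AE x in ?M. norm ((F' n (\<phi> x) - 1)\<^sup>2 * energy_density C g x) \<le> 4 * energy_density C g x" for n
      using energy_density_nonneg[of g]
    proof eventually_elim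
      case (elim x)
      have "\<bar>F' n (\<phi> x) - 1\<bar> \<le> \<bar>2\<bar>" using F'b[of n "\<phi> x"] by linarith
      then have "(F' n (\<phi> x) - 1)\<^sup>2 \<le> 2\<^sup>2" by (simp only: abs_le_square_iff)
      then show ?case using elim by (simp add: abs_mult mult_right_mono)
    qed
  qed (use m gi in auto)
  then have ev2: "eventually (\<lambda>n. energy \<Omega> C (\<lambda>x. F' n (\<phi> x) *\<^sub>R g x - g x) < \<epsilon>) sequentially"
    using \<epsilon> by (intro order_tendstoD(2)) auto
  from eventually_conj[OF ev1 ev2] obtain n where "(LINT x|?M. (F n (\<phi> x) - \<phi> x)\<^sup>2) < \<epsilon>"
    "energy \<Omega> C (\<lambda>x. F' n (\<phi> x) *\<^sub>R g x - g x) < \<epsilon>"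
    by (auto simp: eventually_sequentially)
  then show "\<exists>\<psi> h. approximable \<psi> h \<and> (LINT x|?M. (\<psi> x - \<phi> x)\<^sup>2) < \<epsilon> \<and> energy \<Omega> C (\<lambda>x. h x - g x) < \<epsilon>"
    using app by blast
qed

lemma markov_unique_if_cutoffs:
  assumes has_boundary_cutoffs
  shows "markov_unique \<Omega> C"
  unfolding markov_unique_def
proof (rule antisym[OF h_D_subset_h_N], rule subsetI)
  fix z assume z: "z \<in> h_N \<Omega> C"
  obtain \<phi> v where zz: "z = (\<phi>, v)" by (cases z)
  show "z \<in> h_D \<Omega> C"
    using z unfolding zz
  proof (rule h_ND)
    fix g assume g: "weak_gradient \<Omega> \<phi> g" "\<phi> \<in> L2 \<Omega>" "finite_energy \<Omega> C g" "v = energy \<Omega> C g"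
    have "approximable \<phi> g" by (rule approximable_if_cutoffs[OF g(1-3) assms])
    then show "(\<phi>, v) \<in> h_D \<Omega> C"
      unfolding g(4) approximable_def by (intro h_DI) auto
  qed
qed

end

subsection \<open>Ahlfors regular sets\<close>

text \<open>The given measure lives on a subspace and may be infinite. Restricting it to
  \<open>G \<inter> ball z R\<close> and transporting it to the Borel sets of the whole space gives
  a finite measure, so that Tonelli's theorem applies to its product with
  \<open>lborel\<close>.\<close>

lemma ahlfors_finite_measure:
  fixes G :: "(real^'n) set"
  assumes reg: "ahlfors_regular s G" and G: "closed G" and z: "z \<in> G" and R: "R > 0"
  obtains \<nu> c where "finite_measure \<nu>" "sets \<nu> = sets borel" "c > 0"
    "emeasure \<nu> (- (G \<inter> ball z R)) = 0"
    "\<And>x r. x \<in> G \<inter> ball z R \<Longrightarrow> 0 < r \<Longrightarrow> r < 2 * R \<Longrightarrow> ennreal (r powr s / c) \<le> emeasure \<nu> (ball x r)"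
    "\<And>x r. x \<in> G \<inter> ball z R \<Longrightarrow> 0 < r \<Longrightarrow> r < 2 * R \<Longrightarrow> emeasure \<nu> (ball x r) \<le> ennreal (c * r powr s)"
proof -
  obtain \<mu> where \<mu>0: "regular_borel_measure_on G \<mu>"
    and bd: "\<forall>x0\<in>G. \<forall>R0>0. \<exists>c>0. \<forall>x\<in>G \<inter> ball x0 R0. \<forall>r. 0 < r \<and> r < 2 * R0 \<longrightarrow>
          ennreal (r powr s / c) \<le> emeasure \<mu> (G \<inter> ball x0 R0 \<inter> ball x r)
        \<and> emeasure \<mu> (G \<inter> ball x0 R0 \<inter> ball x r) \<le> ennreal (c * r powr s)"
    using reg unfolding ahlfors_regular_def by (elim exE conjE)
  have \<mu>: "sets \<mu> = sets (restrict_space borel G)"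
    using \<mu>0 by (simp add: regular_borel_measure_on_def)
  obtain c where c0: "c > 0" and c1: "\<forall>x\<in>G \<inter> ball z R. \<forall>r. 0 < r \<and> r < 2 * R \<longrightarrow>
          ennreal (r powr s / c) \<le> emeasure \<mu> (G \<inter> ball z R \<inter> ball x r)
        \<and> emeasure \<mu> (G \<inter> ball z R \<inter> ball x r) \<le> ennreal (c * r powr s)"
    using bd[THEN bspec, OF z, THEN spec, THEN mp, OF R] by (elim exE conjE)
  note c = c0 c1[rule_format, OF _ conjI]
  define A where "A = G \<inter> ball z R"
  have sp: "space \<mu> = G"
    using sets_eq_imp_space_eq[OF \<mu>] by (simp add: space_restrict_space)
  have GB: "G \<inter> E \<in> sets \<mu>" if "E \<in> sets borel" for E
    unfolding \<mu> sets_restrict_space using that by blast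
  have A: "A \<in> sets \<mu>" unfolding A_def by (rule GB) simp
  have idm: "(\<lambda>x. x) \<in> measurable (restrict_space \<mu> A) borel"
  proof (rule measurable_restrict_space1, rule measurableI)
    fix E :: "(real^'n) set" assume "E \<in> sets borel"
    then show "(\<lambda>x. x) -` E \<inter> space \<mu> \<in> sets \<mu>" using GB[of E] by (simp add: sp Int_commute)
  qed simp
  define \<nu> where "\<nu> = distr (restrict_space \<mu> A) borel (\<lambda>x. x)"
  have \<nu>: "emeasure \<nu> E = emeasure \<mu> (A \<inter> E)" if E: "E \<in> sets borel" for E
  proof -
    have "emeasure \<nu> E = emeasure (restrict_space \<mu> A) (E \<inter> A)"
      unfolding \<nu>_def using A sets.sets_into_space[OF A]
      by (subst emeasure_distr[OF idm E]) (simp add: space_restrict_space Int_absorb2)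
    also have "\<dots> = emeasure \<mu> (E \<inter> A)"
    proof (rule emeasure_restrict_space)
      have "A \<inter> space \<mu> = A" by (auto simp: A_def sp)
      then show "A \<inter> space \<mu> \<in> sets \<mu>" using A by simp
    qed simp
    finally show ?thesis by (simp add: Int_commute)
  qed
  show thesis
  proof (rule that[of \<nu> c])
    show "sets \<nu> = sets borel" by (simp add: \<nu>_def)
    \<comment> \<open>Finiteness is the upper regularity bound for the ball around \<open>z\<close>
      of radius \<open>R\<close> itself, which is an admissible radius below
      \<open>2 * R\<close>.\<close>
    have "emeasure \<nu> (space \<nu>) = emeasure \<mu> (A \<inter> UNIV)"
      using \<nu>[of UNIV] by (simp add: \<nu>_def)
    also have "A \<inter> UNIV = G \<inter> ball z R \<inter> ball z R" by (auto simp: A_def)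
    also have "emeasure \<mu> \<dots> \<le> ennreal (c * R powr s)"
      using c(2)[of z R] z R by auto
    finally show "finite_measure \<nu>" by (intro finite_measureI) (auto simp: top_unique)
    show "c > 0" by (rule c)
    have "- (G \<inter> ball z R) \<in> sets borel" using G by auto
    then have "emeasure \<nu> (- (G \<inter> ball z R)) = emeasure \<mu> (A \<inter> - (G \<inter> ball z R))" by (rule \<nu>)
    also have "A \<inter> - (G \<inter> ball z R) = {}" by (auto simp: A_def)
    finally show "emeasure \<nu> (- (G \<inter> ball z R)) = 0" by simp
    show "ennreal (r powr s / c) \<le> emeasure \<nu> (ball x r)" "emeasure \<nu> (ball x r) \<le> ennreal (c * r powr s)"
      if "x \<in> G \<inter> ball z R" "0 < r" "r < 2 * R" for x r
      using c(2)[OF that] \<nu>[of "ball x r"] by (auto simp: A_def)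
  qed
qed

lemma infdist_lt_obtain:
  fixes G :: "'a::heine_borel set"
  assumes "closed G" "G \<noteq> {}" "infdist x G < p"
  obtains q where "q \<in> G" "dist x q < p"
  using infdist_attains_inf[OF assms(1,2), of x] assms(3) by metis

text \<open>Double counting in place of a covering: the set of pairs of a tube point and a boundary
  point closer than 2p is measured in both orders. Each tube point sees boundary measure at least of
  order p^s, each boundary point sees volume of order p^d.\<close>

lemma tube_volume:
  fixes G :: "(real^'n) set"
  assumes reg: "ahlfors_regular s G" and G: "closed G" "G \<noteq> {}" and R: "R > 0"
  obtains K where "K > 0"
    "\<And>p. 0 < p \<Longrightarrow> p \<le> 1 \<Longrightarrow> emeasure lborel {x \<in> ball 0 R. infdist x G < p} \<le> ennreal (K * p powr (real CARD('n) - s))"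
proof -
  obtain z where z: "z \<in> G" using G by auto
  \<comment> \<open>Large enough for \<open>ball z R1\<close> to contain every point of
    \<open>G\<close> within distance 1 of the ball of radius \<open>R\<close> about the
    origin.\<close>
  define R1 where "R1 = norm z + R + 2"
  have R1: "R1 > 0" using R by (simp add: R1_def add_nonneg_pos)
  obtain \<nu> c where \<nu>: "finite_measure \<nu>" "sets \<nu> = sets borel" "c > 0"
    "\<And>x r. x \<in> G \<inter> ball z R1 \<Longrightarrow> 0 < r \<Longrightarrow> r < 2 * R1 \<Longrightarrow> ennreal (r powr s / c) \<le> emeasure \<nu> (ball x r)"
    by (rule ahlfors_finite_measure[OF reg G(1) z R1]) blast
  interpret \<nu>: finite_measure \<nu> by (rule \<nu>(1))
  interpret P: pair_sigma_finite lborel \<nu>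
    by unfold_locales
  have [measurable_cong]: "sets \<nu> = sets borel" by (rule \<nu>(2))
  define m where "m = measure \<nu> (space \<nu>)"
  define \<omega> where "\<omega> = unit_ball_vol (real CARD('n))"
  define K where "K = c * (\<omega> * 2 ^ CARD('n) * m) + 1"
  have pos: "m \<ge> 0" "\<omega> \<ge> 0" by (simp_all add: m_def \<omega>_def)
  show thesis
  proof (rule that[of K])
    show "K > 0" using pos \<nu>(3) unfolding K_def by (intro add_nonneg_pos mult_nonneg_nonneg) auto
    fix p :: real assume p: "0 < p" "p \<le> 1"
    define T where "T = {x \<in> ball 0 R. infdist x G < p}"
    have "open (ball 0 R \<inter> {x. infdist x G < p})"
      by (intro open_Int open_ball open_Collect_less continuous_intros)
    moreover have "T = ball 0 R \<inter> {x. infdist x G < p}" by (auto simp: T_def)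
    ultimately have "open T" by simp
    then have Tm: "T \<in> sets borel" by simp
    have "emeasure lborel T \<le> emeasure lborel (ball (0::real^'n) R)"
      by (rule emeasure_mono) (auto simp: T_def)
    also have "\<dots> < top" using R by (simp add: emeasure_ball)
    finally have Tfin: "emeasure lborel T \<noteq> top" by simp
    have low: "ennreal (p powr s / c) \<le> emeasure \<nu> (ball y (2 * p))" if y: "y \<in> T" for y
    proof -
      obtain q where q: "q \<in> G" "dist y q < p"
        using infdist_lt_obtain[OF G] y unfolding T_def by blast
      have "dist z q \<le> dist z 0 + dist 0 y + dist y q" by metric
      then have qR: "q \<in> ball z R1" using y q(2) p by (simp add: T_def R1_def)
      have "ennreal (p powr s / c) \<le> emeasure \<nu> (ball q p)"
      proof -
        have "2 * R1 = 2 * norm z + 2 * R + 4" by (simp add: R1_def)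
        moreover have "0 \<le> 2 * norm z" by simp
        ultimately have "p < 2 * R1" using p R by linarith
        then show ?thesis using \<nu>(4)[of q p] q(1) qR p(1) by blast
      qed
      also have "\<dots> \<le> emeasure \<nu> (ball y (2 * p))"
      proof (rule emeasure_mono)
        show "ball q p \<subseteq> ball y (2 * p)"
        proof
          fix w assume "w \<in> ball q p"
          moreover have "dist y w \<le> dist y q + dist q w" by metric
          ultimately show "w \<in> ball y (2 * p)" using q(2) by simp
        qed
      qed simp
      finally show ?thesis .
    qed
    have "ennreal (p powr s / c) * emeasure lborel T = (\<integral>\<^sup>+y. ennreal (p powr s / c) * indicator T y \<partial>lborel)"
      using Tm by (simp add: nn_integral_cmult_indicator)
    also have "\<dots> \<le> (\<integral>\<^sup>+y. \<integral>\<^sup>+x. indicator {w. dist y w < 2 * p} x \<partial>\<nu> \<partial>lborel)"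
    proof (rule nn_integral_mono)
      fix y :: "real^'n"
      have "(\<integral>\<^sup>+x. indicator {w. dist y w < 2 * p} x \<partial>\<nu>) = emeasure \<nu> (ball y (2 * p))"
        by (simp add: ball_def[symmetric])
      then show "ennreal (p powr s / c) * indicator T y \<le> (\<integral>\<^sup>+x. indicator {w. dist y w < 2 * p} x \<partial>\<nu>)"
        using low[of y] by (cases "y \<in> T") auto
    qed
    also have "\<dots> = (\<integral>\<^sup>+x. \<integral>\<^sup>+y. indicator {w. dist y w < 2 * p} x \<partial>lborel \<partial>\<nu>)"
    proof (rule P.Fubini'[symmetric])
      have "(\<lambda>(x, y). indicator {w. dist x w < 2 * p} y) = (\<lambda>z. indicator {z. dist (fst z) (snd z) < 2 * p} z :: ennreal)"
        by (auto simp: indicator_def)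
      moreover have "(\<lambda>z. indicator {z. dist (fst z) (snd z) < 2 * p} z :: ennreal) \<in> borel_measurable (lborel \<Otimes>\<^sub>M \<nu>)"
        by measurable
      ultimately show "(\<lambda>(x, y). indicator {w. dist x w < 2 * p} y :: ennreal) \<in> borel_measurable (lborel \<Otimes>\<^sub>M \<nu>)"
        by simp
    qed
    also have "\<dots> = (\<integral>\<^sup>+x. ennreal (\<omega> * (2 * p) ^ CARD('n)) \<partial>\<nu>)"
    proof (rule nn_integral_cong)
      fix x :: "real^'n"
      have "(\<lambda>y. indicator {w. dist y w < 2 * p} x) = (indicator (ball x (2 * p)) :: _ \<Rightarrow> ennreal)"
        by (auto simp: indicator_def dist_commute)
      then show "(\<integral>\<^sup>+y. indicator {w. dist y w < 2 * p} x \<partial>lborel) = ennreal (\<omega> * (2 * p) ^ CARD('n))"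
        using p emeasure_ball[of "2 * p" x] by (simp add: \<omega>_def)
    qed
    also have "\<dots> = ennreal (\<omega> * (2 * p) ^ CARD('n) * m)"
      using pos p by (simp add: \<nu>.emeasure_eq_measure m_def ennreal_mult)
    finally have le: "ennreal (p powr s / c) * emeasure lborel T \<le> ennreal (\<omega> * (2 * p) ^ CARD('n) * m)" .
    obtain t where t: "t \<ge> 0" "emeasure lborel T = ennreal t"
      using Tfin by (cases "emeasure lborel T") auto
    have "p powr s / c * t \<le> \<omega> * (2 * p) ^ CARD('n) * m"
      using le t pos p \<nu>(3) by (simp add: ennreal_le_iff flip: ennreal_mult)
    then have "t \<le> c * (\<omega> * 2 ^ CARD('n) * m) * (p ^ CARD('n) / p powr s)"
      using p \<nu>(3) by (simp add: field_simps power_mult_distrib)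
    also have "p ^ CARD('n) / p powr s = p powr (real CARD('n) - s)"
      using p by (simp add: powr_diff powr_realpow)
    also have "c * (\<omega> * 2 ^ CARD('n) * m) * p powr (real CARD('n) - s) \<le> K * p powr (real CARD('n) - s)"
      by (intro mult_right_mono) (simp_all add: K_def)
    finally show "emeasure lborel {x \<in> ball 0 R. infdist x G < p} \<le> ennreal (K * p powr (real CARD('n) - s))"
      unfolding T_def[symmetric] t(2) by (rule ennreal_leI)
  qed
qed

section \<open>Cutoff functions near the boundary\<close>

lemma partial_sum:
  assumes "\<And>i. i \<in> I \<Longrightarrow> smooth (f i)"
  shows "partial k (\<lambda>x. \<Sum>i\<in>I. f i x) x = (\<Sum>i\<in>I. partial k (f i) x)"
  using assms
proof (induction I rule: infinite_finite_induct)
  case (insert i I)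
  then have "partial k (\<lambda>x. f i x + (\<Sum>i\<in>I. f i x)) x = partial k (f i) x + partial k (\<lambda>x. \<Sum>i\<in>I. f i x) x"
    by (intro partial_add smooth_differentiable) auto
  then show ?case using insert by simp
qed auto

lemma closed_balls_inside:
  fixes \<Omega> :: "'a::metric_space set"
  shows "closed {x. ball x t \<subseteq> \<Omega>}"
proof -
  have "- {x. ball x t \<subseteq> \<Omega>} = (\<Union>y\<in>-\<Omega>. ball y t)"
    by (auto simp: dist_commute)
  then show ?thesis by (metis closed_def open_UN open_ball)
qed

context elliptic
begin

text \<open>
  The function \<open>\<eta> N\<close> averages cutoffs at \<open>N + 1\<close> consecutive dyadic scales. Their gradients overlap only
  boundedly often, so the average gains the factor \<open>1/(N + 1)\<close> that is needed at the critical exponent.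
\<close>

lemma cutoff_sequence:
  fixes F :: "'i set" and G :: "'i \<Rightarrow> (real^'n) set" and b Kv \<delta> e :: "'i \<Rightarrow> real" and r R :: real
  assumes R: "R > 0" and F: "finite F" and r: "r > 0"
    and deg: "\<And>i. i \<in> F \<Longrightarrow> AE x in lebesgue_on \<Omega>. x \<in> ball 0 R \<and> infdist x (G i) < r \<longrightarrow>
        mat_le (C x) (mat (b i * infdist x (G i) powr \<delta> i))"
    and b: "\<And>i. i \<in> F \<Longrightarrow> b i > 0" and \<delta>: "\<And>i. i \<in> F \<Longrightarrow> \<delta> i \<ge> 0"
    and Kv: "\<And>i. i \<in> F \<Longrightarrow> Kv i > 0"
    and vol: "\<And>i p. i \<in> F \<Longrightarrow> 0 < p \<Longrightarrow> p \<le> 1 \<Longrightarrow>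
        emeasure lborel {x \<in> ball 0 R. infdist x (G i) < p} \<le> ennreal (Kv i * p powr e i)"
    and crit: "\<And>i. i \<in> F \<Longrightarrow> \<delta> i + e i \<ge> 2"
    and cov: "\<And>x y t. x \<in> \<Omega> \<inter> ball 0 R \<Longrightarrow> y \<notin> \<Omega> \<Longrightarrow> dist x y < t \<Longrightarrow> t \<le> r \<Longrightarrow> \<exists>i\<in>F. infdist x (G i) < t"
  shows "\<exists>\<eta> K. \<forall>N::nat. \<eta> N \<in> Cc_infinity \<Omega> \<and> (\<forall>x. 0 \<le> \<eta> N x \<and> \<eta> N x \<le> 1)
     \<and> (\<forall>x\<in>\<Omega> \<inter> ball 0 R. (\<lambda>N. \<eta> N x) \<longlonglongrightarrow> 1)
     \<and> (\<exists>H. integrable (lebesgue_on \<Omega>) H \<and> (\<forall>x. 0 \<le> H x) \<and> (LINT x|lebesgue_on \<Omega>. H x) \<le> K / real (Suc N)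
          \<and> (AE x in lebesgue_on \<Omega>. x \<in> ball 0 R \<longrightarrow> energy_density C (grad (\<eta> N)) x \<le> H x))"
proof -
  let ?M = "lebesgue_on \<Omega>"
  obtain \<rho> :: "real \<Rightarrow> real^'n \<Rightarrow> real" and A0 where \<rho>: "\<And>e. e > 0 \<Longrightarrow> mollifier e (\<rho> e)" "A0 > 0"
    "\<And>e k. e > 0 \<Longrightarrow> (LINT x|lborel. \<bar>partial k (\<rho> e) x\<bar>) \<le> A0 / e"
    using mollifier_exists by metis
  have "min r 1 * (4/7) > 0" using r by simp
  then obtain J where J: "(1/2::real) ^ J < min r 1 * (4/7)" using real_arch_pow_inv[of "min r 1 * (4/7)" "1/2"] by auto
  \<comment> \<open>Dyadic scales that start so small that \<open>t j\<close> is at most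
    \<open>r\<close> and 1. Membership in \<open>U j\<close> uses the radius 3/2 l and the mollifier
    has radius l/4. So \<open>\<theta> j\<close> vanishes at x unless the ball of radius 5/4 l about
    x lies in \<Omega>, and near the origin it is 1 once the ball of radius 7/4 l, which is
    \<open>t j\<close>, does.\<close>
  define l where "l j = (1/2::real) ^ (J + j)" for j
  define t where "t j = 7/4 * l j" for j
  have l: "l j > 0" for j by (simp add: l_def)
  have l_le: "l j \<le> (1/2) ^ J" for j unfolding l_def by (intro power_decreasing) auto
  have t: "0 < t j" "t j \<le> r" "t j \<le> 1" for j
    using l[of j] l_le[of j] J by (auto simp: t_def)
  have l1: "l j \<le> 1" for j using t(3)[of j] l[of j] by (simp add: t_def)
  define U where "U j = ball 0 (R + 2) \<inter> {x. ball x (3/2 * l j) \<subseteq> \<Omega>}" for j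
  have "U j \<in> sets borel" for j
    unfolding U_def using closed_balls_inside by (intro sets.Int borel_closed borel_open) auto
  then have Us: "U j \<in> sets lebesgue" for j by (metis sets_completionI_sets sets_lborel)
  have Uf: "emeasure lebesgue (U j) < \<infinity>" for j
  proof -
    have "emeasure lebesgue (U j) \<le> emeasure lebesgue (ball (0::real^'n) (R + 2))"
      by (rule emeasure_mono) (auto simp: U_def)
    also have "\<dots> < \<infinity>" using R by (simp add: emeasure_ball)
    finally show ?thesis .
  qed
  define \<theta> where "\<theta> j = conv (\<rho> (l j / 4)) (indicator (U j))" for j
  have mo: "mollifier (l j / 4) (\<rho> (l j / 4))" for j by (rule \<rho>(1)) (simp add: l)
  have c: "smooth (\<theta> j)" "0 \<le> \<theta> j x" "\<theta> j x \<le> 1" "ball x (l j / 4) \<subseteq> U j \<Longrightarrow> \<theta> j x = 1"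
    "ball x (l j / 4) \<inter> U j = {} \<Longrightarrow> \<theta> j x = 0"
    "\<bar>partial k (\<theta> j) x\<bar> \<le> (LINT x|lborel. \<bar>partial k (\<rho> (l j / 4)) x\<bar>)"
    "ball x (l j / 4) \<subseteq> U j \<Longrightarrow> partial k (\<theta> j) x = 0"
    "ball x (l j / 4) \<inter> U j = {} \<Longrightarrow> partial k (\<theta> j) x = 0" for j x k
    unfolding \<theta>_def
    by (fact conv_indicator_smooth[OF mo Us Uf] conv_indicator_nonneg[OF mo Us Uf] conv_indicator_le_1[OF mo Us Uf]
      conv_indicator_eq_1[OF mo Us Uf] conv_indicator_eq_0[OF mo Us Uf] partial_conv_indicator_le[OF mo Us Uf]
      partial_conv_indicator_inside[OF mo Us Uf] partial_conv_indicator_outside[OF mo Us Uf])+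
  have inside: "ball x (l j / 4) \<subseteq> U j" if "x \<in> ball 0 R" "ball x (t j) \<subseteq> \<Omega>" for x j
  proof
    fix y assume y: "y \<in> ball x (l j / 4)"
    have "dist 0 y \<le> dist 0 x + dist x y" by metric
    moreover have "ball y (3/2 * l j) \<subseteq> ball x (t j)"
    proof
      fix w assume "w \<in> ball y (3/2 * l j)"
      moreover have "dist x w \<le> dist x y + dist y w" by metric
      ultimately show "w \<in> ball x (t j)" using y by (simp add: t_def)
    qed
    ultimately show "y \<in> U j" using y that l1[of j] by (auto simp: U_def)
  qed
  have outside: "ball x (l j / 4) \<inter> U j = {}" if "\<not> ball x (5/4 * l j) \<subseteq> \<Omega>" for x j
  proof (rule ccontr)
    assume "ball x (l j / 4) \<inter> U j \<noteq> {}"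
    then obtain y where y: "dist x y < l j / 4" "ball y (3/2 * l j) \<subseteq> \<Omega>" by (auto simp: U_def)
    have "ball x (5/4 * l j) \<subseteq> ball y (3/2 * l j)"
    proof
      fix w assume "w \<in> ball x (5/4 * l j)"
      moreover have "dist y w \<le> dist x y + dist x w" by metric
      ultimately show "w \<in> ball y (3/2 * l j)" using y(1) by simp
    qed
    with y(2) that show False by blast
  qed
  \<comment> \<open>The layer that contains the gradient of \<open>\<theta> j\<close> inside
    \<open>ball 0 R\<close>. As half of 7/4 is less than 5/4, the layers of different scales are
    disjoint.\<close>
  define A where "A j = {x. ball x (5/4 * l j) \<subseteq> \<Omega> \<and> \<not> ball x (t j) \<subseteq> \<Omega>}" for j
  have grad0: "grad (\<theta> j) x = 0" if "x \<in> ball 0 R" "x \<notin> A j" for x j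
  proof (cases "ball x (t j) \<subseteq> \<Omega>")
    case True
    then show ?thesis using c(7)[OF inside[OF that(1)]] by (simp add: vec_eq_iff)
  next
    case False
    then have "\<not> ball x (5/4 * l j) \<subseteq> \<Omega>" using that(2) unfolding A_def by blast
    then show ?thesis using c(8)[OF outside] by (simp add: vec_eq_iff)
  qed
  have grad_le: "(norm (grad (\<theta> j) x))\<^sup>2 \<le> real CARD('n) * (4 * A0 / l j)\<^sup>2" for j x
  proof -
    have "\<bar>partial k (\<theta> j) x\<bar> \<le> 4 * A0 / l j" for k
      using order_trans[OF c(6) \<rho>(3)[of "l j / 4"]] l[of j] by (simp add: mult.commute)
    then have "(partial k (\<theta> j) x)\<^sup>2 \<le> (4 * A0 / l j)\<^sup>2" for k
      by (metis abs_ge_zero power2_abs power_mono)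
    then have "(\<Sum>k\<in>UNIV. (partial k (\<theta> j) x)\<^sup>2) \<le> (\<Sum>k::'n\<in>UNIV. (4 * A0 / l j)\<^sup>2)"
      by (intro sum_mono) auto
    then show ?thesis by (simp add: norm_vec_def L2_set_def sum_nonneg)
  qed
  have disj: "i = j" if "x \<in> A i" "x \<in> A j" for i j x
  proof -
    have False if "i < j" "x \<in> A i" "x \<in> A j" for i j
    proof -
      have "l j \<le> (1/2) ^ (J + Suc i)" unfolding l_def using that(1) by (intro power_decreasing) auto
      then have "l j \<le> l i / 2" by (simp add: l_def)
      then have "ball x (t j) \<subseteq> ball x (5/4 * l i)" using l[of i] by (intro subset_ball) (simp add: t_def)
      then show False using that(2,3) by (auto simp: A_def)
    qed
    then show ?thesis using that by (metis linorder_neqE_nat)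
  qed
  have \<theta>_Cc: "\<theta> j \<in> Cc_infinity \<Omega>" for j
  proof (rule Cc_infinityI[OF c(1)])
    show "compact (cball 0 (R + 3) \<inter> {x. ball x (l j) \<subseteq> \<Omega>})"
      by (intro compact_Int_closed closed_balls_inside) auto
    show "cball 0 (R + 3) \<inter> {x. ball x (l j) \<subseteq> \<Omega>} \<subseteq> \<Omega>"
      using l[of j] by (auto dest: subsetD[where c="_"] simp: subset_iff) 
    fix x assume x: "x \<notin> cball 0 (R + 3) \<inter> {x. ball x (l j) \<subseteq> \<Omega>}"
    show "\<theta> j x = 0"
    proof (rule c(5), rule ccontr)
      assume ne: "ball x (l j / 4) \<inter> U j \<noteq> {}"
      then obtain y where y: "dist x y < l j / 4" "y \<in> U j" by auto
      have "dist 0 x \<le> dist 0 y + dist x y" by metric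
      then have "x \<in> cball 0 (R + 3)" using y l1[of j] by (auto simp: U_def)
      moreover have "ball x (l j) \<subseteq> ball x (5/4 * l j)" using l[of j] by (intro subset_ball) simp
      then have "ball x (l j) \<subseteq> \<Omega>" using outside[of x j] ne by blast
      ultimately show False using x by simp
    qed
  qed
  define a where "a N = inverse (real (Suc N))" for N
  have a: "a N > 0" "a N * real (Suc N) = 1" for N by (auto simp: a_def)
  define \<eta> where "\<eta> N x = a N * (\<Sum>j<Suc N. \<theta> j x)" for N x
  have \<eta>_Cc: "\<eta> N \<in> Cc_infinity \<Omega>" for N
    unfolding \<eta>_def by (rule Cc_infinity_mult[OF Cc_infinity_sum[OF \<theta>_Cc] smooth_const])
  have \<eta>0: "0 \<le> \<eta> N x" for N x
    unfolding \<eta>_def using a(1)[of N] c(2) by (intro mult_nonneg_nonneg sum_nonneg) auto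
  have \<eta>1: "\<eta> N x \<le> 1" for N x
  proof -
    have "(\<Sum>j<Suc N. \<theta> j x) \<le> (\<Sum>j<Suc N. 1)" by (intro sum_mono c(3))
    then have "a N * (\<Sum>j<Suc N. \<theta> j x) \<le> a N * real (Suc N)" using a(1)[of N] by (intro mult_left_mono) auto
    then show ?thesis using a(2)[of N] by (simp add: \<eta>_def)
  qed
  have grad_\<eta>: "grad (\<eta> N) x = a N *\<^sub>R (\<Sum>j<Suc N. grad (\<theta> j) x)" for N x
  proof -
    have "partial k (\<eta> N) x = a N * (\<Sum>j<Suc N. partial k (\<theta> j) x)" for k
      unfolding \<eta>_def using partial_sum[of "{..<Suc N}" \<theta> k x] c(1)
      by (subst partial_cmult) (auto intro!: smooth_differentiable smooth_sum)
    then show ?thesis by (simp add: vec_eq_iff)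
  qed
  have lim: "(\<lambda>N. \<eta> N x) \<longlonglongrightarrow> 1" if x: "x \<in> \<Omega> \<inter> ball 0 R" for x
  proof -
    obtain e1 where e1: "e1 > 0" "ball x e1 \<subseteq> \<Omega>" using open_\<Omega> x by (auto simp: open_contains_ball)
    obtain j0 where j0: "(1/2::real) ^ j0 < e1 * (4/7)" using real_arch_pow_inv[of "e1 * (4/7)" "1/2"] e1 by auto
    have one: "\<theta> j x = 1" if "j \<ge> j0" for j
    proof -
      have "l j \<le> (1/2) ^ j0" unfolding l_def using that by (intro power_decreasing) auto
      then have "t j \<le> e1" using j0 by (simp add: t_def)
      then have "ball x (t j) \<subseteq> \<Omega>" using e1(2) subset_ball[of "t j" e1 x] by blast
      then show ?thesis using inside x by (intro c(4)) auto
    qed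
    \<comment> \<open>Only the first \<open>j0\<close> scales can have a value other than 1 at
      \<open>x\<close>, so the average misses 1 by at most \<open>j0\<close> times
      \<open>a N\<close>.\<close>
    have bd: "norm (\<eta> N x - 1) \<le> real j0 * a N" for N
    proof -
      have "\<eta> N x - 1 = a N * (\<Sum>j<Suc N. \<theta> j x - 1)"
        using a(2)[of N] by (simp add: \<eta>_def sum_subtractf right_diff_distrib del: sum.lessThan_Suc)
      then have "\<bar>\<eta> N x - 1\<bar> = a N * \<bar>\<Sum>j<Suc N. \<theta> j x - 1\<bar>"
        using a(1)[of N] by (simp add: abs_mult del: sum.lessThan_Suc)
      also have "\<bar>\<Sum>j<Suc N. \<theta> j x - 1\<bar> \<le> (\<Sum>j<Suc N. \<bar>\<theta> j x - 1\<bar>)" by (rule sum_abs)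
      also have "\<dots> \<le> (\<Sum>j<Suc N. if j < j0 then 1 else 0)"
      proof (rule sum_mono)
        fix j show "\<bar>\<theta> j x - 1\<bar> \<le> (if j < j0 then 1 else 0)"
          using one[of j] c(2)[of j x] c(3)[of j x] by auto
      qed
      also have "\<dots> = real (card ({..<Suc N} \<inter> {j. j < j0}))"
        by (simp add: sum.If_cases del: sum.lessThan_Suc)
      also have "\<dots> \<le> real (card {..<j0})"
        by (intro of_nat_mono card_mono) auto
      finally show ?thesis using a(1)[of N] by (simp add: mult.commute mult_left_mono)
    qed
    have "(\<lambda>N. real j0 * a N) \<longlonglongrightarrow> real j0 * 0"
      unfolding a_def by (intro tendsto_intros LIMSEQ_inverse_real_of_nat)
    then have "(\<lambda>N. \<eta> N x - 1) \<longlonglongrightarrow> 0"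
      using bd by (intro Lim_null_comparison[of "\<lambda>N. \<eta> N x - 1" "\<lambda>N. real j0 * a N"]) (auto intro!: always_eventually)
    then show ?thesis by (simp add: LIM_zero_iff)
  qed
  define T where "T i j = {x \<in> ball 0 R. infdist x (G i) < t j}" for i j
  have T_sets: "T i j \<in> sets borel" for i j
  proof -
    have "open (ball 0 R \<inter> {x. infdist x (G i) < t j})"
      by (intro open_Int open_ball open_Collect_less continuous_intros)
    moreover have "T i j = ball 0 R \<inter> {x. infdist x (G i) < t j}" by (auto simp: T_def)
    ultimately show ?thesis by simp
  qed
  have T_vol: "integrable ?M (indicator (T i j) :: _ \<Rightarrow> real)" "(LINT x|?M. indicator (T i j) x) \<le> Kv i * t j powr e i"
    if "i \<in> F" for i j
  proof -
    have v: "emeasure lborel (T i j) \<le> ennreal (Kv i * t j powr e i)"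
      unfolding T_def by (rule vol[OF that t(1,3)])
    then have fin: "emeasure lebesgue (T i j) < \<infinity>" using T_sets
      by (simp add: order_le_less_trans[OF _ ennreal_less_top])
    have Tl: "T i j \<in> sets lebesgue" by (metis T_sets sets_completionI_sets sets_lborel)
    have i0: "integrable (lebesgue_on UNIV) (indicator (T i j) :: _ \<Rightarrow> real)"
      unfolding lebesgue_on_UNIV_eq by (rule integrable_real_indicator[OF Tl fin])
    then show "integrable ?M (indicator (T i j) :: _ \<Rightarrow> real)"
      by (rule integrable_lebesgue_on_subset) (use \<Omega>_sets in auto)
    have "(LINT x|?M. indicator (T i j) x) \<le> (LINT x|lebesgue_on UNIV. indicator (T i j) x :: real)"
      by (rule integral_lebesgue_on_subset_le[OF i0]) (use \<Omega>_sets in auto)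
    also have "\<dots> = measure lborel (T i j)"
      using T_sets by (simp add: lebesgue_on_UNIV_eq)
    also have "\<dots> \<le> Kv i * t j powr e i"
      unfolding measure_def using v Kv[OF that] by (intro enn2real_leI) auto
    finally show "(LINT x|?M. indicator (T i j) x) \<le> Kv i * t j powr e i" .
  qed
  \<comment> \<open>A bound for the energy density of \<open>\<theta> j\<close> in the tube around
    \<open>G i\<close>: the size of the coefficients at distance below \<open>t j\<close>, times a
    squared gradient of order l^(-2).\<close>
  define co where "co i j = b i * t j powr \<delta> i * (real CARD('n) * (4 * A0 / l j)\<^sup>2)" for i j
  have co0: "co i j \<ge> 0" if "i \<in> F" for i j using b[OF that] by (simp add: co_def)
  define K where "K = (\<Sum>i\<in>F. 49 * real CARD('n) * A0\<^sup>2 * (b i * Kv i))"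
  have co_vol: "co i j * (Kv i * t j powr e i) \<le> 49 * real CARD('n) * A0\<^sup>2 * (b i * Kv i)" if "i \<in> F" for i j
  proof -
    \<comment> \<open>Tube volume times size of the coefficients is at most of the order of the
      squared scale, since \<open>t j \<le> 1\<close> and the total exponent is at least 2; this
      cancels the squared gradient. The factor 49 is 16 times (7/4)^2.\<close>
    have "t j powr \<delta> i * t j powr e i = t j powr (\<delta> i + e i)" by (simp add: powr_add)
    also have "\<dots> \<le> t j powr 2" using t[of j] crit[OF that] by (intro powr_mono') auto
    also have "\<dots> = (7/4 * l j)\<^sup>2" using t(1)[of j] l[of j] by (simp add: t_def)
    finally have le: "t j powr \<delta> i * t j powr e i \<le> (7/4 * l j)\<^sup>2" .
    have "co i j * (Kv i * t j powr e i) = (b i * Kv i * real CARD('n) * (4 * A0 / l j)\<^sup>2) * (t j powr \<delta> i * t j powr e i)"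
      by (simp add: co_def)
    also have "\<dots> \<le> (b i * Kv i * real CARD('n) * (4 * A0 / l j)\<^sup>2) * (7/4 * l j)\<^sup>2"
      using b[OF that] Kv[OF that] by (intro mult_left_mono le) auto
    also have "\<dots> = 49 * real CARD('n) * A0\<^sup>2 * (b i * Kv i)"
      using l[of j] by (simp add: power_mult_distrib power_divide field_simps)
    finally show ?thesis .
  qed
  \<comment> \<open>The majorant sums the tubes of all scales. Each scale costs at most
    \<open>K\<close>, so the factor (N + 1)^(-2) leaves K/(N + 1).\<close>
  define H where "H N x = (a N)\<^sup>2 * (\<Sum>j<Suc N. \<Sum>i\<in>F. co i j * indicator (T i j) x)" for N x
  have H_int: "integrable ?M (H N)" for N
    unfolding H_def using T_vol(1) by (intro integrable_mult_right Bochner_Integration.integrable_sum) auto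
  have H0: "0 \<le> H N x" for N x
    unfolding H_def using co0 by (intro mult_nonneg_nonneg sum_nonneg) auto
  have H_le: "(LINT x|?M. H N x) \<le> K / real (Suc N)" for N
  proof -
    have "(LINT x|?M. H N x) = (a N)\<^sup>2 * (\<Sum>j<Suc N. \<Sum>i\<in>F. co i j * (LINT x|?M. indicator (T i j) x))"
      unfolding H_def using T_vol(1) by (simp add: Bochner_Integration.integral_sum del: sum.lessThan_Suc)
    also have "\<dots> \<le> (a N)\<^sup>2 * (\<Sum>j<Suc N. K)"
      unfolding K_def
    proof (intro mult_left_mono sum_mono)
      fix i j assume "i \<in> F"
      have "co i j * (LINT x|?M. indicator (T i j) x) \<le> co i j * (Kv i * t j powr e i)"
        by (intro mult_left_mono T_vol co0 \<open>i \<in> F\<close>)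
      then show "co i j * (LINT x|?M. indicator (T i j) x) \<le> 49 * real CARD('n) * A0\<^sup>2 * (b i * Kv i)"
        using co_vol[OF \<open>i \<in> F\<close>, of j] by simp
    qed simp
    also have "\<dots> = K / real (Suc N)"
      by (simp add: a_def power2_eq_square divide_inverse del: of_nat_Suc)
    finally show ?thesis .
  qed
  have AE_bound: "AE x in ?M. x \<in> ball 0 R \<longrightarrow> energy_density C (grad (\<eta> N)) x \<le> H N x" for N
  proof -
    have "AE x in ?M. \<forall>i\<in>F. x \<in> ball 0 R \<and> infdist x (G i) < r \<longrightarrow> mat_le (C x) (mat (b i * infdist x (G i) powr \<delta> i))"
      by (intro AE_finite_allI F deg)
    moreover have "AE x in ?M. x \<in> \<Omega>" by (rule AE_I2) simp
    ultimately show ?thesis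
    proof eventually_elim
      case (elim x)
      show ?case
      proof
        assume xR: "x \<in> ball 0 R"
        show "energy_density C (grad (\<eta> N)) x \<le> H N x"
        proof (cases "\<exists>j<Suc N. x \<in> A j")
          case False
          then have "grad (\<eta> N) x = 0" unfolding grad_\<eta> using grad0[OF xR] by (simp del: sum.lessThan_Suc)
          then show ?thesis using H0 by (simp add: energy_density_eq)
        next
          case True
          then obtain j where j: "j < Suc N" "x \<in> A j" by blast
          \<comment> \<open>By disjointness of the layers a single scale contributes, so the squared
            average is \<open>(a N)\<^sup>2\<close> times one energy density, without cross
            terms.\<close>
          have "(\<Sum>i<Suc N. grad (\<theta> i) x) = (\<Sum>i\<in>{j}. grad (\<theta> i) x)"
            using j disj grad0[OF xR] by (intro sum.mono_neutral_right) auto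
          then have g: "grad (\<eta> N) x = a N *\<^sub>R grad (\<theta> j) x" by (simp add: grad_\<eta> del: sum.lessThan_Suc)
          have "\<not> ball x (t j) \<subseteq> \<Omega>" using j(2) by (simp add: A_def)
          \<comment> \<open>The layer condition produces a point outside \<Omega> closer than
            \<open>t j\<close>, and the covering hypothesis then names a boundary part whose
            degeneracy bounds the coefficients at \<open>x\<close>.\<close>
          then obtain y where "y \<notin> \<Omega>" "dist x y < t j" by (meson mem_ball subsetI)
          then obtain i where i: "i \<in> F" "infdist x (G i) < t j" using cov[of x y "t j"] elim(2) xR t(2) by blast
          have "mat_le (C x) (mat (b i * infdist x (G i) powr \<delta> i))"
            using elim(1) i xR t(2)[of j] by auto
          then have "grad (\<theta> j) x \<bullet> (C x *v grad (\<theta> j) x) \<le> b i * infdist x (G i) powr \<delta> i * (norm (grad (\<theta> j) x))\<^sup>2"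
            by (metis mat_le_def inner_mat)
          also have "\<dots> \<le> b i * t j powr \<delta> i * (real CARD('n) * (4 * A0 / l j)\<^sup>2)"
            using b[OF i(1)] i(2) \<delta>[OF i(1)] infdist_nonneg grad_le
            by (intro mult_mono powr_mono2) auto
          finally have q: "grad (\<theta> j) x \<bullet> (C x *v grad (\<theta> j) x) \<le> co i j * indicator (T i j) x"
            using xR i(2) by (simp add: co_def T_def)
          also have "\<dots> \<le> (\<Sum>i\<in>F. co i j * indicator (T i j) x)"
            using i(1) F co0 by (intro member_le_sum) auto
          also have "\<dots> \<le> (\<Sum>j<Suc N. \<Sum>i\<in>F. co i j * indicator (T i j) x)"
            using j(1) co0 by (intro member_le_sum[of j "{..<Suc N}" "\<lambda>j. \<Sum>i\<in>F. co i j * indicator (T i j) x"]) (auto intro!: sum_nonneg)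
          finally have "(a N)\<^sup>2 * (grad (\<theta> j) x \<bullet> (C x *v grad (\<theta> j) x)) \<le> H N x"
            unfolding H_def by (intro mult_left_mono) auto
          then show ?thesis
            by (simp add: energy_density_eq g matrix_vector_mult_scaleR power2_eq_square)
        qed
      qed
    qed
  qed
  show ?thesis
  proof (intro exI[of _ \<eta>] exI[of _ K] allI)
    fix N
    have "\<exists>H. integrable ?M H \<and> (\<forall>x. 0 \<le> H x) \<and> (LINT x|?M. H x) \<le> K / real (Suc N)
        \<and> (AE x in ?M. x \<in> ball 0 R \<longrightarrow> energy_density C (grad (\<eta> N)) x \<le> H x)"
      by (intro exI[of _ "H N"] conjI allI H_int H0 H_le AE_bound)
    then show "\<eta> N \<in> Cc_infinity \<Omega> \<and> (\<forall>x. 0 \<le> \<eta> N x \<and> \<eta> N x \<le> 1)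
       \<and> (\<forall>x\<in>\<Omega> \<inter> ball 0 R. (\<lambda>N. \<eta> N x) \<longlonglongrightarrow> 1)
       \<and> (\<exists>H. integrable ?M H \<and> (\<forall>x. 0 \<le> H x) \<and> (LINT x|?M. H x) \<le> K / real (Suc N)
          \<and> (AE x in ?M. x \<in> ball 0 R \<longrightarrow> energy_density C (grad (\<eta> N)) x \<le> H x))"
      using \<eta>_Cc \<eta>0 \<eta>1 lim by simp
  qed
qed

end

text \<open>Representatives chosen in the ball, one for each index, have mutual distance at least
  \<open>d\<close>; infinitely many of them would have a limit point by Bolzano-Weierstrass.\<close>

lemma finite_family_near:
  fixes \<Gamma> :: "'i \<Rightarrow> 'a::euclidean_space set"
  assumes sep: "\<And>\<alpha> \<beta>. \<alpha> \<in> M \<Longrightarrow> \<beta> \<in> M \<Longrightarrow> \<alpha> \<noteq> \<beta> \<Longrightarrow> setdist (\<Gamma> \<alpha>) (\<Gamma> \<beta>) \<ge> d" and d: "d > 0"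
  shows "finite {\<alpha> \<in> M. \<Gamma> \<alpha> \<inter> cball 0 R \<noteq> {}}"
proof (rule ccontr)
  define S where "S = {\<alpha> \<in> M. \<Gamma> \<alpha> \<inter> cball 0 R \<noteq> {}}"
  assume "infinite {\<alpha> \<in> M. \<Gamma> \<alpha> \<inter> cball 0 R \<noteq> {}}"
  then have inf: "infinite S" by (simp add: S_def)
  have "\<forall>\<alpha>\<in>S. \<exists>q. q \<in> \<Gamma> \<alpha> \<inter> cball 0 R" by (auto simp: S_def)
  then obtain q where q: "\<And>\<alpha>. \<alpha> \<in> S \<Longrightarrow> q \<alpha> \<in> \<Gamma> \<alpha> \<inter> cball 0 R" by metis
  have far: "dist (q \<alpha>) (q \<beta>) \<ge> d" if "\<alpha> \<in> S" "\<beta> \<in> S" "\<alpha> \<noteq> \<beta>" for \<alpha> \<beta>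
  proof -
    have "d \<le> setdist (\<Gamma> \<alpha>) (\<Gamma> \<beta>)" using that by (intro sep) (auto simp: S_def)
    also have "\<dots> \<le> dist (q \<alpha>) (q \<beta>)" using q that by (intro setdist_le_dist) auto
    finally show ?thesis .
  qed
  have "inj_on q S"
  proof (rule inj_onI, rule ccontr)
    fix \<alpha> \<beta> assume "\<alpha> \<in> S" "\<beta> \<in> S" "q \<alpha> = q \<beta>" "\<alpha> \<noteq> \<beta>"
    then show False using far[of \<alpha> \<beta>] d by simp
  qed
  then have "infinite (q ` S)" using inf finite_image_iff by blast
  moreover have "q ` S \<subseteq> cball 0 R" using q by blast
  ultimately have "\<exists>x\<in>cball 0 R. x islimpt (q ` S)"
    by (intro compact_cball[unfolded compact_eq_Bolzano_Weierstrass, rule_format] conjI)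
  then obtain x where x: "x islimpt (q ` S)" by blast
  obtain y1 where y1: "y1 \<in> q ` S" "y1 \<noteq> x" "dist y1 x < d / 2"
    using x[unfolded islimpt_approachable, rule_format, of "d / 2"] d by auto
  have "min (d / 2) (dist y1 x) > 0" using y1 d by simp
  then obtain y2 where y2: "y2 \<in> q ` S" "y2 \<noteq> x" "dist y2 x < min (d / 2) (dist y1 x)"
    using x[unfolded islimpt_approachable, rule_format, of "min (d / 2) (dist y1 x)"] by auto
  have ne: "y1 \<noteq> y2" using y2(3) by auto
  obtain \<alpha> \<beta> where ab: "\<alpha> \<in> S" "\<beta> \<in> S" "y1 = q \<alpha>" "y2 = q \<beta>" using y1(1) y2(1) by blast
  have "dist y1 y2 \<le> dist y1 x + dist y2 x" by metric
  then have "dist y1 y2 < d" using y1(3) y2(3) by simp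
  then show False using far[of \<alpha> \<beta>] ab ne by auto
qed

lemma frontier_point_between:
  fixes \<Omega> :: "'a::euclidean_space set"
  assumes "x \<in> \<Omega>" "y \<notin> \<Omega>"
  obtains q where "q \<in> frontier \<Omega>" "dist x q \<le> dist x y"
proof -
  have "closed_segment x y \<inter> \<Omega> \<noteq> {}" "closed_segment x y - \<Omega> \<noteq> {}" using assms by auto
  then have "closed_segment x y \<inter> frontier \<Omega> \<noteq> {}"
    by (intro connected_Int_frontier) auto
  then obtain q where "q \<in> closed_segment x y" "q \<in> frontier \<Omega>" by blast
  then show thesis using that dist_in_closed_segment[of q x y] by (metis dist_commute)
qed

context elliptic
begin

text \<open>Only the finitely many parts that meet a slightly larger ball matter for
  \<open>ball 0 R\<close>; each has its own degeneracy constants on this bounded piece, and the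
  least radius serves all. The exponent of the tube volume is d - s, so the hypothesis
  \<open>crit\<close> is exactly the condition that the two exponents add up to at least 2.\<close>

lemma has_boundary_cutoffsI:
  fixes \<Gamma> :: "'i \<Rightarrow> (real^'n) set"
  assumes fr: "frontier \<Omega> = (\<Union>\<alpha>\<in>M. \<Gamma> \<alpha>)"
    and cl: "\<And>\<alpha>. \<alpha> \<in> M \<Longrightarrow> closed (\<Gamma> \<alpha>) \<and> \<Gamma> \<alpha> \<noteq> {}" and d: "d > 0"
    and sep: "\<And>\<alpha> \<beta>. \<alpha> \<in> M \<Longrightarrow> \<beta> \<in> M \<Longrightarrow> \<alpha> \<noteq> \<beta> \<Longrightarrow> setdist (\<Gamma> \<alpha>) (\<Gamma> \<beta>) \<ge> d"
    and reg: "\<And>\<alpha>. \<alpha> \<in> M \<Longrightarrow> ahlfors_regular (s \<alpha>) (\<Gamma> \<alpha>)"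
    and deg: "\<And>\<alpha>. \<alpha> \<in> M \<Longrightarrow> \<delta> \<alpha> \<ge> 0 \<and> degenerate_on \<Omega> C (\<Gamma> \<alpha>) (\<delta> \<alpha>)"
    and crit: "\<And>\<alpha>. \<alpha> \<in> M \<Longrightarrow> \<delta> \<alpha> \<ge> 1 + (s \<alpha> - (real CARD('n) - 1))"
  shows has_boundary_cutoffs
  unfolding has_boundary_cutoffs_def
proof (intro allI impI)
  fix R :: real assume R: "R > 0"
  define F where "F = {\<alpha> \<in> M. \<Gamma> \<alpha> \<inter> cball 0 (R + 1) \<noteq> {}}"
  have F: "finite F" unfolding F_def by (rule finite_family_near[OF sep d])
  have FM: "\<alpha> \<in> M" if "\<alpha> \<in> F" for \<alpha> using that by (simp add: F_def)
  define P where "P \<alpha> b r \<longleftrightarrow> b > 0 \<and> r > 0 \<and> (AE x in lebesgue_on \<Omega>. x \<in> collar \<Omega> (\<Gamma> \<alpha> \<inter> cball 0 (R + 1)) r \<longrightarrow>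
     mat_le (C x) (mat (b * infdist x (\<Gamma> \<alpha>) powr \<delta> \<alpha>)))" for \<alpha> b r
  have "\<exists>b r. P \<alpha> b r" if "\<alpha> \<in> F" for \<alpha>
  proof -
    have "degenerate_on \<Omega> C (\<Gamma> \<alpha>) (\<delta> \<alpha>)" using deg FM[OF that] by blast
    moreover have "\<Gamma> \<alpha> \<inter> cball 0 (R + 1) \<subseteq> \<Gamma> \<alpha>" "bounded (\<Gamma> \<alpha> \<inter> cball 0 (R + 1))" "\<Gamma> \<alpha> \<inter> cball 0 (R + 1) \<noteq> {}"
      using that by (auto simp: F_def bounded_Int)
    ultimately obtain a b r where abr: "b > 0" "r > 0" "AE x in lebesgue_on \<Omega>. x \<in> collar \<Omega> (\<Gamma> \<alpha> \<inter> cball 0 (R + 1)) r \<longrightarrow>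
          mat_le (mat (a * infdist x (\<Gamma> \<alpha>) powr \<delta> \<alpha>)) (C x)
        \<and> mat_le (C x) (mat (b * infdist x (\<Gamma> \<alpha>) powr \<delta> \<alpha>))"
      unfolding degenerate_on_def by meson
    have "AE x in lebesgue_on \<Omega>. x \<in> collar \<Omega> (\<Gamma> \<alpha> \<inter> cball 0 (R + 1)) r \<longrightarrow> mat_le (C x) (mat (b * infdist x (\<Gamma> \<alpha>) powr \<delta> \<alpha>))"
      using abr(3) by eventually_elim blast
    then show ?thesis using abr(1,2) unfolding P_def by blast
  qed
  then obtain b r' where P: "\<And>\<alpha>. \<alpha> \<in> F \<Longrightarrow> P \<alpha> (b \<alpha>) (r' \<alpha>)" by metis
  define V where "V \<alpha> K \<longleftrightarrow> K > 0 \<and> (\<forall>p. 0 < p \<longrightarrow> p \<le> 1 \<longrightarrow>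
     emeasure lborel {x \<in> ball 0 R. infdist x (\<Gamma> \<alpha>) < p} \<le> ennreal (K * p powr (real CARD('n) - s \<alpha>)))" for \<alpha> K
  have "\<exists>K. V \<alpha> K" if "\<alpha> \<in> F" for \<alpha>
  proof (rule tube_volume[OF reg[OF FM[OF that]] _ _ R])
    show "closed (\<Gamma> \<alpha>)" "\<Gamma> \<alpha> \<noteq> {}" using cl FM[OF that] by auto
  qed (auto simp: V_def)
  then obtain Kv where Kv: "\<And>\<alpha>. \<alpha> \<in> F \<Longrightarrow> V \<alpha> (Kv \<alpha>)" by metis
  \<comment> \<open>The entry 1 keeps the boundary points close to \<open>ball 0 R\<close> inside
    the ball of radius \<open>R + 1\<close>, on which degeneracy was applied.\<close>
  define r where "r = Min (insert 1 (r' ` F))"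
  have r0: "r > 0" unfolding r_def using F P by (subst Min_gr_iff) (auto simp: P_def)
  have r1: "r \<le> 1" unfolding r_def using F by (intro Min_le) auto
  have rr: "r \<le> r' \<alpha>" if "\<alpha> \<in> F" for \<alpha> unfolding r_def using F that by (intro Min_le) auto
  show "\<exists>\<eta> K. \<forall>N::nat. \<eta> N \<in> Cc_infinity \<Omega> \<and> (\<forall>x. 0 \<le> \<eta> N x \<and> \<eta> N x \<le> 1)
     \<and> (\<forall>x\<in>\<Omega> \<inter> ball 0 R. (\<lambda>N. \<eta> N x) \<longlonglongrightarrow> 1)
     \<and> (\<exists>H. integrable (lebesgue_on \<Omega>) H \<and> (\<forall>x. 0 \<le> H x) \<and> (LINT x|lebesgue_on \<Omega>. H x) \<le> K / real (Suc N)
          \<and> (AE x in lebesgue_on \<Omega>. x \<in> ball 0 R \<longrightarrow> energy_density C (grad (\<eta> N)) x \<le> H x))"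
  proof (rule cutoff_sequence[OF R F r0, where G=\<Gamma> and b=b and \<delta>=\<delta> and Kv=Kv and e="\<lambda>\<alpha>. real CARD('n) - s \<alpha>"])
    show "b \<alpha> > 0" if "\<alpha> \<in> F" for \<alpha> using P[OF that] by (simp add: P_def)
    show "Kv \<alpha> > 0" if "\<alpha> \<in> F" for \<alpha> using Kv[OF that] by (simp add: V_def)
    show "\<delta> \<alpha> \<ge> 0" if "\<alpha> \<in> F" for \<alpha> using deg[OF FM[OF that]] by simp
    show "\<delta> \<alpha> + (real CARD('n) - s \<alpha>) \<ge> 2" if "\<alpha> \<in> F" for \<alpha> using crit[OF FM[OF that]] by simp
    show "emeasure lborel {x \<in> ball 0 R. infdist x (\<Gamma> \<alpha>) < p} \<le> ennreal (Kv \<alpha> * p powr (real CARD('n) - s \<alpha>))"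
      if "\<alpha> \<in> F" "0 < p" "p \<le> 1" for \<alpha> p
      using Kv[OF that(1)] that(2,3) unfolding V_def by blast
    show "AE x in lebesgue_on \<Omega>. x \<in> ball 0 R \<and> infdist x (\<Gamma> \<alpha>) < r \<longrightarrow> mat_le (C x) (mat (b \<alpha> * infdist x (\<Gamma> \<alpha>) powr \<delta> \<alpha>))"
      if \<alpha>: "\<alpha> \<in> F" for \<alpha>
    proof -
      have "AE x in lebesgue_on \<Omega>. x \<in> collar \<Omega> (\<Gamma> \<alpha> \<inter> cball 0 (R + 1)) (r' \<alpha>) \<longrightarrow> mat_le (C x) (mat (b \<alpha> * infdist x (\<Gamma> \<alpha>) powr \<delta> \<alpha>))"
        using P[OF \<alpha>] by (simp add: P_def)
      moreover have "AE x in lebesgue_on \<Omega>. x \<in> \<Omega>" by (rule AE_I2) simp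
      ultimately show ?thesis
      proof eventually_elim
        case (elim x)
        show ?case
        proof
          assume x: "x \<in> ball 0 R \<and> infdist x (\<Gamma> \<alpha>) < r"
          obtain q where q: "q \<in> \<Gamma> \<alpha>" "dist x q < r"
            using infdist_lt_obtain[of "\<Gamma> \<alpha>" x r] cl[OF FM[OF \<alpha>]] x by blast
          have "dist 0 q \<le> dist 0 x + dist x q" by metric
          then have "q \<in> \<Gamma> \<alpha> \<inter> cball 0 (R + 1)" using x q r1 by simp
          then have "infdist x (\<Gamma> \<alpha> \<inter> cball 0 (R + 1)) \<le> dist x q" by (rule infdist_le)
          then have "x \<in> collar \<Omega> (\<Gamma> \<alpha> \<inter> cball 0 (R + 1)) (r' \<alpha>)"
            using q(2) rr[OF \<alpha>] elim(2) closure_subset by (auto simp: collar_def)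
          then show "mat_le (C x) (mat (b \<alpha> * infdist x (\<Gamma> \<alpha>) powr \<delta> \<alpha>))" using elim(1) by blast
        qed
      qed
    qed
    fix x y :: "real^'n" and t assume x: "x \<in> \<Omega> \<inter> ball 0 R" and y: "y \<notin> \<Omega>" "dist x y < t" and t: "t \<le> r"
    obtain q where q: "q \<in> frontier \<Omega>" "dist x q \<le> dist x y"
      using frontier_point_between[of x \<Omega> y] x y(1) by blast
    then obtain \<alpha> where \<alpha>: "\<alpha> \<in> M" "q \<in> \<Gamma> \<alpha>" using fr by blast
    have "dist 0 q \<le> dist 0 x + dist x q" by metric
    then have "q \<in> cball 0 (R + 1)" using x q(2) y(2) t r1 by simp
    then have "\<alpha> \<in> F" using \<alpha> by (auto simp: F_def)
    moreover have "infdist x (\<Gamma> \<alpha>) < t" using infdist_le[OF \<alpha>(2), of x] q(2) y(2) by simp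
    ultimately show "\<exists>\<alpha>\<in>F. infdist x (\<Gamma> \<alpha>) < t" by blast
  qed
qed

end

subsection \<open>Averages along curves\<close>

text \<open>Not normalised by the volume of the unit ball.\<close>

definition avg :: "(real^'n \<Rightarrow> real) \<Rightarrow> real^'n \<Rightarrow> real \<Rightarrow> real"
  where "avg u p \<rho> = (LINT v|lborel. indicator (ball 0 1) v * u (p + \<rho> *\<^sub>R v))"

definition grad_integral :: "(real^'n \<Rightarrow> real) \<Rightarrow> (real^'n) set \<Rightarrow> ennreal"
  where "grad_integral u N = (\<integral>\<^sup>+y. indicator N y * ennreal (norm (grad u y)) \<partial>lborel)"

lemma grad_continuous: "smooth u \<Longrightarrow> continuous_on UNIV (grad u)"
  unfolding grad_def by (intro continuous_on_vec_lambda smooth_continuous smooth_partial)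

lemma grad_borel: "smooth u \<Longrightarrow> grad u \<in> borel_measurable borel"
  by (intro borel_measurable_continuous_onI grad_continuous)

lemma segment_difference_le:
  fixes u :: "real^'n \<Rightarrow> real"
  assumes u: "smooth u" and w: "norm w \<le> D"
  shows "ennreal \<bar>u (a + w) - u a\<bar> \<le> (\<integral>\<^sup>+t. indicator {0..1} t * ennreal (D * norm (grad u (a + t *\<^sub>R w))) \<partial>lborel)"
proof -
  have der: "((\<lambda>t. u (a + t *\<^sub>R w)) has_real_derivative grad u (a + t *\<^sub>R w) \<bullet> w) (at t)" for t
  proof -
    have "((\<lambda>t. u (a + t *\<^sub>R w)) has_derivative (\<lambda>h. grad u (a + t *\<^sub>R w) \<bullet> (h *\<^sub>R w))) (at t)"
      by (rule has_derivative_compose[OF _ has_derivative_grad[OF smooth_differentiable[OF u]]])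
        (auto intro!: derivative_eq_intros)
    then show ?thesis by (simp add: has_field_derivative_def mult_commute_abs)
  qed
  have gc: "continuous_on UNIV (\<lambda>t. grad u (a + t *\<^sub>R w))"
    by (intro continuous_on_compose2[OF grad_continuous[OF u]] continuous_intros) auto
  have "continuous_on UNIV (\<lambda>t. grad u (a + t *\<^sub>R w) \<bullet> w)"
    by (intro continuous_intros gc)
  then have cont: "isCont (\<lambda>t. grad u (a + t *\<^sub>R w) \<bullet> w) t" for t
    by (simp add: continuous_on_eq_continuous_at)
  have ftc: "has_bochner_integral lborel (\<lambda>t. (grad u (a + t *\<^sub>R w) \<bullet> w) * indicator {0..1} t) (u (a + 1 *\<^sub>R w) - u (a + 0 *\<^sub>R w))"
    by (rule has_bochner_integral_FTC_Icc_real) (use der cont in \<open>auto intro: has_field_derivative_at_within\<close>)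
  have ci: "integrable lborel (\<lambda>t. D * norm (grad u (a + t *\<^sub>R w)) * indicator {0..1} t)"
    using borel_integrable_compact[of "{0..1::real}" "\<lambda>t. D * norm (grad u (a + t *\<^sub>R w))"]
    by (simp add: mult.commute continuous_on_mult continuous_on_norm continuous_on_subset[OF gc])
  have D: "D \<ge> 0" using w norm_ge_zero order_trans by blast
  have "\<bar>u (a + w) - u a\<bar> = \<bar>LINT t|lborel. (grad u (a + t *\<^sub>R w) \<bullet> w) * indicator {0..1} t\<bar>"
    using ftc by (simp add: has_bochner_integral_iff)
  also have "\<dots> \<le> (LINT t|lborel. D * norm (grad u (a + t *\<^sub>R w)) * indicator {0..1} t)"
  proof (rule integral_abs_bound_integral[OF _ ci])
    show "integrable lborel (\<lambda>t. (grad u (a + t *\<^sub>R w) \<bullet> w) * indicator {0..1} t)"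
      using ftc by (simp add: has_bochner_integral_iff)
    fix t
    have "\<bar>grad u (a + t *\<^sub>R w) \<bullet> w\<bar> \<le> norm (grad u (a + t *\<^sub>R w)) * norm w" by (rule Cauchy_Schwarz_ineq2)
    also have "\<dots> \<le> D * norm (grad u (a + t *\<^sub>R w))"
      using mult_left_mono[OF w, of "norm (grad u (a + t *\<^sub>R w))"] by (simp add: mult.commute)
    finally show "\<bar>(grad u (a + t *\<^sub>R w) \<bullet> w) * indicator {0..1} t\<bar> \<le> D * norm (grad u (a + t *\<^sub>R w)) * indicator {0..1} t"
      by (simp add: indicator_def)
  qed
  finally have "ennreal \<bar>u (a + w) - u a\<bar> \<le> ennreal (LINT t|lborel. D * norm (grad u (a + t *\<^sub>R w)) * indicator {0..1} t)"
    by (rule ennreal_leI)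
  also have "\<dots> = (\<integral>\<^sup>+t. ennreal (D * norm (grad u (a + t *\<^sub>R w)) * indicator {0..1} t) \<partial>lborel)"
    using ci D by (intro nn_integral_eq_integral[symmetric]) auto
  also have "\<dots> = (\<integral>\<^sup>+t. indicator {0..1} t * ennreal (D * norm (grad u (a + t *\<^sub>R w))) \<partial>lborel)"
    by (intro nn_integral_cong) (simp add: indicator_def)
  finally show ?thesis .
qed

lemma avg_integrable:
  fixes u :: "real^'n \<Rightarrow> real"
  assumes "u \<in> Cc_infinity A"
  shows "integrable lborel (\<lambda>v. indicator (ball 0 1) v * u (p + \<rho> *\<^sub>R v))"
proof -
  have m: "(\<lambda>v. u (p + \<rho> *\<^sub>R v)) \<in> borel_measurable borel"
    using smooth_borel[OF Cc_infinity_smooth[OF assms]] by measurable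
  obtain b where "\<And>x. \<bar>u x\<bar> \<le> b" using Cc_infinity_bounded[OF assms] by metis
  then have "\<bar>indicator (ball 0 1) v * u (p + \<rho> *\<^sub>R v)\<bar> \<le> \<bar>b\<bar>" for v
    using order_trans[OF _ abs_ge_self[of b]] by (auto simp: indicator_def)
  then show ?thesis
    using m by (intro integrable_compact_support[of _ "cball 0 1"]) (auto intro!: borel_measurable_times borel_measurable_indicator)
qed

text \<open>Each v in the unit ball is carried along the segment from
  \<open>p + \<rho> *\<^sub>R v\<close> to \<open>q + \<rho>' *\<^sub>R v\<close>, whose length is
  at most \<open>dist p q + \<bar>\<rho> - \<rho>'\<bar>\<close>. After exchanging the integrals,
  the points at a fixed time fill a ball of radius at least \<open>m\<close>, so the change of
  variables costs at most m^(-d). The set \<open>N\<close> has to contain all these intermediate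
  balls.\<close>

lemma avg_diff_le:
  fixes u :: "real^'n \<Rightarrow> real"
  assumes u: "u \<in> Cc_infinity A" and m: "0 < m" "m \<le> \<rho>" "m \<le> \<rho>'" and N: "N \<in> sets borel"
    and inside: "\<And>v t. norm v < 1 \<Longrightarrow> 0 \<le> t \<Longrightarrow> t \<le> 1 \<Longrightarrow> p + t *\<^sub>R (q - p) + (\<rho> + t * (\<rho>' - \<rho>)) *\<^sub>R v \<in> N"
  shows "ennreal \<bar>avg u p \<rho> - avg u q \<rho>'\<bar> \<le> ennreal ((dist p q + \<bar>\<rho> - \<rho>'\<bar>) / m ^ CARD('n)) * grad_integral u N"
proof -
  have su: "smooth u" by (rule Cc_infinity_smooth[OF u])
  have gb [measurable]: "grad u \<in> borel_measurable borel" by (rule grad_borel[OF su])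
  define D where "D = dist p q + \<bar>\<rho> - \<rho>'\<bar>"
  have D: "D \<ge> 0" by (simp add: D_def)
  define \<gamma> where "\<gamma> t v = p + t *\<^sub>R (q - p) + (\<rho> + t * (\<rho>' - \<rho>)) *\<^sub>R v" for t and v :: "real^'n"
  have \<gamma>_meas: "(\<lambda>z. \<gamma> (fst z) (snd z)) \<in> borel_measurable (lborel \<Otimes>\<^sub>M lborel)"
    "(\<lambda>z. \<gamma> (snd z) (fst z)) \<in> borel_measurable (lborel \<Otimes>\<^sub>M lborel)"
    unfolding \<gamma>_def by measurable
  note iu = avg_integrable[OF u]
  have "avg u p \<rho> - avg u q \<rho>' = (LINT v|lborel. indicator (ball 0 1) v * u (p + \<rho> *\<^sub>R v) - indicator (ball 0 1) v * u (q + \<rho>' *\<^sub>R v))"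
    unfolding avg_def using iu by simp
  then have "ennreal \<bar>avg u p \<rho> - avg u q \<rho>'\<bar> \<le> (\<integral>\<^sup>+v. ennreal (norm (indicator (ball 0 1) v * u (p + \<rho> *\<^sub>R v) - indicator (ball 0 1) v * u (q + \<rho>' *\<^sub>R v))) \<partial>lborel)"
    using integral_norm_bound_ennreal[of lborel "\<lambda>v. indicator (ball 0 1) v * u (p + \<rho> *\<^sub>R v) - indicator (ball 0 1) v * u (q + \<rho>' *\<^sub>R v)"] iu
    by simp
  also have "\<dots> \<le> (\<integral>\<^sup>+v. \<integral>\<^sup>+t. indicator (ball 0 1) v * (indicator {0..1} t * ennreal (D * norm (grad u (\<gamma> t v)))) \<partial>lborel \<partial>lborel)"
  proof (rule nn_integral_mono)
    fix v :: "real^'n"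
    show "ennreal (norm (indicator (ball 0 1) v * u (p + \<rho> *\<^sub>R v) - indicator (ball 0 1) v * u (q + \<rho>' *\<^sub>R v)))
      \<le> (\<integral>\<^sup>+t. indicator (ball 0 1) v * (indicator {0..1} t * ennreal (D * norm (grad u (\<gamma> t v)))) \<partial>lborel)"
    proof (cases "norm v < 1")
      case True
      define w where "w = (q - p) + (\<rho>' - \<rho>) *\<^sub>R v"
      have "norm w \<le> norm (q - p) + \<bar>\<rho>' - \<rho>\<bar> * norm v" unfolding w_def by (metis norm_scaleR norm_triangle_ineq)
      also have "\<dots> \<le> D" using mult_left_mono[of "norm v" 1 "\<bar>\<rho>' - \<rho>\<bar>"] True
        by (simp add: D_def dist_norm norm_minus_commute abs_minus_commute)
      finally have w: "norm w \<le> D" .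
      have "q + \<rho>' *\<^sub>R v = (p + \<rho> *\<^sub>R v) + w" by (simp add: w_def algebra_simps)
      moreover have "\<gamma> t v = (p + \<rho> *\<^sub>R v) + t *\<^sub>R w" for t by (simp add: \<gamma>_def w_def algebra_simps)
      ultimately show ?thesis
        using segment_difference_le[OF su w, of "p + \<rho> *\<^sub>R v"] True by (simp add: abs_minus_commute)
    qed simp
  qed
  also have "\<dots> = (\<integral>\<^sup>+t. \<integral>\<^sup>+v. indicator (ball 0 1) v * (indicator {0..1} t * ennreal (D * norm (grad u (\<gamma> t v)))) \<partial>lborel \<partial>lborel)"
  proof (rule lborel_pair.Fubini')
    have "(\<lambda>z. indicator (ball 0 1) (snd z) * (indicator {0..1} (fst z) * ennreal (D * norm (grad u (\<gamma> (fst z) (snd z))))) :: ennreal)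
       \<in> borel_measurable (lborel \<Otimes>\<^sub>M lborel)"
    proof (intro borel_measurable_times_ennreal)
      show "(\<lambda>z :: real \<times> (real^'n). indicator (ball 0 1) (snd z) :: ennreal) \<in> borel_measurable (lborel \<Otimes>\<^sub>M lborel)"
        by (rule measurable_compose[OF measurable_snd borel_measurable_indicator]) simp
      show "(\<lambda>z :: real \<times> (real^'n). indicator {0..1} (fst z) :: ennreal) \<in> borel_measurable (lborel \<Otimes>\<^sub>M lborel)"
        by (rule measurable_compose[OF measurable_fst borel_measurable_indicator]) simp
      show "(\<lambda>z. ennreal (D * norm (grad u (\<gamma> (fst z) (snd z))))) \<in> borel_measurable (lborel \<Otimes>\<^sub>M lborel)"
        by (rule measurable_compose[OF \<gamma>_meas(1)]) measurable
    qed
    then show "(\<lambda>(t, v). indicator (ball 0 1) v * (indicator {0..1} t * ennreal (D * norm (grad u (\<gamma> t v)))))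
       \<in> borel_measurable (lborel \<Otimes>\<^sub>M lborel)"
      by (simp add: case_prod_beta')
  qed
  also have "\<dots> \<le> (\<integral>\<^sup>+t. indicator {0..1::real} t * (ennreal (D / m ^ CARD('n)) * grad_integral u N) \<partial>lborel)"
  proof (rule nn_integral_mono)
    fix t :: real
    show "(\<integral>\<^sup>+v. indicator (ball 0 1) v * (indicator {0..1} t * ennreal (D * norm (grad u (\<gamma> t v)))) \<partial>lborel)
      \<le> indicator {0..1} t * (ennreal (D / m ^ CARD('n)) * grad_integral u N)"
    proof (cases "t \<in> {0..1}")
      case True
      define r where "r = \<rho> + t * (\<rho>' - \<rho>)"
      have "r = (1 - t) * \<rho> + t * \<rho>'" by (simp add: r_def algebra_simps)
      moreover have "(1 - t) * m + t * m \<le> (1 - t) * \<rho> + t * \<rho>'" using m True by (intro add_mono mult_left_mono) auto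
      ultimately have r: "m \<le> r" by (simp add: algebra_simps)
      define f where "f y = indicator N y * ennreal (norm (grad u y))" for y
      have f: "f \<in> borel_measurable borel" unfolding f_def using N by measurable
      have "(\<integral>\<^sup>+v. indicator (ball 0 1) v * (indicator {0..1} t * ennreal (D * norm (grad u (\<gamma> t v)))) \<partial>lborel)
         \<le> (\<integral>\<^sup>+v. ennreal D * f (\<gamma> t v) \<partial>lborel)"
      proof (rule nn_integral_mono)
        fix v :: "real^'n"
        show "indicator (ball 0 1) v * (indicator {0..1} t * ennreal (D * norm (grad u (\<gamma> t v)))) \<le> ennreal D * f (\<gamma> t v)"
        proof (cases "norm v < 1")
          case v: True
          then have "\<gamma> t v \<in> N" unfolding \<gamma>_def using True by (intro inside) auto
          then show ?thesis using D by (simp add: f_def indicator_def ennreal_mult)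
        qed simp
      qed
      also have "\<dots> = ennreal D * (\<integral>\<^sup>+v. f (\<gamma> t v) \<partial>lborel)"
        using f \<gamma>_meas by (intro nn_integral_cmult) (simp add: \<gamma>_def)
      also have "(\<integral>\<^sup>+v. f (\<gamma> t v) \<partial>lborel) \<le> ennreal (1 / m ^ CARD('n)) * grad_integral u N"
      proof -
        have *: "grad_integral u N = ennreal (r ^ CARD('n)) * (\<integral>\<^sup>+v. f (\<gamma> t v) \<partial>lborel)"
          unfolding grad_integral_def f_def[symmetric]
          using lborel_affine_nn_integral[OF f, of r "p + t *\<^sub>R (q - p)"] r m by (simp add: \<gamma>_def r_def)
        have "ennreal (1 / m ^ CARD('n)) * grad_integral u N = ennreal (1 / m ^ CARD('n) * r ^ CARD('n)) * (\<integral>\<^sup>+v. f (\<gamma> t v) \<partial>lborel)"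
        proof -
          have "ennreal (1 / m ^ CARD('n) * r ^ CARD('n)) = ennreal (1 / m ^ CARD('n)) * ennreal (r ^ CARD('n))"
            using r m by (intro ennreal_mult) auto
          then show ?thesis using * by (simp only: mult.assoc)
        qed
        moreover have "ennreal 1 \<le> ennreal (1 / m ^ CARD('n) * r ^ CARD('n))"
          using r m power_mono[of m r "CARD('n)"] by (intro ennreal_leI) (simp add: field_simps)
        ultimately show ?thesis
          using mult_right_mono[of 1 "ennreal (1 / m ^ CARD('n) * r ^ CARD('n))" "\<integral>\<^sup>+v. f (\<gamma> t v) \<partial>lborel"] by simp
      qed
      finally have "(\<integral>\<^sup>+v. indicator (ball 0 1) v * (indicator {0..1} t * ennreal (D * norm (grad u (\<gamma> t v)))) \<partial>lborel)
         \<le> ennreal D * (ennreal (1 / m ^ CARD('n)) * grad_integral u N)" by (simp add: mult_left_mono)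
      also have "\<dots> = ennreal (D / m ^ CARD('n)) * grad_integral u N"
        using D m by (simp add: mult.assoc[symmetric] ennreal_mult[symmetric])
      finally show ?thesis using True by simp
    qed simp
  qed
  also have "\<dots> = ennreal (D / m ^ CARD('n)) * grad_integral u N"
    by (subst nn_integral_multc) auto
  finally show ?thesis by (simp add: D_def)
qed

text \<open>The curve is subdivided so finely that consecutive points are closer than \<rho>. Each
  step is one application of \<open>avg_diff_le\<close> with the same set \<open>N\<close>, whose
  intermediate balls lie in a ball of radius 2\<rho>, and the chords add up to at most the length of
  the curve.\<close>

lemma avg_chain_le:
  fixes u :: "real^'n \<Rightarrow> real"
  assumes u: "u \<in> Cc_infinity A" and \<rho>: "\<rho> > 0" and \<gamma>: "path \<gamma>" and L: "curve_length \<gamma> \<le> ennreal L" "L \<ge> 0"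
    and N: "N \<in> sets borel" and inside: "\<And>w. w \<in> path_image \<gamma> \<Longrightarrow> ball w (2 * \<rho>) \<subseteq> N"
  shows "ennreal \<bar>avg u (pathstart \<gamma>) \<rho> - avg u (pathfinish \<gamma>) \<rho>\<bar> \<le> ennreal (L / \<rho> ^ CARD('n)) * grad_integral u N"
proof -
  have "uniformly_continuous_on {0..1} \<gamma>"
    using \<gamma> unfolding path_def by (rule compact_uniformly_continuous) simp
  then obtain \<tau> where \<tau>: "\<tau> > 0" "\<And>s t. s \<in> {0..1} \<Longrightarrow> t \<in> {0..1} \<Longrightarrow> dist s t < \<tau> \<Longrightarrow> dist (\<gamma> s) (\<gamma> t) < \<rho>"
    unfolding uniformly_continuous_on_def using \<rho> by (metis dist_commute)
  obtain n0 where n0: "inverse (real (Suc n0)) < \<tau>" using reals_Archimedean[OF \<tau>(1)] by blast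
  define n where "n = Suc n0"
  define p where "p i = \<gamma> (real i / real n)" for i
  have n: "real n > 0" by (simp add: n_def)
  have I: "real i / real n \<in> {0..1}" if "i \<le> n" for i using that n by (simp add: field_simps)
  have close: "dist (p i) (p (Suc i)) < \<rho>" if "i < n" for i
  proof -
    have eq: "real i / real n - real (Suc i) / real n = - inverse (real n)"
      by (simp add: add_divide_distrib inverse_eq_divide)
    have "dist (real i / real n) (real (Suc i) / real n) = inverse (real n)"
      unfolding dist_real_def eq using n by simp
    then have "dist (real i / real n) (real (Suc i) / real n) < \<tau>" using n0 by (simp add: n_def)
    then show ?thesis unfolding p_def using that by (intro \<tau>(2) I) auto
  qed
  have step: "ennreal \<bar>avg u (p i) \<rho> - avg u (p (Suc i)) \<rho>\<bar> \<le> ennreal (dist (p i) (p (Suc i)) / \<rho> ^ CARD('n)) * grad_integral u N" if i: "i < n" for i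
  proof -
    have "ennreal \<bar>avg u (p i) \<rho> - avg u (p (Suc i)) \<rho>\<bar> \<le> ennreal ((dist (p i) (p (Suc i)) + \<bar>\<rho> - \<rho>\<bar>) / \<rho> ^ CARD('n)) * grad_integral u N"
    proof (rule avg_diff_le[OF u \<rho> order_refl order_refl N])
      fix v :: "real^'n" and t :: real assume v: "norm v < 1" and t: "0 \<le> t" "t \<le> 1"
      have "norm (t *\<^sub>R (p (Suc i) - p i) + \<rho> *\<^sub>R v) \<le> \<bar>t\<bar> * norm (p (Suc i) - p i) + \<bar>\<rho>\<bar> * norm v"
        by (metis norm_scaleR norm_triangle_ineq)
      also have "\<dots> \<le> 1 * norm (p (Suc i) - p i) + \<rho> * norm v"
        using t \<rho> by (intro add_mono mult_right_mono) auto
      also have "\<dots> < \<rho> + \<rho>"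
        using close[OF i] \<rho> v by (intro add_strict_mono) (auto simp: dist_norm norm_minus_commute)
      finally have "p i + t *\<^sub>R (p (Suc i) - p i) + \<rho> *\<^sub>R v \<in> ball (p i) (2 * \<rho>)"
      proof -
        have "dist c (c + w) = norm w" for c w :: "real^'n" by (simp add: dist_norm)
        moreover assume "norm (t *\<^sub>R (p (Suc i) - p i) + \<rho> *\<^sub>R v) < \<rho> + \<rho>"
        ultimately show ?thesis by (simp only: add.assoc mem_ball)
      qed
      moreover have "p i \<in> path_image \<gamma>" unfolding p_def path_image_def using I[of i] i by auto
      ultimately have "p i + t *\<^sub>R (p (Suc i) - p i) + \<rho> *\<^sub>R v \<in> N" using inside by blast
      then show "p i + t *\<^sub>R (p (Suc i) - p i) + (\<rho> + t * (\<rho> - \<rho>)) *\<^sub>R v \<in> N" by simp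
    qed
    then show ?thesis by simp
  qed
  have "\<bar>avg u (p 0) \<rho> - avg u (p m) \<rho>\<bar> \<le> (\<Sum>i<m. \<bar>avg u (p i) \<rho> - avg u (p (Suc i)) \<rho>\<bar>)" for m
    by (induction m) auto
  then have "ennreal \<bar>avg u (p 0) \<rho> - avg u (p n) \<rho>\<bar> \<le> ennreal (\<Sum>i<n. \<bar>avg u (p i) \<rho> - avg u (p (Suc i)) \<rho>\<bar>)"
    by (rule ennreal_leI)
  also have "\<dots> = (\<Sum>i<n. ennreal \<bar>avg u (p i) \<rho> - avg u (p (Suc i)) \<rho>\<bar>)" by (simp add: sum_ennreal)
  also have "\<dots> \<le> (\<Sum>i<n. ennreal (dist (p i) (p (Suc i)) / \<rho> ^ CARD('n)) * grad_integral u N)"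
    by (intro sum_mono step) auto
  also have "\<dots> = (\<Sum>i<n. ennreal (dist (p i) (p (Suc i)))) * ennreal (1 / \<rho> ^ CARD('n)) * grad_integral u N"
  proof -
    have "ennreal (dist (p i) (p (Suc i)) / \<rho> ^ CARD('n)) = ennreal (dist (p i) (p (Suc i))) * ennreal (1 / \<rho> ^ CARD('n))" for i
      using \<rho> by (subst ennreal_mult[symmetric]) auto
    then show ?thesis by (simp only: sum_distrib_right)
  qed
  also have "(\<Sum>i<n. ennreal (dist (p i) (p (Suc i)))) \<le> curve_length \<gamma>"
  proof -
    define ts where "ts = map (\<lambda>i. real i / real n) [0..<Suc n]"
    have len: "length ts - 1 = n" by (simp add: ts_def)
    have nth: "ts ! i = real i / real n" if "i \<le> n" for i using that unfolding ts_def
      by (subst nth_map) (auto simp del: upt_Suc)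
    have "sorted ts" unfolding ts_def sorted_map
      by (rule sorted_wrt_mono_rel[OF _ sorted_wrt_upt]) (use n in \<open>auto intro: divide_right_mono\<close>)
    moreover have "set ts \<subseteq> {0..1}" unfolding ts_def using I by (auto simp del: upt_Suc)
    ultimately have "(\<Sum>i<length ts - 1. ennreal (dist (\<gamma> (ts ! i)) (\<gamma> (ts ! Suc i)))) \<le> curve_length \<gamma>"
      unfolding curve_length_def by (intro SUP_upper) auto
    moreover have "(\<Sum>i<length ts - 1. ennreal (dist (\<gamma> (ts ! i)) (\<gamma> (ts ! Suc i)))) = (\<Sum>i<n. ennreal (dist (p i) (p (Suc i))))"
      unfolding len by (intro sum.cong) (auto simp: nth p_def)
    ultimately show ?thesis by simp
  qed
  also note L(1)
  also have "ennreal L * ennreal (1 / \<rho> ^ CARD('n)) = ennreal (L / \<rho> ^ CARD('n))"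
    using L(2) \<rho> by (simp add: ennreal_mult[symmetric])
  finally show ?thesis
    using n by (simp add: p_def pathstart_def pathfinish_def mult_right_mono)
qed

lemma dist_le_curve_length:
  assumes "t \<in> {0..1}"
  shows "ennreal (dist (\<gamma> 0) (\<gamma> t)) \<le> curve_length \<gamma>"
proof -
  have "(\<Sum>i<length [0, t] - 1. ennreal (dist (\<gamma> ([0, t] ! i)) (\<gamma> ([0, t] ! Suc i)))) \<le> curve_length \<gamma>"
    unfolding curve_length_def using assms by (intro SUP_upper) auto
  then show ?thesis by simp
qed

section \<open>Dyadic sums and integrals of powers of the distance\<close>

lemma suminf_ennreal_le:
  assumes "\<And>j. 0 \<le> f j" "\<And>n. (\<Sum>j<n. f j) \<le> S"
  shows "(\<Sum>j. ennreal (f j)) \<le> ennreal S"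
proof (rule suminf_le_const[OF summableI])
  fix n
  have "(\<Sum>j<n. ennreal (f j)) = ennreal (\<Sum>j<n. f j)" using assms(1) by (simp add: sum_ennreal)
  then show "(\<Sum>j<n. ennreal (f j)) \<le> ennreal S" using assms(2) by (simp add: ennreal_leI)
qed

text \<open>Comparison with a telescoping sum: if the scale is capped at \<open>X\<close>, the
  differences of its powers are nonnegative throughout and a fixed multiple of the summand once the
  scale is at most \<open>X\<close>. The index at which this happens never has to be
  located.\<close>

lemma dyadic_sum_small:
  fixes r0 X \<tau> :: real
  assumes "r0 > 0" "X > 0" "\<tau> > 0"
  shows "(\<Sum>j. ennreal (if r0 * (1/2)^j \<le> X then (r0 * (1/2)^j) powr \<tau> else 0)) \<le> ennreal (X powr \<tau> / (1 - 2 powr (- \<tau>)))"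
proof (rule suminf_ennreal_le)
  define r where "r j = r0 * (1/2)^j" for j :: nat
  have r: "r j > 0" "r (Suc j) = r j / 2" for j using assms by (auto simp: r_def)
  define \<theta> where "\<theta> = 1 - 2 powr (- \<tau>)"
  have "2 powr (- \<tau>) < (2::real) powr 0" using assms by (intro powr_less_mono) auto
  then have \<theta>: "\<theta> > 0" by (simp add: \<theta>_def)
  define b where "b j = min (r j) X powr \<tau>" for j
  have b0: "b j \<ge> 0" for j by (simp add: b_def)
  have step: "(if r j \<le> X then r j powr \<tau> else 0) \<le> (b j - b (Suc j)) / \<theta>" for j
  proof (cases "r j \<le> X")
    case True
    moreover have "r j / 2 \<le> X" using True r(1)[of j] by linarith
    ultimately have "b j = r j powr \<tau>" "b (Suc j) = (r j / 2) powr \<tau>" by (simp_all add: b_def min_def r(2))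
    then have "b j - b (Suc j) = r j powr \<tau> * \<theta>"
      using r[of j] by (simp add: powr_divide powr_minus \<theta>_def field_simps)
    then show ?thesis using True \<theta> by simp
  next
    case False
    have "b (Suc j) \<le> b j" unfolding b_def using r[of j] assms by (intro powr_mono2) auto
    then show ?thesis using False \<theta> by simp
  qed
  fix n
  have "(\<Sum>j<n. if r j \<le> X then r j powr \<tau> else 0) \<le> (\<Sum>j<n. (b j - b (Suc j)) / \<theta>)"
    by (intro sum_mono step)
  also have "\<dots> = (b 0 - b n) / \<theta>"
    using sum_lessThan_telescope[of "\<lambda>j. - b j" n] by (simp add: sum_divide_distrib[symmetric])
  also have "\<dots> \<le> X powr \<tau> / \<theta>"
  proof (intro divide_right_mono)
    have "b 0 \<le> X powr \<tau>" unfolding b_def using assms r by (intro powr_mono2) (auto simp: less_imp_le)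
    then show "b 0 - b n \<le> X powr \<tau>" using b0[of n] by simp
  qed (use \<theta> in simp)
  finally show "(\<Sum>j<n. if r0 * (1/2)^j \<le> X then (r0 * (1/2)^j) powr \<tau> else 0) \<le> X powr \<tau> / (1 - 2 powr (- \<tau>))"
    by (simp add: r_def \<theta>_def cong: if_cong)
qed simp

lemma dyadic_sum_large:
  fixes r0 X \<tau> :: real
  assumes "r0 > 0" "X > 0" "\<tau> < 0"
  shows "(\<Sum>j. ennreal (if X < r0 * (1/2)^j then (r0 * (1/2)^j) powr \<tau> else 0)) \<le> ennreal ((X / 2) powr \<tau> / (2 powr (- \<tau>) - 1))"
proof (rule suminf_ennreal_le)
  define r where "r j = r0 * (1/2)^j" for j :: nat
  have r: "r j > 0" "r (Suc j) = r j / 2" for j using assms by (auto simp: r_def)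
  define \<theta> where "\<theta> = 2 powr (- \<tau>) - 1"
  have "(2::real) powr 0 < 2 powr (- \<tau>)" using assms by (intro powr_less_mono) auto
  then have \<theta>: "\<theta> > 0" by (simp add: \<theta>_def)
  \<comment> \<open>The floor is X/2 rather than \<open>X\<close>, because a scale above
    \<open>X\<close> may land between X/2 and \<open>X\<close> when it is halved; with this floor
    the telescoping identity is exact for every term that counts.\<close>
  define b where "b j = max (r j) (X / 2) powr \<tau>" for j
  have b0: "b j \<ge> 0" for j by (simp add: b_def)
  have step: "(if X < r j then r j powr \<tau> else 0) \<le> (b (Suc j) - b j) / \<theta>" for j
  proof (cases "X < r j")
    case True
    then have "max (r j) (X / 2) = r j" "max (r j / 2) (X / 2) = r j / 2" using assms by auto
    then have "b j = r j powr \<tau>" "b (Suc j) = (r j / 2) powr \<tau>" by (simp_all add: b_def r(2))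
    then have "b (Suc j) - b j = r j powr \<tau> * \<theta>"
      using r[of j] by (simp add: powr_divide powr_minus \<theta>_def field_simps)
    then show ?thesis using True \<theta> by simp
  next
    case False
    have "b j \<le> b (Suc j)" unfolding b_def using r[of j] assms by (intro powr_mono2') auto
    then show ?thesis using False \<theta> by simp
  qed
  fix n
  have "(\<Sum>j<n. if X < r j then r j powr \<tau> else 0) \<le> (\<Sum>j<n. (b (Suc j) - b j) / \<theta>)"
    by (intro sum_mono step)
  also have "\<dots> = (b n - b 0) / \<theta>"
    using sum_lessThan_telescope[of b n] by (simp add: sum_divide_distrib[symmetric])
  also have "\<dots> \<le> (X / 2) powr \<tau> / \<theta>"
  proof (intro divide_right_mono)
    have "b n \<le> (X / 2) powr \<tau>" unfolding b_def using assms r[of n] by (intro powr_mono2') auto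
    then show "b n - b 0 \<le> (X / 2) powr \<tau>" using b0[of 0] by simp
  qed (use \<theta> in simp)
  finally show "(\<Sum>j<n. if X < r0 * (1/2)^j then (r0 * (1/2)^j) powr \<tau> else 0) \<le> (X / 2) powr \<tau> / (2 powr (- \<tau>) - 1)"
    by (simp add: r_def \<theta>_def cong: if_cong)
qed simp

text \<open>For positive \<open>t\<close>, a decomposition into dyadic tubes: the tube of width
  2^(-j) has volume at most of order 2^(-j (d - s)), and the points first captured there have an
  integrand of order 2^(j t). The condition on \<open>t\<close> makes the resulting geometric series
  converge. For the remaining \<open>t\<close> the integrand is bounded on the ball.\<close>

lemma distance_power_integral_finite:
  fixes G :: "(real^'n) set"
  assumes reg: "ahlfors_regular s G" and G: "closed G" "G \<noteq> {}" and R: "R > 0" and t: "t < real CARD('n) - s"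
  shows "(\<integral>\<^sup>+y. indicator {y \<in> ball 0 R. 0 < infdist y G} y * ennreal (infdist y G powr (- t)) \<partial>lborel) < \<infinity>"
proof (cases "t \<le> 0")
  case True
  obtain z where z: "z \<in> G" using G by auto
  define D where "D = R + norm z"
  have le: "indicator {y \<in> ball 0 R. 0 < infdist y G} y * ennreal (infdist y G powr (- t)) \<le> ennreal (D powr (- t)) * indicator (ball 0 R) y" for y
  proof (cases "y \<in> {y \<in> ball 0 R. 0 < infdist y G}")
    case y: True
    have "infdist y G \<le> dist y z" by (rule infdist_le[OF z])
    also have "\<dots> \<le> dist 0 y + dist 0 z" by metric
    also have "\<dots> \<le> D" using y by (simp add: D_def)
    finally have "infdist y G powr (- t) \<le> D powr (- t)" using True infdist_nonneg by (intro powr_mono2) auto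
    then show ?thesis using y by (simp add: ennreal_leI)
  qed simp
  have "(\<integral>\<^sup>+y. indicator {y \<in> ball 0 R. 0 < infdist y G} y * ennreal (infdist y G powr (- t)) \<partial>lborel)
     \<le> (\<integral>\<^sup>+y. ennreal (D powr (- t)) * indicator (ball (0::real^'n) R) y \<partial>lborel)"
    by (intro nn_integral_mono le)
  also have "\<dots> = ennreal (D powr (- t)) * emeasure lborel (ball (0::real^'n) R)"
    by (rule nn_integral_cmult_indicator) simp
  also have "\<dots> < \<infinity>" using R by (simp add: emeasure_ball ennreal_mult_less_top)
  finally show ?thesis .
next
  case False
  then have t0: "t > 0" by simp
  obtain K where K: "K > 0"
    "\<And>p. 0 < p \<Longrightarrow> p \<le> 1 \<Longrightarrow> emeasure lborel {x \<in> ball 0 R. infdist x G < p} \<le> ennreal (K * p powr (real CARD('n) - s))"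
    using tube_volume[OF reg G R] by blast
  define T where "T j = {x \<in> ball 0 R. infdist x G < (1/2)^j}" for j :: nat
  have T_sets: "T j \<in> sets borel" for j
  proof -
    have "open (ball 0 R \<inter> {x. infdist x G < (1/2)^j})"
      by (intro open_Int open_ball open_Collect_less continuous_intros)
    moreover have "T j = ball 0 R \<inter> {x. infdist x G < (1/2)^j}" by (auto simp: T_def)
    ultimately show ?thesis by simp
  qed
  define a where "a = real CARD('n) - s - t"
  have a: "a > 0" using t by (simp add: a_def)
  have le: "indicator {y \<in> ball 0 R. 0 < infdist y G} y * ennreal (infdist y G powr (- t))
     \<le> indicator (ball 0 R) y + (\<Sum>j. ennreal (((1/2)^Suc j) powr (- t)) * indicator (T j) y)" for y
  proof (cases "y \<in> {y \<in> ball 0 R. 0 < infdist y G}")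
    case y: True
    show ?thesis
    proof (cases "infdist y G < 1")
      case small: True
      obtain n where "(1/2::real)^n < infdist y G" using real_arch_pow_inv[of "infdist y G" "1/2"] y by auto
      \<comment> \<open>The first dyadic power that does not exceed the distance. Its predecessor
        does exceed it, so \<open>y\<close> lies in the tube \<open>T j\<close> while its distance
        is still at least half of that width.\<close>
      define j1 where "j1 = (LEAST n. (1/2::real)^n \<le> infdist y G)"
      have j1: "(1/2::real)^j1 \<le> infdist y G" unfolding j1_def
        by (rule LeastI[of _ n]) (use \<open>(1/2)^n < infdist y G\<close> in simp)
      have "j1 \<noteq> 0" using j1 small by (intro notI) simp
      then obtain j where j: "j1 = Suc j" by (cases j1) auto
      have "\<not> (1/2::real)^j \<le> infdist y G"
        using not_less_Least[of j "\<lambda>n. (1/2::real)^n \<le> infdist y G"] j by (simp add: j1_def)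
      then have yT: "y \<in> T j" using y by (simp add: T_def)
      have "infdist y G powr (- t) \<le> ((1/2)^Suc j) powr (- t)"
        using j1 j t0 by (intro powr_mono2') auto
      then have "ennreal (infdist y G powr (- t)) \<le> ennreal (((1/2)^Suc j) powr (- t)) * indicator (T j) y"
        using yT by (simp add: ennreal_leI)
      also have "\<dots> \<le> (\<Sum>j. ennreal (((1/2)^Suc j) powr (- t)) * indicator (T j) y)"
      proof -
        define f where "f j = ennreal (((1/2)^Suc j) powr (- t)) * (indicator (T j) y :: ennreal)" for j
        have "sum f {j} \<le> suminf f" by (rule sum_le_suminf) auto
        then have "f j \<le> suminf f" by simp
        then show ?thesis by (simp only: f_def[abs_def])
      qed
      also have "\<dots> \<le> indicator (ball 0 R) y + (\<Sum>j. ennreal (((1/2)^Suc j) powr (- t)) * indicator (T j) y)"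
        by (simp add: add_increasing)
      finally show ?thesis using y by simp
    next
      case big: False
      then have "infdist y G powr (- t) \<le> 1 powr (- t)" using t0 by (intro powr_mono2') auto
      then have "ennreal (infdist y G powr (- t)) \<le> 1" by (simp add: ennreal_le_1)
      then show ?thesis using y by (simp add: add_increasing2)
    qed
  qed simp
  have "(\<integral>\<^sup>+y. indicator {y \<in> ball 0 R. 0 < infdist y G} y * ennreal (infdist y G powr (- t)) \<partial>lborel)
    \<le> (\<integral>\<^sup>+y. indicator (ball 0 R) y + (\<Sum>j. ennreal (((1/2)^Suc j) powr (- t)) * indicator (T j) y) \<partial>lborel)"
    by (intro nn_integral_mono le)
  also have "\<dots> = (\<integral>\<^sup>+y. indicator (ball (0::real^'n) R) y \<partial>lborel) + (\<integral>\<^sup>+y. (\<Sum>j. ennreal (((1/2)^Suc j) powr (- t)) * indicator (T j) y) \<partial>lborel)"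
    using T_sets by (intro nn_integral_add) (auto intro!: borel_measurable_suminf_order borel_measurable_times_ennreal borel_measurable_indicator)
  also have "(\<integral>\<^sup>+y. (\<Sum>j. ennreal (((1/2)^Suc j) powr (- t)) * indicator (T j) y) \<partial>lborel)
     = (\<Sum>j. \<integral>\<^sup>+y. ennreal (((1/2)^Suc j) powr (- t)) * indicator (T j) y \<partial>lborel)"
    using T_sets by (intro nn_integral_suminf) (auto intro!: borel_measurable_times_ennreal borel_measurable_indicator)
  also have "\<dots> = (\<Sum>j. ennreal (((1/2)^Suc j) powr (- t)) * emeasure lborel (T j))"
    using T_sets by (intro suminf_cong nn_integral_cmult_indicator) auto
  also have "\<dots> \<le> (\<Sum>j. ennreal (K * 2 powr t * (if 1 * (1/2)^j \<le> (1::real) then (1 * (1/2)^j) powr a else 0)))"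
  proof (intro suminf_le summableI allI)
    fix j :: nat
    have pos: "(1/2::real)^j > 0" and le1: "(1/2::real)^j \<le> 1" by (auto simp: power_le_one)
    have "((1/2)^Suc j) powr (- t) = 2 powr t * ((1/2)^j) powr (- t)"
      using pos by (simp add: powr_mult powr_divide powr_minus field_simps)
    then have "((1/2)^Suc j) powr (- t) * (K * ((1/2)^j) powr (real CARD('n) - s)) = K * 2 powr t * (((1/2)^j) powr (- t) * ((1/2)^j) powr (real CARD('n) - s))"
      by simp
    also have "((1/2::real)^j) powr (- t) * ((1/2)^j) powr (real CARD('n) - s) = ((1/2)^j) powr a"
      by (simp add: powr_add[symmetric] a_def)
    finally have eq: "((1/2)^Suc j) powr (- t) * (K * ((1/2)^j) powr (real CARD('n) - s)) = K * 2 powr t * ((1/2)^j) powr a" .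
    have "ennreal (((1/2)^Suc j) powr (- t)) * emeasure lborel (T j) \<le> ennreal (((1/2)^Suc j) powr (- t)) * ennreal (K * ((1/2)^j) powr (real CARD('n) - s))"
      unfolding T_def using K(2)[OF pos le1] by (intro mult_left_mono) auto
    also have "\<dots> = ennreal (K * 2 powr t * ((1/2)^j) powr a)"
      using K(1) eq by (simp add: ennreal_mult[symmetric])
    finally show "ennreal (((1/2)^Suc j) powr (- t)) * emeasure lborel (T j) \<le> ennreal (K * 2 powr t * (if 1 * (1/2)^j \<le> (1::real) then (1 * (1/2)^j) powr a else 0))"
      using le1 by simp
  qed
  also have "\<dots> = ennreal (K * 2 powr t) * (\<Sum>j. ennreal (if 1 * (1/2)^j \<le> (1::real) then (1 * (1/2)^j) powr a else 0))"
    using K(1) by (simp add: ennreal_mult ennreal_suminf_cmult)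
  also have "\<dots> \<le> ennreal (K * 2 powr t) * ennreal (1 powr a / (1 - 2 powr (- a)))"
    by (intro mult_left_mono dyadic_sum_small) (use a in auto)
  also have "(\<integral>\<^sup>+y. indicator (ball (0::real^'n) R) y \<partial>lborel) = emeasure lborel (ball (0::real^'n) R)"
    by (rule nn_integral_indicator) simp
  also have "emeasure lborel (ball (0::real^'n) R) + ennreal (K * 2 powr t) * ennreal (1 powr a / (1 - 2 powr (- a))) < \<infinity>"
    using R by (simp add: emeasure_ball ennreal_mult_less_top)
  finally show ?thesis by (simp add: add_left_mono)
qed

subsection \<open>Boundary parts of positive capacity\<close>

context elliptic
begin

lemma weak_gradient_smooth:
  assumes "\<phi> \<in> Cc_infinity A"
  shows "weak_gradient \<Omega> \<phi> (grad \<phi>)"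
  unfolding weak_gradient_def
proof (intro conjI allI ballI)
  show "\<phi> \<in> L1_loc \<Omega>" by (intro L2_loc_L1_loc L2_imp_L2_loc test_L2[OF assms])
  show "(\<lambda>x. grad \<phi> x $ k) \<in> L1_loc \<Omega>" for k
    using L2_loc_L1_loc[OF L2_imp_L2_loc[OF test_L2[OF Cc_infinity_partial[OF assms]]]] by simp
  show "(LINT x|lebesgue_on \<Omega>. \<phi> x * partial k \<eta> x) = - (LINT x|lebesgue_on \<Omega>. grad \<phi> x $ k * \<eta> x)"
    if "\<eta> \<in> Cc_infinity \<Omega>" for k \<eta>
    using integral_by_parts_on[OF Cc_infinity_smooth[OF assms] that \<Omega>_sets] by simp
qed

lemma avg_eq_integral:
  assumes u: "u \<in> Cc_infinity \<Omega>" and \<rho>: "\<rho> > 0"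
  shows "\<rho> ^ CARD('n) * avg u c \<rho> = (LINT x|lebesgue_on \<Omega>. u x * indicator (ball c \<rho>) x)"
proof -
  define f where "f x = u x * indicator (ball c \<rho>) x" for x
  have f: "f \<in> borel_measurable borel"
    unfolding f_def[abs_def] using smooth_borel[OF Cc_infinity_smooth[OF u]]
    by (intro borel_measurable_times borel_measurable_indicator) auto
  have "(LINT x|lborel. f x) = \<rho> ^ CARD('n) * (LINT v|lborel. f (c + \<rho> *\<^sub>R v))"
    using lborel_affine_integral[OF f, of \<rho> c] \<rho> by simp
  moreover have "(\<lambda>v. f (c + \<rho> *\<^sub>R v)) = (\<lambda>v. indicator (ball 0 1) v * u (c + \<rho> *\<^sub>R v))"
    using \<rho> by (intro ext) (simp add: f_def indicator_def dist_norm)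
  moreover have "(LINT x|lborel. f x) = (LINT x|lebesgue_on UNIV. f x)"
    using f by (simp add: lebesgue_on_UNIV_eq lebesgue_lborel_integral)
  moreover obtain K where "K \<subseteq> \<Omega>" "\<And>x. x \<notin> K \<Longrightarrow> u x = 0" using u by (metis Cc_infinityE)
  then have "(LINT x|lebesgue_on UNIV. f x) = (LINT x|lebesgue_on \<Omega>. f x)"
    using \<Omega>_sets by (intro integral_lebesgue_on_support) (auto simp: f_def)
  ultimately have "\<rho> ^ CARD('n) * avg u c \<rho> = (LINT x|lebesgue_on \<Omega>. f x)"
    unfolding avg_def by (simp only:)
  then show ?thesis by (simp only: f_def)
qed

text \<open>
  The kernel \<open>k\<close> represents the mean over the ball around \<open>c\<close> by boundary values, which are 0, plus an
  integral of the gradient; \<open>\<nu>\<close> is the measure on the boundary.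
\<close>

lemma not_markov_unique_if_trace:
  fixes G :: "(real^'n) set" and \<nu> :: "(real^'n) measure" and k :: "real^'n \<Rightarrow> real^'n \<Rightarrow> ennreal"
  assumes G: "closed G" "G \<noteq> {}" "G \<subseteq> frontier \<Omega>" and a0: "a0 > 0"
    and low: "AE x in lebesgue_on \<Omega>. x \<in> ball z r \<longrightarrow> mat_le (mat (a0 * infdist x G powr \<delta>)) (C x)"
    and \<rho>: "\<rho> > 0" "ball c \<rho> \<subseteq> ball z r" and x0: "x0 \<in> \<Omega> \<inter> ball c \<rho>"
    and \<nu>: "finite_measure \<nu>" "sets \<nu> = sets borel" and X: "X \<in> sets borel" "emeasure \<nu> X > 0"
    and km: "(\<lambda>(x, y). k x y) \<in> borel_measurable (\<nu> \<Otimes>\<^sub>M lborel)"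
    and K1: "\<And>u x. u \<in> Cc_infinity \<Omega> \<Longrightarrow> x \<in> X \<Longrightarrow> ennreal \<bar>avg u c \<rho>\<bar> \<le> (\<integral>\<^sup>+y. k x y * ennreal (norm (grad u y)) \<partial>lborel)"
    and K2: "\<And>y. y \<in> \<Omega> \<inter> ball z r \<Longrightarrow> (\<integral>\<^sup>+x. indicator X x * k x y \<partial>\<nu>) \<le> ennreal (K * infdist y G powr \<sigma>)" and K: "K \<ge> 0"
    and K3: "\<And>x y. x \<in> X \<Longrightarrow> y \<notin> ball z r \<Longrightarrow> k x y = 0"
    and K4: "(\<integral>\<^sup>+y. indicator {y \<in> ball z r. 0 < infdist y G} y * ennreal (infdist y G powr (2 * \<sigma> - \<delta>)) \<partial>lborel) < \<infinity>"
  shows "\<not> markov_unique \<Omega> C"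
proof
  assume unique: "markov_unique \<Omega> C"
  let ?M = "lebesgue_on \<Omega>"
  interpret \<nu>: finite_measure \<nu> by (rule \<nu>(1))
  interpret P: pair_sigma_finite \<nu> lborel by unfold_locales
  \<comment> \<open>A test function of the whole space belongs to the domain of \<open>h_N\<close>,
    hence by assumption to that of \<open>h_D\<close>. Its gradient vanishes on the ball, so the
    energy of the approximants \<open>u n\<close> there tends to 0, although their values on the
    part of \<Omega> in this ball tend to 1 in \<open>L2\<close>.\<close>
  obtain \<phi> where \<phi>: "\<phi> \<in> Cc_infinity (UNIV :: (real^'n) set)" "\<And>x. x \<in> cball z r \<Longrightarrow> \<phi> x = 1"
    "\<And>x k. x \<in> cball z r \<Longrightarrow> partial k \<phi> x = 0"
    using smooth_cutoff[of "cball z r" UNIV] by (metis compact_cball open_UNIV subset_UNIV)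
  have "(\<phi>, energy \<Omega> C (grad \<phi>)) \<in> h_D \<Omega> C"
    using h_NI[OF weak_gradient_smooth[OF \<phi>(1)] test_L2[OF \<phi>(1)] finite_energy_grad[OF \<phi>(1)]] unique
    by (simp add: markov_unique_def)
  then obtain u g where u: "\<And>n::nat. u n \<in> Cc_infinity \<Omega>"
    and uL: "(\<lambda>n. LINT x|?M. (u n x - \<phi> x)\<^sup>2) \<longlonglongrightarrow> 0"
    and g: "finite_energy \<Omega> C g" "(\<lambda>n. energy \<Omega> C (\<lambda>x. grad (u n) x - g x)) \<longlonglongrightarrow> 0" "weak_gradient \<Omega> \<phi> g"
    by (rule h_D_limit) blast
  have geq: "AE x in ?M. g x = grad \<phi> x"
    by (rule weak_gradient_unique[OF g(3) weak_gradient_smooth[OF \<phi>(1)] open_\<Omega>])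
      (use finite_energy_L2_loc[OF g(1)] finite_energy_L2_loc[OF finite_energy_grad[OF \<phi>(1)]] in auto)
  define e where "e n = energy \<Omega> C (\<lambda>x. grad (u n) x - g x)" for n
  have e: "e \<longlonglongrightarrow> 0" "e n \<ge> 0" for n using g(2) energy_nonneg by (simp_all add: e_def[abs_def])
  have su: "smooth (u n)" for n by (rule Cc_infinity_smooth[OF u])
  have gb [measurable]: "grad (u n) \<in> borel_measurable borel" for n by (rule grad_borel[OF su])
  have u0: "grad (u n) y = 0" if "y \<notin> \<Omega>" for n y
  proof -
    obtain L where "L \<subseteq> \<Omega>" "\<And>x k. x \<notin> L \<Longrightarrow> partial k (u n) x = 0" using u[of n] by (metis Cc_infinityE)
    then show ?thesis using that by (auto simp: vec_eq_iff)
  qed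
  have dpos: "infdist y G > 0" if "y \<in> \<Omega>" for y
  proof -
    have "y \<notin> G" using that G(3) open_\<Omega> by (auto simp: frontier_def interior_open)
    then show ?thesis using G(1,2) infdist_pos_not_in_closed by blast
  qed
  have \<Omega>b: "\<Omega> \<in> sets borel" using open_\<Omega> by simp
  have im: "(\<lambda>y. infdist y G) \<in> borel_measurable borel"
    by (intro borel_measurable_continuous_onI continuous_intros)
  define D where "D = \<Omega> \<inter> ball z r"
  have D: "D \<in> sets borel" unfolding D_def using \<Omega>b by simp
  \<comment> \<open>The weighted Dirichlet integral of \<open>u n\<close> near the boundary part,
    with the coefficients replaced by their lower bound. As the limit field \<open>g\<close> is 0 on
    the ball, the energy of the difference controls it.\<close>
  define J where "J n = (\<integral>\<^sup>+y. indicator D y * ennreal (infdist y G powr \<delta> * (norm (grad (u n) y))\<^sup>2) \<partial>lborel)" for n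
  have J: "J n \<le> ennreal (e n / a0)" for n
  proof -
    have fd: "finite_energy \<Omega> C (\<lambda>x. grad (u n) x - g x)"
      by (intro finite_energy_diff finite_energy_grad[OF u] g)
    have "J n = (\<integral>\<^sup>+y. indicator D y * ennreal (infdist y G powr \<delta> * (norm (grad (u n) y))\<^sup>2) \<partial>lebesgue)"
      unfolding J_def by (rule nn_integral_completion[symmetric])
    also have "\<dots> = (\<integral>\<^sup>+y. (indicator (ball z r) y * ennreal (infdist y G powr \<delta> * (norm (grad (u n) y))\<^sup>2)) * indicator \<Omega> y \<partial>lebesgue)"
      by (intro nn_integral_cong) (auto simp: D_def indicator_def)
    also have "\<dots> = (\<integral>\<^sup>+y. indicator (ball z r) y * ennreal (infdist y G powr \<delta> * (norm (grad (u n) y))\<^sup>2) \<partial>?M)"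
      using \<Omega>_sets by (intro nn_integral_restrict_space[symmetric]) simp
    also have "\<dots> \<le> (\<integral>\<^sup>+y. ennreal (energy_density C (\<lambda>x. grad (u n) x - g x) y / a0) \<partial>?M)"
    proof (rule nn_integral_mono_AE)
      show "AE y in ?M. indicator (ball z r) y * ennreal (infdist y G powr \<delta> * (norm (grad (u n) y))\<^sup>2)
         \<le> ennreal (energy_density C (\<lambda>x. grad (u n) x - g x) y / a0)"
        using low geq energy_density_nonneg[of "\<lambda>x. grad (u n) x - g x"]
      proof eventually_elim
        case (elim y)
        show ?case
        proof (cases "y \<in> ball z r")
          case True
          then have "g y = 0" using elim(2) \<phi>(3)[of y] by (simp add: vec_eq_iff)
          then have "energy_density C (\<lambda>x. grad (u n) x - g x) y = grad (u n) y \<bullet> (C y *v grad (u n) y)"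
            by (simp add: energy_density_eq)
          moreover have "a0 * infdist y G powr \<delta> * (norm (grad (u n) y))\<^sup>2 \<le> grad (u n) y \<bullet> (C y *v grad (u n) y)"
            using elim(1) True by (metis mat_le_def inner_mat)
          ultimately have "infdist y G powr \<delta> * (norm (grad (u n) y))\<^sup>2 \<le> energy_density C (\<lambda>x. grad (u n) x - g x) y / a0"
            using a0 by (simp add: field_simps)
          then show ?thesis using True by (simp add: ennreal_leI)
        qed simp
      qed
    qed
    also have "\<dots> = ennreal (LINT y|?M. energy_density C (\<lambda>x. grad (u n) x - g x) y / a0)"
    proof (rule nn_integral_eq_integral)
      show "integrable ?M (\<lambda>y. energy_density C (\<lambda>x. grad (u n) x - g x) y / a0)"
        using fd by (simp add: finite_energy_def)
      show "AE y in ?M. 0 \<le> energy_density C (\<lambda>x. grad (u n) x - g x) y / a0"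
        using energy_density_nonneg[of "\<lambda>x. grad (u n) x - g x"] by eventually_elim (use a0 in simp)
    qed
    also have "\<dots> = ennreal (e n / a0)" by (simp add: e_def energy_def)
    finally show ?thesis .
  qed
  obtain W where W: "W \<ge> 0" "(\<integral>\<^sup>+y. indicator {y \<in> ball z r. 0 < infdist y G} y * ennreal (infdist y G powr (2 * \<sigma> - \<delta>)) \<partial>lborel) = ennreal W"
    using K4 by (cases "\<integral>\<^sup>+y. indicator {y \<in> ball z r. 0 < infdist y G} y * ennreal (infdist y G powr (2 * \<sigma> - \<delta>)) \<partial>lborel") auto
  define m where "m = measure \<nu> X"
  have m: "m > 0" "emeasure \<nu> X = ennreal m"
    using X(2) by (auto simp: m_def \<nu>.emeasure_eq_measure)
  have bound: "(\<bar>avg (u n) c \<rho>\<bar> * m)\<^sup>2 \<le> K\<^sup>2 * (W * (e n / a0))" for n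
  proof -
    \<comment> \<open>The exponent \<sigma> of the kernel bound is split into \<delta>/2 and
      \<sigma> - \<delta>/2: the first factor belongs to the energy, and the square of the second is
      the weight whose integral is assumed finite.\<close>
    define f where "f y = indicator D y * ennreal (infdist y G powr (\<delta> / 2) * norm (grad (u n) y))" for y
    define h where "h y = indicator {y \<in> ball z r. 0 < infdist y G} y * ennreal (infdist y G powr (\<sigma> - \<delta> / 2))" for y
    have pm: "(\<lambda>y. infdist y G powr t) \<in> borel_measurable borel" for t using im by measurable
    have S: "{y \<in> ball z r. 0 < infdist y G} \<in> sets borel"
    proof -
      have "open (ball z r \<inter> {y. 0 < infdist y G})" by (intro open_Int open_ball open_Collect_less continuous_intros)
      moreover have "{y \<in> ball z r. 0 < infdist y G} = ball z r \<inter> {y. 0 < infdist y G}" by auto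
      ultimately show ?thesis by simp
    qed
    have fm: "f \<in> borel_measurable lborel" unfolding f_def[abs_def] using D pm
      by (intro borel_measurable_times_ennreal borel_measurable_indicator measurable_compose[OF _ measurable_ennreal] borel_measurable_times) auto
    have hm: "h \<in> borel_measurable lborel" unfolding h_def[abs_def] using S pm
      by (intro borel_measurable_times_ennreal borel_measurable_indicator measurable_compose[OF _ measurable_ennreal]) auto
    have nm: "(\<lambda>y. ennreal (norm (grad (u n) y))) \<in> borel_measurable borel" by measurable
    have k_m: "(\<lambda>(x, y). indicator X x * (k x y * ennreal (norm (grad (u n) y)))) \<in> borel_measurable (\<nu> \<Otimes>\<^sub>M lborel)"
    proof -
      have "(\<lambda>w. indicator X (fst w) * (k (fst w) (snd w) * ennreal (norm (grad (u n) (snd w))))) \<in> borel_measurable (\<nu> \<Otimes>\<^sub>M lborel)"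
      proof (intro borel_measurable_times_ennreal)
        show "(\<lambda>w. indicator X (fst w) :: ennreal) \<in> borel_measurable (\<nu> \<Otimes>\<^sub>M lborel)"
          by (rule measurable_compose[OF measurable_fst borel_measurable_indicator]) (use X \<nu>(2) in simp)
        show "(\<lambda>w. k (fst w) (snd w)) \<in> borel_measurable (\<nu> \<Otimes>\<^sub>M lborel)"
          using km by (simp add: case_prod_beta')
        show "(\<lambda>w. ennreal (norm (grad (u n) (snd w)))) \<in> borel_measurable (\<nu> \<Otimes>\<^sub>M lborel)"
          by (rule measurable_compose[OF measurable_snd]) (use nm in simp)
      qed
      then show ?thesis by (simp add: case_prod_beta')
    qed
    have "ennreal (\<bar>avg (u n) c \<rho>\<bar> * m) = ennreal \<bar>avg (u n) c \<rho>\<bar> * emeasure \<nu> X"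
      by (simp add: m(2) ennreal_mult m(1)[THEN less_imp_le])
    also have "\<dots> = (\<integral>\<^sup>+x. ennreal \<bar>avg (u n) c \<rho>\<bar> * indicator X x \<partial>\<nu>)"
      using X \<nu>(2) by (intro nn_integral_cmult_indicator[symmetric]) simp
    also have "\<dots> \<le> (\<integral>\<^sup>+x. \<integral>\<^sup>+y. indicator X x * (k x y * ennreal (norm (grad (u n) y))) \<partial>lborel \<partial>\<nu>)"
    proof (rule nn_integral_mono)
      fix x show "ennreal \<bar>avg (u n) c \<rho>\<bar> * indicator X x \<le> (\<integral>\<^sup>+y. indicator X x * (k x y * ennreal (norm (grad (u n) y))) \<partial>lborel)"
        using K1[OF u, of x n] by (cases "x \<in> X") auto
    qed
    also have "\<dots> = (\<integral>\<^sup>+y. \<integral>\<^sup>+x. indicator X x * (k x y * ennreal (norm (grad (u n) y))) \<partial>\<nu> \<partial>lborel)"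
      by (rule P.Fubini'[OF k_m, symmetric])
    also have "\<dots> \<le> (\<integral>\<^sup>+y. ennreal K * (f y * h y) \<partial>lborel)"
    proof (rule nn_integral_mono)
      fix y :: "real^'n"
      show "(\<integral>\<^sup>+x. indicator X x * (k x y * ennreal (norm (grad (u n) y))) \<partial>\<nu>) \<le> ennreal K * (f y * h y)"
      proof (cases "y \<in> D")
        case True
        have kym: "(\<lambda>x. indicator X x * k x y) \<in> borel_measurable \<nu>"
        proof (rule borel_measurable_times_ennreal)
          show "indicator X \<in> borel_measurable \<nu>" using X \<nu>(2) by (intro borel_measurable_indicator) simp
          show "(\<lambda>x. k x y) \<in> borel_measurable \<nu>"
            using measurable_compose[OF measurable_Pair2'[of y lborel \<nu>] km] by simp
        qed
        have d: "infdist y G > 0" using True dpos by (simp add: D_def)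
        have "(\<integral>\<^sup>+x. indicator X x * (k x y * ennreal (norm (grad (u n) y))) \<partial>\<nu>) = (\<integral>\<^sup>+x. (indicator X x * k x y) * ennreal (norm (grad (u n) y)) \<partial>\<nu>)"
          by (simp add: mult.assoc)
        also have "\<dots> = (\<integral>\<^sup>+x. indicator X x * k x y \<partial>\<nu>) * ennreal (norm (grad (u n) y))"
          by (rule nn_integral_multc[OF kym])
        also have "\<dots> \<le> ennreal (K * infdist y G powr \<sigma>) * ennreal (norm (grad (u n) y))"
          by (intro mult_right_mono K2) (use True in \<open>auto simp: D_def\<close>)
        also have "\<dots> = ennreal (K * infdist y G powr \<sigma> * norm (grad (u n) y))"
          using K by (simp add: ennreal_mult)
        also have "K * infdist y G powr \<sigma> * norm (grad (u n) y) = K * ((infdist y G powr (\<delta> / 2) * norm (grad (u n) y)) * infdist y G powr (\<sigma> - \<delta> / 2))"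
        proof -
          have "infdist y G powr \<sigma> = infdist y G powr (\<delta> / 2) * infdist y G powr (\<sigma> - \<delta> / 2)"
            by (simp add: powr_add[symmetric])
          then show ?thesis by simp
        qed
        also have "ennreal \<dots> = ennreal K * (f y * h y)"
          using True d K by (simp add: f_def h_def D_def ennreal_mult)
        finally show ?thesis .
      next
        case False
        then have "y \<notin> \<Omega> \<or> y \<notin> ball z r" by (simp add: D_def)
        then have "(\<lambda>x. indicator X x * (k x y * ennreal (norm (grad (u n) y)))) = (\<lambda>x. 0)"
          using u0[of y n] K3[of _ y] by (intro ext) (auto simp: indicator_def)
        then show ?thesis by simp
      qed
    qed
    also have "\<dots> = ennreal K * (\<integral>\<^sup>+y. f y * h y \<partial>lborel)"
      using fm hm by (intro nn_integral_cmult) auto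
    finally have "(ennreal (\<bar>avg (u n) c \<rho>\<bar> * m))\<^sup>2 \<le> (ennreal K * (\<integral>\<^sup>+y. f y * h y \<partial>lborel))\<^sup>2"
      by (intro power_mono) auto
    also have "\<dots> = (ennreal K)\<^sup>2 * (\<integral>\<^sup>+y. f y * h y \<partial>lborel)\<^sup>2" by (simp add: power_mult_distrib)
    also have "(\<integral>\<^sup>+y. f y * h y \<partial>lborel)\<^sup>2 \<le> (\<integral>\<^sup>+y. (f y)\<^sup>2 \<partial>lborel) * (\<integral>\<^sup>+y. (h y)\<^sup>2 \<partial>lborel)"
      by (rule Cauchy_Schwarz_nn_integral[OF fm hm])
    also have "(\<integral>\<^sup>+y. (f y)\<^sup>2 \<partial>lborel) = J n"
      unfolding J_def
    proof (rule nn_integral_cong)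
      fix y
      have "(infdist y G powr (\<delta> / 2) * norm (grad (u n) y))\<^sup>2 = infdist y G powr \<delta> * (norm (grad (u n) y))\<^sup>2"
        by (simp add: power2_eq_square powr_add[symmetric] mult.assoc mult.left_commute)
      then show "(f y)\<^sup>2 = indicator D y * ennreal (infdist y G powr \<delta> * (norm (grad (u n) y))\<^sup>2)"
        by (simp add: f_def power_mult_distrib ennreal_power indicator_def)
    qed
    also have "(\<integral>\<^sup>+y. (h y)\<^sup>2 \<partial>lborel) = ennreal W"
      unfolding W(2)[symmetric]
    proof (rule nn_integral_cong)
      fix y
      have "(infdist y G powr (\<sigma> - \<delta> / 2))\<^sup>2 = infdist y G powr (2 * \<sigma> - \<delta>)"
        by (simp add: power2_eq_square powr_add[symmetric])
      then show "(h y)\<^sup>2 = indicator {y \<in> ball z r. 0 < infdist y G} y * ennreal (infdist y G powr (2 * \<sigma> - \<delta>))"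
        by (simp add: h_def power_mult_distrib ennreal_power indicator_def)
    qed
    also have "(ennreal K)\<^sup>2 * (J n * ennreal W) \<le> (ennreal K)\<^sup>2 * (ennreal (e n / a0) * ennreal W)"
      by (intro mult_left_mono mult_right_mono J) auto
    also have "\<dots> = ennreal (K\<^sup>2 * (W * (e n / a0)))"
      using K W(1) e(2)[of n] a0 by (simp add: ennreal_power ennreal_mult[symmetric] mult.commute)
    finally have "ennreal ((\<bar>avg (u n) c \<rho>\<bar> * m)\<^sup>2) \<le> ennreal (K\<^sup>2 * (W * (e n / a0)))"
      using m(1) by (simp add: ennreal_power mult_left_mono)
    then show ?thesis using W(1) e(2)[of n] a0 by (subst (asm) ennreal_le_iff) auto
  qed
  have "(\<lambda>n. (\<bar>avg (u n) c \<rho>\<bar> * m)\<^sup>2) \<longlonglongrightarrow> 0"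
  proof (rule tendsto_sandwich[OF _ _ tendsto_const])
    have "(\<lambda>n. K\<^sup>2 * (W * (e n / a0))) \<longlonglongrightarrow> K\<^sup>2 * (W * (0 / a0))" by (intro tendsto_intros e(1)) (use a0 in simp)
    then show "(\<lambda>n. K\<^sup>2 * (W * (e n / a0))) \<longlonglongrightarrow> 0" by simp
  qed (use bound in auto)
  from tendsto_real_sqrt[OF this] have "(\<lambda>n. \<bar>avg (u n) c \<rho>\<bar> * m) \<longlonglongrightarrow> 0"
    using m(1) by (simp add: abs_mult)
  from tendsto_mult[OF this tendsto_const[of "1 / m"]] have "(\<lambda>n. \<bar>avg (u n) c \<rho>\<bar>) \<longlonglongrightarrow> 0"
    using m(1) by simp
  \<comment> \<open>The trace estimate sends the means to 0. On the other hand \<open>L2\<close>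
    convergence makes them tend, up to the factor \<rho>^d, to the volume of
    \<open>\<Omega> \<inter> ball c \<rho>\<close>, which is positive because this open set contains
    \<open>x0\<close>.\<close>
  then have "(\<lambda>n. avg (u n) c \<rho>) \<longlonglongrightarrow> 0" by (simp add: tendsto_rabs_zero_iff)
  from tendsto_mult[OF tendsto_const[of "\<rho> ^ CARD('n)"] this]
  have lim0: "(\<lambda>n. LINT x|?M. u n x * indicator (ball c \<rho>) x) \<longlonglongrightarrow> 0"
    by (simp add: avg_eq_integral[OF u \<rho>(1)])
  define \<iota> where "\<iota> = (indicator (ball c \<rho>) :: real^'n \<Rightarrow> real)"
  have \<iota>m: "\<iota> \<in> borel_measurable ?M" unfolding \<iota>_def by (intro borel_lebesgue_on borel_measurable_indicator) simp
  have \<iota>i: "integrable ?M (\<lambda>x. (\<iota> x)\<^sup>2)"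
  proof -
    have "integrable (lebesgue_on UNIV) \<iota>"
      unfolding \<iota>_def lebesgue_on_UNIV_eq
      using fmeasurableD2[OF lmeasurable_ball[of c \<rho>]] by (intro integrable_real_indicator) (auto simp: less_top)
    then have "integrable ?M \<iota>" by (rule integrable_lebesgue_on_subset) (use \<Omega>_sets in auto)
    moreover have "(\<iota> x)\<^sup>2 = \<iota> x" for x by (simp add: \<iota>_def indicator_def)
    ultimately show ?thesis by simp
  qed
  note uL2 = L2D[OF test_L2[OF u]] and \<phi>L2 = L2D[OF test_L2[OF \<phi>(1)]]
  have diff: "(\<lambda>x. u n x - \<phi> x) \<in> borel_measurable ?M" "integrable ?M (\<lambda>x. (u n x - \<phi> x)\<^sup>2)" for n
    using uL2 \<phi>L2 by (auto intro!: integrable_diff_square)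
  have "(\<lambda>n. LINT x|?M. u n x * \<iota> x) \<longlonglongrightarrow> (LINT x|?M. \<phi> x * \<iota> x)"
  proof (rule tendsto_integral_abs_diff)
    show "integrable ?M (\<lambda>x. u n x * \<iota> x)" "integrable ?M (\<lambda>x. \<phi> x * \<iota> x)" "integrable ?M (\<lambda>x. \<bar>(u n x - \<phi> x) * \<iota> x\<bar>)" for n
      using integrable_mult_L2[OF uL2 \<iota>m \<iota>i] integrable_mult_L2[OF \<phi>L2 \<iota>m \<iota>i] integrable_mult_L2[OF diff \<iota>m \<iota>i] by auto
    show "(\<lambda>n. LINT x|?M. \<bar>(u n x - \<phi> x) * \<iota> x\<bar>) \<longlonglongrightarrow> 0"
      by (rule tendsto_integral_mult_L2[OF diff uL \<iota>m \<iota>i])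
  qed (simp add: left_diff_distrib)
  then have "(LINT x|?M. \<phi> x * \<iota> x) = 0" using lim0 LIMSEQ_unique unfolding \<iota>_def by blast
  moreover have "(LINT x|?M. \<phi> x * \<iota> x) = measure lborel (\<Omega> \<inter> ball c \<rho>)"
  proof -
    have eq: "\<phi> x * \<iota> x = \<iota> x" for x
    proof (cases "x \<in> ball c \<rho>")
      case True
      then have "x \<in> ball z r" using \<rho>(2) by blast
      then show ?thesis using \<phi>(2)[of x] by simp
    qed (simp add: \<iota>_def)
    have "(LINT x|?M. \<iota> x) = (LINT x|lebesgue. indicator (\<Omega> \<inter> ball c \<rho>) x)"
      unfolding Lebesgue_Measure.integral_restrict_UNIV[OF \<Omega>_sets, symmetric]
      by (intro Bochner_Integration.integral_cong) (auto simp: \<iota>_def indicator_def)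
    then show ?thesis using \<Omega>b by (simp add: eq)
  qed
  moreover have "measure lborel (\<Omega> \<inter> ball c \<rho>) > 0"
  proof -
    have op: "open (\<Omega> \<inter> ball c \<rho>)" using open_\<Omega> by auto
    then obtain t where t: "t > 0" "ball x0 t \<subseteq> \<Omega> \<inter> ball c \<rho>" using x0 by (meson open_contains_ball)
    have "emeasure lborel (\<Omega> \<inter> ball c \<rho>) \<le> emeasure lborel (ball c \<rho>)" by (rule emeasure_mono) auto
    then have fin: "emeasure lborel (\<Omega> \<inter> ball c \<rho>) < top" using \<rho>(1) by (simp add: emeasure_ball order_le_less_trans)
    have "0 < measure lborel (ball x0 t)"
      using t(1) content_ball[of t x0] by simp
    also have "\<dots> \<le> measure lborel (\<Omega> \<inter> ball c \<rho>)"
      using t(2) op fin by (intro measure_mono_fmeasurable) (auto simp: fmeasurable_def)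
    finally show ?thesis .
  qed
  ultimately show False by simp
qed

end

text \<open>One vanishing member ends the chain. The infinite sum on the right does not mention
  \<open>J\<close>, so the same bound serves all test functions although each stops at its own
  index.\<close>

lemma telescoping_le_suminf:
  fixes b :: "nat \<Rightarrow> real" and t :: "nat \<Rightarrow> ennreal"
  assumes "b J = 0" "\<And>j. ennreal \<bar>b j - b (Suc j)\<bar> \<le> t j"
  shows "ennreal \<bar>b 0\<bar> \<le> (\<Sum>j. t j)"
proof -
  have "\<bar>b 0 - b m\<bar> \<le> (\<Sum>j<m. \<bar>b j - b (Suc j)\<bar>)" for m by (induction m) auto
  from this[of J] have "ennreal \<bar>b 0\<bar> \<le> ennreal (\<Sum>j<J. \<bar>b j - b (Suc j)\<bar>)"
    using assms(1) by (intro ennreal_leI) simp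
  also have "\<dots> = (\<Sum>j<J. ennreal \<bar>b j - b (Suc j)\<bar>)" by (simp add: sum_ennreal)
  also have "\<dots> \<le> (\<Sum>j<J. t j)" by (intro sum_mono assms(2))
  also have "\<dots> \<le> (\<Sum>j. t j)" by (rule sum_le_suminf) auto
  finally show ?thesis .
qed

text \<open>
  For \<open>\<sigma> < 0\<close> the sum is dominated by its smallest scale, which is of order \<open>d\<close>; otherwise the scales
  much larger than \<open>d\<close> have to be excluded by \<open>c1 > 0\<close>.
\<close>

lemma dyadic_kernel_bound:
  fixes r0 Cc c1 \<sigma> d :: real
  assumes r0: "r0 > 0" and Cc: "Cc > 0" and c1: "c1 \<ge> 0" and cases: "\<sigma> < 0 \<or> (0 \<le> \<sigma> \<and> 0 < c1)"
  obtains K where "K \<ge> 0" "\<And>d. d > 0 \<Longrightarrow>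
    (\<Sum>j. ennreal (if d < Cc * (r0 * (1/2)^j) \<and> c1 * (r0 * (1/2)^j) \<le> d then (r0 * (1/2)^j) powr \<sigma> else 0)) \<le> ennreal (K * d powr \<sigma>)"
proof (cases "\<sigma> < 0")
  case True
  define K where "K = (1 / (2 * Cc)) powr \<sigma> / (2 powr (- \<sigma>) - 1)"
  have "(2::real) powr 0 < 2 powr (- \<sigma>)" using True by (intro powr_less_mono) auto
  then have K: "K \<ge> 0" by (simp add: K_def)
  show thesis
  proof (rule that[OF K])
    fix d :: real assume d: "d > 0"
    \<comment> \<open>The condition through \<open>c1\<close> is dropped here: the remaining scales
      exceed d/Cc, and for negative \<sigma> this already makes the sum geometric.\<close>
    have "(\<Sum>j. ennreal (if d < Cc * (r0 * (1/2)^j) \<and> c1 * (r0 * (1/2)^j) \<le> d then (r0 * (1/2)^j) powr \<sigma> else 0))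
       \<le> (\<Sum>j. ennreal (if d / Cc < r0 * (1/2)^j then (r0 * (1/2)^j) powr \<sigma> else 0))"
      using Cc by (intro suminf_le summableI allI ennreal_leI) (auto simp: field_simps)
    also have "\<dots> \<le> ennreal ((d / Cc / 2) powr \<sigma> / (2 powr (- \<sigma>) - 1))"
      using d Cc by (intro dyadic_sum_large r0 True) simp
    also have "(d / Cc / 2) powr \<sigma> / (2 powr (- \<sigma>) - 1) = K * d powr \<sigma>"
    proof -
      have "d / Cc / 2 = (1 / (2 * Cc)) * d" by simp
      then have "(d / Cc / 2) powr \<sigma> = (1 / (2 * Cc)) powr \<sigma> * d powr \<sigma>" using d Cc by (simp only: powr_mult) 
      then show ?thesis by (simp add: K_def)
    qed
    finally show "(\<Sum>j. ennreal (if d < Cc * (r0 * (1/2)^j) \<and> c1 * (r0 * (1/2)^j) \<le> d then (r0 * (1/2)^j) powr \<sigma> else 0)) \<le> ennreal (K * d powr \<sigma>)" .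
  qed
next
  case False
  then have s: "\<sigma> \<ge> 0" "c1 > 0" using cases by auto
  define \<theta> where "\<theta> = 1 - 2 powr (- (\<sigma> + 1))"
  have "2 powr (- (\<sigma> + 1)) < (2::real) powr 0" using s by (intro powr_less_mono) auto
  then have \<theta>: "\<theta> > 0" by (simp add: \<theta>_def)
  define K where "K = Cc * (1 / c1) powr (\<sigma> + 1) / \<theta>"
  have K: "K \<ge> 0" using Cc \<theta> by (simp add: K_def)
  show thesis
  proof (rule that[OF K])
    fix d :: real assume d: "d > 0"
    have "(\<Sum>j. ennreal (if d < Cc * (r0 * (1/2)^j) \<and> c1 * (r0 * (1/2)^j) \<le> d then (r0 * (1/2)^j) powr \<sigma> else 0))
       \<le> (\<Sum>j. ennreal (Cc / d) * ennreal (if r0 * (1/2)^j \<le> d / c1 then (r0 * (1/2)^j) powr (\<sigma> + 1) else 0))"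
    proof (intro suminf_le summableI allI)
      fix j :: nat
      define x where "x = r0 * (1/2)^j"
      have x: "x > 0" using r0 by (simp add: x_def)
      \<comment> \<open>Multiplication by the factor Cc x/d, which exceeds 1, raises the exponent to
        \<sigma> + 1 > 0; otherwise the summands for \<sigma> = 0 would all be equal instead of
        forming a geometric series.\<close>
      have "(if d < Cc * x \<and> c1 * x \<le> d then x powr \<sigma> else 0) \<le> Cc / d * (if x \<le> d / c1 then x powr (\<sigma> + 1) else 0)"
      proof (cases "d < Cc * x \<and> c1 * x \<le> d")
        case True
        then have "x \<le> d / c1" using s(2) by (simp add: field_simps)
        have "1 \<le> Cc / d * x" using True d by (simp add: field_simps)
        then have "1 * x powr \<sigma> \<le> (Cc / d * x) * x powr \<sigma>" by (intro mult_right_mono) auto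
        also have "\<dots> = Cc / d * x powr (\<sigma> + 1)" using x by (simp add: powr_add)
        finally show ?thesis using True \<open>x \<le> d / c1\<close> by simp
      next
        case False
        then show ?thesis using d Cc by auto
      qed
      then show "ennreal (if d < Cc * (r0 * (1/2)^j) \<and> c1 * (r0 * (1/2)^j) \<le> d then (r0 * (1/2)^j) powr \<sigma> else 0)
         \<le> ennreal (Cc / d) * ennreal (if r0 * (1/2)^j \<le> d / c1 then (r0 * (1/2)^j) powr (\<sigma> + 1) else 0)"
        unfolding x_def[symmetric] using d Cc by (subst ennreal_mult[symmetric]) (auto intro!: ennreal_leI)
    qed
    also have "\<dots> = ennreal (Cc / d) * (\<Sum>j. ennreal (if r0 * (1/2)^j \<le> d / c1 then (r0 * (1/2)^j) powr (\<sigma> + 1) else 0))"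
      by (rule ennreal_suminf_cmult)
    also have "\<dots> \<le> ennreal (Cc / d) * ennreal ((d / c1) powr (\<sigma> + 1) / (1 - 2 powr (- (\<sigma> + 1))))"
      using d s by (intro mult_left_mono dyadic_sum_small r0) auto
    also have "\<dots> = ennreal (Cc / d * ((d / c1) powr (\<sigma> + 1) / \<theta>))"
      using d Cc \<theta> by (subst ennreal_mult[symmetric]) (auto simp: \<theta>_def)
    also have "Cc / d * ((d / c1) powr (\<sigma> + 1) / \<theta>) = K * d powr \<sigma>"
    proof -
      have "d / c1 = (1 / c1) * d" by simp
      then have "(d / c1) powr (\<sigma> + 1) = (1 / c1) powr (\<sigma> + 1) * d powr (\<sigma> + 1)" using d s by (simp only: powr_mult)
      moreover have "d powr (\<sigma> + 1) = d powr \<sigma> * d" using d by (simp add: powr_add)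
      ultimately show ?thesis using d by (simp add: K_def)
    qed
    finally show "(\<Sum>j. ennreal (if d < Cc * (r0 * (1/2)^j) \<and> c1 * (r0 * (1/2)^j) \<le> d then (r0 * (1/2)^j) powr \<sigma> else 0)) \<le> ennreal (K * d powr \<sigma>)" .
  qed
qed

context elliptic
begin

text \<open>The hypothesis \<open>chain\<close> bounds the reference mean by dyadic gradient
  integrals around a boundary point, with weight l^(1 - d) at scale l. When this is integrated over
  the boundary point, a given \<open>y\<close> is met only from points within \<open>Cc\<close>
  times the scale, a set of measure of order l^s. Summation leaves the power \<sigma> of the
  distance of \<open>y\<close>, and the alternative in \<open>cases\<close> is the one of
  \<open>dyadic_kernel_bound\<close>.\<close>

lemma not_markov_unique_if_chains:
  fixes G :: "(real^'n) set"
  assumes reg: "ahlfors_regular s G" and G: "closed G" "z \<in> G" "G \<subseteq> frontier \<Omega>"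
    and sub: "\<delta> < 1 + (s - (real CARD('n) - 1))" and a0: "a0 > 0" and r: "r > 0"
    and low: "AE x in lebesgue_on \<Omega>. x \<in> ball z r \<longrightarrow> mat_le (mat (a0 * infdist x G powr \<delta>)) (C x)"
    and \<rho>: "\<rho> > 0" "ball c \<rho> \<subseteq> ball z r" and x0: "x0 \<in> \<Omega> \<inter> ball c \<rho>"
    and r0: "r0 > 0" and R': "R' > 0" and Q: "Q \<ge> 0" and Cc: "Cc > 0" and c1: "c1 \<ge> 0"
    and cases: "s < real CARD('n) - 1 \<or> (real CARD('n) - 1 \<le> s \<and> 0 < c1)"
    and reach: "R' + Cc * r0 \<le> r"
    and chain: "\<And>u x. u \<in> Cc_infinity \<Omega> \<Longrightarrow> x \<in> G \<inter> ball z R' \<Longrightarrow> ennreal \<bar>avg u c \<rho>\<bar> \<le>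
       (\<Sum>j. ennreal (Q * (r0 * (1/2)^j) powr (1 - real CARD('n))) *
          grad_integral u {y. dist x y < Cc * (r0 * (1/2)^j) \<and> c1 * (r0 * (1/2)^j) \<le> infdist y G})"
  shows "\<not> markov_unique \<Omega> C"
proof -
  define \<sigma> where "\<sigma> = 1 - real CARD('n) + s"
  define l where "l j = r0 * (1/2)^j" for j :: nat
  have l: "l j > 0" "l j \<le> r0" for j
    using r0 power_le_one[of "1/2::real" j] by (auto simp: l_def mult_left_le)
  \<comment> \<open>Wide enough that all radii \<open>2 * (Cc * l j)\<close> stay below
    \<open>2 * R1\<close>, the range of the regularity bounds.\<close>
  define R1 where "R1 = R' + 2 * (Cc * r0)"
  have R1: "R1 > 0" "R' \<le> R1" using R' Cc r0 by (auto simp: R1_def add_pos_nonneg)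
  obtain \<nu> c0 where \<nu>: "finite_measure \<nu>" "sets \<nu> = sets borel" "c0 > 0"
    "emeasure \<nu> (- (G \<inter> ball z R1)) = 0"
    "\<And>x r. x \<in> G \<inter> ball z R1 \<Longrightarrow> 0 < r \<Longrightarrow> r < 2 * R1 \<Longrightarrow> ennreal (r powr s / c0) \<le> emeasure \<nu> (ball x r)"
    "\<And>x r. x \<in> G \<inter> ball z R1 \<Longrightarrow> 0 < r \<Longrightarrow> r < 2 * R1 \<Longrightarrow> emeasure \<nu> (ball x r) \<le> ennreal (c0 * r powr s)"
    by (rule ahlfors_finite_measure[OF reg G(1,2) R1(1)]) blast
  have [measurable_cong]: "sets \<nu> = sets borel" by (rule \<nu>(2))
  define X where "X = G \<inter> ball z R'"
  have X: "X \<in> sets borel" "X \<subseteq> G \<inter> ball z R1" unfolding X_def using G(1) R1(2) by auto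
  have im [measurable]: "(\<lambda>y. infdist y G) \<in> borel_measurable borel"
    by (intro borel_measurable_continuous_onI continuous_intros)
  define N where "N x j = {y. dist x y < Cc * l j \<and> c1 * l j \<le> infdist y G}" for x j
  have N: "N x j \<in> sets borel" for x j unfolding N_def by measurable
  define k where "k x y = (\<Sum>j. ennreal (Q * l j powr (1 - real CARD('n))) * indicator (N x j) y)" for x y
  \<comment> \<open>The lower regularity bound charges the ball around \<open>z\<close>, and the
    complement of \<open>G \<inter> ball z R1\<close> has measure 0, so \<open>X\<close> itself is
    charged.\<close>
  have "0 < ennreal (R' powr s / c0)" using R' \<nu>(3) by simp
  also have "\<dots> \<le> emeasure \<nu> (ball z R')"
    using G(2) R1 R' by (intro \<nu>(5)) (auto simp: R1_def)
  also have "\<dots> \<le> emeasure \<nu> (X \<union> - (G \<inter> ball z R1))"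
    using X(1) G(1) by (intro emeasure_mono) (auto simp: X_def \<nu>(2))
  also have "\<dots> \<le> emeasure \<nu> X + emeasure \<nu> (- (G \<inter> ball z R1))"
    using X(1) G(1) by (intro emeasure_subadditive) (auto simp: \<nu>(2))
  finally have X_pos: "emeasure \<nu> X > 0" using \<nu>(4) by simp
  have "\<sigma> < 0 \<or> (0 \<le> \<sigma> \<and> 0 < c1)" using cases by (auto simp: \<sigma>_def)
  from dyadic_kernel_bound[OF r0 Cc c1 this] obtain K0 where K0: "K0 \<ge> 0" "\<And>d. d > 0 \<Longrightarrow>
    (\<Sum>j. ennreal (if d < Cc * l j \<and> c1 * l j \<le> d then l j powr \<sigma> else 0)) \<le> ennreal (K0 * d powr \<sigma>)"
    unfolding l_def by blast
  define Q' where "Q' = Q * (c0 * (2 * Cc) powr s)"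
  have Q': "Q' \<ge> 0" using Q \<nu>(3) by (simp add: Q'_def)
  have dpos: "infdist y G > 0" if "y \<in> \<Omega>" for y
  proof -
    have "y \<notin> G" using that G(3) open_\<Omega> by (auto simp: frontier_def interior_open)
    then show ?thesis using G(1,2) infdist_pos_not_in_closed by blast
  qed
  show ?thesis
  proof (rule not_markov_unique_if_trace[OF G(1) _ G(3) a0 low \<rho> x0 \<nu>(1,2) X(1) X_pos, where k=k and K="Q' * K0" and \<sigma>=\<sigma>])
    show "G \<noteq> {}" using G(2) by auto
    show "(\<lambda>(x, y). k x y) \<in> borel_measurable (\<nu> \<Otimes>\<^sub>M lborel)"
    proof -
      have "(\<lambda>w. \<Sum>j. ennreal (Q * l j powr (1 - real CARD('n))) * (if dist (fst w) (snd w) < Cc * l j \<and> c1 * l j \<le> infdist (snd w) G then 1 else 0))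
         \<in> borel_measurable (\<nu> \<Otimes>\<^sub>M lborel)"
        by measurable
      then show ?thesis by (simp add: k_def N_def case_prod_beta' indicator_def of_bool_def)
    qed
    show "ennreal \<bar>avg u c \<rho>\<bar> \<le> (\<integral>\<^sup>+y. k x y * ennreal (norm (grad u y)) \<partial>lborel)"
      if u: "u \<in> Cc_infinity \<Omega>" and x: "x \<in> X" for u x
    proof -
      have gb: "(\<lambda>y. ennreal (norm (grad u y))) \<in> borel_measurable borel"
        using grad_borel[OF Cc_infinity_smooth[OF u]] by measurable
      have Im: "(\<lambda>y. indicator (N x j) y :: ennreal) \<in> borel_measurable lborel" for j
        using N by (intro borel_measurable_indicator) simp
      have "ennreal \<bar>avg u c \<rho>\<bar> \<le> (\<Sum>j. ennreal (Q * l j powr (1 - real CARD('n))) * grad_integral u (N x j))"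
        using chain[OF u, of x] x by (simp add: X_def N_def l_def)
      also have "\<dots> = (\<Sum>j. \<integral>\<^sup>+y. ennreal (Q * l j powr (1 - real CARD('n))) * (indicator (N x j) y * ennreal (norm (grad u y))) \<partial>lborel)"
        unfolding grad_integral_def using gb Im
        by (intro suminf_cong nn_integral_cmult[symmetric] borel_measurable_times_ennreal) auto
      also have "\<dots> = (\<integral>\<^sup>+y. (\<Sum>j. ennreal (Q * l j powr (1 - real CARD('n))) * (indicator (N x j) y * ennreal (norm (grad u y)))) \<partial>lborel)"
        using gb Im by (intro nn_integral_suminf[symmetric] borel_measurable_times_ennreal borel_measurable_const) auto
      also have "\<dots> = (\<integral>\<^sup>+y. k x y * ennreal (norm (grad u y)) \<partial>lborel)"
        by (simp add: k_def ennreal_suminf_multc mult.assoc[symmetric])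
      finally show ?thesis .
    qed
    show "(\<integral>\<^sup>+x. indicator X x * k x y \<partial>\<nu>) \<le> ennreal (Q' * K0 * infdist y G powr \<sigma>)" if y: "y \<in> \<Omega> \<inter> ball z r" for y
    proof -
      define d where "d = infdist y G"
      have d: "d > 0" using dpos y by (simp add: d_def)
      have part: "(\<integral>\<^sup>+x. indicator X x * (ennreal (Q * l j powr (1 - real CARD('n))) * indicator (N x j) y) \<partial>\<nu>)
         \<le> ennreal Q' * ennreal (if d < Cc * l j \<and> c1 * l j \<le> d then l j powr \<sigma> else 0)" for j
      proof -
        define S where "S = (if c1 * l j \<le> d then X \<inter> ball y (Cc * l j) else {})"
        have S: "S \<in> sets \<nu>" using X(1) by (simp add: S_def \<nu>(2))
        have "indicator X x * (ennreal (Q * l j powr (1 - real CARD('n))) * indicator (N x j) y) = ennreal (Q * l j powr (1 - real CARD('n))) * indicator S x" for x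
          by (auto simp: S_def N_def d_def indicator_def dist_commute)
        then have eq: "(\<integral>\<^sup>+x. indicator X x * (ennreal (Q * l j powr (1 - real CARD('n))) * indicator (N x j) y) \<partial>\<nu>)
           = ennreal (Q * l j powr (1 - real CARD('n))) * emeasure \<nu> S"
          using S by (simp add: nn_integral_cmult_indicator)
        show ?thesis
        proof (cases "S = {}")
          case True
          then show ?thesis by (simp add: eq)
        next
          case False
          then obtain q where q: "q \<in> X" "dist y q < Cc * l j" and cd: "c1 * l j \<le> d"
            by (auto simp: S_def split: if_splits)
          have qG: "q \<in> G \<inter> ball z R1" using q(1) X(2) by blast
          have "d \<le> dist y q" unfolding d_def using qG by (intro infdist_le) simp
          then have dl: "d < Cc * l j" using q(2) by simp
          have Y: "Cc * l j \<le> Cc * r0" using l(2)[of j] Cc by simp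
          have "A \<le> B \<Longrightarrow> 0 < R' \<Longrightarrow> 0 < B \<Longrightarrow> 2 * A < 2 * (R' + 2 * B)" for A B :: real
            by (smt (verit))
          from this[OF Y R' mult_pos_pos[OF Cc r0]] have lt: "2 * (Cc * l j) < 2 * R1" unfolding R1_def .
          \<comment> \<open>Regularity is available only at centres in \<open>G\<close>, so the part
            of \<open>X\<close> near \<open>y\<close> is enclosed in a ball of twice the radius
            around one of its own points.\<close>
          have "S \<subseteq> ball q (2 * (Cc * l j))"
          proof
            fix w assume "w \<in> S"
            then have "dist y w < Cc * l j" by (auto simp: S_def split: if_splits)
            moreover have "dist q w \<le> dist y q + dist y w" by metric
            ultimately show "w \<in> ball q (2 * (Cc * l j))" using q(2) by simp
          qed
          then have "emeasure \<nu> S \<le> emeasure \<nu> (ball q (2 * (Cc * l j)))" by (intro emeasure_mono) (auto simp: \<nu>(2))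
          also have "\<dots> \<le> ennreal (c0 * (2 * (Cc * l j)) powr s)"
            using lt Cc l(1)[of j] by (intro \<nu>(6)[OF qG]) auto
          finally have "ennreal (Q * l j powr (1 - real CARD('n))) * emeasure \<nu> S
             \<le> ennreal (Q * l j powr (1 - real CARD('n))) * ennreal (c0 * (2 * (Cc * l j)) powr s)"
            by (intro mult_left_mono) auto
          also have "\<dots> = ennreal ((Q * l j powr (1 - real CARD('n))) * (c0 * (2 * (Cc * l j)) powr s))"
            using Q \<nu>(3) by (subst ennreal_mult) auto
          also have "(Q * l j powr (1 - real CARD('n))) * (c0 * (2 * (Cc * l j)) powr s) = Q' * l j powr \<sigma>"
          proof -
            have "(2 * (Cc * l j)) powr s = (2 * Cc) powr s * l j powr s"
              using Cc l(1)[of j] by (simp add: powr_mult[symmetric] mult.assoc)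
            moreover have "l j powr \<sigma> = l j powr (1 - real CARD('n)) * l j powr s"
              by (simp add: \<sigma>_def powr_add[symmetric])
            ultimately show ?thesis by (simp add: Q'_def)
          qed
          also have "ennreal (Q' * l j powr \<sigma>) = ennreal Q' * ennreal (l j powr \<sigma>)" using Q' by (simp add: ennreal_mult)
          finally show ?thesis using dl cd by (simp add: eq)
        qed
      qed
      have xm: "(\<lambda>x. indicator X x * (ennreal (Q * l j powr (1 - real CARD('n))) * indicator (N x j) y)) \<in> borel_measurable \<nu>" for j
      proof -
        have "(\<lambda>x. indicator X x * (ennreal (Q * l j powr (1 - real CARD('n))) * (if dist x y < Cc * l j \<and> c1 * l j \<le> infdist y G then 1 else 0))) \<in> borel_measurable \<nu>"
          using X(1) by measurable
        then show ?thesis by (simp add: N_def indicator_def of_bool_def)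
      qed
      have "(\<integral>\<^sup>+x. indicator X x * k x y \<partial>\<nu>) = (\<integral>\<^sup>+x. (\<Sum>j. indicator X x * (ennreal (Q * l j powr (1 - real CARD('n))) * indicator (N x j) y)) \<partial>\<nu>)"
        by (simp add: k_def ennreal_suminf_cmult)
      also have "\<dots> = (\<Sum>j. \<integral>\<^sup>+x. indicator X x * (ennreal (Q * l j powr (1 - real CARD('n))) * indicator (N x j) y) \<partial>\<nu>)"
        by (rule nn_integral_suminf[OF xm])
      also have "\<dots> \<le> (\<Sum>j. ennreal Q' * ennreal (if d < Cc * l j \<and> c1 * l j \<le> d then l j powr \<sigma> else 0))"
        by (intro suminf_le summableI allI part)
      also have "\<dots> = ennreal Q' * (\<Sum>j. ennreal (if d < Cc * l j \<and> c1 * l j \<le> d then l j powr \<sigma> else 0))"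
        by (rule ennreal_suminf_cmult)
      also have "\<dots> \<le> ennreal Q' * ennreal (K0 * d powr \<sigma>)" by (intro mult_left_mono K0(2) d) simp
      also have "\<dots> = ennreal (Q' * K0 * infdist y G powr \<sigma>)"
        using Q' K0(1) by (simp add: d_def ennreal_mult[symmetric] mult.assoc)
      finally show ?thesis .
    qed
    show "0 \<le> Q' * K0" using Q' K0 by simp
    show "k x y = 0" if "x \<in> X" "y \<notin> ball z r" for x y
    proof -
      have "y \<notin> N x j" for j
      proof
        assume "y \<in> N x j"
        then have "dist x y < Cc * l j" by (simp add: N_def)
        also have "\<dots> \<le> Cc * r0" using l(2)[of j] Cc by simp
        finally have "dist z x + dist x y < r" using that(1) reach by (simp add: X_def)
        moreover have "dist z y \<le> dist z x + dist x y" by metric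
        ultimately show False using that(2) by simp
      qed
      then show ?thesis by (simp add: k_def)
    qed
    \<comment> \<open>The hypothesis \<open>sub\<close> is exactly
      \<open>\<delta> - 2 * \<sigma> < real CARD('n) - s\<close>, the range in which the power of
      the distance is integrable near \<open>G\<close>.\<close>
    have "(\<integral>\<^sup>+y. indicator {y \<in> ball z r. 0 < infdist y G} y * ennreal (infdist y G powr (2 * \<sigma> - \<delta>)) \<partial>lborel)
      \<le> (\<integral>\<^sup>+y. indicator {y \<in> ball 0 (norm z + r). 0 < infdist y G} y * ennreal (infdist y G powr (- (\<delta> - 2 * \<sigma>))) \<partial>lborel)"
    proof (rule nn_integral_mono)
      fix y :: "real^'n"
      have "dist 0 y \<le> dist 0 z + dist z y" by metric
      then have "y \<in> ball z r \<Longrightarrow> y \<in> ball 0 (norm z + r)" by simp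
      then show "indicator {y \<in> ball z r. 0 < infdist y G} y * ennreal (infdist y G powr (2 * \<sigma> - \<delta>))
         \<le> indicator {y \<in> ball 0 (norm z + r). 0 < infdist y G} y * ennreal (infdist y G powr (- (\<delta> - 2 * \<sigma>)))"
        by (auto simp: indicator_def)
    qed
    also have "\<dots> < \<infinity>"
      by (rule distance_power_integral_finite[OF reg G(1)]) (use G(2) r sub in \<open>auto simp: \<sigma>_def add_nonneg_pos\<close>)
    finally show "(\<integral>\<^sup>+y. indicator {y \<in> ball z r. 0 < infdist y G} y * ennreal (infdist y G powr (2 * \<sigma> - \<delta>)) \<partial>lborel) < \<infinity>" .
  qed
qed

end

section \<open>Construction of the chains\<close>

lemma dyadic_scale_small:
  fixes r0 \<epsilon> :: real
  assumes "\<epsilon> > 0"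
  obtains J where "r0 * (1/2)^Suc J \<le> \<epsilon>"
proof -
  have "(\<lambda>j. r0 * (1/2)^j) \<longlonglongrightarrow> r0 * 0" by (intro tendsto_mult tendsto_const LIMSEQ_power_zero) auto
  then have "(\<lambda>j. r0 * (1/2)^Suc j) \<longlonglongrightarrow> 0" using LIMSEQ_Suc by fastforce
  then have "\<forall>\<^sub>F j in sequentially. r0 * (1/2)^Suc j < \<epsilon>" using assms by (rule order_tendstoD)
  then obtain N where "\<forall>n\<ge>N. r0 * (1/2)^Suc n < \<epsilon>" unfolding eventually_sequentially by blast
  then show thesis using that[of N] by (auto intro: less_imp_le)
qed

lemma scale_powr:
  fixes x :: real
  assumes "x > 0" "\<kappa> > 0"
  shows "A * x / (\<kappa> * x) ^ n = A / \<kappa> ^ n * x powr (1 - real n)"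
  using assms by (simp add: powr_diff powr_realpow power_mult_distrib field_simps)

text \<open>A test function vanishes in a whole neighbourhood of any point outside \<Omega>, so the
  boundary value 0 is reached after finitely many dyadic steps and no limit of averages has to be
  taken.\<close>

lemma Cc_infinity_avg_zero:
  fixes u :: "real^'n \<Rightarrow> real"
  assumes u: "u \<in> Cc_infinity \<Omega>" and x: "x \<notin> \<Omega>"
  obtains \<epsilon> where "\<epsilon> > 0" "\<And>p \<rho>. 0 < \<rho> \<Longrightarrow> dist x p + \<rho> \<le> \<epsilon> \<Longrightarrow> avg u p \<rho> = 0"
proof -
  have "open (- closure {x. u x \<noteq> 0})" "x \<in> - closure {x. u x \<noteq> 0}"
    using u x unfolding Cc_infinity_def by auto
  then obtain \<epsilon> where \<epsilon>: "\<epsilon> > 0" "ball x \<epsilon> \<subseteq> - closure {x. u x \<noteq> 0}" by (rule openE)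
  have z: "u y = 0" if "dist x y < \<epsilon>" for y
    using that \<epsilon>(2) closure_subset[of "{x. u x \<noteq> 0}"] by (auto simp: subset_eq)
  show thesis
  proof (rule that[OF \<epsilon>(1)])
    fix p :: "real^'n" and \<rho> :: real assume \<rho>: "0 < \<rho>" "dist x p + \<rho> \<le> \<epsilon>"
    have *: "indicator (ball 0 1) v * u (p + \<rho> *\<^sub>R v) = 0" for v
    proof (cases "norm v < 1")
      case True
      have "dist x (p + \<rho> *\<^sub>R v) \<le> dist x p + dist p (p + \<rho> *\<^sub>R v)" by (rule dist_triangle)
      also have "dist p (p + \<rho> *\<^sub>R v) = \<rho> * norm v" using \<rho>(1) by (simp add: dist_norm)
      also have "\<rho> * norm v < \<rho>" using True \<rho>(1) by simp
      finally have "dist x (p + \<rho> *\<^sub>R v) < \<epsilon>" using \<rho>(2) by linarith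
      then show ?thesis by (simp add: z)
    qed simp
    show "avg u p \<rho> = 0" unfolding avg_def * by simp
  qed
qed

text \<open>Degeneracy is applied to the single point \<open>z\<close>, whose collar is the part of
  a ball around it in the closure of \<Omega>.\<close>

lemma degenerate_on_lower_bound:
  fixes G :: "(real^'n) set"
  assumes deg: "degenerate_on \<Omega> C G \<delta>" and z: "z \<in> G"
  obtains a r where "a > 0" "r > 0"
    "AE x in lebesgue_on \<Omega>. x \<in> ball z r \<longrightarrow> mat_le (mat (a * infdist x G powr \<delta>)) (C x)"
proof -
  from deg[unfolded degenerate_on_def, rule_format, of "{z}"] z obtain a b r where
    *: "a > 0" "r > 0" "AE x in lebesgue_on \<Omega>. x \<in> collar \<Omega> {z} r \<longrightarrow>
          mat_le (mat (a * infdist x G powr \<delta>)) (C x) \<and> mat_le (C x) (mat (b * infdist x G powr \<delta>))"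
    by auto
  show thesis
  proof (rule that[OF *(1,2)])
    show "AE x in lebesgue_on \<Omega>. x \<in> ball z r \<longrightarrow> mat_le (mat (a * infdist x G powr \<delta>)) (C x)"
      using *(3) AE_space
    proof eventually_elim
      case (elim x)
      then have "x \<in> closure \<Omega>" using closure_subset by (auto simp: space_restrict_space)
      then show ?case using elim(1) by (auto simp: collar_def dist_commute)
    qed
  qed
qed

text \<open>One link of a chain: the ball travels along the curve with constant radius, and the
  radius is halved at the far end. Both parts are estimated with the smaller radius \<rho>/2, which
  only enlarges the bound.\<close>

lemma avg_curve_step:
  fixes u :: "real^'n \<Rightarrow> real"
  assumes u: "u \<in> Cc_infinity A" and \<rho>: "\<rho> > 0" and \<gamma>: "path \<gamma>" and L: "curve_length \<gamma> \<le> ennreal L" "L \<ge> 0"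
    and N: "N \<in> sets borel" and inside: "\<And>w. w \<in> path_image \<gamma> \<Longrightarrow> ball w (2 * \<rho>) \<subseteq> N"
  shows "ennreal \<bar>avg u (pathstart \<gamma>) \<rho> - avg u (pathfinish \<gamma>) (\<rho> / 2)\<bar>
     \<le> ennreal ((L + \<rho> / 2) / (\<rho> / 2) ^ CARD('n)) * grad_integral u N"
proof -
  have "ennreal \<bar>avg u (pathstart \<gamma>) \<rho> - avg u (pathfinish \<gamma>) \<rho>\<bar> \<le> ennreal (L / \<rho> ^ CARD('n)) * grad_integral u N"
    by (rule avg_chain_le[OF u \<rho> \<gamma> L N inside])
  also have "\<dots> \<le> ennreal (L / (\<rho> / 2) ^ CARD('n)) * grad_integral u N"
    using \<rho> L(2) by (intro mult_right_mono ennreal_leI divide_left_mono power_mono) auto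
  finally have 1: "ennreal \<bar>avg u (pathstart \<gamma>) \<rho> - avg u (pathfinish \<gamma>) \<rho>\<bar> \<le> ennreal (L / (\<rho> / 2) ^ CARD('n)) * grad_integral u N" .
  have "ennreal \<bar>avg u (pathfinish \<gamma>) \<rho> - avg u (pathfinish \<gamma>) (\<rho> / 2)\<bar>
     \<le> ennreal ((dist (pathfinish \<gamma>) (pathfinish \<gamma>) + \<bar>\<rho> - \<rho> / 2\<bar>) / (\<rho> / 2) ^ CARD('n)) * grad_integral u N"
  proof (rule avg_diff_le[OF u _ _ _ N])
    fix v :: "real^'n" and t :: real assume v: "norm v < 1" "0 \<le> t" "t \<le> 1"
    have "\<bar>\<rho> + t * (\<rho> / 2 - \<rho>)\<bar> \<le> \<rho>" using v \<rho> by (simp add: abs_le_iff field_simps)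
    then have "norm ((\<rho> + t * (\<rho> / 2 - \<rho>)) *\<^sub>R v) \<le> \<rho> * 1" using v \<rho> unfolding norm_scaleR by (intro mult_mono) auto
    then have "pathfinish \<gamma> + t *\<^sub>R (pathfinish \<gamma> - pathfinish \<gamma>) + (\<rho> + t * (\<rho> / 2 - \<rho>)) *\<^sub>R v \<in> ball (pathfinish \<gamma>) (2 * \<rho>)"
      using \<rho> by (simp add: dist_norm)
    then show "pathfinish \<gamma> + t *\<^sub>R (pathfinish \<gamma> - pathfinish \<gamma>) + (\<rho> + t * (\<rho> / 2 - \<rho>)) *\<^sub>R v \<in> N"
      using inside[OF pathfinish_in_path_image] by blast
  qed (use \<rho> in auto)
  then have 2: "ennreal \<bar>avg u (pathfinish \<gamma>) \<rho> - avg u (pathfinish \<gamma>) (\<rho> / 2)\<bar>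
     \<le> ennreal ((\<rho> / 2) / (\<rho> / 2) ^ CARD('n)) * grad_integral u N" using \<rho> by simp
  have "ennreal \<bar>avg u (pathstart \<gamma>) \<rho> - avg u (pathfinish \<gamma>) (\<rho> / 2)\<bar>
     \<le> ennreal (\<bar>avg u (pathstart \<gamma>) \<rho> - avg u (pathfinish \<gamma>) \<rho>\<bar> + \<bar>avg u (pathfinish \<gamma>) \<rho> - avg u (pathfinish \<gamma>) (\<rho> / 2)\<bar>)"
    by (intro ennreal_leI) linarith
  also have "\<dots> = ennreal \<bar>avg u (pathstart \<gamma>) \<rho> - avg u (pathfinish \<gamma>) \<rho>\<bar> + ennreal \<bar>avg u (pathfinish \<gamma>) \<rho> - avg u (pathfinish \<gamma>) (\<rho> / 2)\<bar>"
    by (rule ennreal_plus) auto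
  also have "\<dots> \<le> ennreal (L / (\<rho> / 2) ^ CARD('n)) * grad_integral u N + ennreal ((\<rho> / 2) / (\<rho> / 2) ^ CARD('n)) * grad_integral u N"
    by (rule add_mono[OF 1 2])
  also have "\<dots> = ennreal (L / (\<rho> / 2) ^ CARD('n) + (\<rho> / 2) / (\<rho> / 2) ^ CARD('n)) * grad_integral u N"
    using L(2) \<rho> by (subst ennreal_plus) (auto simp: distrib_right)
  also have "L / (\<rho> / 2) ^ CARD('n) + (\<rho> / 2) / (\<rho> / 2) ^ CARD('n) = (L + \<rho> / 2) / (\<rho> / 2) ^ CARD('n)"
    by (simp only: add_divide_distrib)
  finally show ?thesis .
qed

context elliptic
begin

text \<open>Since s < d - 1 the kernel sum is dominated by its smallest scale, and the sets may
  touch the boundary: the chain is used with \<open>c1\<close> equal to 0. Averages over balls that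
  cross the boundary make sense because test functions extended by 0 are smooth on the whole
  space.\<close>

lemma not_markov_unique_if_thin:
  fixes G :: "(real^'n) set"
  assumes reg: "ahlfors_regular s G" and G: "closed G" "z \<in> G" "G \<subseteq> frontier \<Omega>"
    and sub: "\<delta> < 1 + (s - (real CARD('n) - 1))" and deg: "degenerate_on \<Omega> C G \<delta>"
    and s: "s < real CARD('n) - 1"
  shows "\<not> markov_unique \<Omega> C"
proof -
  obtain a r where ar: "a > 0" "r > 0"
    "AE x in lebesgue_on \<Omega>. x \<in> ball z r \<longrightarrow> mat_le (mat (a * infdist x G powr \<delta>)) (C x)"
    by (rule degenerate_on_lower_bound[OF deg G(2)])
  define r0 where "r0 = r / 8"
  have r0: "r0 > 0" using ar by (simp add: r0_def)
  have "z \<in> closure \<Omega>" using G by (auto simp: frontier_def)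
  then obtain x0 where x0: "x0 \<in> \<Omega>" "dist x0 z < r0" using r0 by (auto simp: closure_approachable)
  define l where "l j = r0 * (1/2)^j" for j :: nat
  have l: "l j > 0" "l (Suc j) = l j / 2" for j using r0 by (auto simp: l_def)
  show ?thesis
  proof (rule not_markov_unique_if_chains[OF reg G sub ar, where c=z and \<rho>=r0 and ?x0.0=x0 and ?r0.0=r0 and R'=r0 and Q="2 * 2^CARD('n)" and Cc=3 and ?c1.0=0])
    show "ball z r0 \<subseteq> ball z r" using ar by (auto simp: r0_def)
    show "x0 \<in> \<Omega> \<inter> ball z r0" using x0 by (simp add: dist_commute)
    show "r0 + 3 * r0 \<le> r" using ar by (simp add: r0_def)
    fix u x assume u: "u \<in> Cc_infinity \<Omega>" and x: "x \<in> G \<inter> ball z r0"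
    have "x \<notin> \<Omega>" using x G(3) open_\<Omega> by (auto simp: frontier_def interior_open)
    from Cc_infinity_avg_zero[OF u this] obtain \<epsilon> where
      \<epsilon>: "\<epsilon> > 0" "\<And>p \<rho>. 0 < \<rho> \<Longrightarrow> dist x p + \<rho> \<le> \<epsilon> \<Longrightarrow> avg u p \<rho> = 0" by blast
    obtain J where J: "l (Suc J) \<le> \<epsilon>" using dyadic_scale_small[OF \<epsilon>(1)] unfolding l_def by blast
    \<comment> \<open>Only the first centre differs from \<open>x\<close>: the reference ball around
      \<open>z\<close> has to be the same for all boundary points.\<close>
    define p where "p j = (if j = 0 then z else x)" for j :: nat
    define b where "b j = avg u (p j) (l j)" for j
    have "ennreal \<bar>b 0\<bar> \<le> (\<Sum>j. ennreal (2 * 2^CARD('n) * l j powr (1 - real CARD('n))) * grad_integral u {y. dist x y < 3 * l j \<and> 0 * l j \<le> infdist y G})"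
    proof (rule telescoping_le_suminf)
      show "b (Suc J) = 0" using \<epsilon>(2)[of "l (Suc J)" x] J l(1) by (simp add: b_def p_def)
      fix j
      have ps: "p (Suc j) = x" by (simp add: p_def)
      have "dist (p j) x \<le> r0 \<and> (j = 0 \<or> p j = x)" using x by (auto simp: p_def less_imp_le r0)
      then have d: "dist (p j) x \<le> l j" using l(1)[of j] by (auto simp: l_def)
      have "ennreal \<bar>avg u (p j) (l j) - avg u x (l (Suc j))\<bar>
         \<le> ennreal ((dist (p j) x + \<bar>l j - l (Suc j)\<bar>) / l (Suc j) ^ CARD('n)) * grad_integral u {y. dist x y < 3 * l j \<and> 0 * l j \<le> infdist y G}"
      proof (rule avg_diff_le[OF u])
        have "{y. dist x y < 3 * l j \<and> 0 * l j \<le> infdist y G} = ball x (3 * l j)" by (auto simp: infdist_nonneg)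
        then show "{y. dist x y < 3 * l j \<and> 0 * l j \<le> infdist y G} \<in> sets borel" by simp
        fix v :: "real^'n" and t :: real assume v: "norm v < 1" "0 \<le> t" "t \<le> 1"
        have tl: "t * l j \<le> 1 * l j" "0 \<le> t * l j" using v l(1)[of j] by (auto intro: mult_right_mono)
        \<comment> \<open>The centre contributes at most l and the radius at most l, so all
          intermediate points are within 2l of \<open>x\<close>, strictly inside the radius 3l
          chosen through \<open>Cc\<close>.\<close>
        have "dist x (p j + t *\<^sub>R (x - p j) + (l j + t * (l (Suc j) - l j)) *\<^sub>R v)
          = norm ((1 - t) *\<^sub>R (p j - x) + (l j + t * (l (Suc j) - l j)) *\<^sub>R v)"
          by (subst dist_commute) (simp add: dist_norm algebra_simps)
        also have "\<dots> \<le> (1 - t) * dist (p j) x + \<bar>l j + t * (l (Suc j) - l j)\<bar> * norm v"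
          using v by (intro norm_triangle_le) (simp add: dist_norm)
        also have "\<dots> \<le> 1 * l j + l j * 1"
          using v d l(1)[of j] tl by (intro add_mono mult_mono) (auto simp: l(2) algebra_simps)
        finally show "p j + t *\<^sub>R (x - p j) + (l j + t * (l (Suc j) - l j)) *\<^sub>R v \<in> {y. dist x y < 3 * l j \<and> 0 * l j \<le> infdist y G}"
          using l(1)[of j] by (simp add: infdist_nonneg)
      qed (use l(1)[of j] in \<open>auto simp: l(2)\<close>)
      also have "\<dots> \<le> ennreal (2 * 2^CARD('n) * l j powr (1 - real CARD('n))) * grad_integral u {y. dist x y < 3 * l j \<and> 0 * l j \<le> infdist y G}"
      proof (intro mult_right_mono ennreal_leI)
        have "(dist (p j) x + \<bar>l j - l (Suc j)\<bar>) / l (Suc j) ^ CARD('n) \<le> (2 * l j) / (1/2 * l j) ^ CARD('n)"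
          using d l(1)[of j] by (intro frac_le) (auto simp: l(2))
        also have "\<dots> = 2 / (1/2) ^ CARD('n) * l j powr (1 - real CARD('n))" by (rule scale_powr) (use l(1) in auto)
        also have "2 / (1/2) ^ CARD('n) = (2 * 2 ^ CARD('n) :: real)" by (simp add: power_one_over)
        finally show "(dist (p j) x + \<bar>l j - l (Suc j)\<bar>) / l (Suc j) ^ CARD('n) \<le> 2 * 2^CARD('n) * l j powr (1 - real CARD('n))" .
      qed simp
      finally show "ennreal \<bar>b j - b (Suc j)\<bar> \<le> ennreal (2 * 2^CARD('n) * l j powr (1 - real CARD('n))) * grad_integral u {y. dist x y < 3 * l j \<and> 0 * l j \<le> infdist y G}"
        by (simp add: b_def ps)
    qed
    then show "ennreal \<bar>avg u z r0\<bar> \<le> (\<Sum>j. ennreal (2 * 2^CARD('n) * (r0 * (1/2)^j) powr (1 - real CARD('n))) *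
       grad_integral u {y. dist x y < 3 * (r0 * (1/2)^j) \<and> 0 * (r0 * (1/2)^j) \<le> infdist y G})"
      by (simp add: b_def p_def l_def)
  qed (use r0 s in auto)
qed

text \<open>The point lies on the curve that joins a point \<open>y\<close> very close to
  \<open>x\<close> with the distant point \<open>as\<close>: by the intermediate value theorem the
  curve meets the sphere of radius \<rho>/4 about \<open>y\<close>, and there the uniformity
  condition bounds the distance to the frontier from below.\<close>

lemma corkscrew_points:
  fixes G :: "(real^'n) set"
  assumes G: "x \<in> frontier \<Omega>" "dist z x < R'" and R': "R' > 0" "3 * R' < R"
    and as: "as \<in> \<Omega> \<inter> ball z R" "dist as z = 2 * R'" and \<rho>: "0 < \<rho>" "\<rho> \<le> 3 / 2 * R'" and \<sigma>: "\<sigma> \<ge> 1"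
    and curve: "\<And>p q. p \<in> \<Omega> \<inter> ball z R \<Longrightarrow> q \<in> \<Omega> \<inter> ball z R \<Longrightarrow> \<exists>\<gamma>. rectifiable_curve \<gamma> \<and> path_image \<gamma> \<subseteq> \<Omega>
        \<and> pathstart \<gamma> = p \<and> pathfinish \<gamma> = q \<and> curve_length \<gamma> \<le> ennreal (\<sigma> * dist p q)
        \<and> (\<forall>w\<in>path_image \<gamma>. infdist w (frontier \<Omega>) \<ge> min (dist p w) (dist w q) / \<sigma>)"
  obtains w where "w \<in> \<Omega> \<inter> ball z R" "dist w x \<le> \<rho>" "infdist w (frontier \<Omega>) \<ge> \<rho> / (4 * \<sigma>)"
proof -
  have "x \<in> closure \<Omega>" using G by (auto simp: frontier_def)
  then obtain y where y: "y \<in> \<Omega>" "dist y x < \<rho> / 8"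
    using \<rho> unfolding closure_approachable by (meson divide_pos_pos zero_less_numeral)
  have zy: "dist z y \<le> dist z x + dist y x" by metric
  have "y \<in> \<Omega> \<inter> ball z R" using y zy G R' \<rho> by simp
  from curve[OF this as(1)] obtain \<gamma> where \<gamma>: "rectifiable_curve \<gamma>" "path_image \<gamma> \<subseteq> \<Omega>"
    "pathstart \<gamma> = y" "pathfinish \<gamma> = as"
    "\<And>w. w \<in> path_image \<gamma> \<Longrightarrow> infdist w (frontier \<Omega>) \<ge> min (dist y w) (dist w as) / \<sigma>" by blast
  have far: "dist as z \<le> dist y as + dist z y" by metric
  have "\<exists>t\<ge>0. t \<le> 1 \<and> dist y (\<gamma> t) = \<rho> / 4"
  proof (rule IVT')
    have "path \<gamma>" using \<gamma>(1) by (simp add: rectifiable_curve_def)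
    then show "continuous_on {0..1} (\<lambda>t. dist y (\<gamma> t))" unfolding path_def by (intro continuous_intros)
    show "dist y (\<gamma> 0) \<le> \<rho> / 4" using \<gamma>(3) \<rho> by (simp add: pathstart_def)
    show "\<rho> / 4 \<le> dist y (\<gamma> 1)" using \<gamma>(4) far zy as(2) G y \<rho> R' by (simp add: pathfinish_def)
  qed simp
  then obtain t where t: "t \<in> {0..1}" "dist y (\<gamma> t) = \<rho> / 4" by auto
  define w where "w = \<gamma> t"
  have wi: "w \<in> path_image \<gamma>" using t(1) by (simp add: w_def path_image_def)
  have dw: "dist y w = \<rho> / 4" using t(2) by (simp add: w_def)
  have d1: "dist w x \<le> dist y w + dist y x" "dist z w \<le> dist z x + dist w x" "dist y as \<le> dist y w + dist w as" by metric+
  show thesis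
  proof (rule that)
    show "dist w x \<le> \<rho>" using d1 dw y \<rho> by simp
    then show "w \<in> \<Omega> \<inter> ball z R" using d1 G R' \<rho> \<gamma>(2) wi by auto
    \<comment> \<open>The points \<open>y\<close> and \<open>as\<close> are at least R' - \<rho>/8
      apart, and \<open>\<rho> \<le> 3 / 2 * R'\<close> then keeps \<open>w\<close> at least
      \<rho>/4 away from the far end too.\<close>
    have "dist w as \<ge> \<rho> / 4" using d1(3) dw far zy as(2) G y \<rho> R' by linarith
    then have "min (dist y w) (dist w as) = \<rho> / 4" using dw by simp
    then show "infdist w (frontier \<Omega>) \<ge> \<rho> / (4 * \<sigma>)" using \<gamma>(5)[OF wi] by (simp only: divide_divide_eq_left)
  qed
qed

text \<open>Near an endpoint of the curve the distance to \<open>F\<close> is inherited from that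
  endpoint, elsewhere it comes from the uniformity condition. So the curve, and a tube of comparable
  width around it, keeps a distance from \<open>F\<close> proportional to the scale, while the
  length bound keeps the tube within a multiple of the scale from \<open>x\<close>.\<close>

lemma uniform_curve_neighbourhood:
  assumes \<sigma>: "\<sigma> \<ge> 1" and l: "l > 0" and \<theta>: "\<theta> > 0" "\<theta> \<le> 1 / (4 * \<sigma>)" and F: "G \<subseteq> F" "G \<noteq> {}"
    and p: "dist p x \<le> l" "infdist p F \<ge> \<theta> * l" and q: "dist q x \<le> l / 2" "infdist q F \<ge> \<theta> * (l / 2)"
    and \<gamma>: "pathstart \<gamma> = p" "curve_length \<gamma> \<le> ennreal (\<sigma> * dist p q)"
      "\<And>w. w \<in> path_image \<gamma> \<Longrightarrow> infdist w F \<ge> min (dist p w) (dist w q) / \<sigma>"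
    and w: "w \<in> path_image \<gamma>" and y: "dist w y < \<theta> * l / (8 * \<sigma>)"
  shows "dist x y < 4 * \<sigma> * l" "\<theta> / (8 * \<sigma>) * l \<le> infdist y G"
proof -
  have \<sigma>l: "l \<le> \<sigma> * l" using mult_right_mono[OF \<sigma>, of l] l by simp
  have "\<theta> * l / (8 * \<sigma>) \<le> \<theta> * l / 8" using \<sigma> \<theta> l by (intro divide_left_mono) auto
  moreover have \<theta>1: "\<theta> \<le> 1" using \<theta> \<sigma> by (rule_tac order_trans) auto
  then have "\<theta> * l / 8 \<le> l / 8" using l by simp
  ultimately have yw: "dist w y < l / 8" using y by linarith
  have pq: "dist p q \<le> 2 * l" using dist_triangle[of p q x] p(1) q(1) l by (simp add: dist_commute)
  obtain t where t: "t \<in> {0..1}" "w = \<gamma> t" using w by (auto simp: path_image_def)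
  have "ennreal (dist p w) \<le> ennreal (\<sigma> * dist p q)"
    using dist_le_curve_length[OF t(1), of \<gamma>] \<gamma>(1,2) t(2) by (auto simp: pathstart_def intro: order_trans)
  then have "dist p w \<le> \<sigma> * dist p q" using \<sigma> by (subst (asm) ennreal_le_iff) auto
  also have "\<dots> \<le> \<sigma> * (2 * l)" using pq \<sigma> by (intro mult_left_mono) auto
  finally have pw: "dist p w \<le> 2 * (\<sigma> * l)" by simp
  have "dist x y \<le> dist p x + dist p w + dist w y" by metric
  then have "dist x y < 4 * (\<sigma> * l)" using p(1) pw yw \<sigma>l l by linarith
  then show "dist x y < 4 * \<sigma> * l" by simp
  have wF: "\<theta> * l / (4 * \<sigma>) \<le> infdist w F"
  \<comment> \<open>The threshold \<theta>l/4 is half of the distance guaranteed at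
    \<open>q\<close>, so a loss of that size leaves at least \<theta>l/4 at either end.\<close>
  proof (cases "dist p w < \<theta> * l / 4 \<or> dist w q < \<theta> * l / 4")
    case True
    have "infdist p F \<le> infdist w F + dist p w" "infdist q F \<le> infdist w F + dist q w" by (rule infdist_triangle)+
    then have "\<theta> * l / 4 \<le> infdist w F" using True p(2) q(2) mult_pos_pos[OF \<theta>(1) l] dist_commute[of q w] by linarith
    moreover have "\<theta> * l / (4 * \<sigma>) \<le> \<theta> * l / 4" using \<sigma> \<theta> l by (intro divide_left_mono) auto
    ultimately show ?thesis by linarith
  next
    case False
    then have "\<theta> * l / 4 / \<sigma> \<le> min (dist p w) (dist w q) / \<sigma>" using \<sigma> by (intro divide_right_mono) auto
    then show ?thesis using \<gamma>(3)[OF w] by simp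
  qed
  have "infdist w F \<le> infdist y F + dist w y" by (rule infdist_triangle)
  also have "infdist y F \<le> infdist y G" using F by (intro infdist_mono) auto
  finally show "\<theta> / (8 * \<sigma>) * l \<le> infdist y G" using wF y by (simp add: field_simps)
qed

text \<open>The chain consists of corkscrew points of \<Omega> near the boundary point, one for each
  dyadic scale, joined by uniform curves. The sets swept out avoid \<open>G\<close> by
  \<open>c1\<close> times the scale, as the case s \<ge> d - 1 of
  \<open>not_markov_unique_if_chains\<close> requires.\<close>

lemma not_markov_unique_if_uniform:
  fixes G :: "(real^'n) set"
  assumes reg: "ahlfors_regular s G" and G: "closed G" "z \<in> G" "G \<subseteq> frontier \<Omega>"
    and sub: "\<delta> < 1 + (s - (real CARD('n) - 1))" and deg: "degenerate_on \<Omega> C G \<delta>"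
    and s: "real CARD('n) - 1 \<le> s" and R: "R > 0" and unif: "uniform_in \<Omega> (\<Omega> \<inter> ball z R)"
  shows "\<not> markov_unique \<Omega> C"
proof -
  obtain a r where ar: "a > 0" "r > 0"
    "AE x in lebesgue_on \<Omega>. x \<in> ball z r \<longrightarrow> mat_le (mat (a * infdist x G powr \<delta>)) (C x)"
    by (rule degenerate_on_lower_bound[OF deg G(2)])
  define D where "D = \<Omega> \<inter> ball z R"
  define joins where "joins \<sigma> \<gamma> p q \<longleftrightarrow> rectifiable_curve \<gamma> \<and> path_image \<gamma> \<subseteq> \<Omega>
        \<and> pathstart \<gamma> = p \<and> pathfinish \<gamma> = q \<and> curve_length \<gamma> \<le> ennreal (\<sigma> * dist p q)
        \<and> (\<forall>w\<in>path_image \<gamma>. infdist w (frontier \<Omega>) \<ge> min (dist p w) (dist w q) / \<sigma>)" for \<sigma> \<gamma> p q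
  obtain \<sigma> where \<sigma>: "\<sigma> \<ge> 1" and curve: "\<And>p q. p \<in> D \<Longrightarrow> q \<in> D \<Longrightarrow> \<exists>\<gamma>. joins \<sigma> \<gamma> p q"
    using unif unfolding uniform_in_def D_def[symmetric] joins_def[symmetric] by blast
  define Cc where "Cc = 4 * \<sigma>"
  have Cc: "Cc \<ge> 4" using \<sigma> by (simp add: Cc_def)
  \<comment> \<open>The point \<open>as\<close> is taken so close to \<open>z\<close> that
    \<open>3 * Cc + 1\<close> times its distance 2R' is below \<open>R\<close> and \<open>r\<close>:
    then the corkscrew points lie in the ball where curves exist, and the chain in the ball where
    the coefficients are bounded below.\<close>
  define \<epsilon> where "\<epsilon> = min R r / (3 * Cc + 1)"
  have \<epsilon>: "\<epsilon> > 0" using R ar Cc by (simp add: \<epsilon>_def)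
  have "z \<in> closure \<Omega>" "z \<notin> \<Omega>" using G open_\<Omega> by (auto simp: frontier_def interior_open)
  then obtain as where as: "as \<in> \<Omega>" "dist as z < \<epsilon>" using \<epsilon> by (auto simp: closure_approachable)
  define R' where "R' = dist as z / 2"
  have R': "R' > 0" "dist as z = 2 * R'" using as(1) \<open>z \<notin> \<Omega>\<close> by (auto simp: R'_def)
  have "2 * R' * (3 * Cc + 1) < min R r" using as(2) Cc R'(2) by (simp add: \<epsilon>_def pos_less_divide_eq)
  then have 1: "6 * (Cc * R') + 2 * R' < R" "6 * (Cc * R') + 2 * R' < r" by (auto simp: algebra_simps)
  have 2: "4 * R' \<le> Cc * R'" using Cc R'(1) by simp
  have reach: "R' + 3 * (Cc * R') \<le> r" using 1(2) 2 R'(1) by linarith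
  have reach2: "13 * R' < r" "13 * R' < R" using 1 2 R'(1) by linarith+
  \<comment> \<open>Every boundary point within R' of \<open>z\<close> is at distance at most 3R'
    from \<open>as\<close>, so \<open>as\<close> can open the chain for all of them.\<close>
  define r0 where "r0 = 3 * R'"
  have r0: "r0 > 0" using R' by (simp add: r0_def)
  have asD: "as \<in> D" using as reach2 R' by (auto simp: D_def dist_commute)
  define F where "F = frontier \<Omega>"
  have F: "G \<subseteq> F" "G \<noteq> {}" "closed F" "F \<noteq> {}" using G by (auto simp: F_def)
  have "as \<notin> F" using as open_\<Omega> by (auto simp: F_def frontier_def interior_open)
  then have dF: "infdist as F > 0" using F infdist_pos_not_in_closed by blast
  \<comment> \<open>The constant of \<open>corkscrew_points\<close>, reduced so that
    \<open>as\<close> also qualifies at the first scale \<open>r0\<close>.\<close>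
  define \<theta> where "\<theta> = min (1 / (4 * \<sigma>)) (infdist as F / r0)"
  have \<theta>: "\<theta> > 0" "\<theta> \<le> 1 / (4 * \<sigma>)" "\<theta> * r0 \<le> infdist as F"
    using \<sigma> dF r0 by (auto simp: \<theta>_def min_def field_simps)
  have \<theta>1: "\<theta> \<le> 1" using \<theta>(2) \<sigma> by (rule_tac order_trans) auto
  \<comment> \<open>The balls of the chain have radius \<kappa>l. Twice this radius is
    \<theta>l/(8\<sigma>), the width of the tube in
    \<open>uniform_curve_neighbourhood\<close>.\<close>
  define \<kappa> where "\<kappa> = \<theta> / (16 * \<sigma>)"
  have \<kappa>: "\<kappa> > 0" using \<theta> \<sigma> by (simp add: \<kappa>_def)
  have \<kappa>1: "\<kappa> \<le> 1" using \<theta>1 \<sigma> by (simp add: \<kappa>_def)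
  define c1 where "c1 = \<theta> / (8 * \<sigma>)"
  have c1: "c1 > 0" using \<theta> \<sigma> by (simp add: c1_def)
  \<comment> \<open>The curve of length at most 2\<sigma>l and the halving of the radius, in units
    of l, over the d-th power of the smaller radius; \<open>scale_powr\<close> extracts the
    dependence on l.\<close>
  define Q where "Q = (2 * \<sigma> + \<kappa> / 2) / (\<kappa> / 2) ^ CARD('n)"
  have Q: "Q \<ge> 0" using \<sigma> \<kappa> by (simp add: Q_def)
  define l where "l j = r0 * (1/2)^j" for j :: nat
  have l: "l j > 0" "l (Suc j) = l j / 2" "l j \<le> r0" for j
    using r0 power_le_one[of "1/2::real" j] by (auto simp: l_def mult_left_le)
  have \<kappa>r: "0 < \<kappa> * r0" "\<kappa> * r0 \<le> r0" using \<kappa> \<kappa>1 r0 by auto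
  show ?thesis
  proof (rule not_markov_unique_if_chains[OF reg G sub ar, where c=as and \<rho>="\<kappa> * r0" and ?x0.0=as and ?r0.0=r0 and R'=R' and Q=Q and Cc=Cc and ?c1.0=c1])
    show "ball as (\<kappa> * r0) \<subseteq> ball z r"
    proof
      fix y assume "y \<in> ball as (\<kappa> * r0)"
      then have "dist as y < 3 * R'" using \<kappa>r(2) by (simp add: r0_def)
      moreover have "dist z y \<le> dist as z + dist as y" by metric
      ultimately show "y \<in> ball z r" using reach2 R' by simp
    qed
    show "as \<in> \<Omega> \<inter> ball as (\<kappa> * r0)" using as \<kappa>r by simp
    show "R' + Cc * r0 \<le> r" using reach by (simp add: r0_def)
    fix u x assume u: "u \<in> Cc_infinity \<Omega>" and x: "x \<in> G \<inter> ball z R'"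
    have xF: "x \<in> frontier \<Omega>" "dist z x < R'" using x G(3) by auto
    have "x \<notin> \<Omega>" using xF open_\<Omega> by (auto simp: frontier_def interior_open)
    from Cc_infinity_avg_zero[OF u this] obtain \<epsilon>' where
      \<epsilon>': "\<epsilon>' > 0" "\<And>p \<rho>. 0 < \<rho> \<Longrightarrow> dist x p + \<rho> \<le> \<epsilon>' \<Longrightarrow> avg u p \<rho> = 0" by blast
    obtain J where J: "l (Suc J) \<le> \<epsilon>' / 2" using dyadic_scale_small[of "\<epsilon>' / 2" r0] \<epsilon>'(1) unfolding l_def by auto
    have "\<exists>w. w \<in> D \<and> dist w x \<le> l j \<and> \<theta> * l j \<le> infdist w F \<and> (j = 0 \<longrightarrow> w = as)" for j
    proof (cases j)
      case 0
      have "dist as x \<le> dist as z + dist z x" by (rule dist_triangle)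
      then have "dist as x \<le> r0" using R' xF by (simp add: r0_def)
      then show ?thesis using asD \<theta>(3) 0 by (auto simp: l_def)
    next
      case (Suc i)
      \<comment> \<open>From index 1 on the scale is at most r0/2 = 3R'/2, the range of
        \<open>corkscrew_points\<close>; index 0 is out of this range and is filled by
        \<open>as\<close>.\<close>
      have "l j \<le> 3 / 2 * R'" using l(2,3)[of i] Suc by (simp add: r0_def)
      moreover have "3 * R' < R" using reach2 R' by simp
      ultimately obtain w where w: "w \<in> D" "dist w x \<le> l j" "l j / (4 * \<sigma>) \<le> infdist w F"
        using corkscrew_points[OF xF R'(1) _ asD[unfolded D_def] R'(2) l(1) _ \<sigma> curve[unfolded D_def joins_def], of j]
        unfolding D_def F_def by blast
      have "\<theta> * l j \<le> 1 / (4 * \<sigma>) * l j" using \<theta>(2) l(1)[of j] by (intro mult_right_mono) auto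
      then show ?thesis using w Suc by auto
    qed
    then obtain p where p: "\<And>j. p j \<in> D" "\<And>j. dist (p j) x \<le> l j" "\<And>j. \<theta> * l j \<le> infdist (p j) F" "p 0 = as"
      by metis
    define b where "b j = avg u (p j) (\<kappa> * l j)" for j
    define N where "N j = {y. dist x y < Cc * l j \<and> c1 * l j \<le> infdist y G}" for j
    have im [measurable]: "(\<lambda>y. infdist y G) \<in> borel_measurable borel"
      by (intro borel_measurable_continuous_onI continuous_intros)
    have N: "N j \<in> sets borel" for j unfolding N_def by measurable
    have "ennreal \<bar>b 0\<bar> \<le> (\<Sum>j. ennreal (Q * l j powr (1 - real CARD('n))) * grad_integral u (N j))"
    proof (rule telescoping_le_suminf)
      have "\<kappa> * l (Suc J) \<le> l (Suc J)" using \<kappa>1 l(1)[of "Suc J"] by (simp del: l(2))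
      then have "dist x (p (Suc J)) + \<kappa> * l (Suc J) \<le> \<epsilon>'" using J p(2)[of "Suc J"] by (simp add: dist_commute)
      then show "b (Suc J) = 0" using \<epsilon>'(2) \<kappa> l(1)[of "Suc J"] unfolding b_def by (simp add: mult_pos_pos)
      fix j
      obtain \<gamma> where "joins \<sigma> \<gamma> (p j) (p (Suc j))" using curve[OF p(1) p(1)] by blast
      then have \<gamma>: "path \<gamma>" "pathstart \<gamma> = p j" "pathfinish \<gamma> = p (Suc j)"
        "curve_length \<gamma> \<le> ennreal (\<sigma> * dist (p j) (p (Suc j)))"
        "\<And>w. w \<in> path_image \<gamma> \<Longrightarrow> infdist w F \<ge> min (dist (p j) w) (dist w (p (Suc j))) / \<sigma>"
        by (auto simp: joins_def rectifiable_curve_def F_def)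
      have ps: "dist (p (Suc j)) x \<le> l j / 2" "\<theta> * (l j / 2) \<le> infdist (p (Suc j)) F"
        using p(2,3)[of "Suc j"] by (simp_all add: l(2))
      have "dist (p j) (p (Suc j)) \<le> dist (p j) x + dist (p (Suc j)) x" by metric
      then have "\<sigma> * dist (p j) (p (Suc j)) \<le> \<sigma> * (2 * l j)"
        using p(2)[of j] ps(1) \<sigma> l(1)[of j] by (intro mult_left_mono) auto
      then have len: "curve_length \<gamma> \<le> ennreal (2 * \<sigma> * l j)"
        by (intro order_trans[OF \<gamma>(4)] ennreal_leI) simp
      have "ennreal \<bar>avg u (pathstart \<gamma>) (\<kappa> * l j) - avg u (pathfinish \<gamma>) (\<kappa> * l j / 2)\<bar>
        \<le> ennreal ((2 * \<sigma> * l j + \<kappa> * l j / 2) / (\<kappa> * l j / 2) ^ CARD('n)) * grad_integral u (N j)"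
      proof (rule avg_curve_step[OF u _ \<gamma>(1) len _ N])
        fix w assume w: "w \<in> path_image \<gamma>"
        show "ball w (2 * (\<kappa> * l j)) \<subseteq> N j"
        proof
          fix y assume "y \<in> ball w (2 * (\<kappa> * l j))"
          then have "dist w y < \<theta> * l j / (8 * \<sigma>)" by (simp add: \<kappa>_def)
          from uniform_curve_neighbourhood[OF \<sigma> l(1) \<theta>(1,2) F(1,2) p(2,3) ps \<gamma>(2,4,5) w this]
          show "y \<in> N j" by (simp add: N_def Cc_def c1_def)
        qed
      qed (use \<kappa> l(1)[of j] \<sigma> in auto)
      also have "(2 * \<sigma> * l j + \<kappa> * l j / 2) / (\<kappa> * l j / 2) ^ CARD('n) = (2 * \<sigma> + \<kappa> / 2) * l j / (\<kappa> / 2 * l j) ^ CARD('n)"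
        by (simp add: distrib_right)
      also have "\<dots> = Q * l j powr (1 - real CARD('n))"
        unfolding Q_def by (rule scale_powr) (use l(1) \<kappa> in auto)
      finally show "ennreal \<bar>b j - b (Suc j)\<bar> \<le> ennreal (Q * l j powr (1 - real CARD('n))) * grad_integral u (N j)"
        by (simp add: b_def \<gamma>(2,3) l(2))
    qed
    then show "ennreal \<bar>avg u as (\<kappa> * r0)\<bar> \<le> (\<Sum>j. ennreal (Q * (r0 * (1/2)^j) powr (1 - real CARD('n))) *
       grad_integral u {y. dist x y < Cc * (r0 * (1/2)^j) \<and> c1 * (r0 * (1/2)^j) \<le> infdist y G})"
      by (simp add: b_def p(4) N_def l_def)
  qed (use r0 s R' Q Cc c1 \<kappa>r in auto)
qed

end

theorem theorem4p1:
  fixes \<Omega> :: "(real^'n) set"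
    and C :: "real^'n \<Rightarrow> real^'n^'n"
    and M :: "'i set"
    and \<Gamma> :: "'i \<Rightarrow> (real^'n) set"
    and s \<delta> :: "'i \<Rightarrow> real"
    and d\<^sub>0 :: real
  assumes "open \<Omega>" and "connected \<Omega>" and "\<Omega> \<noteq> {}"
    and "coefficients \<Omega> C"
    and "frontier \<Omega> = (\<Union>\<alpha>\<in>M. \<Gamma> \<alpha>)"
    and "\<And>\<alpha>. \<alpha> \<in> M \<Longrightarrow> closed (\<Gamma> \<alpha>) \<and> \<Gamma> \<alpha> \<noteq> {}"
    and "d\<^sub>0 > 0"
    and "\<And>\<alpha> \<beta>. \<alpha> \<in> M \<Longrightarrow> \<beta> \<in> M \<Longrightarrow> \<alpha> \<noteq> \<beta> \<Longrightarrow> setdist (\<Gamma> \<alpha>) (\<Gamma> \<beta>) \<ge> d\<^sub>0"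
    and "\<And>\<alpha>. \<alpha> \<in> M \<Longrightarrow> 0 < s \<alpha> \<and> s \<alpha> < real CARD('n)"
    and "\<And>\<alpha>. \<alpha> \<in> M \<Longrightarrow> ahlfors_regular (s \<alpha>) (\<Gamma> \<alpha>)"
    and "\<And>\<alpha>. \<alpha> \<in> M \<Longrightarrow> real CARD('n) - 1 \<le> s \<alpha> \<Longrightarrow>
           \<exists>z\<in>\<Gamma> \<alpha>. \<exists>R>0. uniform_in \<Omega> (\<Omega> \<inter> ball z R)"
    and "\<And>\<alpha>. \<alpha> \<in> M \<Longrightarrow> \<delta> \<alpha> \<ge> 0 \<and> degenerate_on \<Omega> C (\<Gamma> \<alpha>) (\<delta> \<alpha>)"
  shows "markov_unique \<Omega> C \<longleftrightarrow>
           (\<forall>\<alpha>\<in>M. \<delta> \<alpha> \<ge> 1 + (s \<alpha> - (real CARD('n) - 1)))"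
proof -
  obtain B where "B > 0" "AE x in lebesgue_on \<Omega>. good_matrix B (C x)"
    by (rule coefficients_good[OF assms(4)])
  then interpret elliptic \<Omega> C B by unfold_locales (use assms in auto)
  show ?thesis
  proof
    assume all: "\<forall>\<alpha>\<in>M. \<delta> \<alpha> \<ge> 1 + (s \<alpha> - (real CARD('n) - 1))"
    show "markov_unique \<Omega> C"
      by (rule markov_unique_if_cutoffs, rule has_boundary_cutoffsI[where M=M and \<Gamma>=\<Gamma> and d="d\<^sub>0" and s=s and \<delta>=\<delta>]) (use assms all in auto)
  next
    assume mu: "markov_unique \<Omega> C"
    show "\<forall>\<alpha>\<in>M. \<delta> \<alpha> \<ge> 1 + (s \<alpha> - (real CARD('n) - 1))"
    proof (rule ccontr)
      assume "\<not> ?thesis"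
      then obtain \<alpha> where \<alpha>: "\<alpha> \<in> M" and sub: "\<delta> \<alpha> < 1 + (s \<alpha> - (real CARD('n) - 1))" by force
      have cl: "closed (\<Gamma> \<alpha>)" "\<Gamma> \<alpha> \<noteq> {}" "\<Gamma> \<alpha> \<subseteq> frontier \<Omega>" using assms(5,6) \<alpha> by auto
      have deg: "degenerate_on \<Omega> C (\<Gamma> \<alpha>) (\<delta> \<alpha>)" using assms(12) \<alpha> by blast
      show False
      \<comment> \<open>A thin part can be tested at any of its points, a thick one at the point
        around which \<Omega> is assumed uniform.\<close>
      proof (cases "s \<alpha> < real CARD('n) - 1")
        case True
        obtain z where "z \<in> \<Gamma> \<alpha>" using cl by blast
        from not_markov_unique_if_thin[OF assms(10)[OF \<alpha>] cl(1) this cl(3) sub deg True] show False using mu by simp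
      next
        case False
        then have "real CARD('n) - 1 \<le> s \<alpha>" by simp
        with assms(11)[OF \<alpha>] obtain z R where z: "z \<in> \<Gamma> \<alpha>" "R > 0" "uniform_in \<Omega> (\<Omega> \<inter> ball z R)" by blast
        from not_markov_unique_if_uniform[OF assms(10)[OF \<alpha>] cl(1) z(1) cl(3) sub deg _ z(2,3)] False mu show False by simp
      qed
    qed
  qed
qed

end
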